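(* Let $(\mathbb{M},\mathcal{H},g,\mathcal{V})$ be a sub-Riemannian manifold with transverse symmetries, with $\mathcal{H}$ of rank $d$, sub-Laplacian $L$ and forms $\Gamma,\Gamma^Z,\Gamma_2,\Gamma_2^Z,\mathcal{R},\mathcal{T}$ as defined in the context. Suppose that there exist constants $\rho_1\in\mathbb{R}$, $\rho_2>0$ and $\kappa\ge0$ such that $\mathbb{M}$ satisfies $\mathrm{CD}(\rho_1,\rho_2,\kappa,d)$ with respect to $L$ and $\Gamma^Z$, i.e. for every $f\in C^\infty(\mathbb{M})$ and every $\nu>0$ $$\Gamma_2(f)+\nu\,\Gamma_2^Z(f)\ \ge\ \frac1d(Lf)^2+\Big(\rho_1-\frac\kappa\nu\Big)\Gamma(f)+\rho_2\,\Gamma^Z(f).$$ Then for every $f\in C^\infty(\mathbb{M})$ $$\mathcal{R}(f)\ge\rho_1\Gamma(f)+\rho_2\Gamma^Z(f),\qquad \mathcal{T}(f)\le\kappa\,\Gamma(f).$$ Consequently, for given $\rho_1\in\mathbb{R}$, $\rho_2>0$, $\kappa\ge0$, the inequality $\mathrm{CD}(\rho_1,\rho_2,\kappa,d)$ holds if and only if these two bounds hold for every $f\in C^\infty(\mathbb{M})$.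
   Context: Setting. $\mathbb{M}$ is a smooth connected manifold, $\mathcal{H}$ a bracket generating distribution of rank $d$ (horizontal directions), $g$ a fiberwise inner product on $\mathcal{H}$. A vector field $Z$ is a sub-Riemannian Killing field if $(\mathcal{L}_Zg)(u,v)=0$ for all $x$ and $u,v\in\mathcal{H}(x)$, and $[Z,X]\in\mathcal{H}$ for every horizontal field $X$; $\mathfrak{iso}$ is the Lie algebra of such fields. It is assumed that there is a Lie subalgebra $\mathcal{V}\subset\mathfrak{iso}$ (vertical directions) with $T_x\mathbb{M}=\mathcal{H}(x)\oplus\mathcal{V}(x)$ for all $x$, where $\mathcal{V}(x)=\{Z(x):Z\in\mathcal{V}\}$ has dimension $\mathfrak{h}=\dim\mathcal{V}$. Fix an inner product on the Lie algebra $\mathcal{V}$; it induces a Riemannian metric $g_R=\langle\cdot,\cdot\rangle$ extending $g$, making $\mathcal{H}(x)\perp\mathcal{V}(x)$ and the evaluation $\mathcal{V}\to\mathcal{V}(x)$ isometric. $\mu$ is the Riemannian measure of $g_R$. $\nabla_{\mathcal H}f$, $\nabla_{\mathcal V}f$ are the projections of the Riemannian gradient of $f$ on $\mathcal{H}$ and $\mathcal{V}$. The sub-Laplacian $L$ is the diffusion operator, symmetric with respect to $\mu$, with $\frac12(L(fg)-fLg-gLf)=\langle\nabla_{\mathcal H}f,\nabla_{\mathcal H}g\rangle=:\Gamma(f,g)$ (so $Lf=\mathrm{div}_\mu\nabla_{\mathcal H}f$). Put $\Gamma^Z(f,g)=\langle\nabla_{\mathcal V}f,\nabla_{\mathcal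 V}g\rangle$, $\Gamma(f)=\Gamma(f,f)$, $\Gamma^Z(f)=\Gamma^Z(f,f)$, and $$\Gamma_2(f)=\tfrac12[L\Gamma(f)-2\Gamma(f,Lf)],\qquad \Gamma_2^Z(f)=\tfrac12[L\Gamma^Z(f)-2\Gamma^Z(f,Lf)].$$ Canonical connection. $\nabla$ is the unique affine connection such that: $\nabla g=0$; $\nabla_XY$ is horizontal for horizontal $X,Y$; $\nabla Z=0$ for $Z\in\mathcal{V}$; the torsion $T(X,Y)$ is vertical and $T(X,Z)=0$ for horizontal $X,Y$ and $Z\in\mathcal{V}$. $\mathrm{Ric}$ and $T$ denote its Ricci and torsion tensors. Forms. For a local orthonormal horizontal frame $X_1,\dots,X_d$ (the results are frame independent), $$\mathcal{R}(f)=\mathrm{Ric}(\nabla_{\mathcal H}f,\nabla_{\mathcal H}f)+\sum_{\ell,k=1}^d\Big(-\big((\nabla_{X_\ell}T)(X_\ell,X_k)f\big)(X_kf)+\tfrac14\big(T(X_\ell,X_k)f\big)^2\Big),$$ $$\mathcal{T}(f)=\sum_{i=1}^d\|T(X_i,\nabla_{\mathcal H}f)\|^2 .$$ *)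

theory Defs
  imports "HOL-Analysis.Analysis" "HOL-Library.Function_Algebras"
begin

instantiation "fun" :: (type, real_vector) real_vector
begin

definition scaleR_fun :: "real \<Rightarrow> ('a \<Rightarrow> 'b) \<Rightarrow> 'a \<Rightarrow> 'b"
  where "scaleR_fun c f = (\<lambda>x. c *\<^sub>R f x)"

instance
  by standard (auto simp: scaleR_fun_def fun_eq_iff scaleR_add_right scaleR_add_left)

end

definition inner_product_on :: "'v::real_vector set \<Rightarrow> ('v \<Rightarrow> 'v \<Rightarrow> real) \<Rightarrow> bool"
  where "inner_product_on S b \<longleftrightarrow>
    (\<forall>u\<in>S. \<forall>v\<in>S. b u v = b v u) \<and>
    (\<forall>u\<in>S. \<forall>v\<in>S. \<forall>w\<in>S. b (u + v) w = b u w + b v w) \<and>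
    (\<forall>c. \<forall>u\<in>S. \<forall>v\<in>S. b (c *\<^sub>R u) v = c * b u v) \<and>
    (\<forall>u\<in>S. u \<noteq> 0 \<longrightarrow> 0 < b u u)"

definition trace_on :: "'v::real_vector set \<Rightarrow> ('v \<Rightarrow> 'v) \<Rightarrow> real"
  where "trace_on S F =
    (let B = (SOME B. independent B \<and> span B = S) in \<Sum>b\<in>B. representation B (F b) b)"


section \<open>Smooth manifolds\<close>

text \<open>For an open set \<open>S\<close>, \<open>C_k k f S\<close> says that all iterated directional derivatives of \<open>f\<close>
  of order at most \<open>k\<close> exist and are continuous on \<open>S\<close>.\<close>

fun C_k :: "nat \<Rightarrow> ('b::euclidean_space \<Rightarrow> 'c::real_normed_vector) \<Rightarrow> 'b set \<Rightarrow> bool" where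
  "C_k 0 f S \<longleftrightarrow> continuous_on S f"
| "C_k (Suc k) f S \<longleftrightarrow> (\<forall>x\<in>S. f differentiable (at x)) \<and>
     (\<forall>v. C_k k (\<lambda>x. frechet_derivative f (at x) v) S)"

definition smooth_on :: "'b::euclidean_space set \<Rightarrow> ('b \<Rightarrow> 'c::real_normed_vector) \<Rightarrow> bool"
  where "smooth_on S f \<longleftrightarrow> (\<forall>k. C_k k f S)"

text \<open>A tangent vector at a point of a manifold is a derivation of the algebra of smooth functions
  at this point; since it is a function of arbitrary real functions, it is normalised to \<open>0\<close> off
  the smooth ones. A vector field assigns a tangent vector to every point, so \<open>X x f\<close> is \<open>(X f)(x)\<close>.\<close>

type_synonym 'a tvec = "('a \<Rightarrow> real) \<Rightarrow> real"
type_synonym 'a vfield = "'a \<Rightarrow> 'a tvec"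

text \<open>The manifold is the whole type \<open>'a\<close>. The last two components are the space of vertical
  fields and its inner product.\<close>

record ('a, 'n::finite) sr_structure =
  charts :: "('a set \<times> ('a \<Rightarrow> real^'n)) set"
  hor :: "'a \<Rightarrow> 'a tvec set"
  met :: "'a \<Rightarrow> 'a tvec \<Rightarrow> 'a tvec \<Rightarrow> real"
  vert :: "'a vfield set"
  vip :: "'a vfield \<Rightarrow> 'a vfield \<Rightarrow> real"

definition smooth_atlas :: "('a::topological_space, 'n::finite) sr_structure \<Rightarrow> bool"
  where "smooth_atlas M \<longleftrightarrow>
    (\<Union>(U, \<phi>)\<in>charts M. U) = UNIV \<and>
    (\<forall>(U, \<phi>)\<in>charts M. open U \<and> open (\<phi> ` U) \<and> homeomorphism U (\<phi> ` U) \<phi> (inv_into U \<phi>)) \<and>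
    (\<forall>(U, \<phi>)\<in>charts M. \<forall>(W, \<psi>)\<in>charts M. smooth_on (\<phi> ` (U \<inter> W)) (\<psi> \<circ> inv_into U \<phi>))"

definition C_infinity :: "('a, 'n::finite) sr_structure \<Rightarrow> ('a \<Rightarrow> real) set"
  where "C_infinity M = {f. \<forall>(U, \<phi>)\<in>charts M. smooth_on (\<phi> ` U) (f \<circ> inv_into U \<phi>)}"

definition tangent_space :: "('a, 'n::finite) sr_structure \<Rightarrow> 'a \<Rightarrow> 'a tvec set"
  where "tangent_space M x = {v.
    (\<forall>f. f \<notin> C_infinity M \<longrightarrow> v f = 0) \<and>
    (\<forall>f\<in>C_infinity M. \<forall>h\<in>C_infinity M. v (f + h) = v f + v h) \<and>
    (\<forall>c. \<forall>f\<in>C_infinity M. v (c *\<^sub>R f) = c * v f) \<and>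
    (\<forall>f\<in>C_infinity M. \<forall>h\<in>C_infinity M. v (f * h) = f x * v h + h x * v f)}"

definition vfields :: "('a, 'n::finite) sr_structure \<Rightarrow> 'a vfield set"
  where "vfields M = {X. (\<forall>x. X x \<in> tangent_space M x) \<and>
    (\<forall>f\<in>C_infinity M. (\<lambda>x. X x f) \<in> C_infinity M)}"

definition lie_bracket :: "'a vfield \<Rightarrow> 'a vfield \<Rightarrow> 'a vfield"
  where "lie_bracket X Y = (\<lambda>x f. X x (\<lambda>y. Y y f) - Y x (\<lambda>y. X y f))"


section \<open>Sub-Riemannian manifolds with transverse symmetries\<close>

text \<open>A local frame of vector fields extends, after shrinking its domain, to vector fields on the
  whole manifold by multiplication with a cutoff function. Hence local frames are given here by
  global vector fields that have the required property near the point.\<close>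

definition smooth_distribution :: "('a::topological_space, 'n::finite) sr_structure \<Rightarrow> nat \<Rightarrow> bool"
  where "smooth_distribution M d \<longleftrightarrow>
    (\<forall>x. subspace (hor M x) \<and> hor M x \<subseteq> tangent_space M x \<and> dim (hor M x) = d \<and>
      (\<exists>U X. open U \<and> x \<in> U \<and> (\<forall>i<d. X i \<in> vfields M) \<and>
        (\<forall>y\<in>U. hor M y = span ((\<lambda>i::nat. X i y) ` {..<d}))))"

definition hor_fields :: "('a, 'n::finite) sr_structure \<Rightarrow> 'a vfield set"
  where "hor_fields M = {X \<in> vfields M. \<forall>x. X x \<in> hor M x}"

inductive_set iterated_brackets :: "('a, 'n::finite) sr_structure \<Rightarrow> 'a vfield set"
  for M :: "('a, 'n) sr_structure" where
  "X \<in> hor_fields M \<Longrightarrow> X \<in> iterated_brackets M"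
| "X \<in> iterated_brackets M \<Longrightarrow> Y \<in> iterated_brackets M \<Longrightarrow> lie_bracket X Y \<in> iterated_brackets M"

definition bracket_generating :: "('a, 'n::finite) sr_structure \<Rightarrow> bool"
  where "bracket_generating M \<longleftrightarrow>
    (\<forall>x. span ((\<lambda>X. X x) ` iterated_brackets M) = tangent_space M x)"

definition hor_metric :: "('a, 'n::finite) sr_structure \<Rightarrow> bool"
  where "hor_metric M \<longleftrightarrow> (\<forall>x. inner_product_on (hor M x) (met M x)) \<and>
    (\<forall>X\<in>hor_fields M. \<forall>Y\<in>hor_fields M. (\<lambda>x. met M x (X x) (Y x)) \<in> C_infinity M)"

definition lie_deriv_met :: "('a, 'n::finite) sr_structure \<Rightarrow> 'a vfield \<Rightarrow> 'a vfield \<Rightarrow> 'a vfield \<Rightarrow> 'a \<Rightarrow> real"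
  where "lie_deriv_met M Z X Y x = Z x (\<lambda>y. met M y (X y) (Y y))
    - met M x (lie_bracket Z X x) (Y x) - met M x (X x) (lie_bracket Z Y x)"

definition iso_fields :: "('a, 'n::finite) sr_structure \<Rightarrow> 'a vfield set"
  where "iso_fields M = {Z \<in> vfields M.
    (\<forall>X\<in>hor_fields M. lie_bracket Z X \<in> hor_fields M) \<and>
    (\<forall>X\<in>hor_fields M. \<forall>Y\<in>hor_fields M. \<forall>x. lie_deriv_met M Z X Y x = 0)}"

definition vert_at :: "('a, 'n::finite) sr_structure \<Rightarrow> 'a \<Rightarrow> 'a tvec set"
  where "vert_at M x = (\<lambda>Z. Z x) ` vert M"

definition transverse_symmetries :: "('a, 'n::finite) sr_structure \<Rightarrow> bool"
  where "transverse_symmetries M \<longleftrightarrow>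
    vert M \<subseteq> iso_fields M \<and> subspace (vert M) \<and>
    (\<forall>Z\<in>vert M. \<forall>W\<in>vert M. lie_bracket Z W \<in> vert M) \<and>
    (\<exists>B. finite B \<and> span B = vert M) \<and>
    (\<forall>x. dim (vert_at M x) = dim (vert M) \<and>
      hor M x \<inter> vert_at M x = {0} \<and>
      tangent_space M x = {u + w | u w. u \<in> hor M x \<and> w \<in> vert_at M x})"

definition sub_riemannian_transverse ::
    "('a::{t2_space, second_countable_topology}, 'n::finite) sr_structure \<Rightarrow> nat \<Rightarrow> bool"
  where "sub_riemannian_transverse M d \<longleftrightarrow>
    connected (UNIV :: 'a set) \<and> smooth_atlas M \<and>
    smooth_distribution M d \<and> bracket_generating M \<and> hor_metric M \<and>
    transverse_symmetries M \<and> inner_product_on (vert M) (vip M)"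


section \<open>The Riemannian metric, its measure and the sub-Laplacian\<close>

definition hor_proj :: "('a, 'n::finite) sr_structure \<Rightarrow> 'a \<Rightarrow> 'a tvec \<Rightarrow> 'a tvec"
  where "hor_proj M x u = (THE w. w \<in> hor M x \<and> u - w \<in> vert_at M x)"

definition vert_proj :: "('a, 'n::finite) sr_structure \<Rightarrow> 'a \<Rightarrow> 'a tvec \<Rightarrow> 'a tvec"
  where "vert_proj M x u = (THE w. w \<in> vert_at M x \<and> u - w \<in> hor M x)"

definition vert_lift :: "('a, 'n::finite) sr_structure \<Rightarrow> 'a \<Rightarrow> 'a tvec \<Rightarrow> 'a vfield"
  where "vert_lift M x w = (THE Z. Z \<in> vert M \<and> Z x = w)"

definition gR :: "('a, 'n::finite) sr_structure \<Rightarrow> 'a \<Rightarrow> 'a tvec \<Rightarrow> 'a tvec \<Rightarrow> real"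
  where "gR M x u v = met M x (hor_proj M x u) (hor_proj M x v) +
    vip M (vert_lift M x (vert_proj M x u)) (vert_lift M x (vert_proj M x v))"

definition grad :: "('a, 'n::finite) sr_structure \<Rightarrow> ('a \<Rightarrow> real) \<Rightarrow> 'a vfield"
  where "grad M f x =
    (THE v. v \<in> tangent_space M x \<and> (\<forall>u\<in>tangent_space M x. gR M x v u = u f))"

definition grad_hor :: "('a, 'n::finite) sr_structure \<Rightarrow> ('a \<Rightarrow> real) \<Rightarrow> 'a vfield"
  where "grad_hor M f x = hor_proj M x (grad M f x)"

definition grad_vert :: "('a, 'n::finite) sr_structure \<Rightarrow> ('a \<Rightarrow> real) \<Rightarrow> 'a vfield"
  where "grad_vert M f x = vert_proj M x (grad M f x)"

definition coord_vec :: "('a, 'n::finite) sr_structure \<Rightarrow> 'a set \<Rightarrow> ('a \<Rightarrow> real^'n) \<Rightarrow> 'n \<Rightarrow> 'a vfield"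
  where "coord_vec M U \<phi> i x f =
    (if f \<in> C_infinity M
     then frechet_derivative (f \<circ> inv_into U \<phi>) (at (\<phi> x)) (axis i 1) else 0)"

definition gram_matrix :: "('a, 'n::finite) sr_structure \<Rightarrow> 'a set \<Rightarrow> ('a \<Rightarrow> real^'n) \<Rightarrow> 'a \<Rightarrow> real^'n^'n"
  where "gram_matrix M U \<phi> x = (\<chi> i j. gR M x (coord_vec M U \<phi> i x) (coord_vec M U \<phi> j x))"

definition riemannian_measure ::
    "('a::topological_space, 'n::finite) sr_structure \<Rightarrow> 'a measure \<Rightarrow> bool"
  where "riemannian_measure M \<mu> \<longleftrightarrow> sets \<mu> = sets borel \<and>
    (\<forall>(U, \<phi>)\<in>charts M. \<forall>B\<in>sets borel. B \<subseteq> U \<longrightarrow>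
      emeasure \<mu> B = (\<integral>\<^sup>+ y\<in>\<phi> ` B. ennreal (sqrt (det (gram_matrix M U \<phi> (inv_into U \<phi> y)))) \<partial>lborel))"

definition GammaH :: "('a, 'n::finite) sr_structure \<Rightarrow> ('a \<Rightarrow> real) \<Rightarrow> ('a \<Rightarrow> real) \<Rightarrow> 'a \<Rightarrow> real"
  where "GammaH M f h x = gR M x (grad_hor M f x) (grad_hor M h x)"

definition GammaZ :: "('a, 'n::finite) sr_structure \<Rightarrow> ('a \<Rightarrow> real) \<Rightarrow> ('a \<Rightarrow> real) \<Rightarrow> 'a \<Rightarrow> real"
  where "GammaZ M f h x = gR M x (grad_vert M f x) (grad_vert M h x)"

text \<open>An operator is a diffusion operator if it is of second order without zeroth-order term; the
  carre du champ identity below forces order at most two.\<close>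

definition sub_laplacian ::
    "('a::topological_space, 'n::finite) sr_structure \<Rightarrow> 'a measure \<Rightarrow> (('a \<Rightarrow> real) \<Rightarrow> 'a \<Rightarrow> real) \<Rightarrow> bool"
  where "sub_laplacian M \<mu> L \<longleftrightarrow>
    (\<forall>f\<in>C_infinity M. L f \<in> C_infinity M) \<and>
    (\<forall>f\<in>C_infinity M. \<forall>h\<in>C_infinity M. L (f + h) = L f + L h) \<and>
    (\<forall>c. \<forall>f\<in>C_infinity M. L (c *\<^sub>R f) = c *\<^sub>R L f) \<and>
    L 1 = 0 \<and>
    (\<forall>f\<in>C_infinity M. \<forall>h\<in>C_infinity M. \<forall>x.
      (L (f * h) x - f x * L h x - h x * L f x) / 2 = GammaH M f h x) \<and>
    (\<forall>f\<in>C_infinity M. \<forall>h\<in>C_infinity M.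
      compact (closure {x. f x \<noteq> 0}) \<longrightarrow> compact (closure {x. h x \<noteq> 0}) \<longrightarrow>
      (LINT x|\<mu>. f x * L h x) = (LINT x|\<mu>. h x * L f x))"

definition Gamma2 ::
    "('a, 'n::finite) sr_structure \<Rightarrow> (('a \<Rightarrow> real) \<Rightarrow> 'a \<Rightarrow> real) \<Rightarrow> ('a \<Rightarrow> real) \<Rightarrow> 'a \<Rightarrow> real"
  where "Gamma2 M L f x = (L (GammaH M f f) x - 2 * GammaH M f (L f) x) / 2"

definition Gamma2Z ::
    "('a, 'n::finite) sr_structure \<Rightarrow> (('a \<Rightarrow> real) \<Rightarrow> 'a \<Rightarrow> real) \<Rightarrow> ('a \<Rightarrow> real) \<Rightarrow> 'a \<Rightarrow> real"
  where "Gamma2Z M L f x = (L (GammaZ M f f) x - 2 * GammaZ M f (L f) x) / 2"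

definition CD ::
    "('a, 'n::finite) sr_structure \<Rightarrow> (('a \<Rightarrow> real) \<Rightarrow> 'a \<Rightarrow> real) \<Rightarrow> real \<Rightarrow> real \<Rightarrow> real \<Rightarrow> nat \<Rightarrow> bool"
  where "CD M L \<rho>\<^sub>1 \<rho>\<^sub>2 \<kappa> d \<longleftrightarrow>
    (\<forall>f\<in>C_infinity M. \<forall>\<nu>>0. \<forall>x.
      Gamma2 M L f x + \<nu> * Gamma2Z M L f x
        \<ge> 1 / real d * (L f x)\<^sup>2 + (\<rho>\<^sub>1 - \<kappa> / \<nu>) * GammaH M f f x + \<rho>\<^sub>2 * GammaZ M f f x)"


section \<open>The canonical connection\<close>

definition affine_connection ::
    "('a, 'n::finite) sr_structure \<Rightarrow> ('a vfield \<Rightarrow> 'a vfield \<Rightarrow> 'a vfield) \<Rightarrow> bool"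
  where "affine_connection M D \<longleftrightarrow>
    (\<forall>X\<in>vfields M. \<forall>Y\<in>vfields M. D X Y \<in> vfields M) \<and>
    (\<forall>X\<in>vfields M. \<forall>X'\<in>vfields M. \<forall>Y\<in>vfields M.
      D (X + X') Y = D X Y + D X' Y \<and> D Y (X + X') = D Y X + D Y X') \<and>
    (\<forall>f\<in>C_infinity M. \<forall>X\<in>vfields M. \<forall>Y\<in>vfields M.
      D (\<lambda>x. f x *\<^sub>R X x) Y = (\<lambda>x. f x *\<^sub>R D X Y x) \<and>
      D X (\<lambda>x. f x *\<^sub>R Y x) = (\<lambda>x. X x f *\<^sub>R Y x + f x *\<^sub>R D X Y x))"

definition torsion :: "('a vfield \<Rightarrow> 'a vfield \<Rightarrow> 'a vfield) \<Rightarrow> 'a vfield \<Rightarrow> 'a vfield \<Rightarrow> 'a vfield"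
  where "torsion D X Y = D X Y - D Y X - lie_bracket X Y"

definition deriv_torsion ::
    "('a vfield \<Rightarrow> 'a vfield \<Rightarrow> 'a vfield) \<Rightarrow> 'a vfield \<Rightarrow> 'a vfield \<Rightarrow> 'a vfield \<Rightarrow> 'a vfield"
  where "deriv_torsion D W X Y =
    D W (torsion D X Y) - torsion D (D W X) Y - torsion D X (D W Y)"

definition curvature ::
    "('a vfield \<Rightarrow> 'a vfield \<Rightarrow> 'a vfield) \<Rightarrow> 'a vfield \<Rightarrow> 'a vfield \<Rightarrow> 'a vfield \<Rightarrow> 'a vfield"
  where "curvature D X Y W = D X (D Y W) - D Y (D X W) - D (lie_bracket X Y) W"

definition extend_vec :: "('a, 'n::finite) sr_structure \<Rightarrow> 'a \<Rightarrow> 'a tvec \<Rightarrow> 'a vfield"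
  where "extend_vec M x u = (SOME U. U \<in> vfields M \<and> U x = u)"

text \<open>\<open>Ric(Y, W) = tr (U \<mapsto> R(U, Y)W)\<close>, as is usual; the curvature is a tensor, so that the choice of
  the extension does not matter.\<close>

definition ricci ::
    "('a, 'n::finite) sr_structure \<Rightarrow> ('a vfield \<Rightarrow> 'a vfield \<Rightarrow> 'a vfield) \<Rightarrow> 'a vfield \<Rightarrow> 'a vfield \<Rightarrow> 'a \<Rightarrow> real"
  where "ricci M D Y W x =
    trace_on (tangent_space M x) (\<lambda>u. curvature D (extend_vec M x u) Y W x)"

text \<open>The condition that the horizontal metric is parallel involves \<open>D X Y\<close> for horizontal \<open>Y\<close> and
  arbitrary \<open>X\<close>; this is horizontal for vertical \<open>X\<close> too, because the conditions on the
  vertical fields and on the torsion imply \<open>D Z Y = lie_bracket Z Y\<close> for \<open>Z\<close> in \<open>vert M\<close>.\<close>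

definition canonical_connection ::
    "('a, 'n::finite) sr_structure \<Rightarrow> ('a vfield \<Rightarrow> 'a vfield \<Rightarrow> 'a vfield) \<Rightarrow> bool"
  where "canonical_connection M D \<longleftrightarrow> affine_connection M D \<and>
    (\<forall>X\<in>vfields M. \<forall>Y\<in>hor_fields M. \<forall>W\<in>hor_fields M. \<forall>x.
      X x (\<lambda>y. met M y (Y y) (W y)) = met M x (D X Y x) (W x) + met M x (Y x) (D X W x)) \<and>
    (\<forall>X\<in>hor_fields M. \<forall>Y\<in>hor_fields M. D X Y \<in> hor_fields M) \<and>
    (\<forall>X\<in>vfields M. \<forall>Z\<in>vert M. D X Z = 0) \<and>
    (\<forall>X\<in>hor_fields M. \<forall>Y\<in>hor_fields M. \<forall>x. torsion D X Y x \<in> vert_at M x) \<and>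
    (\<forall>X\<in>hor_fields M. \<forall>Z\<in>vert M. torsion D X Z = 0)"

definition local_frame ::
    "('a::topological_space, 'n::finite) sr_structure \<Rightarrow> nat \<Rightarrow> 'a \<Rightarrow> (nat \<Rightarrow> 'a vfield) \<Rightarrow> bool"
  where "local_frame M d x X \<longleftrightarrow> (\<forall>i\<in>{1..d}. X i \<in> vfields M) \<and>
    (\<exists>U. open U \<and> x \<in> U \<and> (\<forall>y\<in>U. \<forall>i\<in>{1..d}. X i y \<in> hor M y \<and>
      (\<forall>j\<in>{1..d}. met M y (X i y) (X j y) = (if i = j then 1 else 0))))"

text \<open>The two forms at the point \<open>x\<close>, written in a local orthonormal horizontal frame \<open>X\<close> near \<open>x\<close>.\<close>

definition R_form ::
    "('a, 'n::finite) sr_structure \<Rightarrow> ('a vfield \<Rightarrow> 'a vfield \<Rightarrow> 'a vfield) \<Rightarrow> nat \<Rightarrow>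
      (nat \<Rightarrow> 'a vfield) \<Rightarrow> ('a \<Rightarrow> real) \<Rightarrow> 'a \<Rightarrow> real"
  where "R_form M D d X f x = ricci M D (grad_hor M f) (grad_hor M f) x +
    (\<Sum>l=1..d. \<Sum>k=1..d.
      - (deriv_torsion D (X l) (X l) (X k) x f * X k x f) + 1 / 4 * (torsion D (X l) (X k) x f)\<^sup>2)"

definition T_form ::
    "('a, 'n::finite) sr_structure \<Rightarrow> ('a vfield \<Rightarrow> 'a vfield \<Rightarrow> 'a vfield) \<Rightarrow> nat \<Rightarrow>
      (nat \<Rightarrow> 'a vfield) \<Rightarrow> ('a \<Rightarrow> real) \<Rightarrow> 'a \<Rightarrow> real"
  where "T_form M D d X f x =
    (\<Sum>i=1..d. gR M x (torsion D (X i) (grad_hor M f) x) (torsion D (X i) (grad_hor M f) x))"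

end

theory Submission
  imports Defs
begin

text \<open>Write \<open>F\<close> for the horizontal gradient of \<open>f\<close>, let \<open>X\<^sub>l\<close> be a local orthonormal
  horizontal frame and \<open>Z\<^sub>m\<close> an orthonormal basis of \<open>\<V>\<close>. Integration by parts against the Riemannian
  measure identifies \<open>L\<close> with the trace of the horizontal Hessian \<open>\<langle>D\<^bsub>A\<^esub> F, B\<rangle>\<close>. The Ricci and torsion
  identities for \<open>D\<close> then give, with \<open>S\<close> the symmetrised Hessian and
  \<open>T(X\<^sub>l, F) = \<Sum>\<^sub>m \<tau>\<^sub>l\<^sub>m Z\<^sub>m\<close>, Bochner's formulas
  \<open>\<Gamma>\<^sub>2(f) = \<bar>S\<bar>\<^sup>2 + \<R>(f) - 2 \<Sum>\<^sub>l\<^sub>m \<tau>\<^sub>l\<^sub>m X\<^sub>l Z\<^sub>m f\<close> and \<open>\<Gamma>\<^sub>2\<^sup>Z(f) = \<Sum>\<^sub>l\<^sub>m (X\<^sub>l Z\<^sub>m f)\<^sup>2\<close>; the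
  second one because Killing fields commute with \<open>L\<close>. The two bounds imply the curvature-dimension
  inequality by completing squares. Conversely, at a given point \<open>f\<close> can be changed to second order
  such that \<open>S = 0\<close> and \<open>X\<^sub>l Z\<^sub>m f = \<tau>\<^sub>l\<^sub>m / \<nu>\<close>; then the inequality reads
  \<open>\<R>(f) - \<T>(f) / \<nu> \<ge> (\<rho>\<^sub>1 - \<kappa> / \<nu>) \<Gamma>(f) + \<rho>\<^sub>2 \<Gamma>\<^sup>Z(f)\<close>, and \<open>\<nu>\<close> is sent to infinity and to zero.\<close>

section \<open>Calculus of smooth functions\<close>

text \<open>\<open>L\<close> is not given by a formula: only its carre du champ and its symmetry are
  known. Its locality must therefore be derived first, and its first-order part is recovered by
  testing against the divergence theorem. The connection has torsion, so the horizontal Hessian is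
  not symmetric; its antisymmetric part is a torsion derivative of \<open>f\<close>, of order one
  only, and its square is the term with factor 1/4 in the first form. Hence both forms and both
  carre du champ terms depend on first derivatives at the point, whereas S and the mixed derivatives
  are free second-order data. This permits the perturbation. The mixed value \<tau> / \<nu>
  minimises \<nu> w^2 - 2 \<tau> w, with minimum - \<tau>^2 / \<nu>, and S = 0 also removes the
  trace \<open>L f\<close>, hence the dimension term. No frame is chosen parallel at the point: the
  connection coefficients of an orthonormal frame are skew and cancel in the traces. Commutation of
  a vertical Z with \<open>L\<close> is a curvature fact: the commutator is the trace of R(Z, .)F,
  which vanishes by the Bianchi identity and metric skewness.\<close>

lemma frechet_derivative_eqI: "(f has_derivative f') (at x) \<Longrightarrow> frechet_derivative f (at x) = f'"
  by (metis frechet_derivative_at)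

lemma C_k_cong:
  assumes "open S" "\<And>x. x \<in> S \<Longrightarrow> f x = g x" "C_k k f S"
  shows "C_k k g S"
  using assms(2,3)
proof (induction k arbitrary: f g)
  case 0
  then show ?case by (simp cong: continuous_on_cong)
next
  case (Suc k)
  have d: "g differentiable at x" "frechet_derivative g (at x) = frechet_derivative f (at x)" if "x \<in> S" for x
  proof -
    have "f differentiable at x" using Suc.prems that by simp
    then have "(f has_derivative frechet_derivative f (at x)) (at x)"
      by (simp add: frechet_derivative_works)
    then have "(g has_derivative frechet_derivative f (at x)) (at x)"
      by (rule has_derivative_transform_within_open[OF _ assms(1) that]) (simp add: Suc.prems)
    then show "g differentiable at x" "frechet_derivative g (at x) = frechet_derivative f (at x)"
      by (auto simp: differentiable_def frechet_derivative_eqI)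
  qed
  have "C_k k (\<lambda>x. frechet_derivative g (at x) v) S" for v
    by (rule Suc.IH[of "\<lambda>x. frechet_derivative f (at x) v"]) (use d Suc.prems in auto)
  then show ?case using d by simp
qed

lemma C_k_mono: "C_k k f S \<Longrightarrow> T \<subseteq> S \<Longrightarrow> C_k k f T"
  by (induction k arbitrary: f) (auto intro: continuous_on_subset)

lemma C_k_SucD: "C_k (Suc k) f S \<Longrightarrow> C_k k f S"
proof (induction k arbitrary: f)
  case 0
  then show ?case
    by (auto simp: continuous_on_eq_continuous_within intro!: differentiable_imp_continuous_within
        intro: differentiable_at_withinI)
next
  case (Suc k)
  then show ?case by (metis C_k.simps(2))
qed

lemma C_k_const: "C_k k (\<lambda>x. c) S"
  by (induction k arbitrary: c) (auto simp: frechet_derivative_const)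

lemma C_k_linear: "bounded_linear f \<Longrightarrow> C_k k f S"
proof (cases k)
  case 0
  then show "bounded_linear f \<Longrightarrow> C_k k f S" by (simp add: linear_continuous_on)
next
  case (Suc n)
  assume f: "bounded_linear f"
  have "frechet_derivative f (at x) = f" for x
    by (rule frechet_derivative_eqI[OF bounded_linear_imp_has_derivative[OF f]])
  then show "C_k k f S"
    using bounded_linear_imp_differentiable[OF f] unfolding Suc C_k.simps by (simp add: C_k_const)
qed

lemma C_k_open_cover:
  assumes "\<And>x. x \<in> S \<Longrightarrow> \<exists>T. open T \<and> x \<in> T \<and> C_k k f (T \<inter> S)" "open S"
  shows "C_k k f S"
  using assms(1)
proof (induction k arbitrary: f)
  case 0
  then show ?case
    using assms(2)
    unfolding C_k.simps continuous_on_eq_continuous_at[OF assms(2)]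
    by (metis IntI continuous_on_eq_continuous_at open_Int)
next
  case (Suc k)
  show ?case
  proof (simp, intro conjI ballI allI)
    fix x assume "x \<in> S"
    then show "f differentiable at x" using Suc.prems[of x] by auto
  next
    fix v show "C_k k (\<lambda>x. frechet_derivative f (at x) v) S"
    proof (rule Suc.IH)
      fix x assume "x \<in> S"
      with Suc.prems obtain T where "open T" "x \<in> T" "C_k (Suc k) f (T \<inter> S)" by blast
      then show "\<exists>T. open T \<and> x \<in> T \<and> C_k k (\<lambda>x. frechet_derivative f (at x) v) (T \<inter> S)"
        by (metis C_k.simps(2))
    qed
  qed
qed

lemma C_k_add:
  assumes "C_k k f S" "C_k k g S" "open S"
  shows "C_k k (\<lambda>x. f x + g x) S"
  using assms(1,2)
proof (induction k arbitrary: f g)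
  case 0
  then show ?case by (simp add: continuous_on_add)
next
  case (Suc k)
  have "C_k k (\<lambda>x. frechet_derivative (\<lambda>x. f x + g x) (at x) v) S" for v
  proof (rule C_k_cong[OF assms(3)])
    show "C_k k (\<lambda>x. frechet_derivative f (at x) v + frechet_derivative g (at x) v) S"
      using Suc by simp
    fix x assume "x \<in> S"
    then show "frechet_derivative f (at x) v + frechet_derivative g (at x) v =
      frechet_derivative (\<lambda>x. f x + g x) (at x) v"
    proof -
      have "f differentiable at x" "g differentiable at x" using Suc.prems \<open>x \<in> S\<close> by auto
      then have "((\<lambda>x. f x + g x) has_derivative
          (\<lambda>h. frechet_derivative f (at x) h + frechet_derivative g (at x) h)) (at x)"
        by (intro has_derivative_add) (auto simp: frechet_derivative_works)
      from frechet_derivative_eqI[OF this] show ?thesis by simp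
    qed
  qed
  then show ?case using Suc.prems by (simp add: differentiable_add)
qed

lemma C_k_mult:
  fixes f g :: "'b::euclidean_space \<Rightarrow> real"
  assumes "C_k k f S" "C_k k g S" "open S"
  shows "C_k k (\<lambda>x. f x * g x) S"
  using assms(1,2)
proof (induction k arbitrary: f g)
  case 0
  then show ?case by (simp add: continuous_on_mult)
next
  case (Suc k)
  have "C_k k (\<lambda>x. frechet_derivative (\<lambda>x. f x * g x) (at x) v) S" for v
  proof (rule C_k_cong[OF assms(3)])
    show "C_k k (\<lambda>x. f x * frechet_derivative g (at x) v + frechet_derivative f (at x) v * g x) S"
      using Suc by (intro C_k_add assms Suc.IH C_k_SucD[OF Suc.prems(1)] C_k_SucD[OF Suc.prems(2)]) auto
    fix x assume "x \<in> S"
    then have "f differentiable at x" "g differentiable at x" using Suc.prems by auto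
    then have "((\<lambda>x. f x * g x) has_derivative
        (\<lambda>h. f x * frechet_derivative g (at x) h + frechet_derivative f (at x) h * g x)) (at x)"
      by (intro has_derivative_mult) (auto simp: frechet_derivative_works)
    from frechet_derivative_eqI[OF this]
    show "f x * frechet_derivative g (at x) v + frechet_derivative f (at x) v * g x =
      frechet_derivative (\<lambda>x. f x * g x) (at x) v" by simp
  qed
  then show ?case using Suc.prems by (simp add: differentiable_mult)
qed

lemma C_k_sum:
  assumes "\<And>i. i \<in> I \<Longrightarrow> C_k k (f i) S" "open S"
  shows "C_k k (\<lambda>x. \<Sum>i\<in>I. f i x) S"
  using assms(1)
  by (induction I rule: infinite_finite_induct) (auto simp: C_k_const C_k_add assms(2))

text \<open>The derivative of \<open>inverse f\<close> is a derivative of \<open>f\<close> times two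
  copies of \<open>- inverse f\<close> up to sign, so order \<open>k\<close> of the inverse itself
  feeds order \<open>Suc k\<close>; \<open>f\<close> stays fixed in the induction.\<close>

lemma C_k_inverse:
  fixes f :: "'b::euclidean_space \<Rightarrow> real"
  assumes "C_k k f S" "open S" "\<And>x. x \<in> S \<Longrightarrow> f x \<noteq> 0"
  shows "C_k k (\<lambda>x. inverse (f x)) S"
  using assms(1)
proof (induction k)
  case 0
  then show ?case using assms(3) by (auto intro: continuous_on_inverse)
next
  case (Suc k)
  note C = C_k_SucD[OF Suc.prems]
  have D: "((\<lambda>x. inverse (f x)) has_derivative
        (\<lambda>h. - (inverse (f x) * frechet_derivative f (at x) h * inverse (f x)))) (at x)" if "x \<in> S" for x
    by (rule Deriv.has_derivative_inverse)
      (use that assms(3)[OF that] Suc.prems in \<open>auto simp: frechet_derivative_works\<close>)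
  have "C_k k (\<lambda>x. frechet_derivative (\<lambda>x. inverse (f x)) (at x) v) S" for v
  proof (rule C_k_cong[OF assms(2)])
    show "C_k k (\<lambda>x. (-1) * (inverse (f x) * frechet_derivative f (at x) v * inverse (f x))) S"
      by (intro C_k_mult assms(2) C_k_const Suc.IH C) (use Suc.prems in simp)
    fix x assume "x \<in> S"
    then show "(-1) * (inverse (f x) * frechet_derivative f (at x) v * inverse (f x)) =
      frechet_derivative (\<lambda>x. inverse (f x)) (at x) v"
      using frechet_derivative_eqI[OF D] by simp
  qed
  then show ?case using D by (auto simp: differentiable_def)
qed

lemma C_k_bounded_linear_comp:
  assumes "bounded_linear l" "C_k k f S" "open S"
  shows "C_k k (\<lambda>x. l (f x)) S"
  using assms(2)
proof (induction k arbitrary: f)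
  case 0
  then show ?case using assms(1) by (simp add: bounded_linear.continuous_on)
next
  case (Suc k)
  have D: "((\<lambda>x. l (f x)) has_derivative (\<lambda>h. l (frechet_derivative f (at x) h))) (at x)" if "x \<in> S" for x
    using that Suc.prems
    by (intro bounded_linear.has_derivative[OF assms(1)]) (auto simp: frechet_derivative_works)
  have "C_k k (\<lambda>x. frechet_derivative (\<lambda>x. l (f x)) (at x) v) S" for v
  proof (rule C_k_cong[OF assms(3)])
    show "C_k k (\<lambda>x. l (frechet_derivative f (at x) v)) S" using Suc by simp
  qed (simp add: frechet_derivative_eqI[OF D])
  then show ?case using D by (auto simp: differentiable_def)
qed

text \<open>\<open>C_k\<close> speaks of derivatives in a fixed direction only. In the chain rule
  the direction moves with the point; expanding it in the fixed basis directions brings the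
  derivative back into the scope of \<open>C_k\<close>.\<close>

lemma frechet_derivative_componentwise:
  fixes f :: "'b::euclidean_space \<Rightarrow> 'c::real_normed_vector"
  assumes "f differentiable at x"
  shows "frechet_derivative f (at x) v = (\<Sum>b\<in>Basis. (v \<bullet> b) *\<^sub>R frechet_derivative f (at x) b)"
proof -
  have l: "linear (frechet_derivative f (at x))"
    using assms by (rule linear_frechet_derivative)
  have "frechet_derivative f (at x) v = frechet_derivative f (at x) (\<Sum>b\<in>Basis. (v \<bullet> b) *\<^sub>R b)"
    by (simp add: euclidean_representation)
  then show ?thesis using l by (simp only: linear_sum linear_scale)
qed

lemma C_k_compose:
  fixes g :: "'b::euclidean_space \<Rightarrow> real" and h :: "'d::euclidean_space \<Rightarrow> 'b"
  assumes "C_k k g T" "C_k k h S" "h ` S \<subseteq> T" "open S"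
  shows "C_k k (\<lambda>x. g (h x)) S"
  using assms(1,2)
proof (induction k arbitrary: g)
  case 0
  then show ?case using assms(3) by (auto intro: continuous_on_compose2)
next
  case (Suc k)
  have T: "h x \<in> T" if "x \<in> S" for x using that assms(3) by auto
  have gd: "g differentiable at (h x)" if "x \<in> S" for x using T[OF that] Suc.prems by auto
  have D: "((\<lambda>x. g (h x)) has_derivative
        (\<lambda>v. frechet_derivative g (at (h x)) (frechet_derivative h (at x) v))) (at x)" if "x \<in> S" for x
    using that gd[OF that] Suc.prems
    by (intro has_derivative_compose[of h _ _ _ g]) (auto simp: frechet_derivative_works)
  have "C_k k (\<lambda>x. frechet_derivative (\<lambda>x. g (h x)) (at x) v) S" for v
  proof (rule C_k_cong[OF assms(4)])
    have "C_k k (\<lambda>x. frechet_derivative h (at x) v \<bullet> b) S" for b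
      by (rule C_k_bounded_linear_comp[OF bounded_linear_inner_left]) (use Suc assms in auto)
    moreover have "C_k k (\<lambda>x. frechet_derivative g (at (h x)) b) S" for b
      by (rule Suc.IH) (use Suc.prems C_k_SucD in auto)
    ultimately show "C_k k (\<lambda>x. \<Sum>b\<in>Basis. (frechet_derivative h (at x) v \<bullet> b) *
        frechet_derivative g (at (h x)) b) S"
      by (intro C_k_sum C_k_mult assms) auto
    fix x assume x: "x \<in> S"
    show "(\<Sum>b\<in>Basis. (frechet_derivative h (at x) v \<bullet> b) * frechet_derivative g (at (h x)) b) =
      frechet_derivative (\<lambda>x. g (h x)) (at x) v"
      using frechet_derivative_eqI[OF D[OF x]]
        frechet_derivative_componentwise[OF gd[OF x], of "frechet_derivative h (at x) v"] by simp
  qed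
  then show ?case using D by (auto simp: differentiable_def)
qed

lemma smooth_on_cong: "open S \<Longrightarrow> (\<And>x. x \<in> S \<Longrightarrow> f x = g x) \<Longrightarrow> smooth_on S f \<Longrightarrow> smooth_on S g"
  unfolding smooth_on_def using C_k_cong by blast

lemma smooth_on_mono: "smooth_on S f \<Longrightarrow> T \<subseteq> S \<Longrightarrow> smooth_on T f"
  unfolding smooth_on_def using C_k_mono by blast

lemma smooth_on_const: "smooth_on S (\<lambda>x. c)"
  by (simp add: smooth_on_def C_k_const)

lemma smooth_on_linear: "bounded_linear f \<Longrightarrow> smooth_on S f"
  by (simp add: smooth_on_def C_k_linear)

lemma smooth_on_add: "smooth_on S f \<Longrightarrow> smooth_on S g \<Longrightarrow> open S \<Longrightarrow> smooth_on S (\<lambda>x. f x + g x)"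
  by (simp add: smooth_on_def C_k_add)

lemma smooth_on_sum: "(\<And>i. i \<in> I \<Longrightarrow> smooth_on S (f i)) \<Longrightarrow> open S \<Longrightarrow> smooth_on S (\<lambda>x. \<Sum>i\<in>I. f i x)"
  by (simp add: smooth_on_def C_k_sum)

lemma smooth_on_mult:
  fixes f g :: "'b::euclidean_space \<Rightarrow> real"
  shows "smooth_on S f \<Longrightarrow> smooth_on S g \<Longrightarrow> open S \<Longrightarrow> smooth_on S (\<lambda>x. f x * g x)"
  by (simp add: smooth_on_def C_k_mult)

lemma smooth_on_inverse:
  fixes f :: "'b::euclidean_space \<Rightarrow> real"
  shows "smooth_on S f \<Longrightarrow> open S \<Longrightarrow> (\<And>x. x \<in> S \<Longrightarrow> f x \<noteq> 0) \<Longrightarrow> smooth_on S (\<lambda>x. inverse (f x))"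
  by (simp add: smooth_on_def C_k_inverse)

lemma smooth_on_compose:
  fixes g :: "'b::euclidean_space \<Rightarrow> real"
  shows "smooth_on T g \<Longrightarrow> smooth_on S h \<Longrightarrow> h ` S \<subseteq> T \<Longrightarrow> open S \<Longrightarrow> smooth_on S (\<lambda>x. g (h x))"
  unfolding smooth_on_def using C_k_compose by blast

lemma smooth_on_open_cover:
  assumes "\<And>x. x \<in> S \<Longrightarrow> \<exists>T. open T \<and> x \<in> T \<and> smooth_on (T \<inter> S) f" "open S"
  shows "smooth_on S f"
  unfolding smooth_on_def
proof
  fix k show "C_k k f S"
    by (rule C_k_open_cover[OF _ assms(2)]) (use assms(1) in \<open>meson smooth_on_def\<close>)
qed

lemma smooth_on_imp_continuous_on: "smooth_on S f \<Longrightarrow> continuous_on S f"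
  unfolding smooth_on_def by (metis C_k.simps(1))

lemma smooth_on_imp_differentiable: "smooth_on S f \<Longrightarrow> x \<in> S \<Longrightarrow> f differentiable at x"
  unfolding smooth_on_def by (metis C_k.simps(2))

lemma smooth_on_frechet_derivative: "smooth_on S f \<Longrightarrow> smooth_on S (\<lambda>x. frechet_derivative f (at x) v)"
  unfolding smooth_on_def by (metis C_k.simps(2))

lemma smooth_on_imp_has_derivative:
  "smooth_on S f \<Longrightarrow> x \<in> S \<Longrightarrow> (f has_derivative frechet_derivative f (at x)) (at x)"
  using smooth_on_imp_differentiable frechet_derivative_works by blast

section \<open>Bump functions and smooth functions on a manifold\<close>

text \<open>The family in \<open>m\<close> is needed because differentiation of exp(-1/t) produces
  powers of 1/t: up to linear combinations the family is closed under derivatives.\<close>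

definition flat_exp :: "nat \<Rightarrow> real \<Rightarrow> real"
  where "flat_exp m t = (if t > 0 then exp (- 1 / t) / t ^ m else 0)"

text \<open>After the substitution of 1/t for t this is the decay of powers against the exponential.
  The quotient is the difference quotient at 0, so all members are differentiable there with
  derivative 0.\<close>

lemma flat_exp_at_0: "((\<lambda>t. flat_exp m t / t) \<longlongrightarrow> 0) (at 0)"
proof -
  have "((\<lambda>t::real. inverse t ^ Suc m / exp (inverse t)) \<longlongrightarrow> 0) (at_right 0)"
    by (rule filterlim_compose[OF tendsto_power_div_exp_0 filterlim_inverse_at_top_right])
  then have "((\<lambda>t. flat_exp m t / t) \<longlongrightarrow> 0) (at_right 0)"
    by (rule Lim_transform_eventually)
      (auto simp: flat_exp_def eventually_at_filter exp_minus field_simps)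
  moreover have "((\<lambda>t. flat_exp m t / t) \<longlongrightarrow> 0) (at_left 0)"
    by (rule Lim_transform_eventually[OF tendsto_const])
      (auto simp: flat_exp_def eventually_at_filter)
  ultimately show ?thesis by (simp add: filterlim_at_split)
qed

lemma flat_exp_deriv:
  "(flat_exp m has_real_derivative (flat_exp (m + 2) t - real m * flat_exp (m + 1) t)) (at t)"
proof -
  consider "t > 0" | "t < 0" | "t = 0" by linarith
  then show ?thesis
  proof cases
    case 1
    have "((\<lambda>t. exp (- 1 / t) / t ^ m) has_real_derivative
        (exp (- 1 / t) * (1 / t\<^sup>2) * t ^ m - exp (- 1 / t) * (real m * t ^ (m - 1))) / (t ^ m * t ^ m)) (at t)"
      using 1 by (auto intro!: derivative_eq_intros simp: power2_eq_square)
    moreover have "(exp (- 1 / t) * (1 / t\<^sup>2) * t ^ m - exp (- 1 / t) * (real m * t ^ (m - 1))) / (t ^ m * t ^ m)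
       = flat_exp (m + 2) t - real m * flat_exp (m + 1) t"
      using 1 by (cases m) (auto simp: flat_exp_def field_simps power2_eq_square)
    ultimately have "((\<lambda>t. exp (- 1 / t) / t ^ m) has_real_derivative
      flat_exp (m + 2) t - real m * flat_exp (m + 1) t) (at t)" by simp
    then show ?thesis
      by (rule has_field_derivative_transform_within_open[of _ _ _ "{0<..}"])
        (use 1 in \<open>auto simp: flat_exp_def\<close>)
  next
    case 2
    have "((\<lambda>_. 0) has_real_derivative 0) (at t)" by simp
    then have "(flat_exp m has_real_derivative 0) (at t)"
      by (rule has_field_derivative_transform_within_open[of _ _ _ "{..<0}"])
        (use 2 in \<open>auto simp: flat_exp_def\<close>)
    then show ?thesis using 2 by (simp add: flat_exp_def)
  next
    case 3
    then show ?thesis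
      using flat_exp_at_0[of m] unfolding has_field_derivative_iff by (simp add: flat_exp_def)
  qed
qed

lemma C_k_flat_exp: "C_k k (flat_exp m) UNIV"
proof (induction k arbitrary: m)
  case 0
  then show ?case
    using flat_exp_deriv by (auto intro!: continuous_at_imp_continuous_on DERIV_isCont)
next
  case (Suc k)
  have D: "(flat_exp m has_derivative (*) (flat_exp (m + 2) t - real m * flat_exp (m + 1) t)) (at t)" for t
    using flat_exp_deriv[of m t] by (simp add: has_field_derivative_def)
  have "C_k k (\<lambda>t. (flat_exp (m + 2) t + (- real m) * flat_exp (m + 1) t) * v) UNIV" for v
    by (intro C_k_mult C_k_add C_k_const Suc.IH open_UNIV)
  then show ?case using D by (auto simp: frechet_derivative_eqI[OF D] differentiable_def)
qed

lemma smooth_on_flat_exp: "smooth_on UNIV (flat_exp m)"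
  by (simp add: smooth_on_def C_k_flat_exp)

lemma ex_bump:
  fixes p :: "'b::euclidean_space"
  assumes "r > 0"
  obtains b :: "'b \<Rightarrow> real" where "smooth_on UNIV b" "\<And>z. 0 \<le> b z"
    "\<And>z. z \<in> ball p (r / 2) \<Longrightarrow> b z = 1" "\<And>z. z \<notin> cball p r \<Longrightarrow> b z = 0"
proof -
  \<comment> \<open>The squared distance to \<open>p\<close>, written as a sum of products so that
    its smoothness follows from the closure rules.\<close>
  define s where "s = (\<lambda>z. \<Sum>i\<in>Basis. ((z \<bullet> i) + - (p \<bullet> i)) * ((z \<bullet> i) + - (p \<bullet> i)))"
  define e where "e = (\<lambda>c d z. flat_exp 0 (c + d * s z))"
  have s_eq: "s z = (dist p z)\<^sup>2" for z
    unfolding s_def dist_norm norm_minus_commute[of p] power2_norm_eq_inner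
      euclidean_inner[of "z - p" "z - p"] by (simp add: inner_diff_left)
  have s_smooth: "smooth_on UNIV s"
    unfolding s_def
    by (intro smooth_on_sum smooth_on_mult smooth_on_add smooth_on_const smooth_on_linear
        bounded_linear_inner_left open_UNIV)
  have e_smooth: "smooth_on UNIV (e c d)" for c d
    unfolding e_def
    by (rule smooth_on_compose[OF smooth_on_flat_exp])
      (intro s_smooth smooth_on_add smooth_on_mult smooth_on_const open_UNIV subset_UNIV)+
  have e_nonneg: "e c d z \<ge> 0" for c d z by (simp add: e_def flat_exp_def)
  have e_pos: "e c d z > 0 \<longleftrightarrow> c + d * s z > 0" for c d z by (simp add: e_def flat_exp_def)
  \<comment> \<open>The first factor is positive exactly inside the ball of radius \<open>r\<close>,
    the other summand of the denominator exactly outside the closed ball of radius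
    \<open>r / 2\<close>. The denominator never vanishes, and where the other summand is 0 the
    quotient is 1.\<close>
  define b where "b = (\<lambda>z. e (r\<^sup>2) (-1) z * inverse (e (r\<^sup>2) (-1) z + e (- (r\<^sup>2 / 4)) 1 z))"
  have pos: "e (r\<^sup>2) (-1) z + e (- (r\<^sup>2 / 4)) 1 z > 0" for z
  proof (cases "s z < r\<^sup>2")
    case True
    then show ?thesis using e_pos[of "r\<^sup>2" "-1" z] e_nonneg[of "- (r\<^sup>2 / 4)" 1 z] by simp
  next
    case False
    moreover have "r\<^sup>2 / 4 < r\<^sup>2" using assms by simp
    ultimately have "e (- (r\<^sup>2 / 4)) 1 z > 0" unfolding e_pos by linarith
    then show ?thesis using e_nonneg[of "r\<^sup>2" "-1" z] by simp
  qed
  have "smooth_on UNIV b"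
    unfolding b_def
    using pos by (intro smooth_on_mult smooth_on_inverse smooth_on_add e_smooth open_UNIV)
      (metis less_irrefl)
  moreover have "b z \<ge> 0" for z
    unfolding b_def using pos[of z] e_nonneg[of "r\<^sup>2" "-1" z] by simp
  moreover have "b z = 1" if "z \<in> ball p (r / 2)" for z
  proof -
    have "(dist p z)\<^sup>2 < (r / 2)\<^sup>2" using that by (intro power_strict_mono) auto
    then have "e (- (r\<^sup>2 / 4)) 1 z = 0"
      by (simp add: e_def flat_exp_def s_eq power_divide)
    then show ?thesis using pos[of z] unfolding b_def by simp
  qed
  moreover have "b z = 0" if "z \<notin> cball p r" for z
  proof -
    have "r\<^sup>2 < (dist p z)\<^sup>2" using that assms by (intro power_strict_mono) auto
    then show ?thesis by (simp add: b_def e_def flat_exp_def s_eq)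
  qed
  ultimately show ?thesis using that by blast
qed

text \<open>A germ is smooth when it has a globally smooth representative. This suits derivations,
  which act on global functions only, and lets the algebra of germs be inherited from
  \<open>C_infinity\<close>.\<close>

definition smooth_near :: "('a::topological_space, 'n::finite) sr_structure \<Rightarrow> ('a \<Rightarrow> real) \<Rightarrow> 'a \<Rightarrow> bool"
  where "smooth_near M f x \<longleftrightarrow> (\<exists>g\<in>C_infinity M. \<forall>\<^sub>F y in nhds x. f y = g y)"

section \<open>Charts, gluing of smooth functions, extension by zero and cutoffs\<close>

locale smooth_manifold =
  fixes M :: "('a::t2_space, 'n::finite) sr_structure"
  assumes atlas: "smooth_atlas M"
begin

lemma chart_open:
  assumes "(U, \<phi>) \<in> charts M"
  shows "open U" "open (\<phi> ` U)"
  using atlas assms unfolding smooth_atlas_def by blast+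

lemma chart_homeomorphism: "(U, \<phi>) \<in> charts M \<Longrightarrow> homeomorphism U (\<phi> ` U) \<phi> (inv_into U \<phi>)"
  using atlas unfolding smooth_atlas_def by blast

lemma chart_inv: "(U, \<phi>) \<in> charts M \<Longrightarrow> x \<in> U \<Longrightarrow> inv_into U \<phi> (\<phi> x) = x"
  using chart_homeomorphism homeomorphism_apply1 by metis

lemma chart_cont: "(U, \<phi>) \<in> charts M \<Longrightarrow> continuous_on U \<phi>"
  using chart_homeomorphism homeomorphism_cont1 by metis

lemma chart_cont_inv: "(U, \<phi>) \<in> charts M \<Longrightarrow> continuous_on (\<phi> ` U) (inv_into U \<phi>)"
  using chart_homeomorphism homeomorphism_cont2 by metis

lemma chart_open_image:
  assumes "(U, \<phi>) \<in> charts M" "open W" "W \<subseteq> U"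
  shows "open (\<phi> ` W)"
proof -
  have "openin (top_of_set U) W" using assms by (simp add: openin_open_eq chart_open)
  then have "openin (top_of_set (\<phi> ` U)) (\<phi> ` W)"
    by (rule homeomorphism_imp_open_map[OF chart_homeomorphism[OF assms(1)]])
  then show ?thesis using chart_open[OF assms(1)] openin_open_trans by blast
qed

lemma chart_open_vimage:
  assumes "(U, \<phi>) \<in> charts M" "open W"
  shows "open {x \<in> U. \<phi> x \<in> W}"
proof -
  have "open (\<phi> -` W \<inter> U)"
    using continuous_on_open_vimage[OF chart_open(1)[OF assms(1)]] chart_cont[OF assms(1)] assms(2)
    by blast
  moreover have "\<phi> -` W \<inter> U = {x \<in> U. \<phi> x \<in> W}" by auto
  ultimately show ?thesis by simp
qed

lemma chart_transition:
  "(U, \<phi>) \<in> charts M \<Longrightarrow> (W, \<psi>) \<in> charts M \<Longrightarrow> smooth_on (\<phi> ` (U \<inter> W)) (\<psi> \<circ> inv_into U \<phi>)"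
  using atlas unfolding smooth_atlas_def by blast

lemma ex_chart: obtains U \<phi> where "(U, \<phi>) \<in> charts M" "x \<in> U"
proof -
  have "x \<in> (\<Union>(U, \<phi>)\<in>charts M. U)" using atlas unfolding smooth_atlas_def by simp
  then show ?thesis using that by auto
qed

lemma C_infinity_chart: "f \<in> C_infinity M \<Longrightarrow> (U, \<phi>) \<in> charts M \<Longrightarrow> smooth_on (\<phi> ` U) (f \<circ> inv_into U \<phi>)"
  unfolding C_infinity_def by blast

lemma C_infinityI: "(\<And>U \<phi>. (U, \<phi>) \<in> charts M \<Longrightarrow> smooth_on (\<phi> ` U) (f \<circ> inv_into U \<phi>)) \<Longrightarrow> f \<in> C_infinity M"
  unfolding C_infinity_def by blast

lemma C_inf_const [simp, intro]: "(\<lambda>x. c) \<in> C_infinity M"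
  by (intro C_infinityI) (simp add: o_def smooth_on_const)

lemma C_inf_add [simp, intro]: "f \<in> C_infinity M \<Longrightarrow> g \<in> C_infinity M \<Longrightarrow> (\<lambda>x. f x + g x) \<in> C_infinity M"
  using smooth_on_add[OF C_infinity_chart C_infinity_chart chart_open(2)]
  by (intro C_infinityI) (simp add: o_def)

lemma C_inf_mult [simp, intro]: "f \<in> C_infinity M \<Longrightarrow> g \<in> C_infinity M \<Longrightarrow> (\<lambda>x. f x * g x) \<in> C_infinity M"
  using smooth_on_mult[OF C_infinity_chart C_infinity_chart chart_open(2)]
  by (intro C_infinityI) (simp add: o_def)

lemma C_infinity_local:
  assumes "\<And>x. smooth_near M f x"
  shows "f \<in> C_infinity M"
proof (rule C_infinityI)
  fix U \<phi> assume c: "(U, \<phi>) \<in> charts M"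
  show "smooth_on (\<phi> ` U) (f \<circ> inv_into U \<phi>)"
  proof (rule smooth_on_open_cover[OF _ chart_open(2)[OF c]])
    fix p assume "p \<in> \<phi> ` U"
    then obtain x where x: "x \<in> U" "p = \<phi> x" by auto
    obtain g W where g: "g \<in> C_infinity M" "open W" "x \<in> W" "\<And>y. y \<in> W \<Longrightarrow> f y = g y"
      using assms[of x] unfolding smooth_near_def eventually_nhds by blast
    have o: "open (\<phi> ` (U \<inter> W))"
      using chart_open_image[OF c, of "U \<inter> W"] chart_open[OF c] g by auto
    have "smooth_on (\<phi> ` (U \<inter> W)) (f \<circ> inv_into U \<phi>)"
      by (rule smooth_on_cong[OF o _ smooth_on_mono[OF C_infinity_chart[OF g(1) c]]])
        (auto simp: chart_inv[OF c] g(4))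
    moreover have "\<phi> ` (U \<inter> W) \<inter> \<phi> ` U = \<phi> ` (U \<inter> W)" by auto
    ultimately show "\<exists>T. open T \<and> p \<in> T \<and> smooth_on (T \<inter> \<phi> ` U) (f \<circ> inv_into U \<phi>)"
      using o x g(3) by (intro exI[of _ "\<phi> ` (U \<inter> W)"]) auto
  qed
qed

lemma smooth_near_C_infinity: "f \<in> C_infinity M \<Longrightarrow> smooth_near M f x"
  unfolding smooth_near_def by (intro bexI[of _ f]) auto

text \<open>The preimage of \<open>K\<close> in the manifold is compact, hence closed by the
  Hausdorff property. So a point outside \<open>U\<close> has a neighbourhood that misses it, on
  which the extension is 0; inside \<open>U\<close> smoothness is transported by the transition
  maps.\<close>

lemma C_infinity_extend:
  assumes c: "(U, \<phi>) \<in> charts M" and h: "smooth_on (\<phi> ` U) h"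
    and K: "compact K" "K \<subseteq> \<phi> ` U" "\<And>z. z \<in> \<phi> ` U \<Longrightarrow> z \<notin> K \<Longrightarrow> h z = 0"
  shows "(\<lambda>x. if x \<in> U then h (\<phi> x) else 0) \<in> C_infinity M"
    (is "?f \<in> _")
proof (rule C_infinityI)
  fix W \<psi> assume c': "(W, \<psi>) \<in> charts M"
  define K' where "K' = inv_into U \<phi> ` K"
  have "compact K'" unfolding K'_def
    by (rule compact_continuous_image[OF continuous_on_subset[OF chart_cont_inv[OF c] K(2)] K(1)])
  then have closed: "closed K'" by (rule compact_imp_closed)
  have K'U: "K' \<subseteq> U" unfolding K'_def using K(2) inv_into_into[of _ \<phi> U] by auto
  have f0: "?f x = 0" if "x \<notin> K'" for x
    using that K(3)[of "\<phi> x"] chart_inv[OF c, of x] unfolding K'_def by (metis image_eqI)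
  show "smooth_on (\<psi> ` W) (?f \<circ> inv_into W \<psi>)"
  proof (rule smooth_on_open_cover[OF _ chart_open(2)[OF c']])
    fix p assume "p \<in> \<psi> ` W"
    then obtain x where x: "x \<in> W" "p = \<psi> x" by auto
    show "\<exists>T. open T \<and> p \<in> T \<and> smooth_on (T \<inter> \<psi> ` W) (?f \<circ> inv_into W \<psi>)"
    proof (cases "x \<in> U")
      case True
      let ?T = "\<psi> ` (W \<inter> U)"
      have o: "open ?T"
        using chart_open_image[OF c', of "W \<inter> U"] chart_open[OF c] chart_open[OF c'] by auto
      have "smooth_on ?T (\<lambda>z. h ((\<phi> \<circ> inv_into W \<psi>) z))"
        by (rule smooth_on_compose[OF h chart_transition[OF c' c] _ o])
          (auto simp: chart_inv[OF c'])
      then have "smooth_on ?T (?f \<circ> inv_into W \<psi>)"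
        by (rule smooth_on_cong[OF o, rotated]) (auto simp: chart_inv[OF c'])
      moreover have "?T \<inter> \<psi> ` W = ?T" by auto
      ultimately show ?thesis using o x True by (intro exI[of _ ?T]) auto
    next
      case False
      let ?T = "\<psi> ` (W - K')"
      have o: "open ?T"
        using chart_open_image[OF c', of "W - K'"] chart_open[OF c'] closed by (auto simp: open_Diff)
      have "smooth_on ?T (?f \<circ> inv_into W \<psi>)"
      proof (rule smooth_on_cong[OF o _ smooth_on_const[of _ 0]])
        fix z assume "z \<in> ?T"
        then obtain y where "y \<in> W" "y \<notin> K'" "z = \<psi> y" by auto
        then show "0 = (?f \<circ> inv_into W \<psi>) z" using f0[of y] by (auto simp: chart_inv[OF c'])
      qed
      moreover have "?T \<inter> \<psi> ` W = ?T" by auto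
      ultimately show ?thesis using o x False K'U by (intro exI[of _ ?T]) auto
    qed
  qed
qed

text \<open>A bump function supported in \<open>T\<close> and equal to 1 near the point turns a
  local coordinate expression into a global function with the same germ.\<close>

lemma C_infinity_chart_germ:
  assumes c: "(U, \<phi>) \<in> charts M" and x: "x \<in> U"
    and T: "open T" "\<phi> x \<in> T" "T \<subseteq> \<phi> ` U" and h: "smooth_on T h"
  shows "\<exists>g\<in>C_infinity M. \<forall>\<^sub>F y in nhds x. g y = h (\<phi> y)"
proof -
  obtain r where r: "r > 0" "cball (\<phi> x) r \<subseteq> T"
    using T open_contains_cball by blast
  obtain b :: "real^'n \<Rightarrow> real" where b: "smooth_on UNIV b"
    "\<And>z. z \<in> ball (\<phi> x) (r / 2) \<Longrightarrow> b z = 1" "\<And>z. z \<notin> cball (\<phi> x) r \<Longrightarrow> b z = 0"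
    using ex_bump[OF r(1), of "\<phi> x"] by metis
  define k where "k = (\<lambda>z. if z \<in> T then b z * h z else 0)"
  have "smooth_on (\<phi> ` U) k"
  proof (rule smooth_on_open_cover[OF _ chart_open(2)[OF c]])
    fix p assume p: "p \<in> \<phi> ` U"
    show "\<exists>V. open V \<and> p \<in> V \<and> smooth_on (V \<inter> \<phi> ` U) k"
    proof (cases "p \<in> T")
      case True
      have "smooth_on T k"
        by (rule smooth_on_cong[OF T(1) _ smooth_on_mult[OF smooth_on_mono[OF b(1)] h T(1)]])
          (auto simp: k_def)
      then show ?thesis using True T by (intro exI[of _ T]) (auto intro: smooth_on_mono)
    next
      case False
      have o: "open (\<phi> ` U - cball (\<phi> x) r)" using chart_open[OF c] by (auto simp: open_Diff)
      have "smooth_on (\<phi> ` U - cball (\<phi> x) r) k"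
        by (rule smooth_on_cong[OF o _ smooth_on_const[of _ 0]])
          (use b(3) in \<open>auto simp: k_def\<close>)
      then show ?thesis using o False p r
        by (intro exI[of _ "\<phi> ` U - cball (\<phi> x) r"]) (auto intro: smooth_on_mono)
    qed
  qed
  then have "(\<lambda>x. if x \<in> U then k (\<phi> x) else 0) \<in> C_infinity M" (is "?g \<in> _")
    by (rule C_infinity_extend[OF c _ compact_cball[of "\<phi> x" r]])
      (use r T b(3) in \<open>auto simp: k_def\<close>)
  moreover have "\<forall>\<^sub>F y in nhds x. ?g y = h (\<phi> y)"
    unfolding eventually_nhds
  proof (intro exI conjI ballI)
    show "open {y \<in> U. \<phi> y \<in> ball (\<phi> x) (r / 2)}" using chart_open_vimage[OF c] by blast
    show "x \<in> {y \<in> U. \<phi> y \<in> ball (\<phi> x) (r / 2)}" using x r by auto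
    fix y assume y: "y \<in> {y \<in> U. \<phi> y \<in> ball (\<phi> x) (r / 2)}"
    then have "\<phi> y \<in> cball (\<phi> x) r" using r by auto
    then have "\<phi> y \<in> T" using r by blast
    then show "?g y = h (\<phi> y)" using y b(2)[of "\<phi> y"] by (simp add: k_def)
  qed
  ultimately show ?thesis by (intro bexI[where x = "?g"])
qed

text \<open>The cutoff used in all localisations. The set \<open>V\<close> gives equality of germs,
  the compact \<open>K\<close> closes off the support and makes integrals finite, and
  \<open>N\<close> is where the local data live.\<close>

lemma ex_plateau:
  assumes "open N" "x \<in> N"
  obtains \<eta> V K where "\<eta> \<in> C_infinity M" "open V" "x \<in> V" "V \<subseteq> K" "K \<subseteq> N" "compact K"
    "\<And>y. y \<in> V \<Longrightarrow> \<eta> y = 1" "\<And>y. y \<notin> K \<Longrightarrow> \<eta> y = 0" "\<And>y. \<eta> y \<ge> 0"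
proof -
  obtain U \<phi> where c: "(U, \<phi>) \<in> charts M" and x: "x \<in> U" by (rule ex_chart)
  have o: "open (\<phi> ` (U \<inter> N))"
    using chart_open_image[OF c, of "U \<inter> N"] chart_open[OF c] assms by auto
  then obtain r where r: "r > 0" "cball (\<phi> x) r \<subseteq> \<phi> ` (U \<inter> N)"
    using open_contains_cball[of "\<phi> ` (U \<inter> N)"] x assms by blast
  obtain b :: "real^'n \<Rightarrow> real" where b: "smooth_on UNIV b" "\<And>z. 0 \<le> b z"
    "\<And>z. z \<in> ball (\<phi> x) (r / 2) \<Longrightarrow> b z = 1" "\<And>z. z \<notin> cball (\<phi> x) r \<Longrightarrow> b z = 0"
    using ex_bump[OF r(1), of "\<phi> x"] by metis
  have "(\<lambda>x. if x \<in> U then b (\<phi> x) else 0) \<in> C_infinity M" (is "?g \<in> _")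
    by (rule C_infinity_extend[OF c smooth_on_mono[OF b(1)] compact_cball[of "\<phi> x" r]])
      (use r b(4) in auto)
  moreover have V: "open {y \<in> U. \<phi> y \<in> ball (\<phi> x) (r / 2)}" (is "open ?V")
    using chart_open_vimage[OF c] by blast
  moreover have "x \<in> ?V" using x r by auto
  moreover let ?K = "inv_into U \<phi> ` cball (\<phi> x) r"
  have K: "y \<in> ?K" if "y \<in> U" "\<phi> y \<in> cball (\<phi> x) r" for y
    using that chart_inv[OF c that(1)] by (metis image_eqI)
  moreover have "?V \<subseteq> ?K" using K r(1) by auto
  moreover have "?K \<subseteq> N"
  proof
    fix y assume "y \<in> ?K"
    then obtain z where "y = inv_into U \<phi> z" "z \<in> \<phi> ` (U \<inter> N)" using r by blast
    then show "y \<in> N" using chart_inv[OF c] by auto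
  qed
  moreover have "compact ?K"
    by (rule compact_continuous_image[OF continuous_on_subset[OF chart_cont_inv[OF c]]])
      (use r in auto)
  moreover have "?g y = 1" if "y \<in> ?V" for y using that b by auto
  moreover have "?g y = 0" if "y \<notin> ?K" for y using that b(4)[of "\<phi> y"] K[of y] by auto
  moreover have "?g y \<ge> 0" for y using b by auto
  ultimately show ?thesis using that[of ?g ?V ?K] by blast
qed

lemma smooth_near_const: "smooth_near M (\<lambda>x. c) x"
  using C_inf_const by (rule smooth_near_C_infinity)

lemma smooth_near_add: "smooth_near M f x \<Longrightarrow> smooth_near M g x \<Longrightarrow> smooth_near M (\<lambda>x. f x + g x) x"
  unfolding smooth_near_def
proof (elim bexE)
  fix f' g' assume *: "f' \<in> C_infinity M" "g' \<in> C_infinity M"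
    "\<forall>\<^sub>F y in nhds x. f y = f' y" "\<forall>\<^sub>F y in nhds x. g y = g' y"
  show "\<exists>h\<in>C_infinity M. \<forall>\<^sub>F y in nhds x. f y + g y = h y"
    by (rule bexI[OF _ C_inf_add[OF *(1,2)]]) (use *(3,4) in eventually_elim, simp)
qed

lemma smooth_near_mult: "smooth_near M f x \<Longrightarrow> smooth_near M g x \<Longrightarrow> smooth_near M (\<lambda>x. f x * g x) x"
  unfolding smooth_near_def
proof (elim bexE)
  fix f' g' assume *: "f' \<in> C_infinity M" "g' \<in> C_infinity M"
    "\<forall>\<^sub>F y in nhds x. f y = f' y" "\<forall>\<^sub>F y in nhds x. g y = g' y"
  show "\<exists>h\<in>C_infinity M. \<forall>\<^sub>F y in nhds x. f y * g y = h y"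
    by (rule bexI[OF _ C_inf_mult[OF *(1,2)]]) (use *(3,4) in eventually_elim, simp)
qed

lemma smooth_near_sum: "(\<And>i. i \<in> I \<Longrightarrow> smooth_near M (f i) x) \<Longrightarrow> smooth_near M (\<lambda>x. \<Sum>i\<in>I. f i x) x"
  by (induction I rule: infinite_finite_induct) (simp_all add: smooth_near_const smooth_near_add)

lemma smooth_near_prod: "(\<And>i. i \<in> I \<Longrightarrow> smooth_near M (f i) x) \<Longrightarrow> smooth_near M (\<lambda>x. \<Prod>i\<in>I. f i x) x"
  by (induction I rule: infinite_finite_induct) (simp_all add: smooth_near_const smooth_near_mult)

lemma smooth_near_cong: "smooth_near M f x \<Longrightarrow> \<forall>\<^sub>F y in nhds x. f y = g y \<Longrightarrow> smooth_near M g x"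
  unfolding smooth_near_def
proof (elim bexE)
  fix f' assume *: "f' \<in> C_infinity M" "\<forall>\<^sub>F y in nhds x. f y = f' y" "\<forall>\<^sub>F y in nhds x. f y = g y"
  show "\<exists>h\<in>C_infinity M. \<forall>\<^sub>F y in nhds x. g y = h y"
    by (rule bexI[OF _ *(1)]) (use *(2,3) in eventually_elim, simp)
qed

lemma smooth_near_inverse:
  assumes "smooth_near M f x" "f x \<noteq> 0"
  shows "smooth_near M (\<lambda>x. inverse (f x)) x"
proof -
  obtain g where g: "g \<in> C_infinity M" "\<forall>\<^sub>F y in nhds x. f y = g y"
    using assms unfolding smooth_near_def by blast
  obtain U \<phi> where c: "(U, \<phi>) \<in> charts M" and x: "x \<in> U" by (rule ex_chart)
  let ?g = "g \<circ> inv_into U \<phi>"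
  have gs: "smooth_on (\<phi> ` U) ?g" by (rule C_infinity_chart[OF g(1) c])
  let ?T = "?g -` (- {0}) \<inter> \<phi> ` U"
  have "open ?T"
    using smooth_on_imp_continuous_on[OF gs] continuous_on_open_vimage[OF chart_open(2)[OF c]] by blast
  moreover have "\<phi> x \<in> ?T"
    using x assms(2) eventually_nhds_x_imp_x[OF g(2)] by (simp add: chart_inv[OF c])
  moreover have "smooth_on ?T (\<lambda>z. inverse (?g z))"
    by (rule smooth_on_inverse[OF smooth_on_mono[OF gs]]) (use \<open>open ?T\<close> in auto)
  ultimately obtain h where h: "h \<in> C_infinity M" "\<forall>\<^sub>F y in nhds x. h y = inverse (?g (\<phi> y))"
    using C_infinity_chart_germ[OF c x _ _ Int_lower2, of "?g -` (- {0})"] by blast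
  have "\<forall>\<^sub>F y in nhds x. y \<in> U" using chart_open[OF c] x eventually_nhds by blast
  with g(2) h(2) have "\<forall>\<^sub>F y in nhds x. inverse (f y) = h y"
    by eventually_elim (simp add: chart_inv[OF c])
  then show ?thesis using h(1) unfolding smooth_near_def by blast
qed

text \<open>Off \<open>N\<close> the product vanishes on the open complement of \<open>K\<close>, so
  nothing is required of \<open>a\<close> there.\<close>

lemma C_infinity_cutoff:
  assumes "\<eta> \<in> C_infinity M" "closed K" "K \<subseteq> N" "\<And>y. y \<notin> K \<Longrightarrow> \<eta> y = 0"
    "\<And>y. y \<in> N \<Longrightarrow> smooth_near M a y"
  shows "(\<lambda>x. \<eta> x * a x) \<in> C_infinity M"
proof (rule C_infinity_local)
  fix x show "smooth_near M (\<lambda>x. \<eta> x * a x) x"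
  proof (cases "x \<in> N")
    case True
    then show ?thesis by (intro smooth_near_mult assms smooth_near_C_infinity)
  next
    case False
    then have "open (- K)" "x \<in> - K" using assms by auto
    then have "\<forall>\<^sub>F y in nhds x. y \<in> - K" using eventually_nhds by blast
    then have "\<forall>\<^sub>F y in nhds x. 0 = \<eta> y * a y" by eventually_elim (simp add: assms)
    then show ?thesis by (rule smooth_near_cong[OF smooth_near_const])
  qed
qed

lemma C_infinity_continuous:
  assumes "f \<in> C_infinity M"
  shows "continuous_on UNIV f"
proof (rule continuous_at_imp_continuous_on, safe)
  fix x
  obtain U \<phi> where c: "(U, \<phi>) \<in> charts M" and x: "x \<in> U" by (rule ex_chart)
  have "continuous_on U ((f \<circ> inv_into U \<phi>) \<circ> \<phi>)"
    by (intro continuous_on_compose chart_cont[OF c] smooth_on_imp_continuous_on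
        C_infinity_chart[OF assms c])
  then have "continuous_on U f"
    by (rule continuous_on_eq) (simp add: chart_inv[OF c])
  then show "isCont f x" using x chart_open[OF c] continuous_on_eq_continuous_at by blast
qed

end

section \<open>Tangent vectors, vector fields and coordinates\<close>

lemma scaleR_fun_apply [simp]: "(c *\<^sub>R f) x = c *\<^sub>R f x"
  by (simp add: scaleR_fun_def)

lemma sum_fun_apply: "(sum f I) x = (\<Sum>i\<in>I. f i x)"
  by (induction I rule: infinite_finite_induct) auto

lemma sum_Basis_vec: "(\<Sum>b\<in>(Basis::(real^'n) set). F b) = (\<Sum>i\<in>UNIV. F (axis i 1))"
proof -
  have "(Basis::(real^'n) set) = range (\<lambda>i. axis i 1)" by (auto simp: Basis_vec_def)
  moreover have "inj (\<lambda>i. axis i 1 :: real^'n)" by (auto intro!: injI simp: axis_eq_axis)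
  ultimately show ?thesis
    using sum.reindex[of "\<lambda>i. axis i 1 :: real^'n" UNIV F] by (simp only: o_def)
qed

section \<open>Hadamard's lemma\<close>

lemma segment_in_ball:
  fixes p z :: "'b::real_normed_vector"
  assumes "z \<in> ball p r" "t \<in> {0..1}"
  shows "p + t *\<^sub>R (z - p) \<in> ball p r"
proof -
  have "dist p (p + t *\<^sub>R (z - p)) = t * dist p z"
    using assms by (simp add: dist_norm norm_minus_commute)
  also have "\<dots> \<le> 1 * dist p z" using assms by (intro mult_right_mono) auto
  finally show ?thesis using assms by simp
qed

text \<open>Each differentiation under the integral sign replaces \<open>h\<close> by a partial
  derivative and brings out one factor \<open>t\<close> by the chain rule. Hence the weight
  \<open>t ^ m\<close> and the generality in \<open>h\<close> and \<open>m\<close>.\<close>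

lemma C_k_segment_integral:
  fixes h :: "'b::euclidean_space \<Rightarrow> real"
  assumes "smooth_on (ball p r) h"
  shows "C_k k (\<lambda>z. integral (cbox 0 1) (\<lambda>t. t ^ m * h (p + t *\<^sub>R (z - p)))) (ball p r)"
  using assms
proof (induction k arbitrary: h m)
  case (0 h m)
  let ?B = "ball p r"
  have c: "continuous_on ?B h" by (rule smooth_on_imp_continuous_on[OF 0])
  show ?case
    unfolding C_k.simps
    by (rule integral_continuous_on_param)
      (auto intro!: continuous_intros continuous_on_compose2[OF c] simp: split_beta segment_in_ball[simplified])
next
  case (Suc k h m)
  let ?B = "ball p r"
  let ?D = "\<lambda>b z. frechet_derivative h (at z) b"
  have c: "continuous_on ?B h" by (rule smooth_on_imp_continuous_on[OF Suc.prems])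
  have cD: "continuous_on ?B (?D b)" for b
    by (rule smooth_on_imp_continuous_on[OF smooth_on_frechet_derivative[OF Suc.prems]])
  \<comment> \<open>The derivative of the integrand in \<open>z\<close>, packaged as a bounded
    linear function so that differentiation under the integral sign applies.\<close>
  define fx where "fx = (\<lambda>z t. \<Sum>b\<in>Basis. (t ^ Suc m * ?D b (p + t *\<^sub>R (z - p))) *\<^sub>R blinfun_inner_left b)"
  have fx_apply: "blinfun_apply (fx z t) v = (\<Sum>b\<in>Basis. (v \<bullet> b) * (t ^ Suc m * ?D b (p + t *\<^sub>R (z - p))))" for z t v
    by (simp add: fx_def blinfun.sum_left blinfun.scaleR_left mult.commute)
  have cont_fx: "continuous_on (?B \<times> cbox 0 1) (\<lambda>(z, t). fx z t)"
    unfolding fx_def split_beta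
    by (auto intro!: continuous_intros continuous_on_compose2[OF cD] simp: segment_in_ball[simplified])
  have deriv: "((\<lambda>z. integral (cbox 0 1) (\<lambda>t. t ^ m * h (p + t *\<^sub>R (z - p)))) has_derivative
      blinfun_apply (integral (cbox 0 1) (fx z0))) (at z0)" if z0: "z0 \<in> ?B" for z0
  proof -
    have "((\<lambda>z. integral (cbox 0 1) (\<lambda>t. t ^ m * h (p + t *\<^sub>R (z - p)))) has_derivative
      blinfun_apply (integral (cbox 0 1) (fx z0))) (at z0 within ?B)"
    proof (rule leibniz_rule[OF _ _ cont_fx z0 convex_ball])
      fix z t assume *: "z \<in> ?B" "t \<in> cbox 0 (1::real)"
      have hd: "(h has_derivative frechet_derivative h (at (p + t *\<^sub>R (z - p)))) (at (p + t *\<^sub>R (z - p)))"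
        by (rule smooth_on_imp_has_derivative[OF Suc.prems segment_in_ball[OF *[simplified cbox_interval]]])
      have "((\<lambda>z. p + t *\<^sub>R (z - p)) has_derivative (\<lambda>v. t *\<^sub>R v)) (at z)"
        by (auto intro!: derivative_eq_intros)
      from has_derivative_compose[OF this hd]
      have d1: "((\<lambda>z. t ^ m * h (p + t *\<^sub>R (z - p))) has_derivative
         (\<lambda>v. t ^ m * frechet_derivative h (at (p + t *\<^sub>R (z - p))) (t *\<^sub>R v))) (at z)"
        by (rule has_derivative_mult_right)
      have d2: "(\<lambda>v. t ^ m * frechet_derivative h (at (p + t *\<^sub>R (z - p))) (t *\<^sub>R v)) = blinfun_apply (fx z t)"
      proof
        fix v
        have "frechet_derivative h (at (p + t *\<^sub>R (z - p))) (t *\<^sub>R v) =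
          (\<Sum>b\<in>Basis. ((t *\<^sub>R v) \<bullet> b) *\<^sub>R ?D b (p + t *\<^sub>R (z - p)))"
          by (rule frechet_derivative_componentwise[OF smooth_on_imp_differentiable[OF Suc.prems segment_in_ball[OF *[simplified cbox_interval]]]])
        then show "t ^ m * frechet_derivative h (at (p + t *\<^sub>R (z - p))) (t *\<^sub>R v) = blinfun_apply (fx z t) v"
          by (simp add: fx_apply sum_distrib_left algebra_simps)
      qed
      show "((\<lambda>z. t ^ m * h (p + t *\<^sub>R (z - p))) has_derivative blinfun_apply (fx z t)) (at z within ?B)"
        using has_derivative_at_withinI[OF d1] unfolding d2 .
    next
      fix z assume "z \<in> ?B"
      then show "(\<lambda>t. t ^ m * h (p + t *\<^sub>R (z - p))) integrable_on cbox 0 1"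
        by (intro integrable_continuous continuous_intros continuous_on_compose2[OF c])
          (auto simp: segment_in_ball[simplified])
    qed
    then show ?thesis unfolding at_within_open[OF z0 open_ball] .
  qed
  have val: "blinfun_apply (integral (cbox 0 1) (fx z)) v =
    (\<Sum>b\<in>Basis. (v \<bullet> b) * integral (cbox 0 1) (\<lambda>t. t ^ Suc m * ?D b (p + t *\<^sub>R (z - p))))"
    if z: "z \<in> ?B" for z v
  proof -
    have "continuous_on (cbox 0 1) (fx z)"
      unfolding fx_def using z
      by (auto intro!: continuous_intros continuous_on_compose2[OF cD] simp: segment_in_ball[simplified])
    then have "blinfun_apply (integral (cbox 0 1) (fx z)) v = integral (cbox 0 1) (\<lambda>t. blinfun_apply (fx z t) v)"
      by (intro blinfun_apply_integral integrable_continuous)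
    also have "\<dots> = (\<Sum>b\<in>Basis. integral (cbox 0 1) (\<lambda>t. (v \<bullet> b) * (t ^ Suc m * ?D b (p + t *\<^sub>R (z - p)))))"
      unfolding fx_apply using z
      by (intro integral_sum integrable_continuous finite_Basis continuous_intros continuous_on_compose2[OF cD])
        (auto simp: segment_in_ball[simplified])
    finally show ?thesis by simp
  qed
  have "C_k k (\<lambda>z. frechet_derivative (\<lambda>z. integral (cbox 0 1) (\<lambda>t. t ^ m * h (p + t *\<^sub>R (z - p)))) (at z) v) ?B" for v
  proof (rule C_k_cong[OF open_ball])
    show "C_k k (\<lambda>z. \<Sum>b\<in>Basis. (v \<bullet> b) * integral (cbox 0 1) (\<lambda>t. t ^ Suc m * ?D b (p + t *\<^sub>R (z - p)))) ?B"
      by (intro C_k_sum C_k_mult C_k_const open_ball Suc.IH smooth_on_frechet_derivative[OF Suc.prems])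
    fix z assume "z \<in> ?B"
    then show "(\<Sum>b\<in>Basis. (v \<bullet> b) * integral (cbox 0 1) (\<lambda>t. t ^ Suc m * ?D b (p + t *\<^sub>R (z - p)))) =
      frechet_derivative (\<lambda>z. integral (cbox 0 1) (\<lambda>t. t ^ m * h (p + t *\<^sub>R (z - p)))) (at z) v"
      using frechet_derivative_eqI[OF deriv] val by simp
  qed
  moreover have "(\<lambda>z. integral (cbox 0 1) (\<lambda>t. t ^ m * h (p + t *\<^sub>R (z - p)))) differentiable at z"
    if "z \<in> ?B" for z
    by (rule differentiableI[OF deriv[OF that]])
  ultimately show ?case unfolding C_k.simps by blast
qed

text \<open>The functions \<open>g b\<close> are the means of the partial derivatives along the segments from \<open>p\<close>.\<close>

lemma Hadamard:
  fixes f :: "'b::euclidean_space \<Rightarrow> real"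
  assumes f: "smooth_on (ball p r) f" and r: "r > 0"
  obtains g where "\<And>b. smooth_on (ball p r) (g b)"
    "\<And>z. z \<in> ball p r \<Longrightarrow> f z = f p + (\<Sum>b\<in>Basis. ((z - p) \<bullet> b) * g b z)"
    "\<And>b. g b p = frechet_derivative f (at p) b"
proof -
  let ?B = "ball p r"
  let ?D = "\<lambda>b z. frechet_derivative f (at z) b"
  \<comment> \<open>The factor \<open>t ^ 0\<close> only matches the form of
    \<open>C_k_segment_integral\<close>.\<close>
  define g where "g = (\<lambda>b z. integral (cbox 0 1) (\<lambda>t. t ^ 0 * ?D b (p + t *\<^sub>R (z - p))))"
  have cD: "continuous_on ?B (?D b)" for b
    by (rule smooth_on_imp_continuous_on[OF smooth_on_frechet_derivative[OF f]])
  have "smooth_on ?B (g b)" for b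
    unfolding smooth_on_def g_def
    using C_k_segment_integral[OF smooth_on_frechet_derivative[OF f]] by blast
  moreover have "f z = f p + (\<Sum>b\<in>Basis. ((z - p) \<bullet> b) * g b z)" if z: "z \<in> ?B" for z
  proof -
    have "((\<lambda>t. ?D (z - p) (p + t *\<^sub>R (z - p))) has_integral f (p + 1 *\<^sub>R (z - p)) - f (p + 0 *\<^sub>R (z - p))) {0..1}"
    proof (rule fundamental_theorem_of_calculus)
      fix t :: real assume t: "t \<in> {0..1}"
      have hd: "(f has_derivative frechet_derivative f (at (p + t *\<^sub>R (z - p)))) (at (p + t *\<^sub>R (z - p)))"
        by (rule smooth_on_imp_has_derivative[OF f segment_in_ball[OF z t]])
      have "((\<lambda>t. p + t *\<^sub>R (z - p)) has_derivative (\<lambda>v. v *\<^sub>R (z - p))) (at t)"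
        by (auto intro!: derivative_eq_intros)
      from has_derivative_compose[OF this hd]
      have "((\<lambda>t. f (p + t *\<^sub>R (z - p))) has_derivative
         (\<lambda>v. frechet_derivative f (at (p + t *\<^sub>R (z - p))) (v *\<^sub>R (z - p)))) (at t)" .
      moreover have "linear (frechet_derivative f (at (p + t *\<^sub>R (z - p))))"
        by (rule linear_frechet_derivative[OF smooth_on_imp_differentiable[OF f segment_in_ball[OF z t]]])
      ultimately show "((\<lambda>t. f (p + t *\<^sub>R (z - p))) has_vector_derivative ?D (z - p) (p + t *\<^sub>R (z - p))) (at t within {0..1})"
        unfolding has_vector_derivative_def
        by (simp add: linear_scale has_derivative_at_withinI)
    qed simp
    then have "f z - f p = integral {0..1} (\<lambda>t. ?D (z - p) (p + t *\<^sub>R (z - p)))"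
      by (simp add: integral_unique)
    also have "\<dots> = integral {0..1} (\<lambda>t. \<Sum>b\<in>Basis. ((z - p) \<bullet> b) * ?D b (p + t *\<^sub>R (z - p)))"
    proof (rule integral_cong)
      fix t :: real assume t: "t \<in> {0..1}"
      show "?D (z - p) (p + t *\<^sub>R (z - p)) = (\<Sum>b\<in>Basis. ((z - p) \<bullet> b) * ?D b (p + t *\<^sub>R (z - p)))"
        using frechet_derivative_componentwise[OF smooth_on_imp_differentiable[OF f segment_in_ball[OF z t]], of "z - p"]
        by simp
    qed
    also have "\<dots> = (\<Sum>b\<in>Basis. integral {0..1} (\<lambda>t. ((z - p) \<bullet> b) * ?D b (p + t *\<^sub>R (z - p))))"
      by (intro integral_sum integrable_continuous_real finite_Basis continuous_intros continuous_on_compose2[OF cD])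
        (use z segment_in_ball[OF z] in auto)
    finally show ?thesis by (simp add: g_def)
  qed
  moreover have "g b p = ?D b p" for b by (simp add: g_def)
  ultimately show ?thesis using that by blast
qed

context smooth_manifold
begin

section \<open>Derivations and vector fields\<close>

lemma C_inf_minus [simp, intro]: "f \<in> C_infinity M \<Longrightarrow> (\<lambda>x. - f x) \<in> C_infinity M"
  using C_inf_mult[of "\<lambda>x. -1" f] by simp

lemma C_inf_diff [simp, intro]: "f \<in> C_infinity M \<Longrightarrow> g \<in> C_infinity M \<Longrightarrow> (\<lambda>x. f x - g x) \<in> C_infinity M"
  using C_inf_add[of f "\<lambda>x. - g x"] by simp

lemma C_inf_sum [intro]: "(\<And>i. i \<in> I \<Longrightarrow> f i \<in> C_infinity M) \<Longrightarrow> (\<lambda>x. \<Sum>i\<in>I. f i x) \<in> C_infinity M"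
  by (induction I rule: infinite_finite_induct) auto

lemma tangent_nonsmooth: "v \<in> tangent_space M x \<Longrightarrow> f \<notin> C_infinity M \<Longrightarrow> v f = 0"
  unfolding tangent_space_def by blast

lemma tangent_add:
  "v \<in> tangent_space M x \<Longrightarrow> f \<in> C_infinity M \<Longrightarrow> g \<in> C_infinity M \<Longrightarrow> v (\<lambda>y. f y + g y) = v f + v g"
  unfolding tangent_space_def plus_fun_def by blast

lemma tangent_cmult: "v \<in> tangent_space M x \<Longrightarrow> f \<in> C_infinity M \<Longrightarrow> v (\<lambda>y. c * f y) = c * v f"
  unfolding tangent_space_def scaleR_fun_def by simp

lemma tangent_mult:
  "v \<in> tangent_space M x \<Longrightarrow> f \<in> C_infinity M \<Longrightarrow> g \<in> C_infinity M \<Longrightarrow>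
    v (\<lambda>y. f y * g y) = f x * v g + g x * v f"
  unfolding tangent_space_def times_fun_def by blast

text \<open>Since \<open>1 * 1 = 1\<close>, the Leibniz rule gives
  \<open>v 1 = 2 * v 1\<close>.\<close>

lemma tangent_const: "v \<in> tangent_space M x \<Longrightarrow> v (\<lambda>y. c) = 0"
  using tangent_mult[of v x "\<lambda>_. 1" "\<lambda>_. 1"] tangent_cmult[of v x "\<lambda>_. 1" c] by simp

lemma tangent_minus: "v \<in> tangent_space M x \<Longrightarrow> f \<in> C_infinity M \<Longrightarrow> v (\<lambda>y. - f y) = - v f"
  using tangent_cmult[of v x f "-1"] by simp

lemma tangent_diff:
  "v \<in> tangent_space M x \<Longrightarrow> f \<in> C_infinity M \<Longrightarrow> g \<in> C_infinity M \<Longrightarrow> v (\<lambda>y. f y - g y) = v f - v g"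
  using tangent_add[of v x f "\<lambda>y. - g y"] tangent_minus[of v x g] by simp

lemma tangent_sum:
  "v \<in> tangent_space M x \<Longrightarrow> (\<And>i. i \<in> I \<Longrightarrow> f i \<in> C_infinity M) \<Longrightarrow>
    v (\<lambda>y. \<Sum>i\<in>I. f i y) = (\<Sum>i\<in>I. v (f i))"
proof (induction I rule: infinite_finite_induct)
  case (insert i I)
  then show ?case using tangent_add[of v x "f i" "\<lambda>y. \<Sum>i\<in>I. f i y"] by (simp add: C_inf_sum)
qed (auto simp: tangent_const)

text \<open>A cutoff supported where \<open>f\<close> and \<open>g\<close> agree makes the product
  with \<open>f - g\<close> vanish identically. The Leibniz rule at \<open>x\<close>, where the
  cutoff is 1 and the difference is 0, leaves \<open>v f - v g\<close>.\<close>

lemma tangent_germ: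
  assumes v: "v \<in> tangent_space M x" and f: "f \<in> C_infinity M" "g \<in> C_infinity M"
    and e: "\<forall>\<^sub>F y in nhds x. f y = g y"
  shows "v f = v g"
proof -
  obtain N where N: "open N" "x \<in> N" "\<And>y. y \<in> N \<Longrightarrow> f y = g y"
    using e unfolding eventually_nhds by blast
  obtain \<eta> V K where \<eta>: "\<eta> \<in> C_infinity M" "open V" "x \<in> V" "V \<subseteq> K" "K \<subseteq> N" "compact K"
    "\<And>y. y \<in> V \<Longrightarrow> \<eta> y = 1" "\<And>y. y \<notin> K \<Longrightarrow> \<eta> y = 0" "\<And>y. \<eta> y \<ge> 0"
    using ex_plateau[OF N(1,2)] by metis
  have "(\<lambda>y. \<eta> y * (f y - g y)) = (\<lambda>y. 0)"
    using \<eta> N by (metis diff_self mult_zero_left mult_zero_right subsetD)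
  then have "v (\<lambda>y. \<eta> y * (f y - g y)) = 0" using tangent_const[OF v] by simp
  moreover have "v (\<lambda>y. \<eta> y * (f y - g y)) = \<eta> x * (v f - v g) + (f x - g x) * v \<eta>"
    using tangent_mult[OF v \<eta>(1) C_inf_diff[OF f]] tangent_diff[OF v f] by simp
  ultimately show ?thesis using \<eta>(3,7) N by simp
qed

lemma tangent_ext:
  assumes "v \<in> tangent_space M x" "w \<in> tangent_space M x" "\<And>f. f \<in> C_infinity M \<Longrightarrow> v f = w f"
  shows "v = w"
  using assms tangent_nonsmooth by (metis ext)

lemma subspace_tangent: "subspace (tangent_space M x)"
  unfolding subspace_def tangent_space_def by (auto simp: algebra_simps)

lemma vfields_tangent: "A \<in> vfields M \<Longrightarrow> A x \<in> tangent_space M x"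
  unfolding vfields_def by blast

lemma vfields_smooth [simp]: "A \<in> vfields M \<Longrightarrow> f \<in> C_infinity M \<Longrightarrow> (\<lambda>x. A x f) \<in> C_infinity M"
  unfolding vfields_def by blast

lemma vfieldsI: "(\<And>x. A x \<in> tangent_space M x) \<Longrightarrow>
    (\<And>f. f \<in> C_infinity M \<Longrightarrow> (\<lambda>x. A x f) \<in> C_infinity M) \<Longrightarrow> A \<in> vfields M"
  unfolding vfields_def by blast

lemma vfields_add [simp, intro]: "A \<in> vfields M \<Longrightarrow> B \<in> vfields M \<Longrightarrow> A + B \<in> vfields M"
  by (intro vfieldsI) (auto intro: subspace_add[OF subspace_tangent] vfields_tangent)

lemma vfields_mult [simp, intro]:
  "f \<in> C_infinity M \<Longrightarrow> A \<in> vfields M \<Longrightarrow> (\<lambda>x. f x *\<^sub>R A x) \<in> vfields M"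
  by (intro vfieldsI) (auto intro: subspace_scale[OF subspace_tangent] vfields_tangent)

lemma vfields_zero [simp, intro]: "0 \<in> vfields M"
  by (intro vfieldsI) (auto intro: subspace_0[OF subspace_tangent])

lemma vfields_scale [simp, intro]: "A \<in> vfields M \<Longrightarrow> c *\<^sub>R A \<in> vfields M"
  using vfields_mult[of "\<lambda>_. c" A] by (simp add: scaleR_fun_def[of c A])

lemma vfields_minus [simp, intro]: "A \<in> vfields M \<Longrightarrow> - A \<in> vfields M"
  using vfields_scale[of A "-1"] by simp

lemma vfields_diff [simp, intro]: "A \<in> vfields M \<Longrightarrow> B \<in> vfields M \<Longrightarrow> A - B \<in> vfields M"
  using vfields_add[of A "- B"] by simp

lemma vfields_sum [intro]: "(\<And>i. i \<in> I \<Longrightarrow> A i \<in> vfields M) \<Longrightarrow> (\<Sum>i\<in>I. A i) \<in> vfields M"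
  by (induction I rule: infinite_finite_induct) auto

lemma vfields_lie_bracket [simp, intro]:
  assumes A: "A \<in> vfields M" and B: "B \<in> vfields M"
  shows "lie_bracket A B \<in> vfields M"
proof (rule vfieldsI)
  fix x
  note Ax = vfields_tangent[OF A, of x] and Bx = vfields_tangent[OF B, of x]
  note t = vfields_tangent[OF A] vfields_tangent[OF B]
  show "lie_bracket A B x \<in> tangent_space M x"
    unfolding tangent_space_def mem_Collect_eq
  proof (intro conjI allI ballI impI)
    fix f assume "f \<notin> C_infinity M"
    then show "lie_bracket A B x f = 0"
      using tangent_const[OF Ax, of 0] tangent_const[OF Bx, of 0] tangent_nonsmooth[OF t(1)]
        tangent_nonsmooth[OF t(2)] by (simp add: lie_bracket_def)
  next
    fix f g assume fg: "f \<in> C_infinity M" "g \<in> C_infinity M"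
    have "(\<lambda>y. A y (f + g)) = (\<lambda>y. A y f + A y g)" "(\<lambda>y. B y (f + g)) = (\<lambda>y. B y f + B y g)"
      using tangent_add[OF t(1) fg] tangent_add[OF t(2) fg] by (auto simp: plus_fun_def)
    then show "lie_bracket A B x (f + g) = lie_bracket A B x f + lie_bracket A B x g"
      using fg A B by (simp add: lie_bracket_def tangent_add[OF Ax] tangent_add[OF Bx])
    have "(\<lambda>y. A y (f * g)) = (\<lambda>y. f y * A y g + g y * A y f)"
      "(\<lambda>y. B y (f * g)) = (\<lambda>y. f y * B y g + g y * B y f)"
      using tangent_mult[OF t(1) fg] tangent_mult[OF t(2) fg] by (auto simp: times_fun_def)
    \<comment> \<open>The mixed products of first derivatives of \<open>f\<close> and
      \<open>g\<close> occur in both orders of differentiation and cancel.\<close>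
    then show "lie_bracket A B x (f * g) = f x * lie_bracket A B x g + g x * lie_bracket A B x f"
      using fg A B by (simp add: lie_bracket_def tangent_add[OF Ax] tangent_add[OF Bx]
          tangent_mult[OF Ax] tangent_mult[OF Bx] algebra_simps)
  next
    fix c f assume f: "f \<in> C_infinity M"
    have "(\<lambda>y. A y (c *\<^sub>R f)) = (\<lambda>y. c * A y f)" "(\<lambda>y. B y (c *\<^sub>R f)) = (\<lambda>y. c * B y f)"
      using tangent_cmult[OF t(1) f] tangent_cmult[OF t(2) f] by (auto simp: scaleR_fun_def)
    then show "lie_bracket A B x (c *\<^sub>R f) = c * lie_bracket A B x f"
      using f A B by (simp add: lie_bracket_def tangent_cmult[OF Ax] tangent_cmult[OF Bx] algebra_simps)
  qed
next
  fix f assume "f \<in> C_infinity M"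
  then show "(\<lambda>x. lie_bracket A B x f) \<in> C_infinity M"
    using A B by (simp add: lie_bracket_def)
qed

lemma lie_bracket_germ:
  assumes "A \<in> vfields M" "B \<in> vfields M" "A' \<in> vfields M" "B' \<in> vfields M"
    "\<forall>\<^sub>F y in nhds x. A y = A' y" "\<forall>\<^sub>F y in nhds x. B y = B' y"
  shows "lie_bracket A B x = lie_bracket A' B' x"
proof (rule tangent_ext)
  show "lie_bracket A B x \<in> tangent_space M x" "lie_bracket A' B' x \<in> tangent_space M x"
    using assms by (auto intro: vfields_tangent)
  fix f assume f: "f \<in> C_infinity M"
  have "A x = A' x" "B x = B' x" using assms(5,6) eventually_nhds_x_imp_x by fast+
  moreover have "A x (\<lambda>y. B y f) = A x (\<lambda>y. B' y f)"
    by (rule tangent_germ[OF vfields_tangent[OF assms(1)] vfields_smooth[OF assms(2) f]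
          vfields_smooth[OF assms(4) f] eventually_mono[OF assms(6)]]) simp
  moreover have "B x (\<lambda>y. A y f) = B x (\<lambda>y. A' y f)"
    by (rule tangent_germ[OF vfields_tangent[OF assms(2)] vfields_smooth[OF assms(1) f]
          vfields_smooth[OF assms(3) f] eventually_mono[OF assms(5)]]) simp
  ultimately show "lie_bracket A B x f = lie_bracket A' B' x f" by (simp add: lie_bracket_def)
qed

lemma vfields_local:
  assumes "\<And>x. \<exists>B\<in>vfields M. \<forall>\<^sub>F y in nhds x. A y = B y"
  shows "A \<in> vfields M"
proof (rule vfieldsI)
  fix x
  show "A x \<in> tangent_space M x"
    using assms[of x] eventually_nhds_x_imp_x vfields_tangent by fastforce
next
  fix f assume f: "f \<in> C_infinity M"
  show "(\<lambda>x. A x f) \<in> C_infinity M"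
  proof (rule C_infinity_local)
    fix x
    obtain B where "B \<in> vfields M" "\<forall>\<^sub>F y in nhds x. A y = B y" using assms by blast
    then show "smooth_near M (\<lambda>x. A x f) x"
      unfolding smooth_near_def
      by (intro bexI[of _ "\<lambda>x. B x f"]) (use f in \<open>auto elim: eventually_mono\<close>)
  qed
qed

section \<open>Coordinate vectors\<close>

lemma chart_has_derivative:
  assumes "(U, \<phi>) \<in> charts M" "y \<in> U" "f \<in> C_infinity M"
  shows "((f \<circ> inv_into U \<phi>) has_derivative frechet_derivative (f \<circ> inv_into U \<phi>) (at (\<phi> y))) (at (\<phi> y))"
  by (rule smooth_on_imp_has_derivative[OF C_infinity_chart[OF assms(3,1)]]) (use assms in auto)

lemma coord_vec_tangent:
  assumes c: "(U, \<phi>) \<in> charts M" and y: "y \<in> U"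
  shows "coord_vec M U \<phi> i y \<in> tangent_space M y"
  unfolding tangent_space_def mem_Collect_eq
proof (intro conjI allI ballI impI)
  fix f assume "f \<notin> C_infinity M"
  then show "coord_vec M U \<phi> i y f = 0" by (simp add: coord_vec_def)
next
  fix f g assume f: "f \<in> C_infinity M" and g: "g \<in> C_infinity M"
  note d = chart_has_derivative[OF c y]
  have "((\<lambda>z. (f \<circ> inv_into U \<phi>) z + (g \<circ> inv_into U \<phi>) z) has_derivative
      (\<lambda>v. frechet_derivative (f \<circ> inv_into U \<phi>) (at (\<phi> y)) v + frechet_derivative (g \<circ> inv_into U \<phi>) (at (\<phi> y)) v)) (at (\<phi> y))"
    by (rule has_derivative_add[OF d[OF f] d[OF g]])
  moreover have "f + g \<in> C_infinity M" using f g by (simp add: plus_fun_def)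
  ultimately show "coord_vec M U \<phi> i y (f + g) = coord_vec M U \<phi> i y f + coord_vec M U \<phi> i y g"
    using f g by (simp add: coord_vec_def frechet_derivative_eqI o_def)
  have "((\<lambda>z. (f \<circ> inv_into U \<phi>) z * (g \<circ> inv_into U \<phi>) z) has_derivative
      (\<lambda>v. (f \<circ> inv_into U \<phi>) (\<phi> y) * frechet_derivative (g \<circ> inv_into U \<phi>) (at (\<phi> y)) v
        + frechet_derivative (f \<circ> inv_into U \<phi>) (at (\<phi> y)) v * (g \<circ> inv_into U \<phi>) (\<phi> y))) (at (\<phi> y))"
    by (rule has_derivative_mult[OF d[OF f] d[OF g]])
  moreover have "f * g \<in> C_infinity M" using f g by (simp add: times_fun_def)
  ultimately show "coord_vec M U \<phi> i y (f * g) = f y * coord_vec M U \<phi> i y g + g y * coord_vec M U \<phi> i y f"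
    using f g by (simp add: coord_vec_def frechet_derivative_eqI o_def chart_inv[OF c y])
next
  fix a f assume f: "f \<in> C_infinity M"
  have "((\<lambda>z. a * (f \<circ> inv_into U \<phi>) z) has_derivative
      (\<lambda>v. a * frechet_derivative (f \<circ> inv_into U \<phi>) (at (\<phi> y)) v)) (at (\<phi> y))"
    by (rule has_derivative_mult_right[OF chart_has_derivative[OF c y f]])
  moreover have "a *\<^sub>R f \<in> C_infinity M" using f by (simp add: scaleR_fun_def)
  ultimately show "coord_vec M U \<phi> i y (a *\<^sub>R f) = a * coord_vec M U \<phi> i y f"
    using f by (simp add: coord_vec_def frechet_derivative_eqI o_def)
qed

text \<open>By Hadamard's lemma \<open>f\<close> is near \<open>y\<close> the constant
  \<open>f y\<close> plus a sum of centred coordinates times smooth functions; the Leibniz rule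
  differentiates only the centred factors. The global functions \<xi> stand in for the coordinates,
  to which a derivation of global functions cannot be applied.\<close>

lemma tangent_coord_expansion:
  assumes c: "(U, \<phi>) \<in> charts M" and y: "y \<in> U"
    and \<xi>: "\<And>i. \<xi> i \<in> C_infinity M" "\<And>i. \<forall>\<^sub>F z in nhds y. \<xi> i z = \<phi> z $ i"
    and v: "v \<in> tangent_space M y" and f: "f \<in> C_infinity M"
  shows "v f = (\<Sum>i\<in>UNIV. v (\<xi> i) * coord_vec M U \<phi> i y f)"
proof -
  let ?f = "f \<circ> inv_into U \<phi>"
  let ?p = "\<phi> y"
  have "?p \<in> \<phi> ` U" using y by blast
  then obtain r where r: "r > 0" "ball ?p r \<subseteq> \<phi> ` U"
    using chart_open(2)[OF c] open_contains_ball by metis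
  obtain g where g: "\<And>b. smooth_on (ball ?p r) (g b)"
    "\<And>z. z \<in> ball ?p r \<Longrightarrow> ?f z = ?f ?p + (\<Sum>b\<in>Basis. ((z - ?p) \<bullet> b) * g b z)"
    "\<And>b. g b ?p = frechet_derivative ?f (at ?p) b"
    using Hadamard[OF smooth_on_mono[OF C_infinity_chart[OF f c] r(2)] r(1)] by blast
  have "\<exists>G\<in>C_infinity M. \<forall>\<^sub>F z in nhds y. G z = g (axis i 1) (\<phi> z)" for i
    by (rule C_infinity_chart_germ[OF c y open_ball _ r(2) g(1)]) (use r in auto)
  then obtain G where G: "\<And>i. G i \<in> C_infinity M" "\<And>i. \<forall>\<^sub>F z in nhds y. G i z = g (axis i 1) (\<phi> z)"
    by metis
  have near: "\<forall>\<^sub>F z in nhds y. z \<in> U \<and> \<phi> z \<in> ball ?p r"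
    unfolding eventually_nhds using chart_open_vimage[OF c open_ball, of ?p r] y r
    by (intro exI[of _ "{z \<in> U. \<phi> z \<in> ball ?p r}"]) auto
  have GG: "\<forall>\<^sub>F z in nhds y. \<forall>i. G i z = g (axis i 1) (\<phi> z)"
    by (rule eventually_all_finite[OF G(2)])
  have XX: "\<forall>\<^sub>F z in nhds y. \<forall>i. \<xi> i z = \<phi> z $ i"
    by (rule eventually_all_finite[OF \<xi>(2)])
  have \<xi>y: "\<xi> i y = ?p $ i" for i using eventually_nhds_x_imp_x[OF \<xi>(2)] .
  have Gy: "G i y = coord_vec M U \<phi> i y f" for i
    using eventually_nhds_x_imp_x[OF G(2)] f by (simp add: coord_vec_def g(3))
  have "\<forall>\<^sub>F z in nhds y. f z = f y + (\<Sum>i\<in>UNIV. (\<xi> i z - \<xi> i y) * G i z)"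
    using near GG XX
  proof eventually_elim
    case (elim z)
    then have "f z = ?f (\<phi> z)" by (simp add: chart_inv[OF c])
    also have "\<dots> = ?f ?p + (\<Sum>b\<in>Basis. ((\<phi> z - ?p) \<bullet> b) * g b (\<phi> z))"
      using elim by (intro g(2)) simp
    also have "\<dots> = f y + (\<Sum>i\<in>UNIV. (\<xi> i z - \<xi> i y) * G i z)"
      unfolding sum_Basis_vec using elim y by (simp add: chart_inv[OF c] \<xi>y inner_axis)
    finally show ?case .
  qed
  then have "v f = v (\<lambda>z. f y + (\<Sum>i\<in>UNIV. (\<xi> i z - \<xi> i y) * G i z))"
    by (intro tangent_germ[OF v f]) (use \<xi> G in \<open>auto intro!: C_inf_add C_inf_sum\<close>)
  also have "\<dots> = v (\<lambda>z. \<Sum>i\<in>UNIV. (\<xi> i z - \<xi> i y) * G i z)"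
    using tangent_add[OF v, of "\<lambda>_. f y" "\<lambda>z. \<Sum>i\<in>UNIV. (\<xi> i z - \<xi> i y) * G i z"] \<xi> G
      tangent_const[OF v] by (auto simp: C_inf_sum)
  also have "\<dots> = (\<Sum>i\<in>UNIV. v (\<lambda>z. (\<xi> i z - \<xi> i y) * G i z))"
    by (rule tangent_sum[OF v]) (use \<xi> G in auto)
  also have "\<dots> = (\<Sum>i\<in>UNIV. v (\<xi> i) * coord_vec M U \<phi> i y f)"
  proof (rule sum.cong[OF refl])
    fix i
    have "v (\<lambda>z. (\<xi> i z - \<xi> i y) * G i z) = (\<xi> i y - \<xi> i y) * v (G i) + G i y * v (\<lambda>z. \<xi> i z - \<xi> i y)"
      by (rule tangent_mult[OF v]) (use \<xi> G in auto)
    also have "v (\<lambda>z. \<xi> i z - \<xi> i y) = v (\<xi> i)"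
      using tangent_diff[OF v \<xi>(1), of "\<lambda>_. \<xi> i y"] tangent_const[OF v] by simp
    finally show "v (\<lambda>z. (\<xi> i z - \<xi> i y) * G i z) = v (\<xi> i) * coord_vec M U \<phi> i y f"
      by (simp add: Gy)
  qed
  finally show ?thesis .
qed

lemma coord_vec_coord:
  assumes c: "(U, \<phi>) \<in> charts M" and y: "y \<in> U"
    and \<xi>: "\<xi> \<in> C_infinity M" "\<forall>\<^sub>F z in nhds y. \<xi> z = \<phi> z $ j"
  shows "coord_vec M U \<phi> i y \<xi> = (if i = j then 1 else 0)"
proof -
  obtain W where W: "open W" "y \<in> W" "\<And>z. z \<in> W \<Longrightarrow> \<xi> z = \<phi> z $ j"
    using \<xi>(2) unfolding eventually_nhds by blast
  have o: "open (\<phi> ` (U \<inter> W))"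
    using chart_open_image[OF c, of "U \<inter> W"] chart_open[OF c] W by auto
  have "((\<lambda>z. z $ j) has_derivative (\<lambda>z. z $ j)) (at (\<phi> y))"
    by (rule bounded_linear_imp_has_derivative[OF bounded_linear_vec_nth])
  then have "((\<xi> \<circ> inv_into U \<phi>) has_derivative (\<lambda>z. z $ j)) (at (\<phi> y))"
    by (rule has_derivative_transform_within_open[OF _ o])
      (use y W in \<open>auto simp: chart_inv[OF c]\<close>)
  then show ?thesis using \<xi> by (simp add: coord_vec_def frechet_derivative_eqI axis_def)
qed

text \<open>The chart coordinates are multiplied by a cutoff; only their germs on \<open>W\<close>
  are used later.\<close>

lemma ex_coordinates:
  assumes c: "(U, \<phi>) \<in> charts M" and N: "open N" "x \<in> N" "N \<subseteq> U"
  obtains \<xi> W where "open W" "x \<in> W" "W \<subseteq> N" "\<And>i. \<xi> i \<in> C_infinity M"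
    "\<And>y i. y \<in> W \<Longrightarrow> \<xi> i y = \<phi> y $ i"
proof -
  obtain \<eta> V K where \<eta>: "\<eta> \<in> C_infinity M" "open V" "x \<in> V" "V \<subseteq> K" "K \<subseteq> N" "compact K"
    "\<And>y. y \<in> V \<Longrightarrow> \<eta> y = 1" "\<And>y. y \<notin> K \<Longrightarrow> \<eta> y = 0" "\<And>y. \<eta> y \<ge> 0"
    using ex_plateau[OF N(1,2)] by metis
  have near: "smooth_near M (\<lambda>y. \<phi> y $ i) y" if "y \<in> N" for y i
  proof -
    have "y \<in> U" using that N by auto
    have "\<exists>g\<in>C_infinity M. \<forall>\<^sub>F z in nhds y. g z = \<phi> z $ i"
      by (rule C_infinity_chart_germ[OF c \<open>y \<in> U\<close> chart_open(2)[OF c] _ subset_refl])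
        (use \<open>y \<in> U\<close> in \<open>auto intro: smooth_on_linear bounded_linear_vec_nth\<close>)
    then show ?thesis unfolding smooth_near_def by (metis (mono_tags, lifting) eventually_mono)
  qed
  have "(\<lambda>y. \<eta> y * \<phi> y $ i) \<in> C_infinity M" for i
    by (rule C_infinity_cutoff[OF \<eta>(1) compact_imp_closed[OF \<eta>(6)] \<eta>(5)]) (use \<eta>(8) near in auto)
  then show ?thesis using \<eta> by (intro that[of V "\<lambda>i y. \<eta> y * \<phi> y $ i"]) auto
qed

end

section \<open>Orthonormal frames and gradients\<close>

lemma span_image_coeffs:
  assumes "finite I" "v \<in> span (u ` I)"
  shows "\<exists>c. v = (\<Sum>i\<in>I. c i *\<^sub>R u i)"
proof -
  have "subspace {v. \<exists>c. v = (\<Sum>i\<in>I. c i *\<^sub>R u i)}"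
  proof (rule subspaceI; clarsimp)
    show "\<exists>c. (\<Sum>i\<in>I. c i *\<^sub>R u i) = 0" by (intro exI[of _ "\<lambda>_. 0"]) simp
    fix c c' show "\<exists>e. (\<Sum>i\<in>I. c i *\<^sub>R u i) + (\<Sum>i\<in>I. c' i *\<^sub>R u i) = (\<Sum>i\<in>I. e i *\<^sub>R u i)"
      by (intro exI[of _ "\<lambda>i. c i + c' i"]) (simp add: scaleR_add_left sum.distrib)
    fix r show "\<exists>e. r *\<^sub>R (\<Sum>i\<in>I. c i *\<^sub>R u i) = (\<Sum>i\<in>I. e i *\<^sub>R u i)"
      by (intro exI[of _ "\<lambda>i. r * c i"]) (simp add: scaleR_sum_right)
  qed
  moreover have "u ` I \<subseteq> {v. \<exists>c. v = (\<Sum>i\<in>I. c i *\<^sub>R u i)}"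
  proof clarsimp
    fix j assume "j \<in> I"
    then have "u j = (\<Sum>i\<in>I. (if i = j then 1 else 0) *\<^sub>R u i)"
      using assms(1) by (simp add: if_distrib[of "\<lambda>c. c *\<^sub>R _"] sum.delta cong: if_cong)
    then show "\<exists>c. u j = (\<Sum>i\<in>I. c i *\<^sub>R u i)"
      by (intro exI[of _ "\<lambda>i. if i = j then 1 else 0"])
  qed
  ultimately show ?thesis using span_minimal assms(2) by blast
qed

lemma independent_imageI:
  fixes f :: "'i \<Rightarrow> 'v::real_vector"
  assumes "finite I" "inj_on f I" "\<And>c. (\<Sum>i\<in>I. c i *\<^sub>R f i) = 0 \<Longrightarrow> \<forall>i\<in>I. c i = 0"
  shows "independent (f ` I)"
proof (rule independent_if_scalars_zero)
  show "finite (f ` I)" using assms(1) by simp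
  fix c v assume *: "(\<Sum>v\<in>f ` I. c v *\<^sub>R v) = 0" "v \<in> f ` I"
  have "(\<Sum>i\<in>I. c (f i) *\<^sub>R f i) = 0" using *(1) assms(2) by (simp add: sum.reindex)
  then show "c v = 0" using assms(3)[of "\<lambda>i. c (f i)"] *(2) by blast
qed

text \<open>The ambient space of functionals is not finite-dimensional, so the count goes through
  the finite spanning set \<open>T\<close>: one more independent vector in its span would exceed its
  cardinality.\<close>

lemma independent_spans:
  fixes S :: "'v::real_vector set"
  assumes "independent S" "finite T" "S \<subseteq> span T" "card T \<le> card S"
  shows "span T \<subseteq> span S"
proof (rule ccontr)
  assume "\<not> span T \<subseteq> span S"
  then obtain v where v: "v \<in> span T" "v \<notin> span S" by blast
  have "finite S" using independent_span_bound[OF assms(2,1,3)] by blast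
  have "independent (insert v S)" using assms(1) v(2) by (simp add: independent_insert)
  then have "card (insert v S) \<le> card T"
    using independent_span_bound[OF assms(2)] assms(3) v(1) by blast
  moreover have "v \<notin> S" using v(2) span_base by blast
  ultimately show False using assms(4) \<open>finite S\<close> by simp
qed

lemma independent_if_card_le_dim:
  fixes T :: "'v::real_vector set"
  assumes "finite T" "card T \<le> dim (span T)"
  shows "independent T"
proof (rule ccontr)
  assume "\<not> independent T"
  then obtain a where a: "a \<in> T" "a \<in> span (T - {a})" unfolding dependent_def by blast
  then have "T \<subseteq> span (T - {a})" using span_base[of _ "T - {a}"] by blast
  then have "span T \<subseteq> span (T - {a})" by (rule span_minimal) simp
  then have "dim (span T) \<le> card (T - {a})"
    using \<open>span T \<subseteq> span (T - {a})\<close> assms(1) by (intro dim_le_card finite_Diff)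
  also have "\<dots> < card T" using assms(1) a(1) by (rule card_Diff1_less)
  finally show False using assms(2) by simp
qed

lemma inner_product_on_sym: "inner_product_on S b \<Longrightarrow> u \<in> S \<Longrightarrow> v \<in> S \<Longrightarrow> b u v = b v u"
  by (simp add: inner_product_on_def)

lemma inner_product_on_add: "inner_product_on S b \<Longrightarrow> u \<in> S \<Longrightarrow> v \<in> S \<Longrightarrow> w \<in> S \<Longrightarrow> b (u + v) w = b u w + b v w"
  by (simp add: inner_product_on_def)

lemma inner_product_on_scale: "inner_product_on S b \<Longrightarrow> u \<in> S \<Longrightarrow> v \<in> S \<Longrightarrow> b (c *\<^sub>R u) v = c * b u v"
  by (simp add: inner_product_on_def)

lemma inner_product_on_zero: "inner_product_on S b \<Longrightarrow> subspace S \<Longrightarrow> v \<in> S \<Longrightarrow> b 0 v = 0"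
  using inner_product_on_scale[of S b 0 v 0] subspace_0 by force

lemma inner_product_on_eq_zero: "inner_product_on S b \<Longrightarrow> u \<in> S \<Longrightarrow> b u u = 0 \<Longrightarrow> u = 0"
  unfolding inner_product_on_def by (metis less_irrefl)

lemma inner_product_on_sum:
  assumes "inner_product_on S b" "subspace S" "\<And>i. i \<in> I \<Longrightarrow> u i \<in> S" "w \<in> S"
  shows "b (\<Sum>i\<in>I. c i *\<^sub>R u i) w = (\<Sum>i\<in>I. c i * b (u i) w)"
  using assms(3)
  by (induction I rule: infinite_finite_induct)
    (auto simp: inner_product_on_zero[OF assms(1,2,4)] inner_product_on_add[OF assms(1)]
      inner_product_on_scale[OF assms(1)] assms subspace_scale subspace_sum)

lemma inner_product_on_diff:
  assumes "inner_product_on S b" "subspace S" "u \<in> S" "v \<in> S" "w \<in> S"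
  shows "b (u - v) w = b u w - b v w"
  using inner_product_on_add[OF assms(1,3) subspace_scale[OF assms(2,4), of "-1"] assms(5)]
    inner_product_on_scale[OF assms(1,4,5), of "-1"] by simp

lemma inner_product_on_ext:
  assumes "inner_product_on S b" "subspace S" "u \<in> S" "v \<in> S" "\<And>w. w \<in> S \<Longrightarrow> b u w = b v w"
  shows "u = v"
  using inner_product_on_eq_zero[OF assms(1) subspace_diff[OF assms(2,3,4)]]
    inner_product_on_diff[OF assms(1-4) subspace_diff[OF assms(2,3,4)]] assms(5) subspace_diff[OF assms(2,3,4)]
  by simp

definition orthonormal_family :: "('v \<Rightarrow> 'v \<Rightarrow> real) \<Rightarrow> 'i set \<Rightarrow> ('i \<Rightarrow> 'v) \<Rightarrow> bool"
  where "orthonormal_family b I u \<longleftrightarrow> (\<forall>i\<in>I. \<forall>j\<in>I. b (u i) (u j) = (if i = j then 1 else 0))"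

lemma orthonormal_coeff:
  assumes b: "inner_product_on S b" "subspace S" and u: "\<And>i. i \<in> I \<Longrightarrow> u i \<in> S"
    and o: "orthonormal_family b I u" and I: "finite I" "j \<in> I"
  shows "b (\<Sum>i\<in>I. c i *\<^sub>R u i) (u j) = c j"
proof -
  have "b (\<Sum>i\<in>I. c i *\<^sub>R u i) (u j) = (\<Sum>i\<in>I. c i * b (u i) (u j))"
    by (rule inner_product_on_sum[OF b u u[OF I(2)]])
  also have "\<dots> = (\<Sum>i\<in>I. if i = j then c i else 0)"
    by (rule sum.cong) (use o I in \<open>auto simp: orthonormal_family_def\<close>)
  finally show ?thesis using I by simp
qed

lemma orthonormal_expand:
  assumes b: "inner_product_on S b" "subspace S" and u: "\<And>i. i \<in> I \<Longrightarrow> u i \<in> S"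
    and o: "orthonormal_family b I u" and I: "finite I" and v: "v \<in> span (u ` I)"
  shows "v = (\<Sum>i\<in>I. b v (u i) *\<^sub>R u i)"
proof -
  obtain c where c: "v = (\<Sum>i\<in>I. c i *\<^sub>R u i)" using span_image_coeffs[OF I v] by blast
  have "b v (u i) = c i" if "i \<in> I" for i
    unfolding c using orthonormal_coeff[OF b u o I that] by simp
  then show ?thesis using c by simp
qed

lemma orthonormal_independent:
  assumes b: "inner_product_on S b" "subspace S" and u: "\<And>i. i \<in> I \<Longrightarrow> u i \<in> S"
    and o: "orthonormal_family b I u" and I: "finite I"
  shows "inj_on u I" "independent (u ` I)"
proof -
  show inj: "inj_on u I"
    using o unfolding orthonormal_family_def by (intro inj_onI) (metis zero_neq_one)
  show "independent (u ` I)"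
  proof (rule independent_imageI[OF I inj], rule ballI)
    fix c j assume *: "(\<Sum>i\<in>I. c i *\<^sub>R u i) = 0" and j: "j \<in> I"
    show "c j = 0"
      using orthonormal_coeff[OF b u o I j, of c] inner_product_on_zero[OF b u[OF j]] * by simp
  qed
qed

text \<open>Gram-Schmidt, one vector at a time.\<close>

lemma ex_orthonormal_basis:
  fixes B :: "'v::real_vector set"
  assumes "finite B" "inner_product_on S b" "subspace S" "B \<subseteq> S"
  shows "\<exists>C. finite C \<and> C \<subseteq> S \<and> span C = span B \<and> orthonormal_family b C id"
  using assms(1,4)
proof (induction B)
  case empty
  then show ?case by (intro exI[of _ "{}"]) (simp add: orthonormal_family_def)
next
  case (insert v B)
  then obtain C where C: "finite C" "C \<subseteq> S" "span C = span B" "orthonormal_family b C id" by blast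
  have eq: "span (insert v C) = span (insert v B)" using C(3) by (simp add: span_insert)
  show ?case
  proof (cases "v \<in> span C")
    case True
    then show ?thesis using C eq span_redundant[OF True] by metis
  next
    case False
    \<comment> \<open>The component of \<open>v\<close> orthogonal to the vectors already found; it
      is non-zero because \<open>v\<close> lies outside their span.\<close>
    define w where "w = v - (\<Sum>c\<in>C. b v c *\<^sub>R c)"
    define e where "e = (1 / sqrt (b w w)) *\<^sub>R w"
    have s: "(\<Sum>c\<in>C. b v c *\<^sub>R c) \<in> span C" by (intro span_sum span_scale span_base)
    have sS: "(\<Sum>c\<in>C. b v c *\<^sub>R c) \<in> S"
      using C(2) assms(3) by (intro subspace_sum subspace_scale) auto
    have vS: "v \<in> S" using insert.prems by simp
    have wS: "w \<in> S" unfolding w_def by (intro subspace_diff assms(3) vS sS)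
    have "w \<noteq> 0" using False s unfolding w_def by auto
    then have pos: "b w w > 0" using assms(2) wS unfolding inner_product_on_def by blast
    have wc: "b w c = 0" if "c \<in> C" for c
    proof -
      have cS: "c \<in> S" using that C by blast
      have "b w c = b v c - b (\<Sum>c\<in>C. b v c *\<^sub>R c) c"
        unfolding w_def by (rule inner_product_on_diff[OF assms(2,3) vS sS cS])
      also have "b (\<Sum>c\<in>C. b v c *\<^sub>R c) c = b v c"
        using orthonormal_coeff[OF assms(2,3) _ C(4,1) that, of "b v"] C(2) by auto
      finally show ?thesis by simp
    qed
    have eS: "e \<in> S" unfolding e_def by (intro subspace_scale assms(3) wS)
    have ec: "b e c = 0" "b c e = 0" if "c \<in> C" for c
    proof -
      show "b e c = 0" unfolding e_def
        using inner_product_on_scale[OF assms(2) wS, of c] that C(2) wc by auto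
      then show "b c e = 0" using inner_product_on_sym[OF assms(2) eS, of c] that C(2) by auto
    qed
    have "b e e = (1 / sqrt (b w w)) * b w e"
      using inner_product_on_scale[OF assms(2) wS eS] unfolding e_def by blast
    also have "b w e = (1 / sqrt (b w w)) * b w w"
      using inner_product_on_scale[OF assms(2) wS wS] inner_product_on_sym[OF assms(2) wS eS]
      unfolding e_def by metis
    finally have ee: "b e e = 1" using pos by simp
    have "e \<notin> C" using ec(1) ee by force
    have "v \<in> span (insert e C)"
    proof -
      have "v = sqrt (b w w) *\<^sub>R e + (\<Sum>c\<in>C. b v c *\<^sub>R c)" using pos by (simp add: e_def w_def)
      moreover have "(\<Sum>c\<in>C. b v c *\<^sub>R c) \<in> span (insert e C)"
        using s span_mono[of C "insert e C"] by blast
      ultimately show ?thesis by (metis span_add span_scale span_base insertI1)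
    qed
    moreover have "e \<in> span (insert v C)"
    proof -
      have "(\<Sum>c\<in>C. b v c *\<^sub>R c) \<in> span (insert v C)"
        using s span_mono[of C "insert v C"] by blast
      then show ?thesis unfolding e_def w_def
        by (intro span_scale span_diff) (auto intro: span_base)
    qed
    ultimately have "span (insert e C) = span (insert v C)"
      unfolding span_eq using span_mono[of C "insert v C"] span_mono[of C "insert e C"]
      by (auto intro: span_base)
    moreover have "orthonormal_family b (insert e C) id"
      using C(4) ec ee \<open>e \<notin> C\<close> unfolding orthonormal_family_def by auto
    moreover have "finite (insert e C)" "insert e C \<subseteq> S" using C eS by auto
    ultimately show ?thesis unfolding eq by metis
  qed
qed

text \<open>The prescribed orthonormal frames \<open>X0\<close> belong to the locale: apart from
  entering the two forms, they supply the frames for all local computations.\<close>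

locale sr_manifold =
  fixes M :: "('a::{t2_space, second_countable_topology}, 'n::finite) sr_structure"
    and d :: nat
    and X0 :: "'a \<Rightarrow> nat \<Rightarrow> 'a vfield"
  assumes sr: "sub_riemannian_transverse M d"
    and frames: "\<And>x. local_frame M d x (X0 x)"

sublocale sr_manifold \<subseteq> smooth_manifold M
  using sr unfolding sub_riemannian_transverse_def by unfold_locales blast

section \<open>The splitting into horizontal and vertical parts, adapted frames and
  gradients\<close>

context sr_manifold
begin

lemma smooth_distribution: "smooth_distribution M d"
  and hor_metric: "hor_metric M"
  and transverse: "transverse_symmetries M"
  and vip: "inner_product_on (vert M) (vip M)"
  using sr unfolding sub_riemannian_transverse_def by blast+

lemma subspace_hor: "subspace (hor M x)"
  using smooth_distribution unfolding smooth_distribution_def by blast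

lemma hor_tangent: "u \<in> hor M x \<Longrightarrow> u \<in> tangent_space M x"
  using smooth_distribution unfolding smooth_distribution_def by blast

lemma hor_spanned: "\<exists>T. finite T \<and> card T \<le> d \<and> hor M x = span T"
proof -
  obtain U Y where "x \<in> U" "\<forall>y\<in>U. hor M y = span ((\<lambda>i::nat. Y i y) ` {..<d})"
    using smooth_distribution unfolding smooth_distribution_def by meson
  moreover have "card ((\<lambda>i. Y i x) ` {..<d}) \<le> d"
    using card_image_le[of "{..<d}"] by simp
  ultimately show ?thesis by blast
qed

lemma met: "inner_product_on (hor M x) (met M x)"
  using hor_metric unfolding hor_metric_def by blast

lemma met_smooth [simp, intro]:
  "A \<in> hor_fields M \<Longrightarrow> B \<in> hor_fields M \<Longrightarrow> (\<lambda>x. met M x (A x) (B x)) \<in> C_infinity M"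
  using hor_metric unfolding hor_metric_def by blast

lemma hor_fields_vfields [intro]: "A \<in> hor_fields M \<Longrightarrow> A \<in> vfields M"
  by (simp add: hor_fields_def)

lemma hor_fields_hor: "A \<in> hor_fields M \<Longrightarrow> A x \<in> hor M x"
  unfolding hor_fields_def by blast

lemma vert_vfields [intro]: "Z \<in> vert M \<Longrightarrow> Z \<in> vfields M"
  using transverse unfolding transverse_symmetries_def iso_fields_def by blast

lemma subspace_vert: "subspace (vert M)"
  using transverse unfolding transverse_symmetries_def by blast

text \<open>The fields Z_m of the overview, chosen once for the whole manifold. The set serves as
  its own index set.\<close>

definition vbasis :: "'a vfield set"
  where "vbasis = (SOME C. finite C \<and> C \<subseteq> vert M \<and> span C = vert M \<and> orthonormal_family (vip M) C id)"

lemma vbasis: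
  shows finite_vbasis [simp]: "finite vbasis" and vbasis_vert: "vbasis \<subseteq> vert M"
    and span_vbasis: "span vbasis = vert M" and vbasis_orthonormal: "orthonormal_family (vip M) vbasis id"
proof -
  obtain B where "finite B" "span B = vert M" using transverse unfolding transverse_symmetries_def by blast
  then have "\<exists>C. finite C \<and> C \<subseteq> vert M \<and> span C = vert M \<and> orthonormal_family (vip M) C id"
    using ex_orthonormal_basis[OF _ vip subspace_vert, of B] span_superset by metis
  from someI_ex[OF this]
  show "finite vbasis" "vbasis \<subseteq> vert M" "span vbasis = vert M" "orthonormal_family (vip M) vbasis id"
    unfolding vbasis_def by blast+
qed

lemma vbasis_in_vert [simp, intro]: "Z \<in> vbasis \<Longrightarrow> Z \<in> vert M"
  using vbasis_vert by blast

lemma vert_expand: "Z \<in> vert M \<Longrightarrow> Z = (\<Sum>W\<in>vbasis. vip M Z W *\<^sub>R W)"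
  using orthonormal_expand[OF vip subspace_vert _ vbasis_orthonormal finite_vbasis, of Z]
  by (simp add: span_vbasis)

lemma vert_at_span: "vert_at M x = span ((\<lambda>Z. Z x) ` vbasis)"
proof -
  have "linear (\<lambda>Z::'a vfield. Z x)" by (intro linearI) auto
  then show ?thesis unfolding vert_at_def span_vbasis[symmetric] by (rule linear_span_image[symmetric])
qed

text \<open>The values of the basis fields span \<open>vert_at M x\<close>, whose dimension equals
  that of \<open>vert M\<close>. Hence there are as many values as fields, and a spanning set no
  larger than the dimension is independent.\<close>

lemma vbasis_at:
  shows "inj_on (\<lambda>Z. Z x) vbasis" "independent ((\<lambda>Z. Z x) ` vbasis)"
proof -
  have d: "dim (vert_at M x) = dim (vert M)" using transverse unfolding transverse_symmetries_def by blast
  have "independent (id ` vbasis)"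
    using orthonormal_independent(2)[OF vip subspace_vert _ vbasis_orthonormal finite_vbasis] by auto
  then have "dim (vert M) = card vbasis" using dim_eq_card[of vbasis "vert M"] span_vbasis subspace_vert
    by (metis image_id id_apply span_span)
  moreover have "dim (vert_at M x) \<le> card ((\<lambda>Z. Z x) ` vbasis)"
    unfolding vert_at_span by (rule dim_le_card) auto
  moreover have "card ((\<lambda>Z. Z x) ` vbasis) \<le> card vbasis" by (rule card_image_le) simp
  ultimately have c: "card ((\<lambda>Z. Z x) ` vbasis) = card vbasis"
    "card ((\<lambda>Z. Z x) ` vbasis) \<le> dim (vert_at M x)" using d by auto
  show "inj_on (\<lambda>Z. Z x) vbasis" using c(1) by (simp add: eq_card_imp_inj_on)
  show "independent ((\<lambda>Z. Z x) ` vbasis)"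
    using c(2) unfolding vert_at_span by (intro independent_if_card_le_dim) auto
qed

text \<open>A vertical field vanishing at one point has zero coefficients in \<open>vbasis\<close>,
  because the basis is independent at that point. This makes \<open>vert_lift\<close> well
  defined.\<close>

lemma vert_inj:
  assumes "Z \<in> vert M" "W \<in> vert M" "Z x = W x"
  shows "Z = W"
proof -
  define V where "V = Z - W"
  have V: "V \<in> vert M" "V x = 0" unfolding V_def using assms subspace_vert by (auto intro: subspace_diff)
  have "(\<Sum>Y\<in>vbasis. vip M V Y *\<^sub>R Y x) = V x"
    using fun_cong[OF vert_expand[OF V(1)], of x] by (simp add: sum_fun_apply)
  moreover have inv: "inv_into vbasis (\<lambda>Z. Z x) (Y x) = Y" if "Y \<in> vbasis" for Y
    using inv_into_f_f[OF vbasis_at(1)[of x] that] by simp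
  ultimately have "(\<Sum>v\<in>(\<lambda>Z. Z x) ` vbasis. vip M V (inv_into vbasis (\<lambda>Z. Z x) v) *\<^sub>R v) = 0"
    using vbasis_at(1)[of x] V(2) by (simp add: sum.reindex)
  then have "vip M V (inv_into vbasis (\<lambda>Z. Z x) v) = 0" if "v \<in> (\<lambda>Z. Z x) ` vbasis" for v
    using that
    by (rule independentD[OF vbasis_at(2)[of x] finite_imageI[OF finite_vbasis] subset_refl,
          where u = "\<lambda>v. vip M V (inv_into vbasis (\<lambda>Z. Z x) v)"])
  then have "vip M V Y = 0" if "Y \<in> vbasis" for Y using that inv[OF that] by force
  then have "V = 0" using vert_expand[OF V(1)] by simp
  then show ?thesis by (simp add: V_def)
qed

lemma subspace_vert_at: "subspace (vert_at M x)"
  unfolding vert_at_span by simp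

lemma vert_at_iff: "w \<in> vert_at M x \<longleftrightarrow> (\<exists>Z\<in>vert M. w = Z x)"
  unfolding vert_at_def by blast

lemma hor_vert_disjoint: "u \<in> hor M x \<Longrightarrow> u \<in> vert_at M x \<Longrightarrow> u = 0"
  using transverse unfolding transverse_symmetries_def by blast

lemma tangent_decomp:
  assumes "u \<in> tangent_space M x"
  obtains h Z where "h \<in> hor M x" "Z \<in> vert M" "u = h + Z x"
  using assms transverse unfolding transverse_symmetries_def vert_at_def by blast

lemma hor_vert_unique:
  assumes "h \<in> hor M x" "h' \<in> hor M x" "w \<in> vert_at M x" "w' \<in> vert_at M x" "h + w = h' + w'"
  shows "h = h'" "w = w'"
proof -
  have "h - h' = w' - w" using assms(5) by (simp add: algebra_simps)
  moreover have "h - h' \<in> hor M x" "w' - w \<in> vert_at M x"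
    using assms subspace_hor subspace_vert_at by (auto intro: subspace_diff)
  ultimately have "h - h' = 0" using hor_vert_disjoint by metis
  then show "h = h'" "w = w'" using assms(5) by auto
qed

lemma hor_proj_eq:
  assumes "h \<in> hor M x" "w \<in> vert_at M x"
  shows "hor_proj M x (h + w) = h"
  unfolding hor_proj_def
proof (rule the_equality)
  fix h' assume h': "h' \<in> hor M x \<and> h + w - h' \<in> vert_at M x"
  show "h' = h" by (rule hor_vert_unique(1)[of h' x h "h + w - h'" w]) (use h' assms in auto)
qed (use assms in auto)

lemma vert_proj_eq:
  assumes "h \<in> hor M x" "w \<in> vert_at M x"
  shows "vert_proj M x (h + w) = w"
  unfolding vert_proj_def
proof (rule the_equality)
  fix w' assume w': "w' \<in> vert_at M x \<and> h + w - w' \<in> hor M x"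
  show "w' = w" by (rule hor_vert_unique(2)[of "h + w - w'" x h w' w]) (use w' assms in auto)
qed (use assms in auto)

lemma vert_lift_eq: "Z \<in> vert M \<Longrightarrow> vert_lift M x (Z x) = Z"
  unfolding vert_lift_def by (rule the_equality) (auto intro: vert_inj)

lemma gR_eq:
  assumes "h \<in> hor M x" "Z \<in> vert M" "h' \<in> hor M x" "Z' \<in> vert M"
  shows "gR M x (h + Z x) (h' + Z' x) = met M x h h' + vip M Z Z'"
proof -
  have "Z x \<in> vert_at M x" "Z' x \<in> vert_at M x" using assms vert_at_iff by blast+
  then show ?thesis using assms by (simp add: gR_def hor_proj_eq vert_proj_eq vert_lift_eq)
qed

lemma gR_hor:
  assumes "h \<in> hor M x" "h' \<in> hor M x"
  shows "gR M x h h' = met M x h h'"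
  using gR_eq[OF assms(1) subspace_0[OF subspace_vert] assms(2) subspace_0[OF subspace_vert]]
    inner_product_on_zero[OF vip subspace_vert subspace_0[OF subspace_vert]] by simp

lemma met_zero_left: "h \<in> hor M x \<Longrightarrow> met M x 0 h = 0"
  by (rule inner_product_on_zero[OF met subspace_hor])

lemma gR_vert:
  assumes "Z \<in> vert M" "Z' \<in> vert M"
  shows "gR M x (Z x) (Z' x) = vip M Z Z'"
  using gR_eq[OF subspace_0[OF subspace_hor] assms(1) subspace_0[OF subspace_hor] assms(2)]
    met_zero_left[OF subspace_0[OF subspace_hor]] by simp

text \<open>In contrast to \<open>local_frame\<close>, the fields are horizontal on the whole
  manifold, so that the axioms of the canonical connection, which are stated for
  \<open>hor_fields\<close>, apply to them. Orthonormality is still local.\<close>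

definition hframe :: "(nat \<Rightarrow> 'a vfield) \<Rightarrow> 'a set \<Rightarrow> bool"
  where "hframe Y N \<longleftrightarrow> open N \<and> (\<forall>i\<in>{1..d}. Y i \<in> hor_fields M) \<and>
    (\<forall>y\<in>N. orthonormal_family (met M y) {1..d} (\<lambda>i. Y i y))"

lemma hframeD:
  assumes "hframe Y N"
  shows "open N" "i \<in> {1..d} \<Longrightarrow> Y i \<in> hor_fields M" "i \<in> {1..d} \<Longrightarrow> Y i \<in> vfields M"
    "i \<in> {1..d} \<Longrightarrow> Y i y \<in> hor M y"
    "y \<in> N \<Longrightarrow> orthonormal_family (met M y) {1..d} (\<lambda>i. Y i y)"
proof -
  note F = assms[unfolded hframe_def]
  show "open N" using F by blast
  show Y: "i \<in> {1..d} \<Longrightarrow> Y i \<in> hor_fields M" using F by blast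
  show "i \<in> {1..d} \<Longrightarrow> Y i \<in> vfields M" by (rule hor_fields_vfields[OF Y])
  show "i \<in> {1..d} \<Longrightarrow> Y i y \<in> hor M y" by (rule hor_fields_hor[OF Y])
  show "y \<in> N \<Longrightarrow> orthonormal_family (met M y) {1..d} (\<lambda>i. Y i y)" using F by blast
qed

text \<open>A prescribed frame is horizontal only near \<open>x\<close>; a cutoff makes it
  horizontal everywhere without changing it near \<open>x\<close>.\<close>

lemma ex_hframe:
  obtains Y N where "hframe Y N" "x \<in> N" "\<And>i y. i \<in> {1..d} \<Longrightarrow> y \<in> N \<Longrightarrow> Y i y = X0 x i y"
proof -
  have lf: "\<forall>i\<in>{1..d}. X0 x i \<in> vfields M" using frames[of x] unfolding local_frame_def by blast
  obtain U where U: "open U" "x \<in> U" "\<forall>y\<in>U. \<forall>i\<in>{1..d}. X0 x i y \<in> hor M y \<and>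
      (\<forall>j\<in>{1..d}. met M y (X0 x i y) (X0 x j y) = (if i = j then 1 else 0))"
    using frames[of x] unfolding local_frame_def by blast
  obtain \<eta> V K where \<eta>: "\<eta> \<in> C_infinity M" "open V" "x \<in> V" "V \<subseteq> K" "K \<subseteq> U" "compact K"
    "\<And>y. y \<in> V \<Longrightarrow> \<eta> y = 1" "\<And>y. y \<notin> K \<Longrightarrow> \<eta> y = 0" "\<And>y. \<eta> y \<ge> 0"
    using ex_plateau[OF U(1,2)] by metis
  define Y where "Y = (\<lambda>i y. \<eta> y *\<^sub>R X0 x i y)"
  have "Y i \<in> hor_fields M" if i: "i \<in> {1..d}" for i
  proof -
    have "Y i \<in> vfields M" unfolding Y_def using \<eta>(1) lf i by blast
    moreover have "Y i y \<in> hor M y" for y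
    proof (cases "y \<in> K")
      case True
      then have "X0 x i y \<in> hor M y" using U(3) \<eta>(5) i by blast
      then show ?thesis unfolding Y_def by (rule subspace_scale[OF subspace_hor])
    next
      case False
      then show ?thesis using \<eta>(8) subspace_0[OF subspace_hor] by (simp add: Y_def)
    qed
    ultimately show ?thesis by (simp add: hor_fields_def)
  qed
  moreover have eq: "Y i y = X0 x i y" if "y \<in> V" for i y using \<eta>(7)[OF that] by (simp add: Y_def)
  moreover have "orthonormal_family (met M y) {1..d} (\<lambda>i. Y i y)" if "y \<in> V" for y
    using U(3) \<eta>(4,5) that unfolding orthonormal_family_def by (auto simp: eq[OF that])
  ultimately have "hframe Y V" using \<eta>(2) unfolding hframe_def by simp
  then show ?thesis by (rule that[OF _ \<eta>(3) eq])
qed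

text \<open>The \<open>d\<close> orthonormal vectors are independent, and the horizontal space has a
  spanning set of at most \<open>d\<close> elements.\<close>

lemma hframe_span:
  assumes "hframe Y N" "y \<in> N"
  shows "span ((\<lambda>i. Y i y) ` {1..d}) = hor M y"
proof
  note F = hframeD[OF assms(1)]
  have Yh: "(\<lambda>i. Y i y) ` {1..d} \<subseteq> hor M y" using F(4) by blast
  show "span ((\<lambda>i. Y i y) ` {1..d}) \<subseteq> hor M y" by (rule span_minimal[OF Yh subspace_hor])
  obtain T where T: "finite T" "card T \<le> d" "hor M y = span T" using hor_spanned by blast
  note o = orthonormal_independent[OF met subspace_hor F(4) F(5)[OF assms(2)]]
  have "card ((\<lambda>i. Y i y) ` {1..d}) = d" using card_image[OF o(1)] by simp
  then show "hor M y \<subseteq> span ((\<lambda>i. Y i y) ` {1..d})"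
    unfolding T(3) using o(2) T Yh by (intro independent_spans) auto
qed

lemma hor_expand:
  assumes "hframe Y N" "y \<in> N" "u \<in> hor M y"
  shows "u = (\<Sum>i=1..d. met M y u (Y i y) *\<^sub>R Y i y)"
  by (rule orthonormal_expand[OF met subspace_hor hframeD(4)[OF assms(1)] hframeD(5)[OF assms(1,2)]])
    (simp_all only: hframe_span[OF assms(1,2)] assms(3) finite_atLeastAtMost)

lemma met_expand:
  assumes "hframe Y N" "y \<in> N" "u \<in> hor M y" "v \<in> hor M y"
  shows "met M y u v = (\<Sum>i=1..d. met M y u (Y i y) * met M y v (Y i y))"
proof -
  have "met M y u v = met M y (\<Sum>i=1..d. met M y u (Y i y) *\<^sub>R Y i y) v"
    using hor_expand[OF assms(1-3)] by simp
  also have "\<dots> = (\<Sum>i=1..d. met M y u (Y i y) * met M y (Y i y) v)"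
    by (rule inner_product_on_sum[OF met subspace_hor hframeD(4)[OF assms(1)] assms(4)])
  finally show ?thesis
    using inner_product_on_sym[OF met assms(4)] hframeD(4)[OF assms(1)] by simp
qed

text \<open>\<open>grad\<close> is a definite description, so existence and uniqueness are both due.
  Testing against horizontal and vertical vectors separately reduces \<open>gR\<close> to
  \<open>met\<close> and to \<open>vip\<close>.\<close>

lemma grad_eq:
  assumes F: "hframe Y N" "y \<in> N" and f: "f \<in> C_infinity M"
  shows "grad M f y = (\<Sum>i=1..d. Y i y f *\<^sub>R Y i y) + (\<Sum>Z\<in>vbasis. Z y f *\<^sub>R Z) y"
proof -
  define h0 where "h0 = (\<Sum>i=1..d. Y i y f *\<^sub>R Y i y)"
  define Z0 where "Z0 = (\<Sum>Z\<in>vbasis. Z y f *\<^sub>R Z)"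
  have h0: "h0 \<in> hor M y" unfolding h0_def
    by (intro subspace_sum[OF subspace_hor] subspace_scale[OF subspace_hor] hframeD(4)[OF F(1)])
  have Z0: "Z0 \<in> vert M" unfolding Z0_def
    by (intro subspace_sum[OF subspace_vert] subspace_scale[OF subspace_vert]) auto
  have Z0y: "Z0 y \<in> vert_at M y" using Z0 vert_at_iff by blast
  have mh0: "met M y h0 u = u f" if u: "u \<in> hor M y" for u
  proof -
    have "met M y h0 u = (\<Sum>i=1..d. met M y h0 (Y i y) * met M y u (Y i y))"
      by (rule met_expand[OF F h0 u])
    also have "\<dots> = (\<Sum>i=1..d. met M y u (Y i y) * Y i y f)"
      unfolding h0_def
      using orthonormal_coeff[OF met subspace_hor hframeD(4)[OF F(1)] hframeD(5)[OF F], where c = "\<lambda>i. Y i y f"]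
      by (intro sum.cong) auto
    also have "\<dots> = (\<Sum>i=1..d. met M y u (Y i y) *\<^sub>R Y i y) f" by (simp add: sum_fun_apply)
    finally show ?thesis using hor_expand[OF F u] by simp
  qed
  have vZ0: "vip M Z0 Z = Z y f" if Z: "Z \<in> vert M" for Z
  proof -
    have "vip M Z0 Z = vip M Z Z0" by (rule inner_product_on_sym[OF vip Z0 Z])
    also have "\<dots> = vip M (\<Sum>W\<in>vbasis. vip M Z W *\<^sub>R W) Z0" using vert_expand[OF Z] by simp
    also have "\<dots> = (\<Sum>W\<in>vbasis. vip M Z W * vip M W Z0)"
      by (rule inner_product_on_sum[OF vip subspace_vert _ Z0]) auto
    also have "\<dots> = (\<Sum>W\<in>vbasis. vip M Z W * W y f)"
    proof (rule sum.cong[OF refl])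
      fix W assume W: "W \<in> vbasis"
      have "vip M W Z0 = vip M Z0 W" using inner_product_on_sym[OF vip _ Z0] W by auto
      also have "\<dots> = W y f" unfolding Z0_def
        using orthonormal_coeff[OF vip subspace_vert _ vbasis_orthonormal finite_vbasis W, of "\<lambda>Z. Z y f"] by auto
      finally show "vip M Z W * vip M W Z0 = vip M Z W * W y f" by simp
    qed
    also have "\<dots> = (\<Sum>W\<in>vbasis. vip M Z W *\<^sub>R W) y f" by (simp add: sum_fun_apply)
    finally show ?thesis using vert_expand[OF Z] by simp
  qed
  have "grad M f y = h0 + Z0 y"
    unfolding grad_def
  proof (rule the_equality, intro conjI ballI)
    show "h0 + Z0 y \<in> tangent_space M y"
      using h0 Z0 by (intro subspace_add[OF subspace_tangent] hor_tangent vfields_tangent) auto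
    fix u assume "u \<in> tangent_space M y"
    then obtain h Z where hZ: "h \<in> hor M y" "Z \<in> vert M" "u = h + Z y" by (rule tangent_decomp)
    then show "gR M y (h0 + Z0 y) u = u f" using gR_eq[OF h0 Z0] mh0 vZ0 by simp
  next
    fix v assume v: "v \<in> tangent_space M y \<and> (\<forall>u\<in>tangent_space M y. gR M y v u = u f)"
    then obtain h Z where hZ: "h \<in> hor M y" "Z \<in> vert M" "v = h + Z y" using tangent_decomp by blast
    have "h = h0"
    proof (rule inner_product_on_ext[OF met subspace_hor hZ(1) h0])
      fix u assume u: "u \<in> hor M y"
      have "gR M y v (u + 0 y) = u f" using v hor_tangent[OF u] by simp
      then show "met M y h u = met M y h0 u"
        unfolding hZ(3) using gR_eq[OF hZ(1,2) u subspace_0[OF subspace_vert]] mh0[OF u]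
          inner_product_on_zero[OF vip subspace_vert hZ(2)]
          inner_product_on_sym[OF vip subspace_0[OF subspace_vert] hZ(2)] by simp
    qed
    moreover have "Z = Z0"
    proof (rule inner_product_on_ext[OF vip subspace_vert hZ(2) Z0])
      fix W assume W: "W \<in> vert M"
      have "gR M y v (0 + W y) = W y f" using v vfields_tangent[OF vert_vfields[OF W]] by simp
      then show "vip M Z W = vip M Z0 W"
        unfolding hZ(3) using gR_eq[OF hZ(1,2) subspace_0[OF subspace_hor] W] vZ0[OF W]
          met_zero_left[OF hZ(1)] inner_product_on_sym[OF met subspace_0[OF subspace_hor] hZ(1)] by simp
    qed
    ultimately show "v = h0 + Z0 y" using hZ by simp
  qed
  then show ?thesis by (simp add: h0_def Z0_def)
qed

lemma grad_hor_eq: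
  assumes F: "hframe Y N" "y \<in> N" and f: "f \<in> C_infinity M"
  shows "grad_hor M f y = (\<Sum>i=1..d. Y i y f *\<^sub>R Y i y)"
  unfolding grad_hor_def grad_eq[OF F f]
proof (rule hor_proj_eq)
  show "(\<Sum>i=1..d. Y i y f *\<^sub>R Y i y) \<in> hor M y"
    by (intro subspace_sum[OF subspace_hor] subspace_scale[OF subspace_hor] hframeD(4)[OF F(1)])
  have "(\<Sum>Z\<in>vbasis. Z y f *\<^sub>R Z) \<in> vert M"
    by (intro subspace_sum[OF subspace_vert] subspace_scale[OF subspace_vert]) auto
  then show "(\<Sum>Z\<in>vbasis. Z y f *\<^sub>R Z) y \<in> vert_at M y" using vert_at_iff by blast
qed

lemma grad_vert_eq:
  assumes f: "f \<in> C_infinity M"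
  shows "grad_vert M f y = (\<Sum>Z\<in>vbasis. Z y f *\<^sub>R Z) y"
proof -
  obtain Y N where F: "hframe Y N" "y \<in> N" by (rule ex_hframe)
  show ?thesis
    unfolding grad_vert_def grad_eq[OF F f]
  proof (rule vert_proj_eq)
    show "(\<Sum>i=1..d. Y i y f *\<^sub>R Y i y) \<in> hor M y"
      by (intro subspace_sum[OF subspace_hor] subspace_scale[OF subspace_hor] hframeD(4)[OF F(1)])
    have "(\<Sum>Z\<in>vbasis. Z y f *\<^sub>R Z) \<in> vert M"
      by (intro subspace_sum[OF subspace_vert] subspace_scale[OF subspace_vert]) auto
    then show "(\<Sum>Z\<in>vbasis. Z y f *\<^sub>R Z) y \<in> vert_at M y" using vert_at_iff by blast
  qed
qed

lemma grad_hor_in_hor [simp, intro]: "f \<in> C_infinity M \<Longrightarrow> grad_hor M f y \<in> hor M y"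
proof -
  assume f: "f \<in> C_infinity M"
  obtain Y N where F: "hframe Y N" "y \<in> N" by (rule ex_hframe)
  show ?thesis unfolding grad_hor_eq[OF F f]
    by (intro subspace_sum[OF subspace_hor] subspace_scale[OF subspace_hor] hframeD(4)[OF F(1)])
qed

lemma met_grad_hor:
  assumes f: "f \<in> C_infinity M" and u: "u \<in> hor M y"
  shows "met M y (grad_hor M f y) u = u f"
proof -
  obtain Y N where F: "hframe Y N" "y \<in> N" by (rule ex_hframe)
  have "met M y (grad_hor M f y) u = (\<Sum>i=1..d. met M y (grad_hor M f y) (Y i y) * met M y u (Y i y))"
    by (rule met_expand[OF F grad_hor_in_hor[OF f] u])
  also have "\<dots> = (\<Sum>i=1..d. met M y u (Y i y) * Y i y f)"
    unfolding grad_hor_eq[OF F f]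
    using orthonormal_coeff[OF met subspace_hor hframeD(4)[OF F(1)] hframeD(5)[OF F], where c = "\<lambda>i. Y i y f"]
    by (intro sum.cong) auto
  also have "\<dots> = (\<Sum>i=1..d. met M y u (Y i y) *\<^sub>R Y i y) f" by (simp add: sum_fun_apply)
  finally show ?thesis using hor_expand[OF F u] by simp
qed

lemma grad_hor_field [simp, intro]:
  assumes f: "f \<in> C_infinity M"
  shows "grad_hor M f \<in> hor_fields M"
proof -
  have "grad_hor M f \<in> vfields M"
  proof (rule vfields_local)
    fix x
    obtain Y N where F: "hframe Y N" "x \<in> N" by (rule ex_hframe)
    have "\<forall>\<^sub>F y in nhds x. y \<in> N" using F hframeD(1) eventually_nhds by blast
    then have "\<forall>\<^sub>F y in nhds x. grad_hor M f y = (\<Sum>i=1..d. (\<lambda>y. Y i y f *\<^sub>R Y i y)) y"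
      by eventually_elim (simp add: grad_hor_eq[OF F(1) _ f] sum_fun_apply)
    moreover have "(\<Sum>i=1..d. (\<lambda>y. Y i y f *\<^sub>R Y i y)) \<in> vfields M"
      by (rule vfields_sum, rule vfields_mult[OF vfields_smooth[OF hframeD(3)[OF F(1)] f] hframeD(3)[OF F(1)]])
    ultimately show "\<exists>B\<in>vfields M. \<forall>\<^sub>F y in nhds x. grad_hor M f y = B y"
      by (intro bexI[where x = "\<Sum>i=1..d. (\<lambda>y. Y i y f *\<^sub>R Y i y)"])
  qed
  then show ?thesis unfolding hor_fields_def using grad_hor_in_hor[OF f] by blast
qed

lemma GammaH_eq: "f \<in> C_infinity M \<Longrightarrow> g \<in> C_infinity M \<Longrightarrow> GammaH M f g y = grad_hor M f y g"
  unfolding GammaH_def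
  using inner_product_on_sym[OF met grad_hor_in_hor grad_hor_in_hor, of f g]
  by (simp add: gR_hor met_grad_hor[of g])

lemma GammaH_met: "f \<in> C_infinity M \<Longrightarrow> g \<in> C_infinity M \<Longrightarrow>
    GammaH M f g y = met M y (grad_hor M f y) (grad_hor M g y)"
  unfolding GammaH_def by (simp add: gR_hor)

lemma GammaH_smooth: "f \<in> C_infinity M \<Longrightarrow> g \<in> C_infinity M \<Longrightarrow> GammaH M f g \<in> C_infinity M"
proof -
  assume f: "f \<in> C_infinity M" and g: "g \<in> C_infinity M"
  have "GammaH M f g = (\<lambda>y. grad_hor M f y g)" by (rule ext) (rule GammaH_eq[OF f g])
  then show ?thesis
    using vfields_smooth[OF hor_fields_vfields[OF grad_hor_field[OF f]] g] by simp
qed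

lemma GammaH_frame:
  assumes "hframe Y N" "y \<in> N" "f \<in> C_infinity M" "g \<in> C_infinity M"
  shows "GammaH M f g y = (\<Sum>i=1..d. Y i y f * Y i y g)"
  unfolding GammaH_eq[OF assms(3,4)] grad_hor_eq[OF assms(1-3)] by (simp add: sum_fun_apply)

lemma GammaZ_eq:
  assumes "f \<in> C_infinity M" "g \<in> C_infinity M"
  shows "GammaZ M f g y = (\<Sum>Z\<in>vbasis. Z y f * Z y g)"
proof -
  let ?Z = "\<lambda>f. (\<Sum>Z\<in>vbasis. Z y f *\<^sub>R Z)"
  have Z: "?Z f \<in> vert M" for f
    by (intro subspace_sum[OF subspace_vert] subspace_scale[OF subspace_vert]) auto
  have "GammaZ M f g y = vip M (?Z f) (?Z g)"
    unfolding GammaZ_def grad_vert_eq[OF assms(1)] grad_vert_eq[OF assms(2)] by (rule gR_vert[OF Z Z])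
  also have "\<dots> = (\<Sum>Z\<in>vbasis. Z y f * vip M Z (?Z g))"
    by (rule inner_product_on_sum[OF vip subspace_vert _ Z]) auto
  also have "\<dots> = (\<Sum>Z\<in>vbasis. Z y f * Z y g)"
  proof (rule sum.cong[OF refl])
    fix W assume W: "W \<in> vbasis"
    have "vip M W (?Z g) = vip M (?Z g) W" using inner_product_on_sym[OF vip _ Z] W by auto
    also have "\<dots> = W y g"
      using orthonormal_coeff[OF vip subspace_vert _ vbasis_orthonormal finite_vbasis W, of "\<lambda>Z. Z y g"] by auto
    finally show "W y f * vip M W (?Z g) = W y f * W y g" by simp
  qed
  finally show ?thesis .
qed

end

section \<open>Coordinate bases compared with adapted frames\<close>

context smooth_manifold
begin

lemma tangent_coord_sum:
  assumes c: "(U, \<phi>) \<in> charts M" and y: "y \<in> U"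
    and \<xi>: "\<And>i. \<xi> i \<in> C_infinity M" "\<And>i. \<forall>\<^sub>F z in nhds y. \<xi> i z = \<phi> z $ i"
    and v: "v \<in> tangent_space M y"
  shows "v = (\<Sum>i\<in>UNIV. v (\<xi> i) *\<^sub>R coord_vec M U \<phi> i y)"
proof (rule tangent_ext[OF v])
  show "(\<Sum>i\<in>UNIV. v (\<xi> i) *\<^sub>R coord_vec M U \<phi> i y) \<in> tangent_space M y"
    by (intro subspace_sum[OF subspace_tangent] subspace_scale[OF subspace_tangent] coord_vec_tangent[OF c y])
  fix f assume "f \<in> C_infinity M"
  from tangent_coord_expansion[OF c y \<xi> v this]
  show "v f = (\<Sum>i\<in>UNIV. v (\<xi> i) *\<^sub>R coord_vec M U \<phi> i y) f" by (simp add: sum_fun_apply)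
qed

text \<open>The functions \<xi> are dual to the coordinate vectors, which gives injectivity and
  independence; spanning is the coordinate expansion of a tangent vector.\<close>

lemma coord_vec_basis:
  assumes c: "(U, \<phi>) \<in> charts M" and y: "y \<in> U"
  shows "inj (\<lambda>i. coord_vec M U \<phi> i y)" "independent (range (\<lambda>i. coord_vec M U \<phi> i y))"
    "span (range (\<lambda>i. coord_vec M U \<phi> i y)) = tangent_space M y"
proof -
  let ?c = "\<lambda>i. coord_vec M U \<phi> i y"
  obtain \<xi> W where W: "open W" "y \<in> W" "W \<subseteq> U" and \<xi>: "\<And>i. \<xi> i \<in> C_infinity M"
    "\<And>z i. z \<in> W \<Longrightarrow> \<xi> i z = \<phi> z $ i"
    using ex_coordinates[OF c chart_open(1)[OF c] y subset_refl] by metis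
  have near: "\<forall>\<^sub>F z in nhds y. \<xi> i z = \<phi> z $ i" for i
    using W \<xi> unfolding eventually_nhds by blast
  have delta: "?c i (\<xi> j) = (if i = j then 1 else 0)" for i j
    by (rule coord_vec_coord[OF c y \<xi>(1) near])
  show inj: "inj ?c"
    using delta by (intro injI) (metis zero_neq_one)
  show "independent (range ?c)"
  proof (rule independent_imageI[OF finite inj], rule ballI)
    fix u j assume *: "(\<Sum>i\<in>UNIV. u i *\<^sub>R ?c i) = 0"
    from arg_cong[where f = "\<lambda>v. v (\<xi> j)", OF *]
    have "(\<Sum>i\<in>UNIV. u i * (if i = j then 1 else 0)) = 0"
      by (simp only: sum_fun_apply scaleR_fun_apply delta real_scaleR_def zero_fun_apply)
    moreover have "u i * (if i = j then 1 else 0) = (if i = j then u j else 0)" for i by simp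
    ultimately have "(\<Sum>i\<in>UNIV. if i = j then u j else 0) = 0" by (simp only:)
    then show "u j = 0" by simp
  qed
  show "span (range ?c) = tangent_space M y"
  proof
    show "span (range ?c) \<subseteq> tangent_space M y"
      by (rule span_minimal[OF image_subsetI subspace_tangent]) (rule coord_vec_tangent[OF c y])
    show "tangent_space M y \<subseteq> span (range ?c)"
    proof
      fix v assume v: "v \<in> tangent_space M y"
      have "(\<Sum>i\<in>UNIV. v (\<xi> i) *\<^sub>R ?c i) \<in> span (range ?c)"
        by (rule span_sum, rule span_scale, rule span_base, rule rangeI)
      then show "v \<in> span (range ?c)"
        using tangent_coord_sum[where \<xi> = \<xi>, OF c y \<xi>(1) near v] by (metis (no_types))
    qed
  qed
qed

lemma smooth_near_det:
  fixes Q :: "'a \<Rightarrow> real^'m^'m"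
  assumes "\<And>i j. smooth_near M (\<lambda>y. Q y $ i $ j) x"
  shows "smooth_near M (\<lambda>y. det (Q y)) x"
  unfolding det_def by (intro smooth_near_sum smooth_near_mult smooth_near_const smooth_near_prod assms)

end

context sr_manifold
begin

lemma gR_inner_product: "inner_product_on (tangent_space M y) (gR M y)"
  unfolding inner_product_on_def
proof (intro conjI ballI allI impI)
  fix u v assume u: "u \<in> tangent_space M y" and v: "v \<in> tangent_space M y"
  obtain h Z where u': "h \<in> hor M y" "Z \<in> vert M" "u = h + Z y" using tangent_decomp[OF u] by blast
  obtain h' Z' where v': "h' \<in> hor M y" "Z' \<in> vert M" "v = h' + Z' y" using tangent_decomp[OF v] by blast
  show "gR M y u v = gR M y v u"
    unfolding u'(3) v'(3) gR_eq[OF u'(1,2) v'(1,2)] gR_eq[OF v'(1,2) u'(1,2)]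
    using inner_product_on_sym[OF met u'(1) v'(1)] inner_product_on_sym[OF vip u'(2) v'(2)] by simp
  fix w assume w: "w \<in> tangent_space M y"
  obtain h'' Z'' where w': "h'' \<in> hor M y" "Z'' \<in> vert M" "w = h'' + Z'' y" using tangent_decomp[OF w] by blast
  have eq: "u + v = (h + h') + (Z + Z') y" by (simp add: u' v')
  show "gR M y (u + v) w = gR M y u w + gR M y v w"
    unfolding w'(3) eq
    using gR_eq[OF subspace_add[OF subspace_hor u'(1) v'(1)] subspace_add[OF subspace_vert u'(2) v'(2)] w'(1,2)]
      gR_eq[OF u'(1,2) w'(1,2)] gR_eq[OF v'(1,2) w'(1,2)] u'(3) v'(3)
      inner_product_on_add[OF met u'(1) v'(1) w'(1)] inner_product_on_add[OF vip u'(2) v'(2) w'(2)]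
    by simp
next
  fix c u v assume u: "u \<in> tangent_space M y" and v: "v \<in> tangent_space M y"
  obtain h Z where u': "h \<in> hor M y" "Z \<in> vert M" "u = h + Z y" using tangent_decomp[OF u] by blast
  obtain h' Z' where v': "h' \<in> hor M y" "Z' \<in> vert M" "v = h' + Z' y" using tangent_decomp[OF v] by blast
  have eq: "c *\<^sub>R u = c *\<^sub>R h + (c *\<^sub>R Z) y" by (simp add: u' scaleR_add_right)
  show "gR M y (c *\<^sub>R u) v = c * gR M y u v"
    unfolding v'(3) eq
    using gR_eq[OF subspace_scale[OF subspace_hor u'(1)] subspace_scale[OF subspace_vert u'(2)] v'(1,2)]
      gR_eq[OF u'(1,2) v'(1,2)] u'(3)
      inner_product_on_scale[OF met u'(1) v'(1)] inner_product_on_scale[OF vip u'(2) v'(2)]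
    by (simp add: distrib_left)
next
  fix u assume u: "u \<in> tangent_space M y" "u \<noteq> 0"
  obtain h Z where u': "h \<in> hor M y" "Z \<in> vert M" "u = h + Z y" using tangent_decomp[OF u(1)] by blast
  have "met M y h h \<ge> 0" "vip M Z Z \<ge> 0"
    using met[of y] vip u'(1,2) met_zero_left[OF u'(1)] inner_product_on_zero[OF vip subspace_vert u'(2)]
    unfolding inner_product_on_def by (metis order_less_le order_refl)+
  moreover have "met M y h h \<noteq> 0 \<or> vip M Z Z \<noteq> 0"
    using u(2) u' inner_product_on_eq_zero[OF met u'(1)] inner_product_on_eq_zero[OF vip u'(2)] by force
  ultimately show "0 < gR M y u u" unfolding u'(3) gR_eq[OF u'(1,2) u'(1,2)] by linarith
qed

text \<open>The disjoint sum indexes a full \<open>gR\<close>-orthonormal frame of the tangent space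
  without renumbering the vertical fields.\<close>

definition frame_index :: "(nat + 'a vfield) set"
  where "frame_index = {1..d} <+> vbasis"

definition frame_field :: "(nat \<Rightarrow> 'a vfield) \<Rightarrow> nat + 'a vfield \<Rightarrow> 'a vfield"
  where "frame_field Y = case_sum Y id"

lemma frame_field_simps [simp]: "frame_field Y (Inl i) = Y i" "frame_field Y (Inr Z) = Z"
  by (simp_all add: frame_field_def)

lemma finite_frame_index [simp]: "finite frame_index"
  by (simp add: frame_index_def)

lemma sum_frame_index: "(\<Sum>j\<in>frame_index. F j) = (\<Sum>i=1..d. F (Inl i)) + (\<Sum>Z\<in>vbasis. F (Inr Z))"
  unfolding frame_index_def by (subst sum.Plus) (simp_all add: o_def)

lemma frame_field_vfields: "hframe Y N \<Longrightarrow> j \<in> frame_index \<Longrightarrow> frame_field Y j \<in> vfields M"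
  using hframeD(3)[of Y N] vert_vfields[OF vbasis_in_vert] by (auto simp: frame_index_def)

lemma frame_tangent: "hframe Y N \<Longrightarrow> j \<in> frame_index \<Longrightarrow> frame_field Y j y \<in> tangent_space M y"
  by (rule vfields_tangent[OF frame_field_vfields])

lemma gR_hor_vert:
  assumes "h \<in> hor M x" "Z \<in> vert M"
  shows "gR M x h (Z x) = 0"
proof -
  have "gR M x h (Z x) = gR M x (h + 0 x) (0 + Z x)" by simp
  also have "\<dots> = met M x h 0 + vip M 0 Z"
    by (rule gR_eq[OF assms(1) subspace_0[OF subspace_vert] subspace_0[OF subspace_hor] assms(2)])
  also have "\<dots> = 0"
    using met_zero_left[OF assms(1)] inner_product_on_sym[OF met subspace_0[OF subspace_hor] assms(1)]
      inner_product_on_zero[OF vip subspace_vert assms(2)] by simp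
  finally show ?thesis .
qed

lemma frame_orthonormal:
  assumes F: "hframe Y N" "y \<in> N"
  shows "orthonormal_family (gR M y) frame_index (\<lambda>j. frame_field Y j y)"
  unfolding orthonormal_family_def
proof (intro ballI)
  fix j k assume jk: "j \<in> frame_index" "k \<in> frame_index"
  note Yh = hframeD(4)[OF F(1), of _ y]
  note o = hframeD(5)[OF F, unfolded orthonormal_family_def]
  note ov = vbasis_orthonormal[unfolded orthonormal_family_def]
  have mix: "gR M y (Y i y) (Z y) = 0" "gR M y (Z y) (Y i y) = 0" if "i \<in> {1..d}" "Z \<in> vbasis" for i Z
  proof -
    have Z: "Z \<in> vert M" using that by blast
    show "gR M y (Y i y) (Z y) = 0" by (rule gR_hor_vert[OF Yh[OF that(1)] Z])
    then show "gR M y (Z y) (Y i y) = 0"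
      using inner_product_on_sym[OF gR_inner_product hor_tangent[OF Yh[OF that(1)]] vfields_tangent[OF vert_vfields[OF Z]]]
      by simp
  qed
  consider i i' where "j = Inl i" "k = Inl i'" "i \<in> {1..d}" "i' \<in> {1..d}"
    | i Z where "j = Inl i" "k = Inr Z" "i \<in> {1..d}" "Z \<in> vbasis"
    | i Z where "k = Inl i" "j = Inr Z" "i \<in> {1..d}" "Z \<in> vbasis"
    | Z Z' where "j = Inr Z" "k = Inr Z'" "Z \<in> vbasis" "Z' \<in> vbasis"
    using jk unfolding frame_index_def by auto
  then show "gR M y (frame_field Y j y) (frame_field Y k y) = (if j = k then 1 else 0)"
  proof cases
    case 1
    then show ?thesis using o gR_hor[OF Yh[OF 1(3)] Yh[OF 1(4)]] by simp
  next
    case 4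
    then show ?thesis using ov gR_vert[of Z Z' y] by simp
  qed (simp_all add: mix del: One_nat_def)
qed

lemma frame_span:
  assumes F: "hframe Y N" "y \<in> N"
  shows "span ((\<lambda>j. frame_field Y j y) ` frame_index) = tangent_space M y"
proof
  show "span ((\<lambda>j. frame_field Y j y) ` frame_index) \<subseteq> tangent_space M y"
    by (rule span_minimal[OF _ subspace_tangent]) (auto intro: frame_tangent[OF F(1)])
  show "tangent_space M y \<subseteq> span ((\<lambda>j. frame_field Y j y) ` frame_index)" (is "_ \<subseteq> span ?S")
  proof
    fix u assume "u \<in> tangent_space M y"
    then obtain h Z where u: "h \<in> hor M y" "Z \<in> vert M" "u = h + Z y" by (rule tangent_decomp)
    have "(\<lambda>i. Y i y) ` {1..d} \<subseteq> ?S" "(\<lambda>Z. Z y) ` vbasis \<subseteq> ?S"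
      unfolding frame_index_def by (force simp del: One_nat_def)+
    then have "span ((\<lambda>i. Y i y) ` {1..d}) \<subseteq> span ?S" "span ((\<lambda>Z. Z y) ` vbasis) \<subseteq> span ?S"
      by (simp_all only: span_mono)
    then have "h \<in> span ?S" "Z y \<in> span ?S"
      using u(1,2) vert_at_iff[of "Z y" y] unfolding hframe_span[OF F] vert_at_span by blast+
    then show "u \<in> span ?S" unfolding u(3) by (rule span_add)
  qed
qed

lemma tangent_expand:
  assumes F: "hframe Y N" "y \<in> N" and v: "v \<in> tangent_space M y"
  shows "v = (\<Sum>j\<in>frame_index. gR M y v (frame_field Y j y) *\<^sub>R frame_field Y j y)"
  by (rule orthonormal_expand[OF gR_inner_product subspace_tangent frame_tangent[OF F(1)]
        frame_orthonormal[OF F] finite_frame_index])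
    (simp_all only: frame_span[OF F] v)

text \<open>The coordinate vectors and the adapted frame are bases of the same tangent space. The
  count allows the frame to be indexed by the type \<open>'n\<close>, so that frame and coordinates
  are related by square matrices.\<close>

lemma card_frame_index:
  assumes F: "hframe Y N" "y \<in> N"
  shows "card frame_index = CARD('n)"
proof -
  obtain U \<phi> where c: "(U, \<phi>) \<in> charts M" and y: "y \<in> U" by (rule ex_chart)
  note cb = coord_vec_basis[OF c y]
  note fb = orthonormal_independent[OF gR_inner_product subspace_tangent frame_tangent[OF F(1)]
      frame_orthonormal[OF F] finite_frame_index]
  let ?A = "range (\<lambda>i. coord_vec M U \<phi> i y)" and ?B = "(\<lambda>j. frame_field Y j y) ` frame_index"
  have "card ?A \<le> card ?B"
    using independent_span_bound[of ?B ?A] cb frame_span[OF F] span_superset[of ?A] by auto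
  moreover have "card ?B \<le> card ?A"
    using independent_span_bound[of ?A ?B] cb(3) fb(2) frame_span[OF F] span_superset[of ?B] by auto
  ultimately show ?thesis using card_image[OF cb(1)] card_image[OF fb(1)] by simp
qed

lemma ex_frame_enumeration:
  obtains \<beta> :: "'n \<Rightarrow> nat + 'a vfield" where "bij_betw \<beta> UNIV frame_index"
proof -
  \<comment> \<open>Any point will do, as \<open>frame_index\<close> does not depend on it.\<close>
  obtain Y N where F: "hframe Y N" "undefined \<in> N" by (rule ex_hframe)
  have "\<exists>\<beta>. bij_betw \<beta> (UNIV::'n set) frame_index"
    by (rule finite_same_card_bij) (simp_all add: card_frame_index[OF F])
  then show ?thesis using that by blast
qed

text \<open>A coordinate vector is expanded in the frame and then applied to the coordinate
  functions, to which it is dual.\<close>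

lemma frame_matrix:
  assumes c: "(U, \<phi>) \<in> charts M" and y: "y \<in> U"
    and \<xi>: "\<And>i. \<xi> i \<in> C_infinity M" "\<And>i. \<forall>\<^sub>F z in nhds y. \<xi> i z = \<phi> z $ i"
    and F: "hframe Y N" "y \<in> N" and \<beta>: "bij_betw \<beta> (UNIV::'n set) frame_index"
  shows "(\<chi> i b. gR M y (coord_vec M U \<phi> i y) (frame_field Y (\<beta> b) y)) **
      (\<chi> b i. frame_field Y (\<beta> b) y (\<xi> i)) = mat 1" (is "?Q ** ?P = _")
proof -
  have "(?Q ** ?P) $ i $ j = mat 1 $ i $ j" for i j
  proof -
    let ?c = "coord_vec M U \<phi> i y"
    have "?c = (\<Sum>k\<in>frame_index. gR M y ?c (frame_field Y k y) *\<^sub>R frame_field Y k y)"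
      by (rule tangent_expand[OF F coord_vec_tangent[OF c y]])
    also have "\<dots> = (\<Sum>b\<in>UNIV. gR M y ?c (frame_field Y (\<beta> b) y) *\<^sub>R frame_field Y (\<beta> b) y)"
      by (rule sum.reindex_bij_betw[OF \<beta>, symmetric])
    finally have "?c (\<xi> j) = (\<Sum>b\<in>UNIV. gR M y ?c (frame_field Y (\<beta> b) y) *\<^sub>R frame_field Y (\<beta> b) y) (\<xi> j)"
      by (rule arg_cong[where f = "\<lambda>v. v (\<xi> j)"])
    then show ?thesis
      by (simp add: matrix_matrix_mult_def sum_fun_apply coord_vec_coord[OF c y \<xi>] mat_def)
  qed
  then show ?thesis by (simp add: vec_eq_iff)
qed

lemma frame_matrix_det:
  assumes c: "(U, \<phi>) \<in> charts M" and y: "y \<in> U"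
    and \<xi>: "\<And>i. \<xi> i \<in> C_infinity M" "\<And>i. \<forall>\<^sub>F z in nhds y. \<xi> i z = \<phi> z $ i"
    and F: "hframe Y N" "y \<in> N" and \<beta>: "bij_betw \<beta> (UNIV::'n set) frame_index"
  shows "det (\<chi> b i. frame_field Y (\<beta> b) y (\<xi> i)) \<noteq> 0" (is "det ?P \<noteq> 0")
proof -
  have "det ((\<chi> i b. gR M y (coord_vec M U \<phi> i y) (frame_field Y (\<beta> b) y)) ** ?P) = 1"
    unfolding frame_matrix[OF assms] by simp
  then show ?thesis by (auto simp: det_mul)
qed

text \<open>Smoothness of the metric is assumed on horizontal fields only, so it does not yield
  smoothness of the \<open>gR\<close> coefficients of an arbitrary field. They are obtained by
  Cramer's rule from the smooth functions given by \<open>A\<close> and the frame applied to the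
  coordinates. The neighbourhood \<open>V\<close> is the same for all fields.\<close>

lemma smooth_coeffs:
  assumes F: "hframe Y N" "x \<in> N"
  obtains V where "open V" "x \<in> V" "V \<subseteq> N"
    "\<And>A. A \<in> vfields M \<Longrightarrow> \<exists>c. (\<forall>j\<in>frame_index. c j \<in> C_infinity M) \<and>
      (\<forall>y\<in>V. A y = (\<Sum>j\<in>frame_index. c j y *\<^sub>R frame_field Y j y))"
proof -
  obtain U \<phi> where c: "(U, \<phi>) \<in> charts M" and x: "x \<in> U" by (rule ex_chart)
  have NU: "open (N \<inter> U)" "x \<in> N \<inter> U" using hframeD(1)[OF F(1)] chart_open(1)[OF c] F(2) x by auto
  obtain \<xi> W where W: "open W" "x \<in> W" "W \<subseteq> N \<inter> U" and \<xi>: "\<And>i. \<xi> i \<in> C_infinity M"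
    "\<And>z i. z \<in> W \<Longrightarrow> \<xi> i z = \<phi> z $ i"
    using ex_coordinates[OF c NU Int_lower2] by metis
  obtain \<beta> :: "'n \<Rightarrow> nat + 'a vfield" where \<beta>: "bij_betw \<beta> UNIV frame_index" by (rule ex_frame_enumeration)
  obtain \<eta> V K where \<eta>: "\<eta> \<in> C_infinity M" "open V" "x \<in> V" "V \<subseteq> K" "K \<subseteq> W" "compact K"
    "\<And>y. y \<in> V \<Longrightarrow> \<eta> y = 1" "\<And>y. y \<notin> K \<Longrightarrow> \<eta> y = 0" "\<And>y. \<eta> y \<ge> 0"
    using ex_plateau[OF W(1,2)] by metis
  define P where "P = (\<lambda>y. \<chi> b i. frame_field Y (\<beta> b) y (\<xi> i))"
  have E: "frame_field Y (\<beta> b) \<in> vfields M" for b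
    using frame_field_vfields[OF F(1)] \<beta> by (metis UNIV_I bij_betwE)
  have near: "\<forall>\<^sub>F z in nhds y. \<xi> i z = \<phi> z $ i" if "y \<in> W" for y i
    using W(1) \<xi>(2) that unfolding eventually_nhds by blast
  have detP: "det (P y) \<noteq> 0" if y: "y \<in> W" for y
  proof -
    have "y \<in> U" "y \<in> N" using y W by auto
    from frame_matrix_det[OF c this(1) \<xi>(1) near[OF y] F(1) this(2) \<beta>]
    show ?thesis unfolding P_def .
  qed
  have Psm: "smooth_near M (\<lambda>y. P y $ b $ i) y" for b i y
    unfolding P_def using vfields_smooth[OF E \<xi>(1)] by (simp add: smooth_near_C_infinity)
  show ?thesis
  proof (rule that[OF \<eta>(2,3)])
    show "V \<subseteq> N" using \<eta> W by auto
    fix A assume A: "A \<in> vfields M"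
    define g where "g = (\<lambda>j y. gR M y (A y) (frame_field Y j y))"
    \<comment> \<open>Applying the frame expansion of \<open>A\<close> to the coordinates gives a
      linear system with matrix \<open>transpose (P y)\<close>, which is invertible on
      \<open>W\<close>.\<close>
    have cr: "g (\<beta> k) y = det (\<chi> i j. if j = k then A y (\<xi> i) else P y $ j $ i) * inverse (det (transpose (P y)))"
      if y: "y \<in> W" for y k
    proof -
      have yN: "y \<in> N" using y W by auto
      have "A y = (\<Sum>k\<in>frame_index. g k y *\<^sub>R frame_field Y k y)"
        unfolding g_def by (rule tangent_expand[OF F(1) yN vfields_tangent[OF A]])
      also have "\<dots> = (\<Sum>b\<in>UNIV. g (\<beta> b) y *\<^sub>R frame_field Y (\<beta> b) y)"
        by (rule sum.reindex_bij_betw[OF \<beta>, symmetric])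
      finally have "A y (\<xi> i) = (\<Sum>b\<in>UNIV. g (\<beta> b) y *\<^sub>R frame_field Y (\<beta> b) y) (\<xi> i)" for i
        by (rule arg_cong[where f = "\<lambda>v. v (\<xi> i)"])
      then have "transpose (P y) *v (\<chi> b. g (\<beta> b) y) = (\<chi> i. A y (\<xi> i))"
        by (simp add: vec_eq_iff matrix_vector_mult_def transpose_def P_def sum_fun_apply mult.commute)
      then have "(\<chi> b. g (\<beta> b) y) = (\<chi> k. det (\<chi> i j. if j = k then (\<chi> i. A y (\<xi> i)) $ i else transpose (P y) $ i $ j) / det (transpose (P y)))"
        using cramer[of "transpose (P y)"] detP[OF y] by (simp only: det_transpose not_False_eq_True)
      moreover have "(\<chi> i j. if j = k then (\<chi> i. A y (\<xi> i)) $ i else transpose (P y) $ i $ j) =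
          (\<chi> i j. if j = k then A y (\<xi> i) else P y $ j $ i)" for k
        by (simp add: vec_eq_iff transpose_def)
      ultimately have "(\<chi> b. g (\<beta> b) y) $ k = det (\<chi> i j. if j = k then A y (\<xi> i) else P y $ j $ i) / det (transpose (P y))"
        by simp
      then show ?thesis by (simp add: divide_inverse)
    qed
    have gs: "smooth_near M (g (\<beta> k)) y" if y: "y \<in> W" for y k
    proof -
      have "smooth_near M (\<lambda>y. det (\<chi> i j. if j = k then A y (\<xi> i) else P y $ j $ i) * inverse (det (transpose (P y)))) y"
      proof (intro smooth_near_mult smooth_near_inverse smooth_near_det)
        fix i j
        show "smooth_near M (\<lambda>y. (\<chi> i j. if j = k then A y (\<xi> i) else P y $ j $ i) $ i $ j) y"
          using Psm smooth_near_C_infinity[OF vfields_smooth[OF A \<xi>(1)]] by (cases "j = k") simp_all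
        show "smooth_near M (\<lambda>y. transpose (P y) $ i $ j) y" using Psm by (simp add: transpose_def)
        show "det (transpose (P y)) \<noteq> 0" using detP[OF y] by (simp add: det_transpose)
      qed
      moreover have "\<forall>\<^sub>F y in nhds y. y \<in> W" using y W(1) eventually_nhds by blast
      then have "\<forall>\<^sub>F y in nhds y. det (\<chi> i j. if j = k then A y (\<xi> i) else P y $ j $ i) * inverse (det (transpose (P y))) = g (\<beta> k) y"
        by eventually_elim (simp add: cr)
      ultimately show ?thesis by (rule smooth_near_cong)
    qed
    show "\<exists>c. (\<forall>j\<in>frame_index. c j \<in> C_infinity M) \<and>
      (\<forall>y\<in>V. A y = (\<Sum>j\<in>frame_index. c j y *\<^sub>R frame_field Y j y))"
    proof (intro exI[where x = "\<lambda>j y. \<eta> y * g j y"] conjI ballI)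
      fix j assume "j \<in> frame_index"
      then obtain k where "j = \<beta> k" using \<beta> by (metis bij_betw_imp_surj_on imageE)
      then show "(\<lambda>y. \<eta> y * g j y) \<in> C_infinity M"
        using C_infinity_cutoff[OF \<eta>(1) compact_imp_closed[OF \<eta>(6)] \<eta>(5)] \<eta>(8) gs by blast
    next
      fix y assume y: "y \<in> V"
      then have "y \<in> N" using \<eta> W by auto
      then show "A y = (\<Sum>j\<in>frame_index. (\<eta> y * g j y) *\<^sub>R frame_field Y j y)"
        using tangent_expand[OF F(1) _ vfields_tangent[OF A]] \<eta>(7)[OF y] by (simp add: g_def)
    qed
  qed
qed

end

section \<open>Integration by parts and the sub-Laplacian\<close>

lemma integrable_compact_support:
  fixes H :: "'b::euclidean_space \<Rightarrow> real"
  assumes "continuous_on K H" "compact K" "\<And>z. z \<notin> K \<Longrightarrow> H z = 0"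
  shows "integrable lborel H"
proof -
  have "integrable lborel (\<lambda>z. indicator K z *\<^sub>R H z)"
    by (rule borel_integrable_compact[OF assms(2,1)])
  moreover have "(\<lambda>z. indicator K z *\<^sub>R H z) = H"
  proof
    fix z show "indicator K z *\<^sub>R H z = H z" by (cases "z \<in> K") (simp_all add: assms(3))
  qed
  ultimately show ?thesis by (simp only:)
qed

lemma lborel_integral_translate:
  fixes H :: "'b::euclidean_space \<Rightarrow> real"
  assumes "H \<in> borel_measurable borel"
  shows "(LINT z|lborel. H (c + z)) = (LINT z|lborel. H z)"
proof -
  have "(LINT z|lborel. H z) = (LINT z|distr lborel borel ((+) c). H z)"
    by (simp add: lborel_distr_plus)
  also have "\<dots> = (LINT z|lborel. H (c + z))" by (rule integral_distr) (use assms in auto)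
  finally show ?thesis by simp
qed

lemma frechet_derivative_outside_support:
  fixes H :: "'b::euclidean_space \<Rightarrow> real"
  assumes "closed K" "\<And>z. z \<notin> K \<Longrightarrow> H z = 0" "z \<notin> K"
  shows "frechet_derivative H (at z) = (\<lambda>_. 0)"
proof (rule frechet_derivative_eqI)
  have "((\<lambda>_. 0 :: real) has_derivative (\<lambda>_. 0)) (at z)" by simp
  then show "(H has_derivative (\<lambda>_. 0)) (at z)"
    by (rule has_derivative_transform_within_open[OF _ open_Compl[OF assms(1)]]) (use assms in auto)
qed

text \<open>Difference quotients have integral 0 by translation invariance of Lebesgue measure, and
  they converge to the directional derivative under a common integrable bound.\<close>

lemma integral_frechet_derivative_compact_support:
  fixes H :: "'b::euclidean_space \<Rightarrow> real"
  assumes H: "smooth_on UNIV H" and K: "compact K" and out: "\<And>z. z \<notin> K \<Longrightarrow> H z = 0"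
  shows "integrable lborel (\<lambda>z. frechet_derivative H (at z) e)"
    "(LINT z|lborel. frechet_derivative H (at z) e) = 0"
proof -
  define D where "D = (\<lambda>z. frechet_derivative H (at z) e)"
  have cD: "continuous_on UNIV D" unfolding D_def
    by (rule smooth_on_imp_continuous_on[OF smooth_on_frechet_derivative[OF H]])
  have cH: "continuous_on UNIV H" by (rule smooth_on_imp_continuous_on[OF H])
  have D0: "D z = 0" if "z \<notin> K" for z
    unfolding D_def using frechet_derivative_outside_support[OF compact_imp_closed[OF K] out that] by simp
  show "integrable lborel (\<lambda>z. frechet_derivative H (at z) e)"
    using integrable_compact_support[OF continuous_on_subset[OF cD subset_UNIV] K D0] unfolding D_def .
  have iH: "integrable lborel H"
    by (rule integrable_compact_support[OF continuous_on_subset[OF cH subset_UNIV] K out])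
  have mH: "H \<in> borel_measurable borel" by (rule borel_measurable_continuous_onI[OF cH])
  obtain B where B: "B \<ge> 0" "\<And>z. \<bar>D z\<bar> \<le> B"
  proof -
    have "bounded (D ` K)"
      by (rule compact_imp_bounded[OF compact_continuous_image[OF continuous_on_subset[OF cD subset_UNIV] K]])
    then obtain B where B: "\<And>z. z \<in> K \<Longrightarrow> \<bar>D z\<bar> \<le> B" unfolding bounded_iff by auto
    have "\<bar>D z\<bar> \<le> max B 0" for z
      using B[of z] D0[of z] by (cases "z \<in> K") auto
    then show ?thesis using that[of "max B 0"] by simp
  qed
  obtain R where R: "\<And>z. z \<in> K \<Longrightarrow> norm z \<le> R" using compact_imp_bounded[OF K] unfolding bounded_iff by blast
  define h where "h = (\<lambda>n. inverse (real (Suc n)))"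
  have h: "h n > 0" "h n \<le> 1" for n unfolding h_def by (auto simp: field_simps)
  define s where "s = (\<lambda>n z. (H (h n *\<^sub>R e + z) - H z) / h n)"
  have deriv: "((\<lambda>t. H (t *\<^sub>R e + z)) has_real_derivative D (t *\<^sub>R e + z)) (at t)" for t z
  proof -
    have hd: "(H has_derivative frechet_derivative H (at (t *\<^sub>R e + z))) (at (t *\<^sub>R e + z))"
      by (rule smooth_on_imp_has_derivative[OF H]) simp
    have "((\<lambda>t. t *\<^sub>R e + z) has_derivative (\<lambda>v. v *\<^sub>R e)) (at t)"
      by (auto intro!: derivative_eq_intros)
    from has_derivative_compose[OF this hd]
    have "((\<lambda>t. H (t *\<^sub>R e + z)) has_derivative (\<lambda>v. frechet_derivative H (at (t *\<^sub>R e + z)) (v *\<^sub>R e))) (at t)" .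
    moreover have "linear (frechet_derivative H (at (t *\<^sub>R e + z)))"
      by (rule linear_frechet_derivative[OF smooth_on_imp_differentiable[OF H]]) simp
    moreover have "(\<lambda>v. v * D (t *\<^sub>R e + z)) = (*) (D (t *\<^sub>R e + z))" by (simp add: fun_eq_iff)
    ultimately show ?thesis
      unfolding has_field_derivative_def by (simp add: linear_scale D_def)
  qed
  have lim: "(\<lambda>n. s n z) \<longlonglongrightarrow> D z" for z
  proof -
    have "((\<lambda>t. (H (t *\<^sub>R e + z) - H (0 *\<^sub>R e + z)) / (t - 0)) \<longlongrightarrow> D (0 *\<^sub>R e + z)) (at 0)"
      using deriv[of z 0] unfolding has_field_derivative_iff .
    moreover have "filterlim h (at 0) sequentially"
      unfolding filterlim_at h_def using LIMSEQ_inverse_real_of_nat by (auto intro!: always_eventually)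
    ultimately have "(\<lambda>n. (H (h n *\<^sub>R e + z) - H (0 *\<^sub>R e + z)) / (h n - 0)) \<longlonglongrightarrow> D (0 *\<^sub>R e + z)"
      by (rule filterlim_compose)
    then show ?thesis by (simp add: s_def)
  qed
  \<comment> \<open>Because \<open>h n\<close> is at most 1, the quotient vanishes outside the ball
    enlarged by \<open>norm e\<close>; inside it the mean value theorem bounds it by the maximum of
    the derivative.\<close>
  have bound: "\<bar>s n z\<bar> \<le> B * indicator (cball 0 (R + norm e)) z" for n z
  proof (cases "z \<in> cball 0 (R + norm e)")
    case True
    have "\<exists>t. 0 < t \<and> t < h n \<and> H (h n *\<^sub>R e + z) - H (0 *\<^sub>R e + z) = (h n - 0) * D (t *\<^sub>R e + z)"
      using MVT2[OF h(1)[of n], of "\<lambda>t. H (t *\<^sub>R e + z)" "\<lambda>t. D (t *\<^sub>R e + z)"] deriv by blast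
    then obtain t where "H (h n *\<^sub>R e + z) - H z = h n * D (t *\<^sub>R e + z)" by auto
    then have "s n z = D (t *\<^sub>R e + z)" using h(1)[of n] by (simp add: s_def)
    then show ?thesis using B True by simp
  next
    case False
    then have n: "norm z > R + norm e" by simp
    have "norm (h n *\<^sub>R e) \<le> norm e" using h[of n] by (simp add: mult_left_le_one_le)
    moreover have "norm z \<le> norm (h n *\<^sub>R e + z) + norm (h n *\<^sub>R e)"
      using norm_triangle_ineq4[of "h n *\<^sub>R e + z" "h n *\<^sub>R e"] by simp
    ultimately have "norm (h n *\<^sub>R e + z) > R" using n by linarith
    then have "H (h n *\<^sub>R e + z) = 0" using R out by force
    moreover have "norm z > R" using n norm_ge_zero[of e] by linarith
    then have "H z = 0" using R out by force
    ultimately show ?thesis using B by (simp add: s_def)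
  qed
  have "(\<lambda>n. LINT z|lborel. s n z) \<longlonglongrightarrow> (LINT z|lborel. D z)"
  proof (rule integral_dominated_convergence)
    show "D \<in> borel_measurable lborel" using borel_measurable_continuous_onI[OF cD] by simp
    show "s n \<in> borel_measurable lborel" for n
    proof -
      have "continuous_on UNIV (s n)" unfolding s_def
        using h(1)[of n] by (intro continuous_intros continuous_on_compose2[OF cH]) auto
      then show ?thesis using borel_measurable_continuous_onI by simp
    qed
    have "integrable lborel (\<lambda>z. indicator (cball 0 (R + norm e)) z *\<^sub>R B)"
      by (rule borel_integrable_compact) auto
    then show "integrable lborel (\<lambda>z. B * indicator (cball 0 (R + norm e)) z :: real)"
      by (simp add: mult.commute)
  qed (use lim bound in auto)
  moreover have "(LINT z|lborel. s n z) = 0" for n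
  proof -
    have iH': "integrable lborel (\<lambda>z. H (h n *\<^sub>R e + z))"
    proof (rule integrable_compact_support[of "(\<lambda>z. - (h n *\<^sub>R e) + z) ` K"])
      show "continuous_on ((\<lambda>z. - (h n *\<^sub>R e) + z) ` K) (\<lambda>z. H (h n *\<^sub>R e + z))"
        by (intro continuous_intros continuous_on_compose2[OF cH]) auto
      show "compact ((\<lambda>z. - (h n *\<^sub>R e) + z) ` K)" by (rule compact_translation[OF K])
      fix z assume "z \<notin> (\<lambda>z. - (h n *\<^sub>R e) + z) ` K"
      then have "h n *\<^sub>R e + z \<notin> K" by (metis add_minus_cancel image_eqI minus_add_cancel)
      then show "H (h n *\<^sub>R e + z) = 0" by (rule out)
    qed
    have "(LINT z|lborel. s n z) = ((LINT z|lborel. H (h n *\<^sub>R e + z)) - (LINT z|lborel. H z)) / h n"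
      unfolding s_def using iH iH' by simp
    then show ?thesis using lborel_integral_translate[OF mH] by simp
  qed
  ultimately have "(LINT z|lborel. D z) = 0" by (simp add: LIMSEQ_const_iff)
  then show "(LINT z|lborel. frechet_derivative H (at z) e) = 0" by (simp add: D_def)
qed

section \<open>The measure in a chart and derivatives of determinants\<close>

context smooth_manifold
begin

text \<open>The defining values on Borel subsets of a chart say that on \<open>W\<close> the measure
  is the image, under the inverse chart, of Lebesgue measure with density \<sigma>. Passing from
  sets to functions uses the transformation rules for densities, images and restrictions.\<close>

lemma chart_measure:
  fixes u :: "'a \<Rightarrow> real"
  assumes \<mu>: "riemannian_measure M \<mu>" and c: "(U, \<phi>) \<in> charts M"
    and W: "open W" "W \<subseteq> U"
    and \<sigma>: "continuous_on W \<sigma>" "\<And>y. y \<in> W \<Longrightarrow> \<sigma> y = sqrt (det (gram_matrix M U \<phi> y))"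
      "\<And>y. y \<in> W \<Longrightarrow> 0 \<le> \<sigma> y"
    and u: "continuous_on UNIV u" "\<And>y. y \<notin> W \<Longrightarrow> u y = 0"
  shows "integrable \<mu> u \<longleftrightarrow> integrable lborel (\<lambda>z. indicator (\<phi> ` W) z * (\<sigma> (inv_into U \<phi> z) * u (inv_into U \<phi> z)))"
    "(LINT y|\<mu>. u y) = (LINT z|lborel. indicator (\<phi> ` W) z * (\<sigma> (inv_into U \<phi> z) * u (inv_into U \<phi> z)))"
proof -
  let ?V = "\<phi> ` W"
  have sets: "sets \<mu> = sets borel" using \<mu> unfolding riemannian_measure_def by blast
  then have space: "space \<mu> = UNIV" using sets_eq_imp_space_eq by fastforce
  have oV: "open ?V" by (rule chart_open_image[OF c W])
  have VU: "?V \<subseteq> \<phi> ` U" using W by auto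
  have cinv: "continuous_on ?V (inv_into U \<phi>)"
    by (rule continuous_on_subset[OF chart_cont_inv[OF c] VU])
  have invW: "inv_into U \<phi> z \<in> W" if "z \<in> ?V" for z
    using that chart_inv[OF c] W by auto
  define \<sigma>' where "\<sigma>' = (\<lambda>z. indicator ?V z *\<^sub>R \<sigma> (inv_into U \<phi> z))"
  have m\<sigma>: "\<sigma>' \<in> borel_measurable borel"
    unfolding \<sigma>'_def
    by (rule borel_measurable_continuous_on_indicator[OF borel_open[OF oV]
          continuous_on_compose2[OF \<sigma>(1) cinv]]) (use invW in auto)
  have nn: "\<sigma>' z \<ge> 0" for z using \<sigma>(3)[OF invW[of z]] by (cases "z \<in> ?V") (auto simp: \<sigma>'_def)
  \<comment> \<open>The inverse chart, continued by a constant to be Borel on the whole space; the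
    density \<open>\<sigma>'\<close> is 0 there, so the constant is immaterial.\<close>
  define g where "g = (\<lambda>z. if z \<in> ?V then inv_into U \<phi> z else undefined)"
  have mg: "g \<in> borel_measurable borel"
    unfolding g_def by (rule borel_measurable_continuous_on_if[OF borel_open[OF oV] cinv]) simp
  define N where "N = density lborel \<sigma>'"
  define N' where "N' = distr N borel g"
  have mgN: "g \<in> measurable N borel" using mg unfolding N_def by simp
  have mu: "u \<in> borel_measurable borel" by (rule borel_measurable_continuous_onI[OF u(1)])
  have eq: "emeasure \<mu> B = emeasure N' B" if B: "B \<in> sets borel" "B \<subseteq> W" for B
  proof -
    have "emeasure N' B = emeasure N (g -` B \<inter> space N)"
      unfolding N'_def by (rule emeasure_distr[OF mgN]) (use B in simp)
    also have "\<dots> = (\<integral>\<^sup>+ z. ennreal (\<sigma>' z) * indicator (g -` B \<inter> space N) z \<partial>lborel)"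
      unfolding N_def
    proof (rule emeasure_density)
      show "(\<lambda>z. ennreal (\<sigma>' z)) \<in> borel_measurable lborel" using m\<sigma> by simp
      show "g -` B \<inter> space (density lborel (\<lambda>x. ennreal (\<sigma>' x))) \<in> sets lborel"
        using measurable_sets[OF mg] B by simp
    qed
    also have "\<dots> = (\<integral>\<^sup>+ z. ennreal (sqrt (det (gram_matrix M U \<phi> (inv_into U \<phi> z)))) * indicator (\<phi> ` B) z \<partial>lborel)"
    proof (rule nn_integral_cong)
      fix z
      show "ennreal (\<sigma>' z) * indicator (g -` B \<inter> space N) z =
        ennreal (sqrt (det (gram_matrix M U \<phi> (inv_into U \<phi> z)))) * indicator (\<phi> ` B) z"
      proof (cases "z \<in> ?V")
        case True
        have "z \<in> \<phi> ` B \<longleftrightarrow> inv_into U \<phi> z \<in> B"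
        proof
          assume "z \<in> \<phi> ` B" then show "inv_into U \<phi> z \<in> B" using chart_inv[OF c] B W by auto
        next
          assume "inv_into U \<phi> z \<in> B"
          moreover have "\<phi> (inv_into U \<phi> z) = z" using True VU by (intro f_inv_into_f) auto
          ultimately show "z \<in> \<phi> ` B" by (metis image_eqI)
        qed
        then show ?thesis using True \<sigma>(2)[OF invW[OF True]]
          by (simp add: \<sigma>'_def g_def N_def indicator_def)
      next
        case False
        moreover have "z \<notin> \<phi> ` B" using False B by auto
        ultimately show ?thesis by (simp add: \<sigma>'_def)
      qed
    qed
    also have "\<dots> = emeasure \<mu> B"
      using \<mu> c B W unfolding riemannian_measure_def by (auto dest!: bspec)
    finally show ?thesis by simp
  qed
  have Wb: "W \<in> sets borel" using W by simp
  \<comment> \<open>The two measures are compared on subsets of \<open>W\<close> only, which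
    suffices as \<open>u\<close> vanishes elsewhere.\<close>
  have rs: "restrict_space \<mu> W = restrict_space N' W"
  proof (rule measure_eqI)
    show "sets (restrict_space \<mu> W) = sets (restrict_space N' W)"
      by (rule sets_restrict_space_cong) (simp add: sets N'_def)
    fix B assume "B \<in> sets (restrict_space \<mu> W)"
    then have B: "B \<in> sets borel" "B \<subseteq> W"
      using sets Wb by (auto simp: sets_restrict_space_iff space)
    then show "emeasure (restrict_space \<mu> W) B = emeasure (restrict_space N' W) B"
      using eq[OF B] Wb sets by (simp add: emeasure_restrict_space N'_def space)
  qed
  have iu: "(\<lambda>y. indicator W y *\<^sub>R u y) = u"
  proof
    fix y show "indicator W y *\<^sub>R u y = u y" by (cases "y \<in> W") (simp_all add: u(2))
  qed
  have dens: "\<sigma>' z *\<^sub>R u (g z) = indicator ?V z * (\<sigma> (inv_into U \<phi> z) * u (inv_into U \<phi> z))" for z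
    by (simp add: \<sigma>'_def g_def indicator_def)
  have mug: "(\<lambda>z. u (g z)) \<in> borel_measurable lborel" using measurable_compose[OF mg mu] by simp
  have m\<sigma>l: "\<sigma>' \<in> borel_measurable lborel" using m\<sigma> by simp
  have Wm: "W \<inter> space \<mu> \<in> sets \<mu>" "W \<inter> space N' \<in> sets N'" using Wb sets by (simp_all add: space N'_def)
  have "integrable \<mu> u \<longleftrightarrow> integrable (restrict_space \<mu> W) u"
    using integrable_restrict_space[OF Wm(1), of u] by (simp only: iu)
  also have "\<dots> \<longleftrightarrow> integrable N' u"
    unfolding rs using integrable_restrict_space[OF Wm(2), of u] by (simp only: iu)
  also have "\<dots> \<longleftrightarrow> integrable N (\<lambda>z. u (g z))"
    unfolding N'_def by (rule integrable_distr_eq[OF mgN mu])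
  also have "\<dots> \<longleftrightarrow> integrable lborel (\<lambda>z. \<sigma>' z *\<^sub>R u (g z))"
    unfolding N_def by (rule integrable_density[OF mug m\<sigma>l]) (simp add: nn)
  finally show "integrable \<mu> u \<longleftrightarrow> integrable lborel (\<lambda>z. indicator (\<phi> ` W) z * (\<sigma> (inv_into U \<phi> z) * u (inv_into U \<phi> z)))"
    unfolding dens .
  have "(LINT y|\<mu>. u y) = (LINT y|restrict_space \<mu> W. u y)"
    using integral_restrict_space[OF Wm(1), of u] by (simp only: iu)
  also have "\<dots> = (LINT y|N'. u y)"
    unfolding rs using integral_restrict_space[OF Wm(2), of u] by (simp only: iu)
  also have "\<dots> = (LINT z|N. u (g z))"
    unfolding N'_def by (rule integral_distr[OF mgN mu])
  also have "\<dots> = (LINT z|lborel. \<sigma>' z *\<^sub>R u (g z))"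
    unfolding N_def by (rule integral_density[OF mug m\<sigma>l]) (simp add: nn)
  finally show "(LINT y|\<mu>. u y) = (LINT z|lborel. indicator (\<phi> ` W) z * (\<sigma> (inv_into U \<phi> z) * u (inv_into U \<phi> z)))"
    unfolding dens .
qed

lemma integrable_chart:
  fixes u :: "'a \<Rightarrow> real"
  assumes \<mu>: "riemannian_measure M \<mu>" and c: "(U, \<phi>) \<in> charts M"
    and W: "open W" "W \<subseteq> U"
    and \<sigma>: "continuous_on W \<sigma>" "\<And>y. y \<in> W \<Longrightarrow> \<sigma> y = sqrt (det (gram_matrix M U \<phi> y))"
      "\<And>y. y \<in> W \<Longrightarrow> 0 \<le> \<sigma> y"
    and u: "continuous_on UNIV u" "\<And>y. y \<notin> K \<Longrightarrow> u y = 0" and K: "compact K" "K \<subseteq> W"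
  shows "integrable \<mu> u"
proof -
  have u0: "u y = 0" if "y \<notin> W" for y using that u(2) K by auto
  have KU: "\<phi> ` K \<subseteq> \<phi> ` U" using K W by auto
  have cinv: "continuous_on (\<phi> ` K) (inv_into U \<phi>)"
    by (rule continuous_on_subset[OF chart_cont_inv[OF c] KU])
  have inv: "inv_into U \<phi> (\<phi> y) = y" if "y \<in> K" for y using that chart_inv[OF c] K W by auto
  have "integrable lborel (\<lambda>z. indicator (\<phi> ` W) z * (\<sigma> (inv_into U \<phi> z) * u (inv_into U \<phi> z)))"
  proof (rule integrable_compact_support)
    show "compact (\<phi> ` K)"
      using compact_continuous_image[OF continuous_on_subset[OF chart_cont[OF c]] K(1)] K(2) W(2) by auto
    have c1: "continuous_on (\<phi> ` K) (\<lambda>z. \<sigma> (inv_into U \<phi> z))"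
      by (rule continuous_on_compose2[OF \<sigma>(1) cinv]) (use inv K in auto)
    have c2: "continuous_on (\<phi> ` K) (\<lambda>z. u (inv_into U \<phi> z))"
      by (rule continuous_on_compose2[OF u(1) cinv]) simp
    have "continuous_on (\<phi> ` K) (\<lambda>z. \<sigma> (inv_into U \<phi> z) * u (inv_into U \<phi> z))"
      by (rule continuous_on_mult[OF c1 c2])
    then show "continuous_on (\<phi> ` K) (\<lambda>z. indicator (\<phi> ` W) z * (\<sigma> (inv_into U \<phi> z) * u (inv_into U \<phi> z)))"
      by (rule continuous_on_eq) (use K in \<open>auto simp: indicator_def\<close>)
    fix z assume z: "z \<notin> \<phi> ` K"
    show "indicator (\<phi> ` W) z * (\<sigma> (inv_into U \<phi> z) * u (inv_into U \<phi> z)) = 0"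
    proof (cases "z \<in> \<phi> ` W")
      case True
      then obtain y where y: "y \<in> W" "z = \<phi> y" by blast
      then have "inv_into U \<phi> z = y" using chart_inv[OF c] W by auto
      moreover have "y \<notin> K" using y z by auto
      ultimately show ?thesis using u(2) by simp
    qed simp
  qed
  then show ?thesis using chart_measure(1)[OF \<mu> c W \<sigma> u(1) u0] by simp
qed

lemma tangent_prod:
  assumes v: "v \<in> tangent_space M y" and I: "finite I" and f: "\<And>i. i \<in> I \<Longrightarrow> f i \<in> C_infinity M"
  shows "(\<lambda>y. \<Prod>i\<in>I. f i y) \<in> C_infinity M \<and>
    v (\<lambda>y. \<Prod>i\<in>I. f i y) = (\<Sum>i\<in>I. \<Prod>j\<in>I. if j = i then v (f j) else f j y)"
  using I f
proof (induction I)
  case empty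
  then show ?case using tangent_const[OF v, of 1] by simp
next
  case (insert i I)
  then have IH: "(\<lambda>y. \<Prod>i\<in>I. f i y) \<in> C_infinity M"
    "v (\<lambda>y. \<Prod>i\<in>I. f i y) = (\<Sum>i\<in>I. \<Prod>j\<in>I. if j = i then v (f j) else f j y)"
    and fi: "f i \<in> C_infinity M" by auto
  have "v (\<lambda>y. \<Prod>i\<in>insert i I. f i y) = v (\<lambda>y. f i y * (\<Prod>i\<in>I. f i y))"
    using insert.hyps by simp
  also have "\<dots> = f i y * (\<Sum>k\<in>I. \<Prod>j\<in>I. if j = k then v (f j) else f j y) + (\<Prod>i\<in>I. f i y) * v (f i)"
    using tangent_mult[OF v fi IH(1)] IH(2) by simp
  also have "(\<Prod>i\<in>I. f i y) = (\<Prod>j\<in>I. if j = i then v (f j) else f j y)"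
    using insert.hyps by (intro prod.cong) auto
  also have "f i y * (\<Sum>k\<in>I. \<Prod>j\<in>I. if j = k then v (f j) else f j y) =
     (\<Sum>k\<in>I. \<Prod>j\<in>insert i I. if j = k then v (f j) else f j y)"
    unfolding sum_distrib_left using insert.hyps by (intro sum.cong) auto
  finally show ?case using insert.hyps C_inf_mult[OF fi IH(1)] by (simp add: mult.commute)
qed

text \<open>Jacobi's formula for a matrix whose derivative along \<open>v\<close> is
  \<open>m\<close> times itself. By the product rule one row at a time is differentiated; the
  derivative of row \<open>b\<close> is a combination of all rows, of which only the multiple of row
  \<open>b\<close> contributes to the determinant.\<close>

lemma tangent_det:
  fixes P :: "'m::finite \<Rightarrow> 'm \<Rightarrow> 'a \<Rightarrow> real"
  assumes v: "v \<in> tangent_space M y" and P: "\<And>b i. P b i \<in> C_infinity M"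
    and m: "\<And>b i. v (P b i) = (\<Sum>c\<in>UNIV. m $ b $ c * P c i y)"
  shows "(\<lambda>y. det (\<chi> b i. P b i y)) \<in> C_infinity M"
    "v (\<lambda>y. det (\<chi> b i. P b i y)) = trace m * det (\<chi> b i. P b i y)"
proof -
  let ?U = "UNIV :: 'm set"
  let ?S = "{p. p permutes ?U}"
  have pr: "(\<lambda>y. \<Prod>b\<in>?U. P b (p b) y) \<in> C_infinity M"
    "v (\<lambda>y. \<Prod>b\<in>?U. P b (p b) y) = (\<Sum>b\<in>?U. \<Prod>j\<in>?U. if j = b then v (P j (p j)) else P j (p j) y)" for p
    using tangent_prod[OF v, of ?U "\<lambda>b. P b (p b)"] P by auto
  have det: "(\<lambda>y. det (\<chi> b i. P b i y)) = (\<lambda>y. \<Sum>p\<in>?S. of_int (sign p) * (\<Prod>b\<in>?U. P b (p b) y))"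
    by (simp add: det_def)
  show "(\<lambda>y. det (\<chi> b i. P b i y)) \<in> C_infinity M"
    unfolding det by (intro C_inf_sum C_inf_mult C_inf_const pr(1))
  have "v (\<lambda>y. det (\<chi> b i. P b i y)) = (\<Sum>p\<in>?S. v (\<lambda>y. of_int (sign p) * (\<Prod>b\<in>?U. P b (p b) y)))"
    unfolding det by (rule tangent_sum[OF v]) (intro C_inf_mult C_inf_const pr(1))
  also have "\<dots> = (\<Sum>p\<in>?S. \<Sum>b\<in>?U. of_int (sign p) * (\<Prod>j\<in>?U. if j = b then v (P j (p j)) else P j (p j) y))"
    by (intro sum.cong refl) (simp only: tangent_cmult[OF v pr(1)] pr(2) sum_distrib_left)
  also have "\<dots> = (\<Sum>b\<in>?U. \<Sum>p\<in>?S. of_int (sign p) * (\<Prod>j\<in>?U. if j = b then v (P j (p j)) else P j (p j) y))"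
    by (rule sum.swap)
  also have "\<dots> = (\<Sum>b\<in>?U. det (\<chi> j i. if j = b then v (P j i) else P j i y))"
    by (simp add: det_def)
  also have "\<dots> = (\<Sum>b\<in>?U. m $ b $ b * det (\<chi> b i. P b i y))"
  proof (rule sum.cong[OF refl])
    fix b
    let ?A = "\<chi> b i. P b i y"
    have "(\<chi> j i. if j = b then v (P j i) else P j i y) =
      (\<chi> j. if j = b then sum (\<lambda>c. (m $ b) $ c *s row c ?A) ?U else row j ?A)"
      by (simp add: vec_eq_iff m row_def)
    then show "det (\<chi> j i. if j = b then v (P j i) else P j i y) = m $ b $ b * det ?A"
      using cramer_lemma_transpose[of b "m $ b" ?A] by simp
  qed
  finally show "v (\<lambda>y. det (\<chi> b i. P b i y)) = trace m * det (\<chi> b i. P b i y)"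
    by (simp add: trace_def sum_distrib_right)
qed

end

lemma matrix_mult_add_distrib: "(B + C) ** A = B ** A + C ** (A :: 'a::semiring_1^'n^'m)"
  by (simp add: vec_eq_iff matrix_matrix_mult_def distrib_right sum.distrib)

lemma frechet_derivative_cong_open:
  assumes "f differentiable at x" "open S" "x \<in> S" "\<And>y. y \<in> S \<Longrightarrow> f y = g y"
  shows "frechet_derivative g (at x) = frechet_derivative f (at x)"
proof (rule frechet_derivative_eqI)
  have "(f has_derivative frechet_derivative f (at x)) (at x)"
    using assms(1) by (simp add: frechet_derivative_works)
  then show "(g has_derivative frechet_derivative f (at x)) (at x)"
    by (rule has_derivative_transform_within_open[OF _ assms(2,3,4)])
qed

context smooth_manifold
begin

lemma tangent_eq_zero_germ:
  assumes "v \<in> tangent_space M x" "f \<in> C_infinity M" "\<forall>\<^sub>F y in nhds x. f y = 0"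
  shows "v f = 0"
  using tangent_germ[OF assms(1,2) C_inf_const assms(3)] tangent_const[OF assms(1)] by simp

lemma eventually_not_in_compact: "compact K \<Longrightarrow> y \<notin> K \<Longrightarrow> \<forall>\<^sub>F z in nhds y. z \<notin> (K::'a set)"
  using open_Compl[OF compact_imp_closed] unfolding eventually_nhds by blast

lemma tangent_outside_support:
  assumes "v \<in> tangent_space M y" "f \<in> C_infinity M" "compact K" "\<And>z. z \<notin> K \<Longrightarrow> f z = 0" "y \<notin> K"
  shows "v f = 0"
  by (rule tangent_eq_zero_germ[OF assms(1,2) eventually_mono[OF eventually_not_in_compact[OF assms(3,5)]]])
    (rule assms(4))

end

context sr_manifold
begin

lemma frame_sum_reindex:
  "bij_betw \<beta> (UNIV::'n set) frame_index \<Longrightarrow> (\<Sum>j\<in>frame_index. F j) = (\<Sum>b\<in>UNIV. F (\<beta> b))"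
  by (rule sum.reindex_bij_betw[symmetric])

text \<open>Up to sign, \<open>q\<close> is the density of the Riemannian measure in the coordinates \<open>\<xi>\<close>.\<close>

lemma divergence_identity:
  assumes c: "(U, \<phi>) \<in> charts M" and y: "y \<in> U"
    and \<xi>: "\<And>i. \<xi> i \<in> C_infinity M" "\<And>i. \<forall>\<^sub>F z in nhds y. \<xi> i z = \<phi> z $ i"
    and F: "hframe Y N" "y \<in> N" and \<beta>: "bij_betw \<beta> (UNIV::'n set) frame_index"
    and A: "A \<in> vfields M" and f: "f \<in> C_infinity M" and q: "q \<in> C_infinity M"
    and qP: "\<forall>\<^sub>F z in nhds y. q z * det (\<chi> b i. frame_field Y (\<beta> b) z (\<xi> i)) = 1"
  shows "(\<Sum>i\<in>UNIV. coord_vec M U \<phi> i y (\<lambda>z. q z * f z * A z (\<xi> i))) =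
    q y * (A y f - f y * (\<Sum>j\<in>frame_index. gR M y (lie_bracket A (frame_field Y j) y) (frame_field Y j y)))"
proof -
  let ?E = "\<lambda>b. frame_field Y (\<beta> b)"
  let ?c = "\<lambda>i. coord_vec M U \<phi> i y"
  have E: "?E b \<in> vfields M" for b
    using frame_field_vfields[OF F(1)] \<beta> by (metis UNIV_I bij_betwE)
  define Pf where "Pf = (\<lambda>b i z. ?E b z (\<xi> i))"
  have Pf: "Pf b i \<in> C_infinity M" for b i unfolding Pf_def by (rule vfields_smooth[OF E \<xi>(1)])
  define P where "P = (\<chi> b i. Pf b i y)"
  define Q where "Q = (\<chi> i b. gR M y (?c i) (?E b y))"
  have QP: "Q ** P = mat 1"
    unfolding Q_def P_def Pf_def by (rule frame_matrix[where \<xi> = \<xi>, OF c y \<xi> F \<beta>])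
  define J where "J = (\<chi> j i. ?c j (\<lambda>z. A z (\<xi> i)))"
  define \<kappa> where "\<kappa> = (\<chi> b b'. gR M y (lie_bracket A (?E b) y) (?E b' y))"
  \<comment> \<open>Applying \<open>lie_bracket A (?E b)\<close> to the coordinates gives the
    derivative of \<open>P\<close> along \<open>A\<close> as \<open>\<kappa> ** P + P ** J\<close>;
    because \<open>Q ** P = mat 1\<close> it equals \<open>m ** P\<close>.\<close>
  define m where "m = \<kappa> + P ** J ** Q"
  note v = vfields_tangent[OF A, of y]
  have A\<xi>: "(\<lambda>z. A z (\<xi> i)) \<in> C_infinity M" for i by (rule vfields_smooth[OF A \<xi>(1)])
  have exp: "w g = (\<Sum>i\<in>UNIV. w (\<xi> i) * ?c i g)" if "w \<in> tangent_space M y" "g \<in> C_infinity M" for w g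
    by (rule tangent_coord_expansion[where \<xi> = \<xi>, OF c y \<xi> that])
  have m: "A y (Pf b i) = (\<Sum>b'\<in>UNIV. m $ b $ b' * Pf b' i y)" for b i
  proof -
    have "lie_bracket A (?E b) y = (\<Sum>j\<in>frame_index. gR M y (lie_bracket A (?E b) y) (frame_field Y j y) *\<^sub>R frame_field Y j y)"
      by (rule tangent_expand[OF F vfields_tangent[OF vfields_lie_bracket[OF A E]]])
    also have "\<dots> = (\<Sum>b'\<in>UNIV. \<kappa> $ b $ b' *\<^sub>R ?E b' y)"
      unfolding frame_sum_reindex[OF \<beta>] by (simp add: \<kappa>_def)
    finally have "lie_bracket A (?E b) y (\<xi> i) = (\<kappa> ** P) $ b $ i"
      by (simp add: sum_fun_apply matrix_matrix_mult_def P_def Pf_def)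
    moreover have "lie_bracket A (?E b) y (\<xi> i) = A y (Pf b i) - ?E b y (\<lambda>z. A z (\<xi> i))"
      by (simp add: lie_bracket_def Pf_def)
    moreover have "?E b y (\<lambda>z. A z (\<xi> i)) = (P ** J) $ b $ i"
      using exp[OF vfields_tangent[OF E] A\<xi>] by (simp add: matrix_matrix_mult_def P_def Pf_def J_def)
    ultimately have "A y (Pf b i) = (\<kappa> ** P + P ** J ** (Q ** P)) $ b $ i"
      by (simp add: QP)
    also have "\<kappa> ** P + P ** J ** (Q ** P) = m ** P"
      unfolding m_def by (simp add: matrix_mult_add_distrib matrix_mul_assoc)
    finally show ?thesis by (simp add: matrix_matrix_mult_def P_def)
  qed
  have trm: "trace m = trace \<kappa> + trace J"
  proof -
    have "trace (P ** J ** Q) = trace (Q ** (P ** J))" by (rule trace_mul_sym)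
    also have "\<dots> = trace J" by (simp add: matrix_mul_assoc QP)
    finally show ?thesis by (simp add: m_def trace_def sum.distrib)
  qed
  let ?D = "\<lambda>z. det (\<chi> b i. Pf b i z)"
  note D = tangent_det[where P = Pf, OF v Pf m]
  have qD: "\<forall>\<^sub>F z in nhds y. q z * ?D z = 1" using qP by (simp add: Pf_def)
  have "A y (\<lambda>z. q z * ?D z) = A y (\<lambda>z. 1)"
    by (rule tangent_germ[OF v C_inf_mult[OF q D(1)] C_inf_const qD])
  then have "q y * (trace m * ?D y) + ?D y * A y q = 0"
    using tangent_mult[OF v q D(1)] tangent_const[OF v] D(2) by simp
  then have "(q y * ?D y) * (q y * trace m + A y q) = 0 * q y"
    by (simp add: algebra_simps)
  \<comment> \<open>This is the equation \<open>q * det P = 1\<close> differentiated along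
    \<open>A\<close>. The summand \<open>trace J\<close> of \<open>trace m\<close> will cancel the
    coordinate divergence of \<open>A\<close>, leaving the coordinate-free
    \<open>trace \<kappa>\<close>.\<close>
  then have vq: "A y q = - (q y * trace m)"
    using eventually_nhds_x_imp_x[OF qD] by simp
  have qf: "(\<lambda>z. q z * f z) \<in> C_infinity M" using q f by simp
  have "(\<Sum>i\<in>UNIV. ?c i (\<lambda>z. q z * f z * A z (\<xi> i))) =
    (\<Sum>i\<in>UNIV. q y * f y * ?c i (\<lambda>z. A z (\<xi> i)) + A y (\<xi> i) * ?c i (\<lambda>z. q z * f z))"
    by (rule sum.cong[OF refl]) (rule tangent_mult[OF coord_vec_tangent[OF c y] qf A\<xi>])
  also have "\<dots> = q y * f y * trace J + A y (\<lambda>z. q z * f z)"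
    unfolding exp[OF v qf] by (simp add: sum.distrib trace_def J_def sum_distrib_left)
  also have "\<dots> = q y * (A y f - f y * trace \<kappa>)"
    using tangent_mult[OF v q f] by (simp add: vq trm algebra_simps)
  finally show ?thesis
    unfolding frame_sum_reindex[OF \<beta>] by (simp add: trace_def \<kappa>_def)
qed

text \<open>The Gram matrix is \<open>Q ** transpose Q\<close> with \<open>Q\<close> inverse to the
  frame matrix \<open>P\<close>, so the density is the absolute value of \<open>1 / det P\<close>.
  On a small neighbourhood the sign of \<open>det P\<close> is the constant \<open>s\<close>, hence
  the density is smooth there and extends to a global smooth function.\<close>

lemma ex_adapted_chart:
  assumes F: "hframe Y N" "x \<in> N"
  obtains U \<phi> \<xi> W \<beta> q \<sigma> s where "(U, \<phi>) \<in> charts M" "open W" "x \<in> W" "W \<subseteq> N" "W \<subseteq> U"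
    "\<And>i. \<xi> i \<in> C_infinity M" "\<And>z i. z \<in> W \<Longrightarrow> \<xi> i z = \<phi> z $ i"
    "bij_betw \<beta> (UNIV::'n set) frame_index" "q \<in> C_infinity M"
    "\<And>z. z \<in> W \<Longrightarrow> q z * det (\<chi> b i. frame_field Y (\<beta> b) z (\<xi> i)) = 1"
    "\<And>z. z \<in> W \<Longrightarrow> \<sigma> z = sqrt (det (gram_matrix M U \<phi> z))"
    "\<sigma> \<in> C_infinity M" "\<And>z. z \<in> W \<Longrightarrow> \<sigma> z > 0" "\<And>z. \<sigma> z = s * q z"
proof -
  obtain U \<phi> where c: "(U, \<phi>) \<in> charts M" and x: "x \<in> U" by (rule ex_chart)
  have NU: "open (N \<inter> U)" "x \<in> N \<inter> U" using hframeD(1)[OF F(1)] chart_open(1)[OF c] F(2) x by auto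
  obtain \<xi> W where W: "open W" "x \<in> W" "W \<subseteq> N \<inter> U" and \<xi>: "\<And>i. \<xi> i \<in> C_infinity M"
    "\<And>z i. z \<in> W \<Longrightarrow> \<xi> i z = \<phi> z $ i"
    using ex_coordinates[OF c NU Int_lower2] by metis
  obtain \<beta> :: "'n \<Rightarrow> nat + 'a vfield" where \<beta>: "bij_betw \<beta> UNIV frame_index" by (rule ex_frame_enumeration)
  let ?E = "\<lambda>b. frame_field Y (\<beta> b)"
  define P where "P = (\<lambda>y. \<chi> b i. ?E b y (\<xi> i))"
  define Q where "Q = (\<lambda>y. \<chi> i b. gR M y (coord_vec M U \<phi> i y) (?E b y))"
  have \<beta>I: "\<beta> b \<in> frame_index" for b using \<beta> by (metis UNIV_I bij_betwE)
  have E: "?E b \<in> vfields M" for b by (rule frame_field_vfields[OF F(1) \<beta>I])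
  have near: "\<forall>\<^sub>F z in nhds y. \<xi> i z = \<phi> z $ i" if "y \<in> W" for y i
    using W(1) \<xi>(2) that unfolding eventually_nhds by blast
  have QP: "Q y ** P y = mat 1" if y: "y \<in> W" for y
  proof -
    have "y \<in> U" "y \<in> N" using y W by auto
    from frame_matrix[where \<xi> = \<xi>, OF c this(1) \<xi>(1) near[OF y] F(1) this(2) \<beta>]
    show ?thesis unfolding P_def Q_def .
  qed
  have detQP: "det (Q y) * det (P y) = 1" if y: "y \<in> W" for y
    using arg_cong[OF QP[OF y], of det] by (simp add: det_mul)
  have gram: "det (gram_matrix M U \<phi> y) = (det (Q y))\<^sup>2" if y: "y \<in> W" for y
  proof -
    have yN: "y \<in> N" and yU: "y \<in> U" using y W by auto
    have "gram_matrix M U \<phi> y $ i $ j = (Q y ** transpose (Q y)) $ i $ j" for i j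
    proof -
      let ?ci = "coord_vec M U \<phi> i y" and ?cj = "coord_vec M U \<phi> j y"
      note t = coord_vec_tangent[OF c yU]
      have "gR M y ?ci ?cj = gR M y (\<Sum>k\<in>frame_index. gR M y ?ci (frame_field Y k y) *\<^sub>R frame_field Y k y) ?cj"
        using tangent_expand[OF F(1) yN t[of i]] by simp
      also have "\<dots> = (\<Sum>k\<in>frame_index. gR M y ?ci (frame_field Y k y) * gR M y (frame_field Y k y) ?cj)"
        by (rule inner_product_on_sum[OF gR_inner_product subspace_tangent frame_tangent[OF F(1)] t])
      also have "\<dots> = (\<Sum>k\<in>frame_index. gR M y ?ci (frame_field Y k y) * gR M y ?cj (frame_field Y k y))"
        by (rule sum.cong[OF refl]) (simp only: inner_product_on_sym[OF gR_inner_product frame_tangent[OF F(1)] t])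
      finally show ?thesis
        unfolding frame_sum_reindex[OF \<beta>]
        by (simp add: gram_matrix_def Q_def matrix_matrix_mult_def transpose_def)
    qed
    then have "gram_matrix M U \<phi> y = Q y ** transpose (Q y)" by (simp add: vec_eq_iff)
    then show ?thesis by (simp add: det_mul power2_eq_square)
  qed
  let ?D = "\<lambda>y. det (P y)"
  have Dsm: "smooth_near M ?D y" for y
    by (rule smooth_near_det) (simp add: P_def smooth_near_C_infinity[OF vfields_smooth[OF E \<xi>(1)]])
  have Dx: "?D x \<noteq> 0" using detQP[OF W(2)] by auto
  obtain q where q: "q \<in> C_infinity M" "\<forall>\<^sub>F z in nhds x. inverse (?D z) = q z"
    using smooth_near_inverse[OF Dsm Dx] unfolding smooth_near_def by blast
  then obtain N1 where N1: "open N1" "x \<in> N1" "\<And>z. z \<in> N1 \<Longrightarrow> inverse (?D z) = q z"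
    unfolding eventually_nhds by blast
  define s where "s = sgn (q x)"
  have qx: "q x \<noteq> 0" using N1(2,3) Dx by (metis inverse_nonzero_iff_nonzero)
  define \<sigma> where "\<sigma> = (\<lambda>z. s * q z)"
  have \<sigma>C: "\<sigma> \<in> C_infinity M" unfolding \<sigma>_def using q(1) by simp
  define W' where "W' = W \<inter> N1 \<inter> {z. \<sigma> z > 0}"
  have "open {z. \<sigma> z > 0}"
    using open_vimage[OF open_greaterThan[of "0::real"] C_infinity_continuous[OF \<sigma>C]] by (simp add: vimage_def)
  then have W': "open W'" unfolding W'_def using W N1 by auto
  have "\<sigma> x > 0" using qx by (auto simp: \<sigma>_def s_def sgn_real_def)
  then have xW': "x \<in> W'" unfolding W'_def using W N1 by auto
  have qD: "q z * ?D z = 1" if "z \<in> W'" for z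
    using N1(3)[of z] detQP[of z] that unfolding W'_def by (metis IntD1 IntD2 left_inverse mult_zero_right zero_neq_one)
  have "\<sigma> z = sqrt (det (gram_matrix M U \<phi> z))" if z: "z \<in> W'" for z
  proof -
    have zW: "z \<in> W" using z W'_def by auto
    have "q z * (?D z * det (Q z)) = det (Q z)" using qD[OF z] by (simp add: mult.assoc[symmetric])
    moreover have "?D z * det (Q z) = 1" using detQP[OF zW] by (simp add: mult.commute)
    ultimately have "q z = det (Q z)" by simp
    then have "sqrt (det (gram_matrix M U \<phi> z)) = \<bar>q z\<bar>" using gram[OF zW] by simp
    moreover have "\<sigma> z > 0" using z W'_def by auto
    moreover have "\<bar>s\<bar> = 1" using qx by (simp add: s_def abs_sgn_eq)
    then have "\<bar>\<sigma> z\<bar> = \<bar>q z\<bar>" by (simp add: \<sigma>_def abs_mult)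
    ultimately show ?thesis by simp
  qed
  note sq = this
  have "W' \<subseteq> N" "W' \<subseteq> U" using W unfolding W'_def by auto
  then show ?thesis
  proof (rule that[where s = s and \<beta> = \<beta> and \<xi> = \<xi> and \<sigma> = \<sigma> and q = q, OF c W' xW' _ _ \<xi>(1) _ \<beta> q(1) _ _ \<sigma>C])
    show "\<sigma> z = s * q z" for z by (simp add: \<sigma>_def)
    fix z assume z: "z \<in> W'"
    then show "\<xi> i z = \<phi> z $ i" for i using \<xi>(2) by (simp add: W'_def)
    show "q z * det (\<chi> b i. frame_field Y (\<beta> b) z (\<xi> i)) = 1" using qD[OF z] by (simp add: P_def)
    show "\<sigma> z = sqrt (det (gram_matrix M U \<phi> z))" by (rule sq[OF z])
    show "\<sigma> z > 0" using z by (simp add: W'_def)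
  qed
qed

end

section \<open>Identification of the sub-Laplacian in a frame\<close>

locale sr_laplacian = sr_manifold M d X0
  for M :: "('a::{t2_space, second_countable_topology}, 'n::finite) sr_structure" and d X0 +
  fixes \<mu> :: "'a measure" and L :: "('a \<Rightarrow> real) \<Rightarrow> 'a \<Rightarrow> real"
  assumes riemannian_measure: "riemannian_measure M \<mu>"
    and sub_laplacian: "sub_laplacian M \<mu> L"
begin

text \<open>Three facts about the measure near \<open>x\<close>: compactly supported continuous
  functions are integrable, the support of the measure contains \<open>x\<close>, and the divergence
  theorem holds, with minus the sum of the diagonal bracket coefficients as divergence. The set
  \<open>W\<close> is chosen before the fields and functions, as the later test function depends on
  both.\<close>

lemma ex_ibp_domain:
  assumes F: "hframe Y N" "x \<in> N"
  obtains W where "open W" "x \<in> W" "W \<subseteq> N"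
    "\<And>u K. continuous_on UNIV u \<Longrightarrow> compact K \<Longrightarrow> K \<subseteq> W \<Longrightarrow> (\<And>y. y \<notin> K \<Longrightarrow> u y = 0) \<Longrightarrow>
      integrable \<mu> (u :: 'a \<Rightarrow> real)"
    "\<And>u K. continuous_on UNIV u \<Longrightarrow> compact K \<Longrightarrow> K \<subseteq> W \<Longrightarrow> (\<And>y. y \<notin> K \<Longrightarrow> u y = 0) \<Longrightarrow>
      (\<And>y. 0 \<le> u y) \<Longrightarrow> (LINT y|\<mu>. u y) = (0::real) \<Longrightarrow> u x = 0"
    "\<And>A c f K. A \<in> vfields M \<Longrightarrow> c \<in> C_infinity M \<Longrightarrow>
      (\<And>y. y \<in> W \<Longrightarrow> c y = - (\<Sum>j\<in>frame_index. gR M y (lie_bracket A (frame_field Y j) y) (frame_field Y j y))) \<Longrightarrow>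
      f \<in> C_infinity M \<Longrightarrow> compact K \<Longrightarrow> K \<subseteq> W \<Longrightarrow> (\<And>y. y \<notin> K \<Longrightarrow> f y = 0) \<Longrightarrow>
      (LINT y|\<mu>. A y f + f y * c y) = 0"
proof -
  show ?thesis
  proof (rule ex_adapted_chart[OF F])
    fix U \<phi> \<xi> W \<beta> q \<sigma> s
    assume c: "(U, \<phi>) \<in> charts M" and W: "open W" "x \<in> W" "W \<subseteq> N" "W \<subseteq> U"
      and \<xi>: "\<And>i. \<xi> i \<in> C_infinity M" "\<And>z i. z \<in> W \<Longrightarrow> \<xi> i z = \<phi> z $ i"
      and \<beta>: "bij_betw \<beta> (UNIV::'n set) frame_index" and q: "q \<in> C_infinity M"
      "\<And>z. z \<in> W \<Longrightarrow> q z * det (\<chi> b i. frame_field Y (\<beta> b) z (\<xi> i)) = 1"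
      and \<sigma>: "\<And>z. z \<in> W \<Longrightarrow> \<sigma> z = sqrt (det (gram_matrix M U \<phi> z))"
      "\<sigma> \<in> C_infinity M" "\<And>z. z \<in> W \<Longrightarrow> \<sigma> z > 0" "\<And>z. \<sigma> z = s * q z"
    have \<sigma>c: "continuous_on W \<sigma>" by (rule continuous_on_subset[OF C_infinity_continuous[OF \<sigma>(2)] subset_UNIV])
    have \<sigma>0: "0 \<le> \<sigma> z" if "z \<in> W" for z using \<sigma>(3)[OF that] by simp
    have chart_measure':
      "integrable \<mu> u \<longleftrightarrow> integrable lborel (\<lambda>z. indicator (\<phi> ` W) z * (\<sigma> (inv_into U \<phi> z) * u (inv_into U \<phi> z)))"
      "(LINT y|\<mu>. u y) = (LINT z|lborel. indicator (\<phi> ` W) z * (\<sigma> (inv_into U \<phi> z) * u (inv_into U \<phi> z)))"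
      if "continuous_on UNIV u" "\<And>y. y \<notin> W \<Longrightarrow> u y = 0" for u :: "'a \<Rightarrow> real"
      by (rule chart_measure[OF riemannian_measure c W(1,4) \<sigma>c _ _ that(1)]; (erule \<sigma>(1) \<sigma>0 that(2)))+
    have inv: "inv_into U \<phi> (\<phi> y) = y" if "y \<in> W" for y using chart_inv[OF c] that W(4) by auto
    have oV: "open (\<phi> ` W)" by (rule chart_open_image[OF c W(1,4)])
    show ?thesis
    proof (rule that[OF W(1-3)])
      fix u :: "'a \<Rightarrow> real" and K
      assume u: "continuous_on UNIV u" "compact K" "K \<subseteq> W" "\<And>y. y \<notin> K \<Longrightarrow> u y = 0"
      show int: "integrable \<mu> u"
        by (rule integrable_chart[OF riemannian_measure c W(1,4) \<sigma>c _ _ u(1) _ u(2,3)]) (erule \<sigma>(1) \<sigma>0 u(4))+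
      assume nn: "\<And>y. 0 \<le> u y" and int0: "(LINT y|\<mu>. u y) = 0"
      have u0: "u y = 0" if "y \<notin> W" for y using that u by auto
      define G where "G = (\<lambda>z. indicator (\<phi> ` W) z * (\<sigma> (inv_into U \<phi> z) * u (inv_into U \<phi> z)))"
      have iG: "integrable lborel G" using int chart_measure'(1)[OF u(1) u0] unfolding G_def by simp
      have G0: "0 \<le> G z" for z
        unfolding G_def using inv \<sigma>0 nn by (cases "z \<in> \<phi> ` W") auto
      have "(LINT z|lborel. G z) = 0" using int0 chart_measure'(2)[OF u(1) u0] unfolding G_def by simp
      then have ae: "AE z in lborel. G z = 0"
        using integral_nonneg_eq_0_iff_AE[OF iG] G0 by simp
      \<comment> \<open>An open set on which the transported integrand is positive. It is Lebesgue
        null once the integral is 0, and a null open set is empty.\<close>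
      define S where "S = \<phi> ` W \<inter> (\<lambda>z. u (inv_into U \<phi> z)) -` {0<..}"
      have "continuous_on (\<phi> ` W) (\<lambda>z. u (inv_into U \<phi> z))"
        by (rule continuous_on_compose2[OF u(1) continuous_on_subset[OF chart_cont_inv[OF c]]]) (use W in auto)
      then have oS: "open S"
        unfolding S_def using continuous_on_open_vimage[OF oV] open_greaterThan by (metis Int_commute)
      have "AE z in lborel. z \<notin> S"
        using ae
      proof (rule AE_mp, intro AE_I2 impI notI)
        fix z assume "G z = 0" "z \<in> S"
        then obtain y where "y \<in> W" "z = \<phi> y" "u y > 0" unfolding S_def using inv by auto
        then show False using \<open>G z = 0\<close> \<sigma>(3)[of y] inv[of y] by (simp add: G_def)
      qed
      then have "S \<in> null_sets lborel" using AE_iff_null_sets[of S lborel] oS by simp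
      then have "negligible S" by (simp add: negligible_iff_null_sets null_sets_completionI)
      then have "S = {}" using open_not_negligible[OF oS] by blast
      then have "\<not> u x > 0" using W(2) inv[OF W(2)] unfolding S_def by force
      then show "u x = 0" using nn[of x] by simp
    next
      fix A cc f K
      assume A: "A \<in> vfields M" and cc: "cc \<in> C_infinity M"
        "\<And>y. y \<in> W \<Longrightarrow> cc y = - (\<Sum>j\<in>frame_index. gR M y (lie_bracket A (frame_field Y j) y) (frame_field Y j y))"
        and f: "f \<in> C_infinity M" and K: "compact K" "K \<subseteq> W" "\<And>y. y \<notin> K \<Longrightarrow> f y = 0"
      define u where "u = (\<lambda>y. A y f + f y * cc y)"
      have uC: "u \<in> C_infinity M" unfolding u_def using vfields_smooth[OF A f] f cc(1) by simp
      have u0: "u y = 0" if "y \<notin> W" for y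
      proof -
        have "y \<notin> K" using that K by auto
        then show ?thesis
          using tangent_outside_support[OF vfields_tangent[OF A] f K(1,3)] K(3) by (simp add: u_def)
      qed
      define H where "H = (\<lambda>i z. q z * f z * A z (\<xi> i))"
      have HC: "H i \<in> C_infinity M" for i
        unfolding H_def using q(1) f vfields_smooth[OF A \<xi>(1)] by simp
      \<comment> \<open>The components of the density \<open>q * f * A\<close> in the chart,
        extended by 0 to all of Euclidean space; they are smooth since \<open>f\<close> is supported
        in \<open>K\<close>.\<close>
      define G where "G = (\<lambda>i z. if z \<in> \<phi> ` W then H i (inv_into U \<phi> z) else 0)"
      have cK: "compact (\<phi> ` K)"
        by (rule compact_continuous_image[OF continuous_on_subset[OF chart_cont[OF c]] K(1)]) (use K W in auto)
      have G0: "G i z = 0" if "z \<notin> \<phi> ` K" for i z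
      proof (cases "z \<in> \<phi> ` W")
        case True
        then obtain y where y: "y \<in> W" "z = \<phi> y" by blast
        then have "y \<notin> K" using that by auto
        then show ?thesis using y inv K(3) by (simp add: G_def H_def)
      qed (simp add: G_def)
      have sH: "smooth_on (\<phi> ` W) (H i \<circ> inv_into U \<phi>)" for i
        by (rule smooth_on_mono[OF C_infinity_chart[OF HC c]]) (use W in auto)
      have sG: "smooth_on UNIV (G i)" for i
      proof (rule smooth_on_open_cover[OF _ open_UNIV])
        fix z :: "real^'n"
        show "\<exists>T. open T \<and> z \<in> T \<and> smooth_on (T \<inter> UNIV) (G i)"
        proof (cases "z \<in> \<phi> ` W")
          case True
          have "smooth_on (\<phi> ` W) (G i)"
            by (rule smooth_on_cong[OF oV _ sH[of i]]) (simp add: G_def)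
          then show ?thesis using True oV by (intro exI[where x = "\<phi> ` W"]) simp
        next
          case False
          then have z: "z \<in> - (\<phi> ` K)" using K by auto
          have o: "open (- (\<phi> ` K))" using compact_imp_closed[OF cK] by blast
          have "smooth_on (- (\<phi> ` K)) (G i)"
            by (rule smooth_on_cong[OF o _ smooth_on_const[of _ 0]]) (simp add: G0)
          then show ?thesis using z o by (intro exI[where x = "- (\<phi> ` K)"]) simp
        qed
      qed
      \<comment> \<open>The integrand is, up to the constant sign \<open>s\<close>, the coordinate
        divergence of \<open>G\<close>, by \<open>divergence_identity\<close> on the chart image and
        trivially elsewhere.\<close>
      have pt: "indicator (\<phi> ` W) z * (\<sigma> (inv_into U \<phi> z) * u (inv_into U \<phi> z)) =
        s * (\<Sum>i\<in>UNIV. frechet_derivative (G i) (at z) (axis i 1))" for z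
      proof (cases "z \<in> \<phi> ` W")
        case True
        then obtain y where y: "y \<in> W" "z = \<phi> y" by blast
        have yU: "y \<in> U" and yN: "y \<in> N" using y W by auto
        have evW: "\<forall>\<^sub>F z in nhds y. z \<in> W" using y W(1) eventually_nhds by blast
        have near: "\<forall>\<^sub>F z in nhds y. \<xi> i z = \<phi> z $ i" for i
          by (rule eventually_mono[OF evW]) (rule \<xi>(2))
        have qP: "\<forall>\<^sub>F z in nhds y. q z * det (\<chi> b i. frame_field Y (\<beta> b) z (\<xi> i)) = 1"
          by (rule eventually_mono[OF evW]) (rule q(2))
        have "frechet_derivative (G i) (at z) (axis i 1) = coord_vec M U \<phi> i y (H i)" for i
        proof -
          have "frechet_derivative (G i) (at z) = frechet_derivative (H i \<circ> inv_into U \<phi>) (at z)"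
            by (rule frechet_derivative_cong_open[OF smooth_on_imp_differentiable[OF sH True] oV True])
              (simp add: G_def)
          then show ?thesis using HC y by (simp add: coord_vec_def)
        qed
        then have "(\<Sum>i\<in>UNIV. frechet_derivative (G i) (at z) (axis i 1)) = q y * u y"
          using divergence_identity[where \<xi> = \<xi>, OF c yU \<xi>(1) near F(1) yN \<beta> A f q(1) qP] cc(2)[OF y(1)]
          by (simp add: H_def u_def)
        then show ?thesis using y inv[OF y(1)] \<sigma>(4) by (simp add: mult.assoc)
      next
        case False
        then have "z \<notin> \<phi> ` K" using K by auto
        then show ?thesis
          using frechet_derivative_outside_support[OF compact_imp_closed[OF cK] G0] False by simp
      qed
      note int = integral_frechet_derivative_compact_support[OF sG cK G0]
      have "(LINT y|\<mu>. u y) = (LINT z|lborel. indicator (\<phi> ` W) z * (\<sigma> (inv_into U \<phi> z) * u (inv_into U \<phi> z)))"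
        by (rule chart_measure'(2)[OF C_infinity_continuous[OF uC]]) (rule u0)
      also have "\<dots> = (LINT z|lborel. s * (\<Sum>i\<in>UNIV. frechet_derivative (G i) (at z) (axis i 1)))"
        by (simp only: pt)
      also have "\<dots> = s * (\<Sum>i\<in>UNIV. (LINT z|lborel. frechet_derivative (G i) (at z) (axis i 1)))"
        using int(1) by simp
      also have "\<dots> = 0" using int(2) by simp
      finally show "(LINT y|\<mu>. A y f + f y * cc y) = 0" by (simp add: u_def)
    qed
  qed
qed

lemma L_smooth: "f \<in> C_infinity M \<Longrightarrow> L f \<in> C_infinity M"
  using sub_laplacian unfolding sub_laplacian_def by blast

lemma L_add: "f \<in> C_infinity M \<Longrightarrow> g \<in> C_infinity M \<Longrightarrow> L (\<lambda>x. f x + g x) = (\<lambda>x. L f x + L g x)"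
  using sub_laplacian unfolding sub_laplacian_def plus_fun_def by simp

lemma L_cmult: "f \<in> C_infinity M \<Longrightarrow> L (\<lambda>x. c * f x) = (\<lambda>x. c * L f x)"
  using sub_laplacian unfolding sub_laplacian_def scaleR_fun_def by simp

lemma L_const: "L (\<lambda>x. c) = (\<lambda>x. 0)"
proof -
  have "L (\<lambda>x. 1) = (\<lambda>x. 0)"
    using sub_laplacian unfolding sub_laplacian_def one_fun_def zero_fun_def by simp
  then show ?thesis using L_cmult[OF C_inf_const, of c 1] by simp
qed

lemma L_diff: "f \<in> C_infinity M \<Longrightarrow> g \<in> C_infinity M \<Longrightarrow> L (\<lambda>x. f x - g x) = (\<lambda>x. L f x - L g x)"
  using L_add[of f "\<lambda>x. -1 * g x"] L_cmult[of g "-1"] by simp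

lemma L_sum: "finite I \<Longrightarrow> (\<And>i. i \<in> I \<Longrightarrow> f i \<in> C_infinity M) \<Longrightarrow>
    L (\<lambda>x. \<Sum>i\<in>I. f i x) = (\<lambda>x. \<Sum>i\<in>I. L (f i) x)"
proof (induction I rule: finite_induct)
  case empty
  show ?case by (simp add: L_const)
next
  case (insert i I)
  then show ?case using L_add[of "f i" "\<lambda>x. \<Sum>i\<in>I. f i x"] by (simp add: C_inf_sum)
qed

lemma L_mult:
  assumes "f \<in> C_infinity M" "g \<in> C_infinity M"
  shows "L (\<lambda>x. f x * g x) x = f x * L g x + g x * L f x + 2 * GammaH M f g x"
proof -
  have "(L (f * g) x - f x * L g x - g x * L f x) / 2 = GammaH M f g x"
    using sub_laplacian assms unfolding sub_laplacian_def by blast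
  then show ?thesis unfolding times_fun_def by (simp add: field_simps)
qed

lemma L_symmetric:
  assumes f: "f \<in> C_infinity M" "compact K" "\<And>y. y \<notin> K \<Longrightarrow> f y = 0"
    and g: "g \<in> C_infinity M" "compact K'" "\<And>y. y \<notin> K' \<Longrightarrow> g y = 0"
  shows "(LINT x|\<mu>. f x * L g x) = (LINT x|\<mu>. g x * L f x)"
proof -
  have cl: "compact (closure {x. h x \<noteq> 0})" if "compact K" "\<And>y. y \<notin> K \<Longrightarrow> h y = 0"
    for K and h :: "'a \<Rightarrow> real"
  proof -
    have "{x. h x \<noteq> 0} \<subseteq> K" using that(2) by blast
    then have "closure {x. h x \<noteq> 0} \<subseteq> K" by (rule closure_minimal[OF _ compact_imp_closed[OF that(1)]])
    then show ?thesis using that(1) closed_closure by (metis closed_Int_compact inf.absorb1)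
  qed
  have "compact (closure {x. f x \<noteq> 0})" by (rule cl[OF f(2)]) (rule f(3))
  moreover have "compact (closure {x. g x \<noteq> 0})" by (rule cl[OF g(2)]) (rule g(3))
  ultimately show ?thesis
    using sub_laplacian f(1) g(1) unfolding sub_laplacian_def by blast
qed

lemma GammaH_eq_zero: "f \<in> C_infinity M \<Longrightarrow> g \<in> C_infinity M \<Longrightarrow> \<forall>\<^sub>F z in nhds y. g z = 0 \<Longrightarrow> GammaH M f g y = 0"
  using GammaH_eq tangent_eq_zero_germ[OF hor_tangent[OF grad_hor_in_hor]] by simp

text \<open>Locality of \<open>L\<close>. A cutoff supported where \<open>w\<close> vanishes gives
  the zero product; in its product rule at \<open>x\<close> the terms with \<open>w x\<close> and
  with the carre du champ vanish, leaving \<open>L w x\<close>.\<close>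

lemma L_eq_zero:
  assumes w: "w \<in> C_infinity M" and e: "\<forall>\<^sub>F z in nhds x. w z = 0"
  shows "L w x = 0"
proof -
  obtain N where N: "open N" "x \<in> N" "\<And>y. y \<in> N \<Longrightarrow> w y = 0" using e unfolding eventually_nhds by blast
  obtain \<eta> V K where \<eta>: "\<eta> \<in> C_infinity M" "open V" "x \<in> V" "V \<subseteq> K" "K \<subseteq> N" "compact K"
    "\<And>y. y \<in> V \<Longrightarrow> \<eta> y = 1" "\<And>y. y \<notin> K \<Longrightarrow> \<eta> y = 0" "\<And>y. \<eta> y \<ge> 0"
    using ex_plateau[OF N(1,2)] by metis
  have "(\<lambda>y. \<eta> y * w y) = (\<lambda>y. 0)"
    using \<eta> N by (metis mult_zero_left mult_zero_right subsetD)
  then have "L (\<lambda>y. \<eta> y * w y) x = 0" using L_const by simp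
  moreover have "GammaH M \<eta> w x = 0" by (rule GammaH_eq_zero[OF \<eta>(1) w e])
  ultimately show ?thesis using L_mult[OF \<eta>(1) w, of x] \<eta>(3,7) N by simp
qed

lemma L_germ:
  assumes "f \<in> C_infinity M" "g \<in> C_infinity M" "\<forall>\<^sub>F z in nhds x. f z = g z"
  shows "L f x = L g x"
proof -
  have "L (\<lambda>x. f x - g x) x = 0"
    by (rule L_eq_zero) (use assms in \<open>auto elim: eventually_mono\<close>)
  then show ?thesis by (simp add: L_diff[OF assms(1,2)])
qed

text \<open>The left side is the integrand of the divergence theorem for \<open>Y i\<close> and the
  function \<open>h * Y i f\<close>, summed over the frame, with \<open>c i\<close> as the
  divergence of \<open>Y i\<close>.\<close>

lemma sum_frame_ibp:
  assumes F: "hframe Y N" and f: "f \<in> C_infinity M" and h: "h \<in> C_infinity M"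
    and y: "y \<in> N"
  shows "(\<Sum>i=1..d. Y i y (\<lambda>z. h z * Y i z f) + h y * Y i y f * c i y) =
    h y * (\<Sum>i=1..d. Y i y (\<lambda>z. Y i z f) + c i y * Y i y f) + GammaH M f h y"
proof -
  have "(\<Sum>i=1..d. Y i y (\<lambda>z. h z * Y i z f) + h y * Y i y f * c i y) =
    (\<Sum>i=1..d. h y * (Y i y (\<lambda>z. Y i z f) + c i y * Y i y f) + Y i y f * Y i y h)"
  proof (rule sum.cong[OF refl])
    fix i assume i: "i \<in> {1..d}"
    note A = hframeD(3)[OF F i]
    show "Y i y (\<lambda>z. h z * Y i z f) + h y * Y i y f * c i y =
      h y * (Y i y (\<lambda>z. Y i z f) + c i y * Y i y f) + Y i y f * Y i y h"
      using tangent_mult[OF vfields_tangent[OF A] h vfields_smooth[OF A f]] by (simp add: algebra_simps)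
  qed
  then show ?thesis
    by (simp add: GammaH_frame[OF F y f h] sum.distrib sum_distrib_left distrib_left)
qed

text \<open>The difference \<open>e\<close> of the two sides is tested against \<open>\<eta> e\<close> for a cutoff function \<open>\<eta>\<close>.\<close>

lemma laplacian_frame:
  assumes F: "hframe Y N" "x \<in> N" and f: "f \<in> C_infinity M"
    and c: "\<And>i. i \<in> {1..d} \<Longrightarrow> c i \<in> C_infinity M"
    "\<And>i y. i \<in> {1..d} \<Longrightarrow> y \<in> N \<Longrightarrow>
      c i y = - (\<Sum>j\<in>frame_index. gR M y (lie_bracket (Y i) (frame_field Y j) y) (frame_field Y j y))"
  shows "L f x = (\<Sum>i=1..d. Y i x (\<lambda>z. Y i z f) + c i x * Y i x f)"
proof (rule ex_ibp_domain[OF F])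
  fix W assume W: "open W" "x \<in> W" "W \<subseteq> N"
    and int: "\<And>u K. continuous_on UNIV u \<Longrightarrow> compact K \<Longrightarrow> K \<subseteq> W \<Longrightarrow> (\<And>y. y \<notin> K \<Longrightarrow> u y = 0) \<Longrightarrow>
      integrable \<mu> (u :: 'a \<Rightarrow> real)"
    and pos: "\<And>u K. continuous_on UNIV u \<Longrightarrow> compact K \<Longrightarrow> K \<subseteq> W \<Longrightarrow> (\<And>y. y \<notin> K \<Longrightarrow> u y = 0) \<Longrightarrow>
      (\<And>y. 0 \<le> u y) \<Longrightarrow> (LINT y|\<mu>. u y) = (0::real) \<Longrightarrow> u x = 0"
    and ibp: "\<And>A c f K. A \<in> vfields M \<Longrightarrow> c \<in> C_infinity M \<Longrightarrow>
      (\<And>y. y \<in> W \<Longrightarrow> c y = - (\<Sum>j\<in>frame_index. gR M y (lie_bracket A (frame_field Y j) y) (frame_field Y j y))) \<Longrightarrow>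
      f \<in> C_infinity M \<Longrightarrow> compact K \<Longrightarrow> K \<subseteq> W \<Longrightarrow> (\<And>y. y \<notin> K \<Longrightarrow> f y = 0) \<Longrightarrow>
      (LINT y|\<mu>. A y f + f y * c y) = 0"
  \<comment> \<open>Two nested cutoffs: \<open>\<eta>2\<close> equals 1 on a neighbourhood of the
    support of \<eta>, and so replaces the constant 1, which need not have compact support.\<close>
  obtain \<eta>2 V2 K2 where \<eta>2: "\<eta>2 \<in> C_infinity M" "open V2" "x \<in> V2" "V2 \<subseteq> K2" "K2 \<subseteq> W" "compact K2"
    "\<And>y. y \<in> V2 \<Longrightarrow> \<eta>2 y = 1" "\<And>y. y \<notin> K2 \<Longrightarrow> \<eta>2 y = 0" "\<And>y. \<eta>2 y \<ge> 0"
    using ex_plateau[OF W(1,2)] by metis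
  obtain \<eta> V K where \<eta>: "\<eta> \<in> C_infinity M" "open V" "x \<in> V" "V \<subseteq> K" "K \<subseteq> V2" "compact K"
    "\<And>y. y \<in> V \<Longrightarrow> \<eta> y = 1" "\<And>y. y \<notin> K \<Longrightarrow> \<eta> y = 0" "\<And>y. \<eta> y \<ge> 0"
    using ex_plateau[OF \<eta>2(2,3)] by metis
  have KW: "K \<subseteq> W" using \<eta>(5) \<eta>2(4,5) by blast
  have Yv: "Y i \<in> vfields M" if "i \<in> {1..d}" for i by (rule hframeD(3)[OF F(1) that])
  define L' where "L' = (\<lambda>f y. \<Sum>i=1..d. Y i y (\<lambda>z. Y i z f) + c i y * Y i y f)"
  have L'C: "L' g \<in> C_infinity M" if "g \<in> C_infinity M" for g
    unfolding L'_def
    by (rule C_inf_sum, rule C_inf_add[OF vfields_smooth[OF Yv vfields_smooth[OF Yv that]] C_inf_mult[OF c(1) vfields_smooth[OF Yv that]]])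
  \<comment> \<open>Symmetry of \<open>L\<close> is available for compactly supported functions
    only; \<open>f'\<close> has the germ of \<open>f\<close> at \<open>x\<close>.\<close>
  define f' where "f' = (\<lambda>y. \<eta> y * f y)"
  have f': "f' \<in> C_infinity M" "\<And>y. y \<notin> K \<Longrightarrow> f' y = 0" unfolding f'_def using \<eta>(1,8) f by auto
  define e where "e = (\<lambda>y. L f' y - L' f' y)"
  have e: "e \<in> C_infinity M" unfolding e_def by (rule C_inf_diff[OF L_smooth[OF f'(1)] L'C[OF f'(1)]])
  define h where "h = (\<lambda>y. \<eta> y * e y)"
  have h: "h \<in> C_infinity M" "\<And>y. y \<notin> K \<Longrightarrow> h y = 0" unfolding h_def using \<eta>(1,8) e by auto
  have intC: "integrable \<mu> u" if "u \<in> C_infinity M" "\<And>y. y \<notin> K \<Longrightarrow> u y = 0" for u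
    by (rule int[OF C_infinity_continuous[OF that(1)] \<eta>(6) KW that(2)])
  have \<Gamma>C: "GammaH M f' h \<in> C_infinity M" by (rule GammaH_smooth[OF f'(1) h(1)])
  have \<Gamma>0: "GammaH M f' h y = 0" if "y \<notin> K" for y
    by (rule GammaH_eq_zero[OF f'(1) h(1) eventually_mono[OF eventually_not_in_compact[OF \<eta>(6) that]]]) (rule h(2))
  have hL: "(\<lambda>y. h y * L f' y) \<in> C_infinity M" "(\<lambda>y. h y * L' f' y) \<in> C_infinity M"
    "(\<lambda>y. f' y * L h y) \<in> C_infinity M"
    using h(1) f'(1) L_smooth[OF f'(1)] L_smooth[OF h(1)] L'C[OF f'(1)] by auto
  have iL: "integrable \<mu> (\<lambda>y. h y * L f' y)" "integrable \<mu> (\<lambda>y. h y * L' f' y)"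
    "integrable \<mu> (\<lambda>y. f' y * L h y)" "integrable \<mu> (GammaH M f' h)"
    using intC[OF hL(1)] intC[OF hL(2)] intC[OF hL(3)] intC[OF \<Gamma>C \<Gamma>0] h(2) f'(2) by simp_all
  have claim1: "(LINT y|\<mu>. h y * L f' y) + (LINT y|\<mu>. GammaH M f' h y) = 0"
  proof -
    define u where "u = (\<lambda>y. f' y * h y)"
    have u: "u \<in> C_infinity M" "\<And>y. y \<notin> K \<Longrightarrow> u y = 0" unfolding u_def using f' h by auto
    \<comment> \<open>Symmetry against \<open>\<eta>2\<close>, whose image under \<open>L\<close>
      vanishes on the support of \<open>u\<close>, says that \<open>L (f' * h)\<close> has integral
      0. The product rule and symmetry for the pair \<open>f'\<close>, \<open>h\<close> then give
      the claim.\<close>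
    have "(LINT y|\<mu>. \<eta>2 y * L u y) = (LINT y|\<mu>. u y * L \<eta>2 y)"
      by (rule L_symmetric[OF \<eta>2(1,6,8) u(1) \<eta>(6) u(2)])
    moreover have "u y * L \<eta>2 y = 0" for y
    proof (cases "y \<in> K")
      case True
      then have "y \<in> V2" using \<eta>(5) by blast
      then have "\<forall>\<^sub>F z in nhds y. \<eta>2 z = 1" unfolding eventually_nhds using \<eta>2(2,7) by blast
      then have "L \<eta>2 y = L (\<lambda>_. 1) y" by (rule L_germ[OF \<eta>2(1) C_inf_const])
      then show ?thesis by (simp add: L_const)
    next
      case False
      then show ?thesis using u(2) by simp
    qed
    moreover have "\<eta>2 y * L u y = f' y * L h y + h y * L f' y + 2 * GammaH M f' h y" for y
    proof -
      have "\<eta>2 y * L u y = L u y"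
      proof (cases "y \<in> V2")
        case True
        then show ?thesis using \<eta>2(7) by simp
      next
        case False
        then have "y \<notin> K" using \<eta>(5) by blast
        then have "L u y = 0"
          by (intro L_eq_zero[OF u(1) eventually_mono[OF eventually_not_in_compact[OF \<eta>(6)]]]) (auto simp: u(2))
        then show ?thesis by simp
      qed
      then show ?thesis unfolding u_def using L_mult[OF f'(1) h(1)] by simp
    qed
    ultimately have "(LINT y|\<mu>. f' y * L h y + h y * L f' y + 2 * GammaH M f' h y) = 0" by simp
    then have "(LINT y|\<mu>. f' y * L h y) + (LINT y|\<mu>. h y * L f' y) + 2 * (LINT y|\<mu>. GammaH M f' h y) = 0"
      using iL by simp
    moreover have "(LINT y|\<mu>. f' y * L h y) = (LINT y|\<mu>. h y * L f' y)"
      by (rule L_symmetric[OF f'(1) \<eta>(6) f'(2) h(1) \<eta>(6) h(2)])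
    ultimately show ?thesis by simp
  qed
  \<comment> \<open>The explicit operator satisfies the same weak equation, by the divergence
    theorem for each frame field.\<close>
  have claim2: "(LINT y|\<mu>. h y * L' f' y) + (LINT y|\<mu>. GammaH M f' h y) = 0"
  proof -
    define g where "g = (\<lambda>i y. h y * Y i y f')"
    have g: "g i \<in> C_infinity M" "\<And>y. y \<notin> K \<Longrightarrow> g i y = 0" if "i \<in> {1..d}" for i
      unfolding g_def using h f'(1) vfields_smooth[OF Yv[OF that] f'(1)] by auto
    have gC: "(\<lambda>y. Y i y (g i) + g i y * c i y) \<in> C_infinity M" if i: "i \<in> {1..d}" for i
      using vfields_smooth[OF Yv[OF i] g(1)[OF i]] g(1)[OF i] c(1)[OF i] by simp
    have g0: "Y i y (g i) + g i y * c i y = 0" if i: "i \<in> {1..d}" and y: "y \<notin> K" for i y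
      using tangent_outside_support[OF vfields_tangent[OF Yv[OF i]] g(1)[OF i] \<eta>(6) g(2)[OF i] y] g(2)[OF i y]
      by simp
    have "(LINT y|\<mu>. Y i y (g i) + g i y * c i y) = 0" if i: "i \<in> {1..d}" for i
      by (rule ibp[OF Yv[OF i] c(1)[OF i] _ g(1)[OF i] \<eta>(6) KW g(2)[OF i]]) (use c(2)[OF i] W(3) in auto)
    then have "(\<Sum>i=1..d. (LINT y|\<mu>. Y i y (g i) + g i y * c i y)) = 0" by (intro sum.neutral) blast
    moreover have "(LINT y|\<mu>. (\<Sum>i=1..d. Y i y (g i) + g i y * c i y)) =
        (\<Sum>i=1..d. (LINT y|\<mu>. Y i y (g i) + g i y * c i y))"
      by (rule Bochner_Integration.integral_sum) (rule intC[OF gC g0])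
    ultimately have "(LINT y|\<mu>. (\<Sum>i=1..d. Y i y (g i) + g i y * c i y)) = 0" by simp
    moreover have "(\<Sum>i=1..d. Y i y (g i) + g i y * c i y) = h y * L' f' y + GammaH M f' h y" for y
    proof (cases "y \<in> K")
      case True
      then have "y \<in> N" using KW W by blast
      from sum_frame_ibp[OF F(1) f'(1) h(1) this, of c] show ?thesis unfolding g_def L'_def .
    next
      case False
      then have "(\<Sum>i=1..d. Y i y (g i) + g i y * c i y) = 0" using g0 by (intro sum.neutral) blast
      then show ?thesis using h(2)[OF False] \<Gamma>0[OF False] by simp
    qed
    ultimately have "(LINT y|\<mu>. h y * L' f' y + GammaH M f' h y) = 0" by simp
    then show ?thesis using iL by simp
  qed
  \<comment> \<open>The integrand is \<eta> times the square of \<open>e\<close>, hence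
    non-negative; integral 0 forces \<open>e x = 0\<close>, as the measure charges every
    neighbourhood of \<open>x\<close>.\<close>
  have "(LINT y|\<mu>. h y * e y) = (LINT y|\<mu>. h y * L f' y) - (LINT y|\<mu>. h y * L' f' y)"
    unfolding e_def right_diff_distrib by (rule Bochner_Integration.integral_diff[OF iL(1,2)])
  then have "(LINT y|\<mu>. h y * e y) = 0" using claim1 claim2 by simp
  moreover have "h y * e y \<ge> 0" for y
    unfolding h_def using mult_nonneg_nonneg[OF \<eta>(9)[of y], of "e y * e y"] by (simp add: mult.assoc)
  moreover have "(\<lambda>y. h y * e y) \<in> C_infinity M" using h(1) e by simp
  ultimately have "h x * e x = 0"
    using pos[OF C_infinity_continuous \<eta>(6) KW, of "\<lambda>y. h y * e y"] h(2) by simp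
  then have "L f' x = L' f' x" unfolding h_def e_def using \<eta>(3,7) by simp
  moreover have ev: "\<forall>\<^sub>F z in nhds x. f' z = f z"
    unfolding f'_def eventually_nhds using \<eta>(2,3,7) by (intro exI[where x = V]) simp
  then have "L f' x = L f x" by (rule L_germ[OF f'(1) f])
  moreover have "L' f' x = L' f x"
    unfolding L'_def
  proof (rule sum.cong[OF refl])
    fix i assume i: "i \<in> {1..d}"
    note t = vfields_tangent[OF Yv[OF i]]
    have "Y i z f' = Y i z f" if "z \<in> V" for z
    proof (rule tangent_germ[OF t f'(1) f])
      show "\<forall>\<^sub>F w in nhds z. f' w = f w"
        unfolding f'_def eventually_nhds using \<eta>(2,7) that by (intro exI[where x = V]) simp
    qed
    moreover from this have "Y i x (\<lambda>z. Y i z f') = Y i x (\<lambda>z. Y i z f)"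
      by (intro tangent_germ[OF t vfields_smooth[OF Yv[OF i] f'(1)] vfields_smooth[OF Yv[OF i] f]])
        (use \<eta>(2,3) eventually_nhds in blast)
    ultimately show "Y i x (\<lambda>z. Y i z f') + c i x * Y i x f' = Y i x (\<lambda>z. Y i z f) + c i x * Y i x f"
      using \<eta>(3) by simp
  qed
  ultimately show ?thesis by (simp add: L'_def)
qed

end

section \<open>Tensors of the canonical connection\<close>

context smooth_manifold
begin

lemma lie_bracket_skew: "lie_bracket A B = - lie_bracket B A"
  by (simp add: fun_eq_iff lie_bracket_def)

lemma lie_bracket_add_left:
  assumes "A \<in> vfields M" "A' \<in> vfields M" "B \<in> vfields M"
  shows "lie_bracket (A + A') B = lie_bracket A B + lie_bracket A' B"
proof (rule ext)
  fix x
  show "lie_bracket (A + A') B x = (lie_bracket A B + lie_bracket A' B) x"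
  proof (rule tangent_ext)
    show "lie_bracket (A + A') B x \<in> tangent_space M x"
      by (rule vfields_tangent[OF vfields_lie_bracket[OF vfields_add[OF assms(1,2)] assms(3)]])
    show "(lie_bracket A B + lie_bracket A' B) x \<in> tangent_space M x"
      by (rule vfields_tangent[OF vfields_add[OF vfields_lie_bracket[OF assms(1,3)] vfields_lie_bracket[OF assms(2,3)]]])
    fix f assume f: "f \<in> C_infinity M"
    have "B x (\<lambda>y. A y f + A' y f) = B x (\<lambda>y. A y f) + B x (\<lambda>y. A' y f)"
      by (rule tangent_add[OF vfields_tangent[OF assms(3)] vfields_smooth[OF assms(1) f] vfields_smooth[OF assms(2) f]])
    then show "lie_bracket (A + A') B x f = (lie_bracket A B + lie_bracket A' B) x f"
      by (simp add: lie_bracket_def)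
  qed
qed

lemma lie_bracket_mult_left:
  assumes A: "A \<in> vfields M" and B: "B \<in> vfields M" and g: "g \<in> C_infinity M"
  shows "lie_bracket (\<lambda>y. g y *\<^sub>R A y) B x = g x *\<^sub>R lie_bracket A B x - B x g *\<^sub>R A x"
proof (rule tangent_ext)
  show "lie_bracket (\<lambda>y. g y *\<^sub>R A y) B x \<in> tangent_space M x"
    by (rule vfields_tangent[OF vfields_lie_bracket[OF vfields_mult[OF g A] B]])
  show "g x *\<^sub>R lie_bracket A B x - B x g *\<^sub>R A x \<in> tangent_space M x"
    by (intro subspace_diff[OF subspace_tangent] subspace_scale[OF subspace_tangent] vfields_tangent
        vfields_lie_bracket A B)
  fix f assume f: "f \<in> C_infinity M"
  have "B x (\<lambda>y. g y * A y f) = g x * B x (\<lambda>y. A y f) + A x f * B x g"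
    by (rule tangent_mult[OF vfields_tangent[OF B] g vfields_smooth[OF A f]])
  then show "lie_bracket (\<lambda>y. g y *\<^sub>R A y) B x f = (g x *\<^sub>R lie_bracket A B x - B x g *\<^sub>R A x) f"
    by (simp add: lie_bracket_def algebra_simps)
qed

lemma jacobi_identity:
  assumes "A \<in> vfields M" "B \<in> vfields M" "C \<in> vfields M"
  shows "lie_bracket A (lie_bracket B C) = lie_bracket (lie_bracket A B) C + lie_bracket B (lie_bracket A C)"
proof (rule ext)
  fix x
  show "lie_bracket A (lie_bracket B C) x = (lie_bracket (lie_bracket A B) C + lie_bracket B (lie_bracket A C)) x"
  proof (rule tangent_ext)
    show "lie_bracket A (lie_bracket B C) x \<in> tangent_space M x"
      by (rule vfields_tangent) (intro vfields_lie_bracket assms)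
    show "(lie_bracket (lie_bracket A B) C + lie_bracket B (lie_bracket A C)) x \<in> tangent_space M x"
      by (rule vfields_tangent) (intro vfields_add vfields_lie_bracket assms)
    fix f assume f: "f \<in> C_infinity M"
    have d: "P x (\<lambda>y. Q y (\<lambda>z. R z f) - R y (\<lambda>z. Q z f)) = P x (\<lambda>y. Q y (\<lambda>z. R z f)) - P x (\<lambda>y. R y (\<lambda>z. Q z f))"
      if "P \<in> vfields M" "Q \<in> vfields M" "R \<in> vfields M" for P Q R
      by (rule tangent_diff[OF vfields_tangent[OF that(1)]
            vfields_smooth[OF that(2) vfields_smooth[OF that(3) f]]
            vfields_smooth[OF that(3) vfields_smooth[OF that(2) f]]])
    show "lie_bracket A (lie_bracket B C) x f = (lie_bracket (lie_bracket A B) C + lie_bracket B (lie_bracket A C)) x f"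
      by (simp add: lie_bracket_def d assms)
  qed
qed

end

locale sr_connection = sr_laplacian M d X0 \<mu> L
  for M :: "('a::{t2_space, second_countable_topology}, 'n::finite) sr_structure" and d X0 \<mu> L +
  fixes D :: "'a vfield \<Rightarrow> 'a vfield \<Rightarrow> 'a vfield"
  assumes canonical: "canonical_connection M D"
begin

section \<open>Axioms of the connection and tensoriality\<close>

lemma D_affine: "affine_connection M D"
  using canonical unfolding canonical_connection_def by blast

lemma D_vfields [simp, intro]: "A \<in> vfields M \<Longrightarrow> B \<in> vfields M \<Longrightarrow> D A B \<in> vfields M"
  using D_affine unfolding affine_connection_def by blast

lemma D_add_left: "A \<in> vfields M \<Longrightarrow> A' \<in> vfields M \<Longrightarrow> B \<in> vfields M \<Longrightarrow> D (A + A') B = D A B + D A' B"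
  using D_affine unfolding affine_connection_def by blast

lemma D_add_right: "A \<in> vfields M \<Longrightarrow> B \<in> vfields M \<Longrightarrow> B' \<in> vfields M \<Longrightarrow> D A (B + B') = D A B + D A B'"
  using D_affine unfolding affine_connection_def by blast

lemma D_mult_left: "f \<in> C_infinity M \<Longrightarrow> A \<in> vfields M \<Longrightarrow> B \<in> vfields M \<Longrightarrow>
    D (\<lambda>x. f x *\<^sub>R A x) B = (\<lambda>x. f x *\<^sub>R D A B x)"
  using D_affine unfolding affine_connection_def by blast

lemma D_mult_right: "f \<in> C_infinity M \<Longrightarrow> A \<in> vfields M \<Longrightarrow> B \<in> vfields M \<Longrightarrow>
    D A (\<lambda>x. f x *\<^sub>R B x) = (\<lambda>x. A x f *\<^sub>R B x + f x *\<^sub>R D A B x)"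
  using D_affine unfolding affine_connection_def by blast

lemma D_minus_left:
  assumes "A \<in> vfields M" "B \<in> vfields M"
  shows "D (- A) B = - D A B"
proof -
  have "(\<lambda>x. -1 *\<^sub>R A x) = - A" "(\<lambda>x. -1 *\<^sub>R D A B x) = - D A B" by (simp_all add: fun_eq_iff)
  then show ?thesis using D_mult_left[OF C_inf_const assms, of "-1"] by simp
qed

lemma D_minus_right:
  assumes "A \<in> vfields M" "B \<in> vfields M"
  shows "D A (- B) = - D A B"
proof -
  have "(\<lambda>x. -1 *\<^sub>R B x) = - B" "(\<lambda>x. A x (\<lambda>_. -1) *\<^sub>R B x + -1 *\<^sub>R D A B x) = - D A B"
    using tangent_const[OF vfields_tangent[OF assms(1)]] by (simp_all add: fun_eq_iff)
  then show ?thesis using D_mult_right[OF C_inf_const assms, of "-1"] by (simp only:)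
qed

lemma D_diff_left: "A \<in> vfields M \<Longrightarrow> A' \<in> vfields M \<Longrightarrow> B \<in> vfields M \<Longrightarrow> D (A - A') B = D A B - D A' B"
  using D_add_left[of A "- A'" B] D_minus_left[of A' B] by simp

lemma D_diff_right: "A \<in> vfields M \<Longrightarrow> B \<in> vfields M \<Longrightarrow> B' \<in> vfields M \<Longrightarrow> D A (B - B') = D A B - D A B'"
  using D_add_right[of A B "- B'"] D_minus_right[of A B'] by simp

lemma D_hor_hor: "A \<in> hor_fields M \<Longrightarrow> B \<in> hor_fields M \<Longrightarrow> D A B \<in> hor_fields M"
  using canonical unfolding canonical_connection_def by blast

lemma D_vert: "A \<in> vfields M \<Longrightarrow> Z \<in> vert M \<Longrightarrow> D A Z = 0"
  using canonical unfolding canonical_connection_def by blast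

lemma D_met: "A \<in> vfields M \<Longrightarrow> B \<in> hor_fields M \<Longrightarrow> C \<in> hor_fields M \<Longrightarrow>
    A x (\<lambda>y. met M y (B y) (C y)) = met M x (D A B x) (C x) + met M x (B x) (D A C x)"
  using canonical unfolding canonical_connection_def by blast

lemma torsion_hor: "A \<in> hor_fields M \<Longrightarrow> B \<in> hor_fields M \<Longrightarrow> torsion D A B x \<in> vert_at M x"
  using canonical unfolding canonical_connection_def by blast

lemma torsion_hor_vert: "A \<in> hor_fields M \<Longrightarrow> Z \<in> vert M \<Longrightarrow> torsion D A Z = 0"
  using canonical unfolding canonical_connection_def by blast

lemma torsion_vfields [simp, intro]: "A \<in> vfields M \<Longrightarrow> B \<in> vfields M \<Longrightarrow> torsion D A B \<in> vfields M"
  unfolding torsion_def by (intro vfields_diff D_vfields vfields_lie_bracket)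

lemma torsion_skew: "torsion D A B = - torsion D B A"
  unfolding torsion_def using lie_bracket_skew[of A B] by (simp add: algebra_simps)

text \<open>Vanishing torsion on mixed pairs and parallel vertical fields leave only the bracket,
  which is horizontal because vertical fields are sub-Riemannian Killing fields.\<close>

lemma D_vert_hor:
  assumes "Z \<in> vert M" "A \<in> hor_fields M"
  shows "D Z A = lie_bracket Z A" "D Z A \<in> hor_fields M"
proof -
  have "0 - D Z A - lie_bracket A Z = 0"
    using torsion_hor_vert[OF assms(2,1)] D_vert[OF hor_fields_vfields[OF assms(2)] assms(1)]
    by (simp only: torsion_def)
  then have "D Z A = - lie_bracket A Z" by (metis diff_0 eq_iff_diff_eq_0 minus_minus)
  then show eq: "D Z A = lie_bracket Z A" by (simp only: lie_bracket_skew[of Z A])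
  have "Z \<in> iso_fields M" using transverse assms(1) unfolding transverse_symmetries_def by blast
  then show "D Z A \<in> hor_fields M" unfolding eq using assms(2) unfolding iso_fields_def by blast
qed

text \<open>Linearity over smooth functions in one argument, read at \<open>x\<close>. The target is
  any real vector space, so that vector-valued and scalar expressions are covered alike.\<close>

definition is_tensor :: "'a \<Rightarrow> ('a vfield \<Rightarrow> 'v::real_vector) \<Rightarrow> bool"
  where "is_tensor x \<Phi> \<longleftrightarrow> (\<forall>A\<in>vfields M. \<forall>B\<in>vfields M. \<Phi> (A + B) = \<Phi> A + \<Phi> B) \<and>
    (\<forall>f\<in>C_infinity M. \<forall>A\<in>vfields M. \<Phi> (\<lambda>y. f y *\<^sub>R A y) = f x *\<^sub>R \<Phi> A)"

lemma is_tensorI: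
  assumes "\<And>A B. A \<in> vfields M \<Longrightarrow> B \<in> vfields M \<Longrightarrow> \<Phi> (A + B) = \<Phi> A + \<Phi> B"
    "\<And>f A. f \<in> C_infinity M \<Longrightarrow> A \<in> vfields M \<Longrightarrow> \<Phi> (\<lambda>y. f y *\<^sub>R A y) = f x *\<^sub>R \<Phi> A"
  shows "is_tensor x \<Phi>"
  using assms unfolding is_tensor_def by blast

lemma tensor_add: "is_tensor x \<Phi> \<Longrightarrow> A \<in> vfields M \<Longrightarrow> B \<in> vfields M \<Longrightarrow> \<Phi> (A + B) = \<Phi> A + \<Phi> B"
  unfolding is_tensor_def by blast

lemma tensor_mult: "is_tensor x \<Phi> \<Longrightarrow> f \<in> C_infinity M \<Longrightarrow> A \<in> vfields M \<Longrightarrow> \<Phi> (\<lambda>y. f y *\<^sub>R A y) = f x *\<^sub>R \<Phi> A"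
  unfolding is_tensor_def by blast

lemma tensor_sum:
  assumes "is_tensor x \<Phi>" "finite I" "\<And>i. i \<in> I \<Longrightarrow> A i \<in> vfields M"
  shows "\<Phi> (\<Sum>i\<in>I. A i) = (\<Sum>i\<in>I. \<Phi> (A i))"
  using assms(2,3)
proof (induction I rule: finite_induct)
  case empty
  show ?case using tensor_mult[OF assms(1) C_inf_const[of 0] vfields_zero] by (simp add: zero_fun_def)
next
  case (insert i I)
  have "\<Phi> (\<Sum>i\<in>insert i I. A i) = \<Phi> (A i + (\<Sum>i\<in>I. A i))" by (simp only: sum.insert[OF insert.hyps])
  also have "\<dots> = \<Phi> (A i) + \<Phi> (\<Sum>i\<in>I. A i)"
    by (rule tensor_add[OF assms(1)]) (use insert.prems in \<open>auto intro!: vfields_sum\<close>)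
  also have "\<Phi> (\<Sum>i\<in>I. A i) = (\<Sum>i\<in>I. \<Phi> (A i))"
    by (rule insert.IH) (use insert.prems in auto)
  finally show ?case by (simp only: sum.insert[OF insert.hyps])
qed

text \<open>The expansion in the frame with smooth coefficients holds only near \<open>x\<close>; a
  cutoff makes it global without changing the value, and linearity over functions evaluates the
  coefficients at \<open>x\<close>. In particular only \<open>A x\<close> matters.\<close>

lemma tensor_expand:
  assumes \<Phi>: "is_tensor x \<Phi>" and F: "hframe Y N" "x \<in> N" and A: "A \<in> vfields M"
  shows "\<Phi> A = (\<Sum>j\<in>frame_index. gR M x (A x) (frame_field Y j x) *\<^sub>R \<Phi> (frame_field Y j))"
proof (rule smooth_coeffs[OF F])
  fix V assume V: "open V" "x \<in> V" "V \<subseteq> N"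
    and co: "\<And>A. A \<in> vfields M \<Longrightarrow> \<exists>c. (\<forall>j\<in>frame_index. c j \<in> C_infinity M) \<and>
      (\<forall>y\<in>V. A y = (\<Sum>j\<in>frame_index. c j y *\<^sub>R frame_field Y j y))"
  obtain c where c: "\<And>j. j \<in> frame_index \<Longrightarrow> c j \<in> C_infinity M"
    "\<And>y. y \<in> V \<Longrightarrow> A y = (\<Sum>j\<in>frame_index. c j y *\<^sub>R frame_field Y j y)" using co[OF A] by blast
  obtain \<eta> V' K where \<eta>: "\<eta> \<in> C_infinity M" "open V'" "x \<in> V'" "V' \<subseteq> K" "K \<subseteq> V" "compact K"
    "\<And>y. y \<in> V' \<Longrightarrow> \<eta> y = 1" "\<And>y. y \<notin> K \<Longrightarrow> \<eta> y = 0" "\<And>y. \<eta> y \<ge> 0"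
    using ex_plateau[OF V(1,2)] by metis
  have \<eta>x: "\<eta> x = 1" using \<eta>(3,7) by blast
  have eq: "(\<lambda>y. \<eta> y *\<^sub>R A y) = (\<Sum>j\<in>frame_index. (\<lambda>y. (\<eta> y * c j y) *\<^sub>R frame_field Y j y))"
  proof (rule ext)
    fix y show "\<eta> y *\<^sub>R A y = (\<Sum>j\<in>frame_index. (\<lambda>y. (\<eta> y * c j y) *\<^sub>R frame_field Y j y)) y"
    proof (cases "y \<in> V")
      case True
      then show ?thesis by (simp add: c(2) sum_fun_apply scaleR_sum_right)
    next
      case False
      then have "\<eta> y = 0" using \<eta>(5,8) by blast
      then show ?thesis by (simp add: sum_fun_apply)
    qed
  qed
  have v: "\<eta> \<in> C_infinity M" "(\<lambda>y. \<eta> y * c j y) \<in> C_infinity M" "frame_field Y j \<in> vfields M" if "j \<in> frame_index" for j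
    using \<eta>(1) c(1)[OF that] frame_field_vfields[OF F(1) that] by auto
  have "\<Phi> A = \<Phi> (\<lambda>y. \<eta> y *\<^sub>R A y)" using tensor_mult[OF \<Phi> \<eta>(1) A] \<eta>x by simp
  also have "\<dots> = (\<Sum>j\<in>frame_index. \<Phi> (\<lambda>y. (\<eta> y * c j y) *\<^sub>R frame_field Y j y))"
    unfolding eq by (rule tensor_sum[OF \<Phi> finite_frame_index]) (rule vfields_mult[OF v(2,3)])
  also have "\<dots> = (\<Sum>j\<in>frame_index. gR M x (A x) (frame_field Y j x) *\<^sub>R \<Phi> (frame_field Y j))"
  proof (rule sum.cong[OF refl])
    fix j assume j: "j \<in> frame_index"
    have "gR M x (A x) (frame_field Y j x) = c j x"
      unfolding c(2)[OF V(2)]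
      by (rule orthonormal_coeff[OF gR_inner_product subspace_tangent frame_tangent[OF F(1)]
            frame_orthonormal[OF F] finite_frame_index j])
    then show "\<Phi> (\<lambda>y. (\<eta> y * c j y) *\<^sub>R frame_field Y j y) = gR M x (A x) (frame_field Y j x) *\<^sub>R \<Phi> (frame_field Y j)"
      using tensor_mult[OF \<Phi> v(2)[OF j] v(3)[OF j]] \<eta>x by simp
  qed
  finally show ?thesis .
qed

lemma tensor_cong:
  assumes "is_tensor x \<Phi>" "A \<in> vfields M" "B \<in> vfields M" "A x = B x"
  shows "\<Phi> A = \<Phi> B"
proof -
  obtain Y N where F: "hframe Y N" "x \<in> N" by (rule ex_hframe)
  show ?thesis unfolding tensor_expand[OF assms(1) F assms(2)] tensor_expand[OF assms(1) F assms(3)] assms(4) ..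
qed

lemma tensor_expand_hor:
  assumes \<Phi>: "is_tensor x \<Phi>" and F: "hframe Y N" "x \<in> N" and A: "A \<in> vfields M" "A x \<in> hor M x"
  shows "\<Phi> A = (\<Sum>i=1..d. met M x (A x) (Y i x) *\<^sub>R \<Phi> (Y i))"
proof -
  have "(\<Sum>i=1..d. gR M x (A x) (Y i x) *\<^sub>R \<Phi> (Y i)) = (\<Sum>i=1..d. met M x (A x) (Y i x) *\<^sub>R \<Phi> (Y i))"
    by (rule sum.cong[OF refl]) (simp only: gR_hor[OF A(2) hframeD(4)[OF F(1)]])
  moreover have "(\<Sum>Z\<in>vbasis. gR M x (A x) (Z x) *\<^sub>R \<Phi> Z) = 0"
    by (rule sum.neutral) (simp add: gR_hor_vert[OF A(2)] vbasis_in_vert)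
  ultimately show ?thesis
    unfolding tensor_expand[OF \<Phi> F A(1)] sum_frame_index by simp
qed

lemma gR_vert_hor: "h \<in> hor M x \<Longrightarrow> w \<in> vert_at M x \<Longrightarrow> gR M x w h = 0"
proof -
  assume h: "h \<in> hor M x" and "w \<in> vert_at M x"
  then obtain Z where Z: "Z \<in> vert M" "w = Z x" using vert_at_iff by blast
  then show ?thesis
    using inner_product_on_sym[OF gR_inner_product vfields_tangent[OF vert_vfields[OF Z(1)]] hor_tangent[OF h]]
      gR_hor_vert[OF h Z(1)] by simp
qed

lemma tensor_expand_vert:
  assumes \<Phi>: "is_tensor x \<Phi>" and A: "A \<in> vfields M" "A x \<in> vert_at M x"
  shows "\<Phi> A = (\<Sum>Z\<in>vbasis. gR M x (A x) (Z x) *\<^sub>R \<Phi> Z)"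
proof -
  obtain Y N where F: "hframe Y N" "x \<in> N" by (rule ex_hframe)
  have "(\<Sum>i=1..d. gR M x (A x) (Y i x) *\<^sub>R \<Phi> (Y i)) = 0"
    by (rule sum.neutral) (use gR_vert_hor[OF hframeD(4)[OF F(1)] A(2)] in \<open>simp del: One_nat_def\<close>)
  then show ?thesis
    unfolding tensor_expand[OF \<Phi> F A(1)] sum_frame_index by simp
qed

lemma tensor_D_left: "B \<in> vfields M \<Longrightarrow> is_tensor x (\<lambda>A. D A B x)"
  by (rule is_tensorI) (simp_all add: D_add_left D_mult_left)

text \<open>Tensoriality in the direction reduces the claim to frame fields: horizontal directions
  are an axiom, vertical ones are covered by \<open>D_vert_hor\<close>.\<close>

lemma D_hor: "A \<in> vfields M \<Longrightarrow> B \<in> hor_fields M \<Longrightarrow> D A B \<in> hor_fields M"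
proof -
  assume A: "A \<in> vfields M" and B: "B \<in> hor_fields M"
  have "D A B x \<in> hor M x" for x
  proof -
    obtain Y N where F: "hframe Y N" "x \<in> N" by (rule ex_hframe)
    have "D (frame_field Y j) B x \<in> hor M x" if "j \<in> frame_index" for j
      using that hor_fields_hor[OF D_hor_hor[OF hframeD(2)[OF F(1)] B]] hor_fields_hor[OF D_vert_hor(2)[OF vbasis_in_vert B]]
      unfolding frame_index_def by auto
    then show ?thesis
      unfolding tensor_expand[OF tensor_D_left[OF hor_fields_vfields[OF B]] F A]
      by (intro subspace_sum[OF subspace_hor] subspace_scale[OF subspace_hor])
  qed
  then show ?thesis using A B by (auto simp: hor_fields_def)
qed

lemma tensor_torsion_left: "B \<in> vfields M \<Longrightarrow> is_tensor x (\<lambda>A. torsion D A B x)"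
proof (rule is_tensorI)
  fix A A' assume *: "B \<in> vfields M" "A \<in> vfields M" "A' \<in> vfields M"
  then show "torsion D (A + A') B x = torsion D A B x + torsion D A' B x"
    by (simp add: torsion_def D_add_left D_add_right lie_bracket_add_left)
next
  fix f A assume *: "B \<in> vfields M" "f \<in> C_infinity M" "A \<in> vfields M"
  then show "torsion D (\<lambda>y. f y *\<^sub>R A y) B x = f x *\<^sub>R torsion D A B x"
    by (simp add: torsion_def D_mult_left D_mult_right lie_bracket_mult_left scaleR_diff_right)
qed

lemma tensor_uminus: "is_tensor x \<Phi> \<Longrightarrow> is_tensor x (\<lambda>A. - \<Phi> A)"
  unfolding is_tensor_def by simp

lemma tensor_torsion_right: "B \<in> vfields M \<Longrightarrow> is_tensor x (\<lambda>A. torsion D B A x)"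
  using tensor_uminus[OF tensor_torsion_left, of B x] torsion_skew[of B] by simp

lemma torsion_mult_right: "f \<in> C_infinity M \<Longrightarrow> A \<in> vfields M \<Longrightarrow> B \<in> vfields M \<Longrightarrow>
    torsion D B (\<lambda>y. f y *\<^sub>R A y) = (\<lambda>y. f y *\<^sub>R torsion D B A y)"
  by (rule ext) (rule tensor_mult[OF tensor_torsion_right])

lemma torsion_mult_left: "f \<in> C_infinity M \<Longrightarrow> A \<in> vfields M \<Longrightarrow> B \<in> vfields M \<Longrightarrow>
    torsion D (\<lambda>y. f y *\<^sub>R A y) B = (\<lambda>y. f y *\<^sub>R torsion D A B y)"
  by (rule ext) (rule tensor_mult[OF tensor_torsion_left])

lemma torsion_add_right: "A \<in> vfields M \<Longrightarrow> A' \<in> vfields M \<Longrightarrow> B \<in> vfields M \<Longrightarrow>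
    torsion D B (A + A') = torsion D B A + torsion D B A'"
  by (rule ext, rule trans[OF tensor_add[OF tensor_torsion_right] plus_fun_apply[symmetric]])

lemma torsion_add_left: "A \<in> vfields M \<Longrightarrow> A' \<in> vfields M \<Longrightarrow> B \<in> vfields M \<Longrightarrow>
    torsion D (A + A') B = torsion D A B + torsion D A' B"
  by (rule ext, rule trans[OF tensor_add[OF tensor_torsion_left] plus_fun_apply[symmetric]])

text \<open>In the last two arguments the derivative of the coefficient arises once from
  differentiating the torsion and once, with opposite sign, from differentiating the
  argument.\<close>

lemma tensor_deriv_torsion:
  assumes "A \<in> vfields M" "B \<in> vfields M"
  shows "is_tensor x (\<lambda>W. deriv_torsion D W A B x)"
    "is_tensor x (\<lambda>W. deriv_torsion D A W B x)"
    "is_tensor x (\<lambda>W. deriv_torsion D A B W x)"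
proof -
  show "is_tensor x (\<lambda>W. deriv_torsion D W A B x)"
    by (rule is_tensorI)
      (simp_all add: deriv_torsion_def assms D_add_left D_mult_left torsion_add_left torsion_add_right
        torsion_mult_left torsion_mult_right scaleR_diff_right)
  have torsion_add2: "torsion D (\<lambda>y. P y + Q y) R = torsion D P R + torsion D Q R"
    "torsion D R (\<lambda>y. P y + Q y) = torsion D R P + torsion D R Q"
    if "P \<in> vfields M" "Q \<in> vfields M" "R \<in> vfields M" for P Q R
    using torsion_add_left[OF that] torsion_add_right[OF that] by (simp_all add: plus_fun_def)
  show "is_tensor x (\<lambda>W. deriv_torsion D A W B x)"
  proof (rule is_tensorI)
    fix W W' assume "W \<in> vfields M" "W' \<in> vfields M"
    then show "deriv_torsion D A (W + W') B x = deriv_torsion D A W B x + deriv_torsion D A W' B x"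
      by (simp add: deriv_torsion_def assms D_add_right torsion_add_left)
  next
    fix f W assume f: "f \<in> C_infinity M" and W: "W \<in> vfields M"
    then have "(\<lambda>y. A y f *\<^sub>R W y) \<in> vfields M" "(\<lambda>y. f y *\<^sub>R D A W y) \<in> vfields M"
      using assms vfields_mult[OF vfields_smooth[OF assms(1) f] W] by simp_all
    then show "deriv_torsion D A (\<lambda>y. f y *\<^sub>R W y) B x = f x *\<^sub>R deriv_torsion D A W B x"
      using f W assms vfields_smooth[OF assms(1) f]
      by (simp add: deriv_torsion_def D_mult_right torsion_mult_left torsion_add2 scaleR_diff_right)
  qed
  show "is_tensor x (\<lambda>W. deriv_torsion D A B W x)"
  proof (rule is_tensorI)
    fix W W' assume "W \<in> vfields M" "W' \<in> vfields M"
    then show "deriv_torsion D A B (W + W') x = deriv_torsion D A B W x + deriv_torsion D A B W' x"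
      by (simp add: deriv_torsion_def assms D_add_right torsion_add_right)
  next
    fix f W assume f: "f \<in> C_infinity M" and W: "W \<in> vfields M"
    then have "(\<lambda>y. A y f *\<^sub>R W y) \<in> vfields M" "(\<lambda>y. f y *\<^sub>R D A W y) \<in> vfields M"
      using assms vfields_mult[OF vfields_smooth[OF assms(1) f] W] by simp_all
    then show "deriv_torsion D A B (\<lambda>y. f y *\<^sub>R W y) x = f x *\<^sub>R deriv_torsion D A B W x"
      using f W assms vfields_smooth[OF assms(1) f]
      by (simp add: deriv_torsion_def D_mult_right torsion_mult_right torsion_add2 scaleR_diff_right)
  qed
qed

lemma lie_bracket_mult_left':
  assumes "A \<in> vfields M" "B \<in> vfields M" "g \<in> C_infinity M"
  shows "lie_bracket (\<lambda>y. g y *\<^sub>R A y) B = (\<lambda>x. g x *\<^sub>R lie_bracket A B x) - (\<lambda>x. B x g *\<^sub>R A x)"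
  by (rule ext) (simp add: lie_bracket_mult_left[OF assms])

lemma lie_bracket_mult_right':
  assumes "A \<in> vfields M" "B \<in> vfields M" "g \<in> C_infinity M"
  shows "lie_bracket B (\<lambda>y. g y *\<^sub>R A y) = (\<lambda>x. g x *\<^sub>R lie_bracket B A x) + (\<lambda>x. B x g *\<^sub>R A x)"
  using lie_bracket_mult_left'[OF assms] lie_bracket_skew[of B "\<lambda>y. g y *\<^sub>R A y"] lie_bracket_skew[of B A]
  by (simp add: fun_eq_iff)

lemma lie_bracket_add_right:
  assumes "A \<in> vfields M" "A' \<in> vfields M" "B \<in> vfields M"
  shows "lie_bracket B (A + A') = lie_bracket B A + lie_bracket B A'"
  using lie_bracket_add_left[OF assms] lie_bracket_skew[of B "A + A'"] lie_bracket_skew[of B A] lie_bracket_skew[of B A']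
  by simp

lemma D_add_right': "A \<in> vfields M \<Longrightarrow> B \<in> vfields M \<Longrightarrow> B' \<in> vfields M \<Longrightarrow> D A (\<lambda>y. B y + B' y) = D A B + D A B'"
  using D_add_right by (simp add: plus_fun_def)

lemma tensor_curvature_1:
  assumes B: "B \<in> vfields M" and W: "W \<in> vfields M"
  shows "is_tensor x (\<lambda>A. curvature D A B W x)"
proof (rule is_tensorI)
  fix A A' assume A: "A \<in> vfields M" "A' \<in> vfields M"
  then show "curvature D (A + A') B W x = curvature D A B W x + curvature D A' B W x"
    using B W by (simp add: curvature_def D_add_left D_add_right lie_bracket_add_left)
next
  fix f A assume f: "f \<in> C_infinity M" and A: "A \<in> vfields M"
  note Bf = vfields_smooth[OF B f]
  have "D (lie_bracket (\<lambda>y. f y *\<^sub>R A y) B) W = (\<lambda>x. f x *\<^sub>R D (lie_bracket A B) W x) - (\<lambda>x. B x f *\<^sub>R D A W x)"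
    unfolding lie_bracket_mult_left'[OF A B f]
    using A B W f vfields_mult[OF Bf A] by (simp add: D_diff_left D_mult_left Bf)
  then show "curvature D (\<lambda>y. f y *\<^sub>R A y) B W x = f x *\<^sub>R curvature D A B W x"
    using A B W f by (simp add: curvature_def D_mult_left D_mult_right scaleR_diff_right)
qed

lemma curvature_skew: "A \<in> vfields M \<Longrightarrow> B \<in> vfields M \<Longrightarrow> W \<in> vfields M \<Longrightarrow> curvature D A B W = - curvature D B A W"
  unfolding curvature_def lie_bracket_skew[of A B] by (simp add: D_minus_left)

lemma tensor_curvature_2:
  assumes B: "B \<in> vfields M" and W: "W \<in> vfields M"
  shows "is_tensor x (\<lambda>A. curvature D B A W x)"
proof -
  have eq: "curvature D B A W x = - curvature D A B W x" if "A \<in> vfields M" for A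
    using curvature_skew[OF B that W] by simp
  have "is_tensor x (\<lambda>A. - curvature D A B W x)" by (rule tensor_uminus[OF tensor_curvature_1[OF B W]])
  then show ?thesis unfolding is_tensor_def by (simp add: eq)
qed

lemma tensor_curvature_3:
  assumes A: "A \<in> vfields M" and B: "B \<in> vfields M"
  shows "is_tensor x (\<lambda>W. curvature D A B W x)"
proof (rule is_tensorI)
  fix W W' assume "W \<in> vfields M" "W' \<in> vfields M"
  then show "curvature D A B (W + W') x = curvature D A B W x + curvature D A B W' x"
    using A B by (simp add: curvature_def D_add_right)
next
  fix f W assume f: "f \<in> C_infinity M" and W: "W \<in> vfields M"
  note Bf = vfields_smooth[OF B f] and Af = vfields_smooth[OF A f]
  have v: "(\<lambda>y. B y f *\<^sub>R W y) \<in> vfields M" "(\<lambda>y. f y *\<^sub>R D B W y) \<in> vfields M"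
    "(\<lambda>y. A y f *\<^sub>R W y) \<in> vfields M" "(\<lambda>y. f y *\<^sub>R D A W y) \<in> vfields M"
    using vfields_mult[OF Bf W] vfields_mult[OF Af W] f A B W by simp_all
  \<comment> \<open>The second derivatives of \<open>f\<close> in front of \<open>W\<close> form the
    commutator and cancel against the derivative along the bracket.\<close>
  have lb: "lie_bracket A B x f = A x (\<lambda>y. B y f) - B x (\<lambda>y. A y f)" by (simp add: lie_bracket_def)
  show "curvature D A B (\<lambda>y. f y *\<^sub>R W y) x = f x *\<^sub>R curvature D A B W x"
    using f W A B v Af Bf
    by (simp add: curvature_def D_mult_right D_add_right' lb algebra_simps)
qed

lemma curvature_hor:
  assumes "A \<in> vfields M" "B \<in> vfields M" "W \<in> hor_fields M"
  shows "curvature D A B W \<in> hor_fields M"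
proof -
  have "D A (D B W) \<in> hor_fields M" "D B (D A W) \<in> hor_fields M" "D (lie_bracket A B) W \<in> hor_fields M"
    using assms by (auto intro!: D_hor)
  then show ?thesis
    unfolding hor_fields_def curvature_def by (auto intro: subspace_diff[OF subspace_hor])
qed

section \<open>Bochner's formulas\<close>

lemma met_sym: "u \<in> hor M x \<Longrightarrow> v \<in> hor M x \<Longrightarrow> met M x u v = met M x v u"
  by (rule inner_product_on_sym[OF met])

lemma met_diff_left: "u \<in> hor M x \<Longrightarrow> v \<in> hor M x \<Longrightarrow> w \<in> hor M x \<Longrightarrow> met M x (u - v) w = met M x u w - met M x v w"
  by (rule inner_product_on_diff[OF met subspace_hor])

text \<open>Metric compatibility applied to the identity
  \<open>met M y (grad_hor M f y) (B y) = B y f\<close>. The left side is the Hessian of the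
  overview, with \<open>A\<close> allowed to be vertical.\<close>

lemma hess_eq:
  assumes A: "A \<in> vfields M" and B: "B \<in> hor_fields M" and f: "f \<in> C_infinity M"
  shows "met M x (D A (grad_hor M f) x) (B x) = A x (\<lambda>y. B y f) - D A B x f"
proof -
  have "(\<lambda>y. met M y (grad_hor M f y) (B y)) = (\<lambda>y. B y f)"
    by (rule ext) (rule met_grad_hor[OF f hor_fields_hor[OF B]])
  moreover have "met M x (grad_hor M f x) (D A B x) = D A B x f"
    by (rule met_grad_hor[OF f hor_fields_hor[OF D_hor[OF A B]]])
  ultimately show ?thesis using D_met[OF A grad_hor_field[OF f] B, of x] by simp
qed

text \<open>Because \<open>D\<close> has torsion, the commutator of \<open>A\<close> and
  \<open>B\<close> acting on \<open>f\<close> is not absorbed by the covariant derivatives. What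
  remains involves first derivatives of \<open>f\<close> only.\<close>

lemma hess_sym:
  assumes A: "A \<in> hor_fields M" and B: "B \<in> hor_fields M" and f: "f \<in> C_infinity M"
  shows "met M x (D A (grad_hor M f) x) (B x) = met M x (D B (grad_hor M f) x) (A x) - torsion D A B x f"
  using hess_eq[OF hor_fields_vfields[OF A] B f, of x] hess_eq[OF hor_fields_vfields[OF B] A f, of x]
  by (simp add: torsion_def lie_bracket_def)

text \<open>The inner products of an orthonormal frame are locally constant: the connection
  coefficients form a skew matrix.\<close>

lemma frame_deriv:
  assumes F: "hframe Y N" "x \<in> N" and A: "A \<in> vfields M" and ik: "i \<in> {1..d}" "k \<in> {1..d}"
  shows "met M x (D A (Y i) x) (Y k x) + met M x (Y i x) (D A (Y k) x) = 0"
proof -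
  have "\<forall>\<^sub>F y in nhds x. y \<in> N" using F hframeD(1) eventually_nhds by blast
  then have "\<forall>\<^sub>F y in nhds x. met M y (Y i y) (Y k y) = (if i = k then 1 else 0)"
    by eventually_elim (use hframeD(5)[OF F(1)] ik in \<open>simp add: orthonormal_family_def\<close>)
  then have "A x (\<lambda>y. met M y (Y i y) (Y k y)) = A x (\<lambda>y. if i = k then 1 else 0)"
    by (rule tangent_germ[OF vfields_tangent[OF A] met_smooth[OF hframeD(2)[OF F(1) ik(1)] hframeD(2)[OF F(1) ik(2)]] C_inf_const])
  then show ?thesis
    using D_met[OF A hframeD(2)[OF F(1) ik(1)] hframeD(2)[OF F(1) ik(2)], of x] tangent_const[OF vfields_tangent[OF A]]
    by simp
qed

text \<open>The divergence of \<open>Y i\<close> is computed with the connection: vertical frame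
  fields contribute nothing since their brackets with \<open>Y i\<close> are horizontal, and the
  torsion drops out against horizontal fields because it is vertical. Skewness of the connection
  coefficients then collects the first-order terms into \<open>D (Y l) (Y l)\<close>.\<close>

lemma laplacian_D:
  assumes F: "hframe Y N" "x \<in> N" and f: "f \<in> C_infinity M"
  shows "L f x = (\<Sum>l=1..d. Y l x (\<lambda>y. Y l y f) - D (Y l) (Y l) x f)"
proof -
  note Yh = hframeD(2)[OF F(1)] and Yv = hframeD(3)[OF F(1)]
  define c where "c = (\<lambda>i y. \<Sum>l=1..d. met M y (D (Y l) (Y i) y) (Y l y))"
  have c1: "c i \<in> C_infinity M" if "i \<in> {1..d}" for i
    unfolding c_def by (rule C_inf_sum) (rule met_smooth[OF D_hor[OF Yv Yh[OF that]] Yh])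
  have c2: "c i y = - (\<Sum>j\<in>frame_index. gR M y (lie_bracket (Y i) (frame_field Y j) y) (frame_field Y j y))"
    if i: "i \<in> {1..d}" and y: "y \<in> N" for i y
  proof -
    have "gR M y (lie_bracket (Y i) Z y) (Z y) = 0" if "Z \<in> vbasis" for Z
    proof -
      have Z: "Z \<in> vert M" using that by blast
      have "lie_bracket (Y i) Z y = - D Z (Y i) y"
        unfolding D_vert_hor(1)[OF Z Yh[OF i]] lie_bracket_skew[of "Y i"] by simp
      then have "lie_bracket (Y i) Z y \<in> hor M y"
        using hor_fields_hor[OF D_vert_hor(2)[OF Z Yh[OF i]]] by (simp add: subspace_neg[OF subspace_hor])
      then show ?thesis by (rule gR_hor_vert[OF _ Z])
    qed
    moreover have "gR M y (lie_bracket (Y i) (Y l) y) (Y l y) = - met M y (D (Y l) (Y i) y) (Y l y)"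
      if l: "l \<in> {1..d}" for l
    proof -
      let ?a = "D (Y i) (Y l) y" and ?b = "D (Y l) (Y i) y" and ?t = "torsion D (Y i) (Y l) y"
      have h: "?a \<in> hor M y" "?b \<in> hor M y" "Y l y \<in> hor M y"
        using hor_fields_hor[OF D_hor[OF Yv Yh]] hor_fields_hor[OF Yh] i l by blast+
      have tv: "?t \<in> vert_at M y" by (rule torsion_hor[OF Yh[OF i] Yh[OF l]])
      have tt: "?t \<in> tangent_space M y" by (rule vfields_tangent[OF torsion_vfields[OF Yv[OF i] Yv[OF l]]])
      have "lie_bracket (Y i) (Y l) y = (?a - ?b) - ?t" by (simp add: torsion_def)
      then have "gR M y (lie_bracket (Y i) (Y l) y) (Y l y) = gR M y (?a - ?b) (Y l y) - gR M y ?t (Y l y)"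
        using inner_product_on_diff[OF gR_inner_product subspace_tangent hor_tangent[OF subspace_diff[OF subspace_hor h(1,2)]] tt hor_tangent[OF h(3)]]
        by simp
      also have "\<dots> = met M y ?a (Y l y) - met M y ?b (Y l y)"
        using gR_vert_hor[OF h(3) tv] gR_hor[OF subspace_diff[OF subspace_hor h(1,2)] h(3)] met_diff_left[OF h] by simp
      also have "met M y ?a (Y l y) = 0"
        using frame_deriv[OF F(1) y Yv[OF i] l l] met_sym[OF h(1,3)] by simp
      finally show ?thesis by simp
    qed
    ultimately show ?thesis
      unfolding sum_frame_index by (simp add: c_def sum_negf del: One_nat_def)
  qed
  have "L f x = (\<Sum>i=1..d. Y i x (\<lambda>z. Y i z f) + c i x * Y i x f)"
    by (rule laplacian_frame[OF F f c1 c2])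
  also have "\<dots> = (\<Sum>i=1..d. Y i x (\<lambda>z. Y i z f)) + (\<Sum>i=1..d. c i x * Y i x f)"
    by (rule sum.distrib)
  also have "(\<Sum>i=1..d. c i x * Y i x f) = (\<Sum>l=1..d. \<Sum>i=1..d. met M x (D (Y l) (Y i) x) (Y l x) * Y i x f)"
    unfolding c_def sum_distrib_right by (rule sum.swap)
  also have "\<dots> = (\<Sum>l=1..d. - D (Y l) (Y l) x f)"
  proof (rule sum.cong[OF refl])
    fix l assume l: "l \<in> {1..d}"
    have h: "D (Y l) (Y l) x \<in> hor M x" by (rule hor_fields_hor[OF D_hor[OF Yv[OF l] Yh[OF l]]])
    have "met M x (D (Y l) (Y i) x) (Y l x) = - met M x (D (Y l) (Y l) x) (Y i x)" if i: "i \<in> {1..d}" for i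
      using frame_deriv[OF F Yv[OF l] i l] met_sym[OF h hor_fields_hor[OF Yh[OF i]]] by simp
    then have "(\<Sum>i=1..d. met M x (D (Y l) (Y i) x) (Y l x) * Y i x f) =
      - (\<Sum>i=1..d. met M x (D (Y l) (Y l) x) (Y i x) *\<^sub>R Y i x) f"
      by (simp add: sum_fun_apply sum_negf del: One_nat_def)
    then show "(\<Sum>i=1..d. met M x (D (Y l) (Y i) x) (Y l x) * Y i x f) = - D (Y l) (Y l) x f"
      using hor_expand[OF F h] by simp
  qed
  finally show ?thesis by (simp add: sum_subtractf sum_negf)
qed

lemma laplacian_hess:
  assumes F: "hframe Y N" "x \<in> N" and f: "f \<in> C_infinity M"
  shows "L f x = (\<Sum>l=1..d. met M x (D (Y l) (grad_hor M f) x) (Y l x))"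
  unfolding laplacian_D[OF assms]
  by (rule sum.cong[OF refl]) (simp only: hess_eq[OF hframeD(3)[OF F(1)] hframeD(2)[OF F(1)] f])

text \<open>The contribution of a moving frame to the derivative of the trace of the Hessian: skew
  connection coefficients contracted with the Hessian and its transpose cancel. It replaces the
  choice of a frame that is parallel at \<open>x\<close>.\<close>

lemma hess_skew_sum:
  assumes F: "hframe Y N" "x \<in> N" and f: "f \<in> C_infinity M" and A: "A \<in> vfields M"
  shows "(\<Sum>l=1..d. met M x (D (D A (Y l)) (grad_hor M f) x) (Y l x) +
      met M x (D (Y l) (grad_hor M f) x) (D A (Y l) x)) = 0"
proof -
  note Yh = hframeD(2)[OF F(1)] and Yv = hframeD(3)[OF F(1)]
  let ?G = "grad_hor M f"
  have G: "?G \<in> hor_fields M" using f by simp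
  define \<theta> where "\<theta> = (\<lambda>l j. met M x (D A (Y l) x) (Y j x))"
  define a where "a = (\<lambda>l j. met M x (D (Y l) ?G x) (Y j x))"
  have 1: "met M x (D (D A (Y l)) ?G x) (Y l x) = (\<Sum>j=1..d. \<theta> l j * a j l)" if l: "l \<in> {1..d}" for l
  proof -
    have DA: "D A (Y l) \<in> hor_fields M" by (rule D_hor[OF A Yh[OF l]])
    have "D (D A (Y l)) ?G x = (\<Sum>j=1..d. \<theta> l j *\<^sub>R D (Y j) ?G x)"
      unfolding \<theta>_def
      by (rule tensor_expand_hor[OF tensor_D_left[OF hor_fields_vfields[OF G]] F hor_fields_vfields[OF DA] hor_fields_hor[OF DA]])
    then show ?thesis
      unfolding a_def
      using inner_product_on_sum[OF met subspace_hor hor_fields_hor[OF D_hor[OF Yv G]] hor_fields_hor[OF Yh[OF l]],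
          where I = "{1..d}" and c = "\<theta> l"]
      by simp
  qed
  have 2: "met M x (D (Y l) ?G x) (D A (Y l) x) = (\<Sum>j=1..d. \<theta> l j * a l j)" if l: "l \<in> {1..d}" for l
    unfolding \<theta>_def a_def
    using met_expand[OF F hor_fields_hor[OF D_hor[OF Yv[OF l] G]] hor_fields_hor[OF D_hor[OF A Yh[OF l]]]]
    by (simp add: mult.commute)
  have 3: "\<theta> l j + \<theta> j l = 0" if "l \<in> {1..d}" "j \<in> {1..d}" for l j
    unfolding \<theta>_def
    using frame_deriv[OF F A that] met_sym[OF hor_fields_hor[OF D_hor[OF A Yh[OF that(2)]]] hor_fields_hor[OF Yh[OF that(1)]], of x]
    by simp
  have "(\<Sum>l=1..d. met M x (D (D A (Y l)) ?G x) (Y l x) + met M x (D (Y l) ?G x) (D A (Y l) x)) =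
    (\<Sum>l=1..d. \<Sum>j=1..d. \<theta> l j * a j l) + (\<Sum>l=1..d. \<Sum>j=1..d. \<theta> l j * a l j)"
    unfolding sum.distrib by (intro arg_cong2[where f = plus] sum.cong refl 1 2)
  also have "(\<Sum>l=1..d. \<Sum>j=1..d. \<theta> l j * a l j) = (\<Sum>l=1..d. \<Sum>j=1..d. \<theta> j l * a j l)"
    by (rule sum.swap)
  also have "(\<Sum>l=1..d. \<Sum>j=1..d. \<theta> l j * a j l) + (\<Sum>l=1..d. \<Sum>j=1..d. \<theta> j l * a j l) =
    (\<Sum>l=1..d. \<Sum>j=1..d. (\<theta> l j + \<theta> j l) * a j l)"
    by (simp add: sum.distrib distrib_right)
  also have "\<dots> = 0" by (intro sum.neutral ballI) (simp add: 3 del: One_nat_def)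
  finally show ?thesis .
qed

text \<open>The left side is the summand of \<open>Gamma2\<close> for the frame field
  \<open>X\<close>. \<open>hess_sym\<close> moves the gradient between the two slots at the price of
  torsion, the two orders of differentiation differ by curvature, and the bracket is rewritten by
  the torsion. The last line is the part that \<open>hess_skew_sum\<close> removes after
  summation.\<close>

lemma bochner_term:
  assumes X: "X \<in> hor_fields M" and f: "f \<in> C_infinity M"
  defines "G \<equiv> grad_hor M f"
  shows "X x (\<lambda>y. met M y (D X G y) (G y)) - met M x (D (D X X) G x) (G x)
      - met M x (D G (D X G) x) (X x) - met M x (D X G x) (D G X x) =
    met M x (curvature D X G G x) (X x) + met M x (D X G x) (D X G x) - deriv_torsion D X X G x f
      - (X x (\<lambda>y. torsion D X G y f) - D X (torsion D X G) x f) - met M x (D (torsion D X G) G x) (X x)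
      - (met M x (D (D G X) G x) (X x) + met M x (D X G x) (D G X x))"
proof -
  have G: "G \<in> hor_fields M" unfolding G_def using f by simp
  note Xv = hor_fields_vfields[OF X] and Gv = hor_fields_vfields[OF G]
  have DGG: "D G G \<in> hor_fields M" and DXG: "D X G \<in> hor_fields M" and DXX: "D X X \<in> hor_fields M"
    and DGX: "D G X \<in> hor_fields M"
    using D_hor Xv Gv X G by blast+
  have T: "torsion D X G \<in> vfields M" using Xv Gv by blast
  have s1: "(\<lambda>y. met M y (D X G y) (G y)) = (\<lambda>y. met M y (D G G y) (X y) - torsion D X G y f)"
    unfolding G_def by (rule ext) (rule hess_sym[OF X G[unfolded G_def] f])
  have s2: "X x (\<lambda>y. met M y (D X G y) (G y)) =
      met M x (D X (D G G) x) (X x) + met M x (D G G x) (D X X x) - X x (\<lambda>y. torsion D X G y f)"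
    unfolding s1 tangent_diff[OF vfields_tangent[OF Xv] met_smooth[OF DGG X] vfields_smooth[OF T f]]
      D_met[OF Xv DGG X] ..
  have s3: "met M x (D (D X X) G x) (G x) = met M x (D G G x) (D X X x) - torsion D (D X X) G x f"
    unfolding G_def by (rule hess_sym[OF DXX G[unfolded G_def] f])
  have s5: "met M x (D (D X G) G x) (X x) = met M x (D X G x) (D X G x) - torsion D (D X G) X x f"
    unfolding G_def by (rule hess_sym[OF DXG[unfolded G_def] X f])
  have s5': "torsion D (D X G) X x f = - torsion D X (D X G) x f"
    using torsion_skew[of "D X G" X] by simp
  have s6: "deriv_torsion D X X G x f = D X (torsion D X G) x f - torsion D (D X X) G x f - torsion D X (D X G) x f"
    by (simp add: deriv_torsion_def)
  have lb: "lie_bracket X G = D X G - D G X - torsion D X G" by (simp add: torsion_def)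
  have Dlb: "D (lie_bracket X G) G = D (D X G) G - D (D G X) G - D (torsion D X G) G"
    unfolding lb using DXG DGX T Gv by (simp add: D_diff_left hor_fields_vfields)
  have h: "D X (D G G) x \<in> hor M x" "D G (D X G) x \<in> hor M x" "D (D X G) G x \<in> hor M x"
    "D (D G X) G x \<in> hor M x" "D (torsion D X G) G x \<in> hor M x" "X x \<in> hor M x"
    using hor_fields_hor[OF D_hor[OF Xv DGG]] hor_fields_hor[OF D_hor[OF Gv DXG]]
      hor_fields_hor[OF D_hor[OF hor_fields_vfields[OF DXG] G]] hor_fields_hor[OF D_hor[OF hor_fields_vfields[OF DGX] G]]
      hor_fields_hor[OF D_hor[OF T G]] hor_fields_hor[OF X] by blast+
  have "curvature D X G G x = (D X (D G G) x - D G (D X G) x) - ((D (D X G) G x - D (D G X) G x) - D (torsion D X G) G x)"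
    by (simp add: curvature_def Dlb)
  then have s4: "met M x (curvature D X G G x) (X x) = met M x (D X (D G G) x) (X x) - met M x (D G (D X G) x) (X x)
      - (met M x (D (D X G) G x) (X x) - met M x (D (D G X) G x) (X x) - met M x (D (torsion D X G) G x) (X x))"
    using h by (simp add: met_diff_left subspace_diff[OF subspace_hor])
  show ?thesis unfolding s2 s3 s4 s5 s5' s6 by simp
qed

text \<open>Both expressions are tensorial in \<open>V\<close> and agree with
  \<open>X x (\<lambda>y. Z y f)\<close> on a vertical field \<open>Z\<close>, in the first case as
  \<open>Z\<close> is parallel, in the second as \<open>D Z X\<close> is the bracket. Applied to the
  torsion, the two coincide; hence the factor 2 in Bochner's formula.\<close>

lemma vert_second_deriv:
  assumes X: "X \<in> hor_fields M" and V: "V \<in> vfields M" "V x \<in> vert_at M x" and f: "f \<in> C_infinity M"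
  shows "X x (\<lambda>y. V y f) - D X V x f = (\<Sum>Z\<in>vbasis. gR M x (V x) (Z x) * X x (\<lambda>y. Z y f))"
    "met M x (D V (grad_hor M f) x) (X x) = (\<Sum>Z\<in>vbasis. gR M x (V x) (Z x) * X x (\<lambda>y. Z y f))"
proof -
  note Xv = hor_fields_vfields[OF X]
  let ?\<Phi> = "\<lambda>V. X x (\<lambda>y. V y f) - D X V x f"
  have "is_tensor x ?\<Phi>"
  proof (rule is_tensorI)
    fix A B assume AB: "A \<in> vfields M" "B \<in> vfields M"
    show "?\<Phi> (A + B) = ?\<Phi> A + ?\<Phi> B"
      using tangent_add[OF vfields_tangent[OF Xv] vfields_smooth[OF AB(1) f] vfields_smooth[OF AB(2) f]]
        D_add_right[OF Xv AB] by simp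
  next
    fix g A assume g: "g \<in> C_infinity M" and A: "A \<in> vfields M"
    show "?\<Phi> (\<lambda>y. g y *\<^sub>R A y) = g x *\<^sub>R ?\<Phi> A"
      using tangent_mult[OF vfields_tangent[OF Xv] g vfields_smooth[OF A f]] D_mult_right[OF g Xv A]
      by (simp add: algebra_simps)
  qed
  from tensor_expand_vert[OF this V]
  show "?\<Phi> V = (\<Sum>Z\<in>vbasis. gR M x (V x) (Z x) * X x (\<lambda>y. Z y f))"
    by (simp add: D_vert[OF Xv vbasis_in_vert])
  let ?\<Psi> = "\<lambda>V. met M x (D V (grad_hor M f) x) (X x)"
  have G: "grad_hor M f \<in> hor_fields M" using f by simp
  have h: "D A (grad_hor M f) x \<in> hor M x" if "A \<in> vfields M" for A
    by (rule hor_fields_hor[OF D_hor[OF that G]])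
  have "is_tensor x ?\<Psi>"
  proof (rule is_tensorI)
    fix A B assume AB: "A \<in> vfields M" "B \<in> vfields M"
    show "?\<Psi> (A + B) = ?\<Psi> A + ?\<Psi> B"
      using inner_product_on_add[OF met h[OF AB(1)] h[OF AB(2)] hor_fields_hor[OF X]]
        D_add_left[OF AB hor_fields_vfields[OF G]] by simp
  next
    fix g A assume g: "g \<in> C_infinity M" and A: "A \<in> vfields M"
    show "?\<Psi> (\<lambda>y. g y *\<^sub>R A y) = g x *\<^sub>R ?\<Psi> A"
      using inner_product_on_scale[OF met h[OF A] hor_fields_hor[OF X]]
        D_mult_left[OF g A hor_fields_vfields[OF G]] by simp
  qed
  note e = tensor_expand_vert[OF this V]
  have "?\<Psi> Z = X x (\<lambda>y. Z y f)" if "Z \<in> vbasis" for Z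
  proof -
    have Z: "Z \<in> vert M" using that by blast
    show ?thesis
      unfolding hess_eq[OF vert_vfields[OF Z] X f] D_vert_hor(1)[OF Z X] by (simp add: lie_bracket_def)
  qed
  then show "?\<Psi> V = (\<Sum>Z\<in>vbasis. gR M x (V x) (Z x) * X x (\<lambda>y. Z y f))"
    unfolding e by simp
qed

text \<open>\<open>laplacian_D\<close> is applied to the squared gradient, and the gradient field
  itself differentiates the trace formula for \<open>L f\<close>; the difference is a sum of
  instances of \<open>bochner_term\<close>.\<close>

lemma gamma2_bochner:
  assumes F: "hframe Y N" "x \<in> N" and f: "f \<in> C_infinity M"
  defines "G \<equiv> grad_hor M f"
  shows "Gamma2 M L f x = (\<Sum>l=1..d. met M x (curvature D (Y l) G G x) (Y l x)
      + met M x (D (Y l) G x) (D (Y l) G x) - deriv_torsion D (Y l) (Y l) G x f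
      - 2 * (\<Sum>Z\<in>vbasis. gR M x (torsion D (Y l) G x) (Z x) * Y l x (\<lambda>y. Z y f)))"
proof -
  note Yh = hframeD(2)[OF F(1)] and Yv = hframeD(3)[OF F(1)]
  have G: "G \<in> hor_fields M" unfolding G_def using f by simp
  note Gv = hor_fields_vfields[OF G]
  let ?\<phi> = "GammaH M f f"
  have \<phi>: "?\<phi> = (\<lambda>y. met M y (G y) (G y))" unfolding G_def by (rule ext) (rule GammaH_met[OF f f])
  have \<phi>C: "?\<phi> \<in> C_infinity M" by (rule GammaH_smooth[OF f f])
  have A\<phi>: "A y ?\<phi> = 2 * met M y (D A G y) (G y)" if "A \<in> vfields M" for A y
    unfolding \<phi> D_met[OF that G G]
    using met_sym[OF hor_fields_hor[OF D_hor[OF that G]] hor_fields_hor[OF G], of y] by simp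
  have "L ?\<phi> x = (\<Sum>l=1..d. 2 * (Y l x (\<lambda>y. met M y (D (Y l) G y) (G y)) - met M x (D (D (Y l) (Y l)) G x) (G x)))"
    unfolding laplacian_D[OF F \<phi>C]
  proof (rule sum.cong[OF refl])
    fix l assume l: "l \<in> {1..d}"
    have "Y l x (\<lambda>y. Y l y ?\<phi>) = Y l x (\<lambda>y. 2 * met M y (D (Y l) G y) (G y))"
      by (simp only: A\<phi>[OF Yv[OF l]])
    also have "\<dots> = 2 * Y l x (\<lambda>y. met M y (D (Y l) G y) (G y))"
      by (rule tangent_cmult[OF vfields_tangent[OF Yv[OF l]] met_smooth[OF D_hor[OF Yv[OF l] G] G]])
    finally show "Y l x (\<lambda>y. Y l y ?\<phi>) - D (Y l) (Y l) x ?\<phi> =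
      2 * (Y l x (\<lambda>y. met M y (D (Y l) G y) (G y)) - met M x (D (D (Y l) (Y l)) G x) (G x))"
      by (simp add: A\<phi>[OF D_vfields[OF Yv[OF l] Yv[OF l]]])
  qed
  moreover have "GammaH M f (L f) x = (\<Sum>l=1..d. met M x (D G (D (Y l) G) x) (Y l x) + met M x (D (Y l) G x) (D G (Y l) x))"
  proof -
    have "\<forall>\<^sub>F y in nhds x. y \<in> N" using F hframeD(1) eventually_nhds by blast
    then have ev: "\<forall>\<^sub>F y in nhds x. L f y = (\<Sum>l=1..d. met M y (D (Y l) G y) (Y l y))"
      unfolding G_def by eventually_elim (rule laplacian_hess[OF F(1) _ f])
    have sm: "(\<lambda>y. met M y (D (Y l) G y) (Y l y)) \<in> C_infinity M" if "l \<in> {1..d}" for l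
      by (rule met_smooth[OF D_hor[OF Yv[OF that] G] Yh[OF that]])
    have "GammaH M f (L f) x = G x (L f)" unfolding G_def by (rule GammaH_eq[OF f L_smooth[OF f]])
    also have "\<dots> = G x (\<lambda>y. \<Sum>l=1..d. met M y (D (Y l) G y) (Y l y))"
      by (rule tangent_germ[OF vfields_tangent[OF Gv] L_smooth[OF f] C_inf_sum[OF sm] ev])
    also have "\<dots> = (\<Sum>l=1..d. G x (\<lambda>y. met M y (D (Y l) G y) (Y l y)))"
      by (rule tangent_sum[OF vfields_tangent[OF Gv] sm])
    also have "\<dots> = (\<Sum>l=1..d. met M x (D G (D (Y l) G) x) (Y l x) + met M x (D (Y l) G x) (D G (Y l) x))"
      by (rule sum.cong[OF refl]) (rule D_met[OF Gv D_hor[OF Yv G] Yh])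
    finally show ?thesis .
  qed
  ultimately have "Gamma2 M L f x = (\<Sum>l=1..d. (Y l x (\<lambda>y. met M y (D (Y l) G y) (G y)) - met M x (D (D (Y l) (Y l)) G x) (G x)))
      - (\<Sum>l=1..d. met M x (D G (D (Y l) G) x) (Y l x) + met M x (D (Y l) G x) (D G (Y l) x))"
    unfolding Gamma2_def sum_distrib_left[symmetric] by simp
  also have "\<dots> = (\<Sum>l=1..d. met M x (curvature D (Y l) G G x) (Y l x)
      + met M x (D (Y l) G x) (D (Y l) G x) - deriv_torsion D (Y l) (Y l) G x f
      - 2 * (\<Sum>Z\<in>vbasis. gR M x (torsion D (Y l) G x) (Z x) * Y l x (\<lambda>y. Z y f))
      - (met M x (D (D G (Y l)) G x) (Y l x) + met M x (D (Y l) G x) (D G (Y l) x)))"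
    unfolding sum_subtractf[symmetric]
  proof (rule sum.cong[OF refl])
    fix l assume l: "l \<in> {1..d}"
    have T: "torsion D (Y l) G \<in> vfields M" "torsion D (Y l) G x \<in> vert_at M x"
      using Yv[OF l] Gv torsion_hor[OF Yh[OF l] G] by auto
    show "Y l x (\<lambda>y. met M y (D (Y l) G y) (G y)) - met M x (D (D (Y l) (Y l)) G x) (G x)
      - (met M x (D G (D (Y l) G) x) (Y l x) + met M x (D (Y l) G x) (D G (Y l) x)) =
      met M x (curvature D (Y l) G G x) (Y l x)
      + met M x (D (Y l) G x) (D (Y l) G x) - deriv_torsion D (Y l) (Y l) G x f
      - 2 * (\<Sum>Z\<in>vbasis. gR M x (torsion D (Y l) G x) (Z x) * Y l x (\<lambda>y. Z y f))
      - (met M x (D (D G (Y l)) G x) (Y l x) + met M x (D (Y l) G x) (D G (Y l) x))"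
      using bochner_term[OF Yh[OF l] f, of x] vert_second_deriv[OF Yh[OF l] T f]
      unfolding G_def[symmetric] by simp
  qed
  also have "\<dots> = (\<Sum>l=1..d. met M x (curvature D (Y l) G G x) (Y l x)
      + met M x (D (Y l) G x) (D (Y l) G x) - deriv_torsion D (Y l) (Y l) G x f
      - 2 * (\<Sum>Z\<in>vbasis. gR M x (torsion D (Y l) G x) (Z x) * Y l x (\<lambda>y. Z y f)))"
    using hess_skew_sum[OF F f Gv] unfolding G_def[symmetric] sum_subtractf by simp
  finally show ?thesis .
qed

lemma extend_vec:
  assumes "u \<in> tangent_space M x"
  shows "extend_vec M x u \<in> vfields M" "extend_vec M x u x = u"
proof -
  obtain Y N where F: "hframe Y N" "x \<in> N" by (rule ex_hframe)
  let ?U = "\<Sum>j\<in>frame_index. gR M x u (frame_field Y j x) *\<^sub>R frame_field Y j"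
  have "?U \<in> vfields M" by (rule vfields_sum, rule vfields_scale, rule frame_field_vfields[OF F(1)])
  moreover have "?U x = u" using tangent_expand[OF F assms] by (simp add: sum_fun_apply)
  ultimately have "\<exists>U. U \<in> vfields M \<and> U x = u" by blast
  from someI_ex[OF this] show "extend_vec M x u \<in> vfields M" "extend_vec M x u x = u"
    unfolding extend_vec_def by blast+
qed

text \<open>The basis chosen in \<open>trace_on\<close> is arbitrary. Expanding each
  \<open>\<Psi> j\<close> in it and exchanging the two sums gives the trace in the orthonormal
  frame.\<close>

lemma trace_on_frame:
  assumes F: "hframe Y N" "x \<in> N" and \<Psi>: "\<And>j. j \<in> frame_index \<Longrightarrow> \<Psi> j \<in> tangent_space M x"
    and \<Phi>: "\<And>u. u \<in> tangent_space M x \<Longrightarrow> \<Phi> u = (\<Sum>j\<in>frame_index. gR M x u (frame_field Y j x) *\<^sub>R \<Psi> j)"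
  shows "trace_on (tangent_space M x) \<Phi> = (\<Sum>j\<in>frame_index. gR M x (\<Psi> j) (frame_field Y j x))"
proof -
  let ?T = "tangent_space M x"
  let ?E = "\<lambda>j. frame_field Y j x"
  define B where "B = (SOME B. independent B \<and> span B = ?T)"
  have "\<exists>B. independent B \<and> span B = ?T"
    using orthonormal_independent(2)[OF gR_inner_product subspace_tangent frame_tangent[OF F(1)]
        frame_orthonormal[OF F] finite_frame_index] frame_span[OF F] by blast
  from someI_ex[OF this] have B: "independent B" "span B = ?T" unfolding B_def by blast+
  have BT: "b \<in> ?T" if "b \<in> B" for b using that B(2) span_base by blast
  have fB: "finite B"
    using independent_span_bound[of "?E ` frame_index" B] B frame_span[OF F] span_superset[of B] by simp
  have "trace_on ?T \<Phi> = (\<Sum>b\<in>B. representation B (\<Phi> b) b)"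
    unfolding trace_on_def Let_def B_def ..
  also have "\<dots> = (\<Sum>b\<in>B. \<Sum>j\<in>frame_index. gR M x b (?E j) * representation B (\<Psi> j) b)"
  proof (rule sum.cong[OF refl])
    fix b assume b: "b \<in> B"
    have "representation B (\<Phi> b) = (\<lambda>c. \<Sum>j\<in>frame_index. representation B (gR M x b (?E j) *\<^sub>R \<Psi> j) c)"
      unfolding \<Phi>[OF BT[OF b]]
      by (rule representation_sum[OF B(1)]) (use \<Psi> B(2) in \<open>auto intro: subspace_scale[OF subspace_tangent]\<close>)
    then show "representation B (\<Phi> b) b = (\<Sum>j\<in>frame_index. gR M x b (?E j) * representation B (\<Psi> j) b)"
      using \<Psi> B(2) by (simp add: representation_scale[OF B(1)])
  qed
  also have "\<dots> = (\<Sum>j\<in>frame_index. \<Sum>b\<in>B. gR M x b (?E j) * representation B (\<Psi> j) b)"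
    by (rule sum.swap)
  also have "\<dots> = (\<Sum>j\<in>frame_index. gR M x (\<Psi> j) (?E j))"
  proof (rule sum.cong[OF refl])
    fix j assume j: "j \<in> frame_index"
    have "(\<Sum>b\<in>B. representation B (\<Psi> j) b *\<^sub>R b) = \<Psi> j"
      by (rule sum_representation_eq[OF B(1) _ fB subset_refl]) (use \<Psi>[OF j] B(2) in simp)
    moreover have "gR M x (\<Sum>b\<in>B. representation B (\<Psi> j) b *\<^sub>R b) (?E j) =
      (\<Sum>b\<in>B. representation B (\<Psi> j) b * gR M x b (?E j))"
      by (rule inner_product_on_sum[OF gR_inner_product subspace_tangent BT frame_tangent[OF F(1) j]])
    ultimately show "(\<Sum>b\<in>B. gR M x b (?E j) * representation B (\<Psi> j) b) = gR M x (\<Psi> j) (?E j)"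
      by (simp add: mult.commute)
  qed
  finally show ?thesis .
qed

text \<open>The curvature maps the horizontal field \<open>W\<close> to a horizontal vector, so the
  vertical frame vectors drop out of the trace.\<close>

lemma ricci_frame:
  assumes F: "hframe Y N" "x \<in> N" and B: "B \<in> vfields M" and W: "W \<in> hor_fields M"
  shows "ricci M D B W x = (\<Sum>l=1..d. met M x (curvature D (Y l) B W x) (Y l x))"
proof -
  note Wv = hor_fields_vfields[OF W]
  let ?\<Psi> = "\<lambda>j. curvature D (frame_field Y j) B W x"
  have h: "?\<Psi> j \<in> hor M x" if "j \<in> frame_index" for j
    by (rule hor_fields_hor[OF curvature_hor[OF frame_field_vfields[OF F(1) that] B W]])
  have "ricci M D B W x = (\<Sum>j\<in>frame_index. gR M x (?\<Psi> j) (frame_field Y j x))"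
    unfolding ricci_def
  proof (rule trace_on_frame[OF F])
    show "?\<Psi> j \<in> tangent_space M x" if "j \<in> frame_index" for j by (rule hor_tangent[OF h[OF that]])
    fix u assume u: "u \<in> tangent_space M x"
    show "curvature D (extend_vec M x u) B W x = (\<Sum>j\<in>frame_index. gR M x u (frame_field Y j x) *\<^sub>R ?\<Psi> j)"
      using tensor_expand[OF tensor_curvature_1[OF B Wv] F extend_vec(1)[OF u]] extend_vec(2)[OF u] by simp
  qed
  moreover have "(\<Sum>Z\<in>vbasis. gR M x (?\<Psi> (Inr Z)) (Z x)) = 0"
  proof (rule sum.neutral, rule ballI)
    fix Z assume Z: "Z \<in> vbasis"
    have "Inr Z \<in> frame_index" unfolding frame_index_def using Z by (rule InrI)
    then show "gR M x (?\<Psi> (Inr Z)) (Z x) = 0" by (rule gR_hor_vert[OF h vbasis_in_vert[OF Z]])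
  qed
  moreover have "(\<Sum>l=1..d. gR M x (?\<Psi> (Inl l)) (Y l x)) = (\<Sum>l=1..d. met M x (curvature D (Y l) B W x) (Y l x))"
  proof (rule sum.cong[OF refl])
    fix l assume l: "l \<in> {1..d}"
    have "Inl l \<in> frame_index" unfolding frame_index_def using l by (rule InlI)
    from gR_hor[OF h[OF this] hor_fields_hor[OF hframeD(2)[OF F(1) l]]]
    show "gR M x (?\<Psi> (Inl l)) (Y l x) = met M x (curvature D (Y l) B W x) (Y l x)" by simp
  qed
  ultimately show ?thesis unfolding sum_frame_index by simp
qed

text \<open>Near \<open>x\<close>, \<open>V\<close> is a combination of basis fields with function
  coefficients, and the bracket of \<open>Z\<close> with \<open>c * U\<close> is
  \<open>c * [Z, U] + (Z c) * U\<close>, where \<open>[Z, U]\<close> is vertical as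
  \<open>vert M\<close> is a Lie algebra.\<close>

lemma vert_bracket:
  assumes Z: "Z \<in> vert M" and V: "V \<in> vfields M" "\<And>y. V y \<in> vert_at M y"
  shows "lie_bracket Z V x \<in> vert_at M x"
proof -
  obtain Y N where F: "hframe Y N" "x \<in> N" by (rule ex_hframe)
  note Zv = vert_vfields[OF Z]
  show ?thesis
  proof (rule smooth_coeffs[OF F])
    fix W assume W: "open W" "x \<in> W" "W \<subseteq> N"
      and co: "\<And>A. A \<in> vfields M \<Longrightarrow> \<exists>c. (\<forall>j\<in>frame_index. c j \<in> C_infinity M) \<and>
        (\<forall>y\<in>W. A y = (\<Sum>j\<in>frame_index. c j y *\<^sub>R frame_field Y j y))"
    obtain c where c: "\<And>j. j \<in> frame_index \<Longrightarrow> c j \<in> C_infinity M"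
      "\<And>y. y \<in> W \<Longrightarrow> V y = (\<Sum>j\<in>frame_index. c j y *\<^sub>R frame_field Y j y)" using co[OF V(1)] by blast
    have c0: "c (Inl i) y = 0" if i: "i \<in> {1..d}" and y: "y \<in> W" for i y
    proof -
      have yN: "y \<in> N" using y W by blast
      have j: "Inl i \<in> frame_index" unfolding frame_index_def using i by (rule InlI)
      have "gR M y (V y) (frame_field Y (Inl i) y) = c (Inl i) y"
        unfolding c(2)[OF y]
        by (rule orthonormal_coeff[OF gR_inner_product subspace_tangent frame_tangent[OF F(1)]
              frame_orthonormal[OF F(1) yN] finite_frame_index j])
      then show ?thesis using gR_vert_hor[OF hframeD(4)[OF F(1) i] V(2)[of y]] by simp
    qed
    have cC: "c (Inr U) \<in> C_infinity M" if "U \<in> vbasis" for U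
      by (rule c(1)) (use that in \<open>simp add: frame_index_def InrI\<close>)
    \<comment> \<open>Partial sums over subsets of \<open>vbasis\<close>, for induction on the
      finite set.\<close>
    define B where "B = (\<lambda>S. \<Sum>U\<in>S. (\<lambda>y. c (Inr U) y *\<^sub>R U y))"
    have cU: "(\<lambda>y. c (Inr U) y *\<^sub>R U y) \<in> vfields M" if "U \<in> vbasis" for U
      by (rule vfields_mult[OF cC[OF that] vert_vfields[OF vbasis_in_vert[OF that]]])
    have "lie_bracket Z (B S) x \<in> vert_at M x \<and> B S \<in> vfields M" if "finite S" "S \<subseteq> vbasis" for S
      using that
    proof (induction S rule: finite_induct)
      case empty
      have "B {} = 0" by (simp add: B_def)
      moreover have "lie_bracket Z 0 x = 0"
        using tangent_const[OF vfields_tangent[OF Zv, of x], of 0] by (simp add: fun_eq_iff lie_bracket_def)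
      ultimately show ?case using subspace_0[OF subspace_vert_at] vfields_zero by metis
    next
      case (insert U S)
      have U: "U \<in> vbasis" using insert.prems by simp
      have IH: "lie_bracket Z (B S) x \<in> vert_at M x" "B S \<in> vfields M" using insert by auto
      have eq: "B (insert U S) = (\<lambda>y. c (Inr U) y *\<^sub>R U y) + B S"
        unfolding B_def by (rule sum.insert[OF insert.hyps])
      have UM: "U \<in> vert M" using U by blast
      have "lie_bracket Z (\<lambda>y. c (Inr U) y *\<^sub>R U y) x = c (Inr U) x *\<^sub>R lie_bracket Z U x + Z x (c (Inr U)) *\<^sub>R U x"
        unfolding lie_bracket_mult_right'[OF vert_vfields[OF UM] Zv cC[OF U]] by simp
      moreover have "lie_bracket Z U \<in> vert M" using transverse Z UM unfolding transverse_symmetries_def by blast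
      then have "lie_bracket Z U x \<in> vert_at M x" "U x \<in> vert_at M x" using UM unfolding vert_at_def by blast+
      ultimately have "lie_bracket Z (\<lambda>y. c (Inr U) y *\<^sub>R U y) x \<in> vert_at M x"
        by (simp add: subspace_add[OF subspace_vert_at] subspace_scale[OF subspace_vert_at])
      then have "lie_bracket Z (B (insert U S)) x \<in> vert_at M x"
        unfolding eq lie_bracket_add_right[OF cU[OF U] IH(2) Zv]
        using subspace_add[OF subspace_vert_at _ IH(1)] by simp
      moreover have "B (insert U S) \<in> vfields M" unfolding eq by (rule vfields_add[OF cU[OF U] IH(2)])
      ultimately show ?case by blast
    qed
    from this[OF finite_vbasis subset_refl]
    have Bv: "lie_bracket Z (B vbasis) x \<in> vert_at M x" "B vbasis \<in> vfields M" by blast+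
    have eqW: "V y = B vbasis y" if y: "y \<in> W" for y
    proof -
      have "(\<Sum>i=1..d. c (Inl i) y *\<^sub>R Y i y) = 0"
        by (rule sum.neutral) (use c0[OF _ y] in \<open>simp del: One_nat_def\<close>)
      then show ?thesis unfolding c(2)[OF y] sum_frame_index by (simp add: B_def sum_fun_apply)
    qed
    have "\<forall>\<^sub>F y in nhds x. y \<in> W" using W eventually_nhds by blast
    then have ev: "\<forall>\<^sub>F y in nhds x. V y = B vbasis y" by (rule eventually_mono) (rule eqW)
    have "lie_bracket Z V x = lie_bracket Z (B vbasis) x"
      by (rule lie_bracket_germ[OF Zv V(1) Zv Bv(2) _ ev]) simp
    then show ?thesis using Bv(1) by simp
  qed
qed

text \<open>The algebraic Bianchi identity for one vertical and two horizontal arguments: the difference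
  of the two sides is horizontal, while Jacobi's identity shows that it is vertical.\<close>

lemma curvature_vert_sym:
  assumes Z: "Z \<in> vert M" and A: "A \<in> hor_fields M" and B: "B \<in> hor_fields M"
  shows "curvature D Z A B x = curvature D Z B A x"
proof -
  note Zv = vert_vfields[OF Z] and Av = hor_fields_vfields[OF A] and Bv = hor_fields_vfields[OF B]
  define A' where "A' = lie_bracket Z A"
  define B' where "B' = lie_bracket Z B"
  have DZ: "D Z A = A'" "D Z B = B'" unfolding A'_def B'_def by (rule D_vert_hor(1)[OF Z A] D_vert_hor(1)[OF Z B])+
  have A': "A' \<in> hor_fields M" and B': "B' \<in> hor_fields M"
    using D_vert_hor(2)[OF Z A] D_vert_hor(2)[OF Z B] DZ by simp_all
  define H where "H = D A B - D B A"
  define V where "V = torsion D A B"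
  have DAB: "D A B \<in> hor_fields M" "D B A \<in> hor_fields M" by (rule D_hor_hor[OF A B] D_hor_hor[OF B A])+
  have H: "H \<in> hor_fields M"
    using DAB unfolding H_def hor_fields_def by (auto intro: subspace_diff[OF subspace_hor])
  have Vv: "V \<in> vfields M" unfolding V_def using Av Bv by blast
  have AB: "lie_bracket A B = H - V" by (simp add: H_def V_def torsion_def)
  have Vvert: "V y \<in> vert_at M y" for y unfolding V_def by (rule torsion_hor[OF A B])
  have "lie_bracket Z (H - V) = lie_bracket Z H + lie_bracket Z (- V)"
    using lie_bracket_add_right[OF hor_fields_vfields[OF H] vfields_minus[OF Vv] Zv] by simp
  moreover have "lie_bracket Z (- V) = - lie_bracket Z V"
  proof (rule ext, rule ext)
    fix y f
    have "Z y (\<lambda>y. - V y f) = - Z y (\<lambda>y. V y f)" if "f \<in> C_infinity M"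
      by (rule tangent_minus[OF vfields_tangent[OF Zv] vfields_smooth[OF Vv that]])
    moreover have "lie_bracket Z (- V) y f = (- lie_bracket Z V) y f" if "f \<notin> C_infinity M"
    proof -
      have "(- lie_bracket Z V) y f = 0" "lie_bracket Z (- V) y f = 0"
        using tangent_nonsmooth[OF vfields_tangent[OF vfields_lie_bracket[OF Zv Vv]] that]
          tangent_nonsmooth[OF vfields_tangent[OF vfields_lie_bracket[OF Zv vfields_minus[OF Vv]]] that]
        by simp_all
      then show ?thesis by simp
    qed
    ultimately show "lie_bracket Z (- V) y f = (- lie_bracket Z V) y f"
      by (cases "f \<in> C_infinity M") (auto simp: lie_bracket_def)
  qed
  ultimately have ZH: "lie_bracket Z H = lie_bracket A' B + lie_bracket A B' + lie_bracket Z V"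
    using jacobi_identity[OF Zv Av Bv] unfolding AB A'_def[symmetric] B'_def[symmetric]
    by (simp add: algebra_simps)
  have DZH: "D Z (D A B) - D Z (D B A) = lie_bracket Z H"
    using D_diff_right[OF Zv hor_fields_vfields[OF DAB(1)] hor_fields_vfields[OF DAB(2)]] D_vert_hor(1)[OF Z H]
    by (simp add: H_def)
  have e1: "D A B' - D B' A = lie_bracket A B' + torsion D A B'" by (simp add: torsion_def)
  have e2: "D B A' - D A' B = - lie_bracket A' B + torsion D B A'"
    using lie_bracket_skew[of B A'] by (simp add: torsion_def)
  \<comment> \<open>On horizontal fields \<open>D Z\<close> is the bracket with \<open>Z\<close>, so
    the brackets of horizontal fields cancel by Jacobi's identity. The bracket of \<open>Z\<close>
    with the torsion and two torsion terms survive, all vertical.\<close>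
  have "curvature D Z A B - curvature D Z B A =
    (D Z (D A B) - D Z (D B A)) - (D A B' - D B' A) + (D B A' - D A' B)"
    unfolding curvature_def DZ A'_def[symmetric] B'_def[symmetric] by (simp add: algebra_simps)
  also have "\<dots> = lie_bracket Z V - torsion D A B' + torsion D B A'"
    unfolding DZH e1 e2 ZH by (simp add: algebra_simps)
  finally have "curvature D Z A B x - curvature D Z B A x = lie_bracket Z V x - torsion D A B' x + torsion D B A' x"
    by (simp add: fun_eq_iff)
  then have "curvature D Z A B x - curvature D Z B A x \<in> vert_at M x"
    using vert_bracket[OF Z Vv Vvert] torsion_hor[OF A B'] torsion_hor[OF B A']
    by (simp add: subspace_add[OF subspace_vert_at] subspace_diff[OF subspace_vert_at])
  moreover have "curvature D Z A B x - curvature D Z B A x \<in> hor M x"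
    by (rule subspace_diff[OF subspace_hor hor_fields_hor[OF curvature_hor[OF Zv Av B]] hor_fields_hor[OF curvature_hor[OF Zv Bv A]]])
  ultimately have "curvature D Z A B x - curvature D Z B A x = 0" using hor_vert_disjoint by blast
  then show ?thesis by simp
qed

text \<open>The commutator of \<open>A\<close> and \<open>B\<close> applied to the squared length of
  \<open>C\<close>, with metric compatibility used twice; the products of first derivatives cancel
  by symmetry of the metric.\<close>

lemma curvature_metric:
  assumes A: "A \<in> vfields M" and B: "B \<in> vfields M" and C: "C \<in> hor_fields M"
  shows "met M x (curvature D A B C x) (C x) = 0"
proof -
  note h = hor_fields_hor[OF C, of x]
  have DC: "D W C \<in> hor_fields M" if "W \<in> vfields M" for W by (rule D_hor[OF that C])
  have u: "W y (\<lambda>y. met M y (C y) (C y)) = 2 * met M y (D W C y) (C y)" if "W \<in> vfields M" for W y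
    unfolding D_met[OF that C C] using met_sym[OF hor_fields_hor[OF DC[OF that]] hor_fields_hor[OF C], of y] by simp
  have uu: "W' x (\<lambda>y. W y (\<lambda>y. met M y (C y) (C y))) = 2 * (met M x (D W' (D W C) x) (C x) + met M x (D W C x) (D W' C x))"
    if "W \<in> vfields M" "W' \<in> vfields M" for W W'
    unfolding u[OF that(1)] tangent_cmult[OF vfields_tangent[OF that(2)] met_smooth[OF DC[OF that(1)] C]]
      D_met[OF that(2) DC[OF that(1)] C] ..
  have "lie_bracket A B x (\<lambda>y. met M y (C y) (C y)) =
      A x (\<lambda>y. B y (\<lambda>y. met M y (C y) (C y))) - B x (\<lambda>y. A y (\<lambda>y. met M y (C y) (C y)))"
    by (simp add: lie_bracket_def)
  then have "met M x (D (lie_bracket A B) C x) (C x) =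
      met M x (D A (D B C) x) (C x) - met M x (D B (D A C) x) (C x)"
    unfolding uu[OF A B] uu[OF B A] u[OF vfields_lie_bracket[OF A B]]
    using met_sym[OF hor_fields_hor[OF DC[OF A]] hor_fields_hor[OF DC[OF B]], of x] by simp
  moreover have "met M x (curvature D A B C x) (C x) =
      met M x (D A (D B C) x) (C x) - met M x (D B (D A C) x) (C x) - met M x (D (lie_bracket A B) C x) (C x)"
    unfolding curvature_def
    using hor_fields_hor[OF D_hor[OF A DC[OF B]]] hor_fields_hor[OF D_hor[OF B DC[OF A]]]
      hor_fields_hor[OF DC[OF vfields_lie_bracket[OF A B]]] h
    by (simp add: met_diff_left subspace_diff[OF subspace_hor])
  ultimately show ?thesis by simp
qed

text \<open>The function \<open>Z f\<close> has horizontal gradient \<open>D Z\<close> of the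
  gradient of \<open>f\<close>. Commuting \<open>D Z\<close> with the frame derivatives costs the
  curvature in \<open>Z\<close> and \<open>Y l\<close>, which \<open>curvature_vert_sym\<close>
  turns into an expression with \<open>Y l\<close> in both metric slots, so that
  \<open>curvature_metric\<close> annihilates it. The terms from moving the frame vanish by
  \<open>hess_skew_sum\<close>.\<close>

lemma vert_laplacian_commute:
  assumes Z: "Z \<in> vert M" and f: "f \<in> C_infinity M"
  shows "L (\<lambda>y. Z y f) x = Z x (L f)"
proof -
  obtain Y N where F: "hframe Y N" "x \<in> N" by (rule ex_hframe)
  note Yh = hframeD(2)[OF F(1)] and Yv = hframeD(3)[OF F(1)] and Zv = vert_vfields[OF Z]
  let ?G = "grad_hor M f"
  have G: "?G \<in> hor_fields M" using f by simp
  note Zf = vfields_smooth[OF Zv f]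
  have vh: "met M y (D Z ?G y) (B y) = B y (\<lambda>y. Z y f)" if B: "B \<in> hor_fields M" for B y
    unfolding hess_eq[OF Zv B f] D_vert_hor(1)[OF Z B] by (simp add: lie_bracket_def)
  have DZG: "D Z ?G \<in> hor_fields M" by (rule D_hor[OF Zv G])
  have YG: "D (Y l) ?G \<in> hor_fields M" if "l \<in> {1..d}" for l by (rule D_hor[OF Yv[OF that] G])
  have "L (\<lambda>y. Z y f) x = (\<Sum>l=1..d. met M x (D (Y l) (D Z ?G) x) (Y l x))"
    unfolding laplacian_D[OF F Zf]
  proof (rule sum.cong[OF refl])
    fix l assume l: "l \<in> {1..d}"
    have "Y l x (\<lambda>y. Y l y (\<lambda>y. Z y f)) = Y l x (\<lambda>y. met M y (D Z ?G y) (Y l y))"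
      by (simp only: vh[OF Yh[OF l]])
    also have "\<dots> = met M x (D (Y l) (D Z ?G) x) (Y l x) + met M x (D Z ?G x) (D (Y l) (Y l) x)"
      by (rule D_met[OF Yv[OF l] DZG Yh[OF l]])
    finally show "Y l x (\<lambda>y. Y l y (\<lambda>y. Z y f)) - D (Y l) (Y l) x (\<lambda>y. Z y f) = met M x (D (Y l) (D Z ?G) x) (Y l x)"
      using vh[OF D_hor[OF Yv[OF l] Yh[OF l]], of x] by simp
  qed
  also have "\<dots> = (\<Sum>l=1..d. met M x (D Z (D (Y l) ?G) x) (Y l x) - met M x (D (D Z (Y l)) ?G x) (Y l x))"
  proof (rule sum.cong[OF refl])
    fix l assume l: "l \<in> {1..d}"
    have h: "D Z (D (Y l) ?G) x \<in> hor M x" "D (Y l) (D Z ?G) x \<in> hor M x" "D (D Z (Y l)) ?G x \<in> hor M x" "Y l x \<in> hor M x"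
      by (rule hor_fields_hor, rule D_hor[OF Zv YG[OF l]], rule hor_fields_hor, rule D_hor[OF Yv[OF l] DZG],
          rule hor_fields_hor, rule D_hor[OF D_vfields[OF Zv Yv[OF l]] G], rule hor_fields_hor[OF Yh[OF l]])
    have "met M x (curvature D Z (Y l) ?G x) (Y l x) = met M x (curvature D Z ?G (Y l) x) (Y l x)"
      by (simp only: curvature_vert_sym[OF Z Yh[OF l] G])
    also have "\<dots> = 0" by (rule curvature_metric[OF Zv hor_fields_vfields[OF G] Yh[OF l]])
    finally have "met M x (curvature D Z (Y l) ?G x) (Y l x) = 0" .
    moreover have "curvature D Z (Y l) ?G x = D Z (D (Y l) ?G) x - D (Y l) (D Z ?G) x - D (D Z (Y l)) ?G x"
      by (simp add: curvature_def D_vert_hor(1)[OF Z Yh[OF l]])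
    ultimately show "met M x (D (Y l) (D Z ?G) x) (Y l x) =
      met M x (D Z (D (Y l) ?G) x) (Y l x) - met M x (D (D Z (Y l)) ?G x) (Y l x)"
      using h by (simp add: met_diff_left subspace_diff[OF subspace_hor])
  qed
  also have "\<dots> = (\<Sum>l=1..d. met M x (D Z (D (Y l) ?G) x) (Y l x) + met M x (D (Y l) ?G x) (D Z (Y l) x))"
    using hess_skew_sum[OF F f Zv] by (simp add: sum.distrib sum_subtractf)
  also have "\<dots> = Z x (L f)"
  proof -
    have "\<forall>\<^sub>F y in nhds x. y \<in> N" using F hframeD(1) eventually_nhds by blast
    then have ev: "\<forall>\<^sub>F y in nhds x. L f y = (\<Sum>l=1..d. met M y (D (Y l) ?G y) (Y l y))"
      by eventually_elim (rule laplacian_hess[OF F(1) _ f])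
    have sm: "(\<lambda>y. met M y (D (Y l) ?G y) (Y l y)) \<in> C_infinity M" if "l \<in> {1..d}" for l
      by (rule met_smooth[OF YG[OF that] Yh[OF that]])
    have "Z x (L f) = Z x (\<lambda>y. \<Sum>l=1..d. met M y (D (Y l) ?G y) (Y l y))"
      by (rule tangent_germ[OF vfields_tangent[OF Zv] L_smooth[OF f] C_inf_sum[OF sm] ev])
    also have "\<dots> = (\<Sum>l=1..d. Z x (\<lambda>y. met M y (D (Y l) ?G y) (Y l y)))"
      by (rule tangent_sum[OF vfields_tangent[OF Zv] sm])
    also have "\<dots> = (\<Sum>l=1..d. met M x (D Z (D (Y l) ?G) x) (Y l x) + met M x (D (Y l) ?G x) (D Z (Y l) x))"
      by (rule sum.cong[OF refl]) (rule D_met[OF Zv YG Yh])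
    finally show ?thesis by simp
  qed
  finally show ?thesis .
qed

text \<open>The product rule for \<open>L\<close> on the squares of \<open>Z f\<close> gives carre
  du champ terms and products with \<open>L (Z f)\<close>; commutation with \<open>L\<close> makes
  the latter cancel against \<open>GammaZ M f (L f)\<close>.\<close>

lemma gamma2Z_formula:
  assumes F: "hframe Y N" "x \<in> N" and f: "f \<in> C_infinity M"
  shows "Gamma2Z M L f x = (\<Sum>l=1..d. \<Sum>Z\<in>vbasis. (Y l x (\<lambda>y. Z y f))\<^sup>2)"
proof -
  have Zf: "(\<lambda>y. Z y f) \<in> C_infinity M" if "Z \<in> vbasis" for Z
    by (rule vfields_smooth[OF vert_vfields[OF vbasis_in_vert[OF that]] f])
  have "GammaZ M f f = (\<lambda>y. \<Sum>Z\<in>vbasis. Z y f * Z y f)" by (rule ext) (rule GammaZ_eq[OF f f])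
  moreover have "L (\<lambda>y. \<Sum>Z\<in>vbasis. Z y f * Z y f) = (\<lambda>y. \<Sum>Z\<in>vbasis. L (\<lambda>y. Z y f * Z y f) y)"
    by (rule L_sum[OF finite_vbasis]) (rule C_inf_mult[OF Zf Zf])
  ultimately have "L (GammaZ M f f) x = (\<Sum>Z\<in>vbasis. L (\<lambda>y. Z y f * Z y f) x)" by simp
  also have "\<dots> = (\<Sum>Z\<in>vbasis. 2 * (Z x f * Z x (L f)) + 2 * GammaH M (\<lambda>y. Z y f) (\<lambda>y. Z y f) x)"
    by (rule sum.cong[OF refl])
      (simp add: L_mult[OF Zf Zf] vert_laplacian_commute[OF vbasis_in_vert f])
  also have "\<dots> = 2 * GammaZ M f (L f) x + 2 * (\<Sum>Z\<in>vbasis. GammaH M (\<lambda>y. Z y f) (\<lambda>y. Z y f) x)"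
    unfolding GammaZ_eq[OF f L_smooth[OF f]] by (simp add: sum.distrib sum_distrib_left)
  finally have "Gamma2Z M L f x = (\<Sum>Z\<in>vbasis. GammaH M (\<lambda>y. Z y f) (\<lambda>y. Z y f) x)"
    by (simp add: Gamma2Z_def)
  also have "\<dots> = (\<Sum>Z\<in>vbasis. \<Sum>l=1..d. (Y l x (\<lambda>y. Z y f))\<^sup>2)"
    by (rule sum.cong[OF refl]) (simp add: GammaH_frame[OF F Zf Zf] power2_eq_square)
  also have "\<dots> = (\<Sum>l=1..d. \<Sum>Z\<in>vbasis. (Y l x (\<lambda>y. Z y f))\<^sup>2)" by (rule sum.swap)
  finally show ?thesis .
qed

text \<open>Symmetric and antisymmetric parts of a matrix are orthogonal. The second part will be
  the torsion term with factor 1/4 in \<open>R_form\<close>.\<close>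

lemma sum_square_decomposition:
  fixes H :: "nat \<Rightarrow> nat \<Rightarrow> real"
  shows "(\<Sum>l=1..d. \<Sum>k=1..d. (H l k)\<^sup>2) =
    (\<Sum>l=1..d. \<Sum>k=1..d. ((H l k + H k l) / 2)\<^sup>2) + (\<Sum>l=1..d. \<Sum>k=1..d. 1 / 4 * (H k l - H l k)\<^sup>2)"
proof -
  have "2 * (\<Sum>l=1..d. \<Sum>k=1..d. (H l k)\<^sup>2) = (\<Sum>l=1..d. \<Sum>k=1..d. (H l k)\<^sup>2) + (\<Sum>l=1..d. \<Sum>k=1..d. (H k l)\<^sup>2)"
    using sum.swap[of "\<lambda>l k. (H l k)\<^sup>2" "{1..d}" "{1..d}"] by simp
  also have "\<dots> = (\<Sum>l=1..d. \<Sum>k=1..d. 2 * ((H l k + H k l) / 2)\<^sup>2 + 2 * (1 / 4 * (H k l - H l k)\<^sup>2))"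
    unfolding sum.distrib[symmetric]
    by (intro sum.cong refl) (simp add: power2_eq_square field_simps)
  also have "\<dots> = 2 * (\<Sum>l=1..d. \<Sum>k=1..d. ((H l k + H k l) / 2)\<^sup>2) + 2 * (\<Sum>l=1..d. \<Sum>k=1..d. 1 / 4 * (H k l - H l k)\<^sup>2)"
    by (simp only: sum.distrib sum_distrib_left)
  finally show ?thesis by linarith
qed

lemma gamma2_formula:
  assumes F: "hframe Y N" "x \<in> N" and f: "f \<in> C_infinity M"
  defines "G \<equiv> grad_hor M f"
  defines "H \<equiv> \<lambda>l k. met M x (D (Y l) G x) (Y k x)"
  shows "Gamma2 M L f x = (\<Sum>l=1..d. \<Sum>k=1..d. ((H l k + H k l) / 2)\<^sup>2) + R_form M D d Y f x
      - 2 * (\<Sum>l=1..d. \<Sum>Z\<in>vbasis. gR M x (torsion D (Y l) G x) (Z x) * Y l x (\<lambda>y. Z y f))"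
proof -
  note Yh = hframeD(2)[OF F(1)] and Yv = hframeD(3)[OF F(1)]
  have G: "G \<in> hor_fields M" unfolding G_def using f by simp
  note Gv = hor_fields_vfields[OF G]
  have "(\<Sum>l=1..d. met M x (D (Y l) G x) (D (Y l) G x)) = (\<Sum>l=1..d. \<Sum>k=1..d. (H l k)\<^sup>2)"
    unfolding H_def
  proof (rule sum.cong[OF refl])
    fix l assume l: "l \<in> {1..d}"
    have h: "D (Y l) G x \<in> hor M x" by (rule hor_fields_hor[OF D_hor[OF Yv[OF l] G]])
    show "met M x (D (Y l) G x) (D (Y l) G x) = (\<Sum>k=1..d. (met M x (D (Y l) G x) (Y k x))\<^sup>2)"
      unfolding power2_eq_square by (rule met_expand[OF F h h])
  qed
  also have "\<dots> = (\<Sum>l=1..d. \<Sum>k=1..d. ((H l k + H k l) / 2)\<^sup>2) + (\<Sum>l=1..d. \<Sum>k=1..d. 1 / 4 * (H k l - H l k)\<^sup>2)"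
    by (rule sum_square_decomposition)
  also have "(\<Sum>l=1..d. \<Sum>k=1..d. 1 / 4 * (H k l - H l k)\<^sup>2) = (\<Sum>l=1..d. \<Sum>k=1..d. 1 / 4 * (torsion D (Y l) (Y k) x f)\<^sup>2)"
  proof (intro sum.cong refl)
    fix l k assume "l \<in> {1..d}" "k \<in> {1..d}"
    then have "H k l - H l k = torsion D (Y l) (Y k) x f"
      unfolding H_def G_def using hess_sym[OF Yh Yh f, of l k x] by simp
    then show "1 / 4 * (H k l - H l k)\<^sup>2 = 1 / 4 * (torsion D (Y l) (Y k) x f)\<^sup>2" by simp
  qed
  finally have sq: "(\<Sum>l=1..d. met M x (D (Y l) G x) (D (Y l) G x)) =
    (\<Sum>l=1..d. \<Sum>k=1..d. ((H l k + H k l) / 2)\<^sup>2) + (\<Sum>l=1..d. \<Sum>k=1..d. 1 / 4 * (torsion D (Y l) (Y k) x f)\<^sup>2)" .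
  have dT: "(\<Sum>l=1..d. deriv_torsion D (Y l) (Y l) G x f) =
    (\<Sum>l=1..d. \<Sum>k=1..d. deriv_torsion D (Y l) (Y l) (Y k) x f * Y k x f)"
  proof (rule sum.cong[OF refl])
    fix l assume l: "l \<in> {1..d}"
    have "deriv_torsion D (Y l) (Y l) G x = (\<Sum>k=1..d. met M x (G x) (Y k x) *\<^sub>R deriv_torsion D (Y l) (Y l) (Y k) x)"
      by (rule tensor_expand_hor[OF tensor_deriv_torsion(3)[OF Yv[OF l] Yv[OF l]] F Gv hor_fields_hor[OF G]])
    then have "deriv_torsion D (Y l) (Y l) G x f = (\<Sum>k=1..d. met M x (G x) (Y k x) * deriv_torsion D (Y l) (Y l) (Y k) x f)"
      by (simp add: sum_fun_apply)
    also have "\<dots> = (\<Sum>k=1..d. deriv_torsion D (Y l) (Y l) (Y k) x f * Y k x f)"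
      unfolding G_def by (rule sum.cong[OF refl]) (simp add: met_grad_hor[OF f hframeD(4)[OF F(1)]] del: One_nat_def)
    finally show "deriv_torsion D (Y l) (Y l) G x f = (\<Sum>k=1..d. deriv_torsion D (Y l) (Y l) (Y k) x f * Y k x f)" .
  qed
  have R: "R_form M D d Y f x = (\<Sum>l=1..d. met M x (curvature D (Y l) G G x) (Y l x))
      - (\<Sum>l=1..d. \<Sum>k=1..d. deriv_torsion D (Y l) (Y l) (Y k) x f * Y k x f)
      + (\<Sum>l=1..d. \<Sum>k=1..d. 1 / 4 * (torsion D (Y l) (Y k) x f)\<^sup>2)"
    unfolding R_form_def G_def[symmetric] ricci_frame[OF F Gv G]
    by (simp add: sum.distrib sum_negf sum_subtractf)
  have "Gamma2 M L f x = (\<Sum>l=1..d. met M x (curvature D (Y l) G G x) (Y l x))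
      + (\<Sum>l=1..d. met M x (D (Y l) G x) (D (Y l) G x)) - (\<Sum>l=1..d. deriv_torsion D (Y l) (Y l) G x f)
      - 2 * (\<Sum>l=1..d. \<Sum>Z\<in>vbasis. gR M x (torsion D (Y l) G x) (Z x) * Y l x (\<lambda>y. Z y f))"
    unfolding gamma2_bochner[OF F f] G_def[symmetric] by (simp add: sum.distrib sum_subtractf sum_distrib_left)
  then show ?thesis unfolding sq dT R by simp
qed

text \<open>The torsion of horizontal fields is vertical, so its squared length needs only the
  vertical frame coefficients.\<close>

lemma T_form_eq:
  assumes F: "hframe Y N" "x \<in> N" and f: "f \<in> C_infinity M"
  shows "T_form M D d Y f x = (\<Sum>l=1..d. \<Sum>Z\<in>vbasis. (gR M x (torsion D (Y l) (grad_hor M f) x) (Z x))\<^sup>2)"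
  unfolding T_form_def
proof (rule sum.cong[OF refl])
  fix l assume l: "l \<in> {1..d}"
  let ?t = "torsion D (Y l) (grad_hor M f) x"
  have G: "grad_hor M f \<in> hor_fields M" using f by simp
  have tT: "?t \<in> tangent_space M x"
    by (rule vfields_tangent[OF torsion_vfields[OF hframeD(3)[OF F(1) l] hor_fields_vfields[OF G]]])
  have tv: "?t \<in> vert_at M x" by (rule torsion_hor[OF hframeD(2)[OF F(1) l] G])
  have "gR M x ?t ?t = gR M x (\<Sum>j\<in>frame_index. gR M x ?t (frame_field Y j x) *\<^sub>R frame_field Y j x) ?t"
    using tangent_expand[OF F tT] by simp
  also have "\<dots> = (\<Sum>j\<in>frame_index. gR M x ?t (frame_field Y j x) * gR M x (frame_field Y j x) ?t)"
    by (rule inner_product_on_sum[OF gR_inner_product subspace_tangent frame_tangent[OF F(1)] tT])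
  also have "\<dots> = (\<Sum>j\<in>frame_index. (gR M x ?t (frame_field Y j x))\<^sup>2)"
    by (rule sum.cong[OF refl])
      (simp add: inner_product_on_sym[OF gR_inner_product frame_tangent[OF F(1)] tT] power2_eq_square)
  also have "\<dots> = (\<Sum>Z\<in>vbasis. (gR M x ?t (Z x))\<^sup>2)"
  proof -
    have "(\<Sum>i=1..d. (gR M x ?t (Y i x))\<^sup>2) = 0"
      by (rule sum.neutral) (simp add: gR_vert_hor[OF hframeD(4)[OF F(1)] tv] del: One_nat_def)
    then show ?thesis unfolding sum_frame_index by simp
  qed
  finally show "gR M x ?t ?t = (\<Sum>Z\<in>vbasis. (gR M x ?t (Z x))\<^sup>2)" .
qed

section \<open>The curvature-dimension inequality\<close>

lemma deriv_torsion_cong: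
  assumes "A \<in> vfields M" "B \<in> vfields M" "C \<in> vfields M" "A' \<in> vfields M" "B' \<in> vfields M" "C' \<in> vfields M"
    "A x = A' x" "B x = B' x" "C x = C' x"
  shows "deriv_torsion D A B C x = deriv_torsion D A' B' C' x"
proof -
  have "deriv_torsion D A B C x = deriv_torsion D A' B C x"
    by (rule tensor_cong[OF tensor_deriv_torsion(1)[OF assms(2,3)] assms(1,4,7)])
  also have "\<dots> = deriv_torsion D A' B' C x"
    by (rule tensor_cong[OF tensor_deriv_torsion(2)[OF assms(4,3)] assms(2,5,8)])
  also have "\<dots> = deriv_torsion D A' B' C' x"
    by (rule tensor_cong[OF tensor_deriv_torsion(3)[OF assms(4,5)] assms(3,6,9)])
  finally show ?thesis .
qed

lemma torsion_cong:
  assumes "A \<in> vfields M" "B \<in> vfields M" "A' \<in> vfields M" "B' \<in> vfields M" "A x = A' x" "B x = B' x"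
  shows "torsion D A B x = torsion D A' B' x"
  using tensor_cong[OF tensor_torsion_left[OF assms(2)] assms(1,3,5)]
    tensor_cong[OF tensor_torsion_right[OF assms(3)] assms(2,4,6)] by simp

text \<open>Although \<open>deriv_torsion\<close> differentiates its arguments, it is tensorial, so
  agreement of the frames at the single point \<open>x\<close> suffices.\<close>

lemma forms_frame_cong:
  assumes "\<And>i. i \<in> {1..d} \<Longrightarrow> X i \<in> vfields M" "\<And>i. i \<in> {1..d} \<Longrightarrow> Y i \<in> vfields M"
    "\<And>i. i \<in> {1..d} \<Longrightarrow> X i x = Y i x" and f: "f \<in> C_infinity M"
  shows "R_form M D d X f x = R_form M D d Y f x" "T_form M D d X f x = T_form M D d Y f x"
proof -
  have "deriv_torsion D (X l) (X l) (X k) x = deriv_torsion D (Y l) (Y l) (Y k) x"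
    "torsion D (X l) (X k) x = torsion D (Y l) (Y k) x" if "l \<in> {1..d}" "k \<in> {1..d}" for l k
    by (rule deriv_torsion_cong torsion_cong; (rule assms(1) assms(2) assms(3), rule that))+
  then show "R_form M D d X f x = R_form M D d Y f x"
    unfolding R_form_def using assms(3) by (intro arg_cong2[where f = plus] sum.cong refl) simp_all
  have G: "grad_hor M f \<in> vfields M" using hor_fields_vfields[OF grad_hor_field[OF f]] .
  have "torsion D (X l) (grad_hor M f) x = torsion D (Y l) (grad_hor M f) x" if "l \<in> {1..d}" for l
    by (rule torsion_cong[OF assms(1)[OF that] G assms(2)[OF that] G assms(3)[OF that] refl])
  then show "T_form M D d X f x = T_form M D d Y f x"
    unfolding T_form_def by (intro sum.cong refl) simp
qed

lemma grad_hor_cong: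
  assumes "f \<in> C_infinity M" "g \<in> C_infinity M" "\<And>v. v \<in> tangent_space M x \<Longrightarrow> v f = v g"
  shows "grad_hor M f x = grad_hor M g x"
proof -
  obtain Y N where F: "hframe Y N" "x \<in> N" by (rule ex_hframe)
  show ?thesis
    unfolding grad_hor_eq[OF F assms(1)] grad_hor_eq[OF F assms(2)]
    by (rule sum.cong[OF refl]) (simp only: assms(3)[OF vfields_tangent[OF hframeD(3)[OF F(1)]]])
qed

text \<open>All these quantities are pointwise algebraic in first derivatives of the function at
  \<open>x\<close>. They therefore survive a perturbation of second order, unlike \<open>L\<close>,
  \<open>Gamma2\<close> and \<open>Gamma2Z\<close>.\<close>

lemma first_order_cong:
  assumes F: "hframe Y N" "x \<in> N" and f: "f \<in> C_infinity M" and g: "g \<in> C_infinity M"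
    and fg: "\<And>v. v \<in> tangent_space M x \<Longrightarrow> v f = v g"
  shows "GammaH M f f x = GammaH M g g x" "GammaZ M f f x = GammaZ M g g x"
    "R_form M D d Y f x = R_form M D d Y g x" "T_form M D d Y f x = T_form M D d Y g x"
    "l \<in> {1..d} \<Longrightarrow> torsion D (Y l) (grad_hor M f) x = torsion D (Y l) (grad_hor M g) x"
proof -
  note Yv = hframeD(3)[OF F(1)]
  have G: "grad_hor M f \<in> hor_fields M" "grad_hor M g \<in> hor_fields M" using f g by simp_all
  note Gv = hor_fields_vfields[OF G(1)] hor_fields_vfields[OF G(2)]
  note Gx = grad_hor_cong[OF f g fg]
  have Yfg: "Y i x f = Y i x g" if "i \<in> {1..d}" for i by (rule fg[OF vfields_tangent[OF Yv[OF that]]])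
  have Zfg: "Z x f = Z x g" if "Z \<in> vbasis" for Z
    by (rule fg[OF vfields_tangent[OF vert_vfields[OF vbasis_in_vert[OF that]]]])
  show "GammaH M f f x = GammaH M g g x"
    unfolding GammaH_frame[OF F f f] GammaH_frame[OF F g g]
    by (rule sum.cong[OF refl]) (simp only: Yfg)
  show "GammaZ M f f x = GammaZ M g g x"
    unfolding GammaZ_eq[OF f f] GammaZ_eq[OF g g]
    by (rule sum.cong[OF refl]) (simp only: Zfg)
  show tor: "torsion D (Y l) (grad_hor M f) x = torsion D (Y l) (grad_hor M g) x" if "l \<in> {1..d}" for l
    by (rule torsion_cong[OF Yv[OF that] Gv(1) Yv[OF that] Gv(2) refl Gx])
  then show "T_form M D d Y f x = T_form M D d Y g x"
    unfolding T_form_def by (intro sum.cong refl) simp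
  have "curvature D (Y l) (grad_hor M f) (grad_hor M f) x = curvature D (Y l) (grad_hor M g) (grad_hor M g) x"
    if "l \<in> {1..d}" for l
    using tensor_cong[OF tensor_curvature_2[OF Yv[OF that] Gv(1)] Gv Gx]
      tensor_cong[OF tensor_curvature_3[OF Yv[OF that] Gv(2)] Gv Gx] by simp
  then have "ricci M D (grad_hor M f) (grad_hor M f) x = ricci M D (grad_hor M g) (grad_hor M g) x"
    unfolding ricci_frame[OF F Gv(1) G(1)] ricci_frame[OF F Gv(2) G(2)]
    by (intro sum.cong refl) simp
  moreover have "deriv_torsion D (Y l) (Y l) (Y k) x f = deriv_torsion D (Y l) (Y l) (Y k) x g"
    "torsion D (Y l) (Y k) x f = torsion D (Y l) (Y k) x g" if "l \<in> {1..d}" "k \<in> {1..d}" for l k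
  proof -
    note v = Yv[OF that(1)] Yv[OF that(2)]
    have "deriv_torsion D (Y l) (Y l) (Y k) \<in> vfields M"
      unfolding deriv_torsion_def by (intro vfields_diff D_vfields torsion_vfields v)
    then show "deriv_torsion D (Y l) (Y l) (Y k) x f = deriv_torsion D (Y l) (Y l) (Y k) x g"
      by (intro fg vfields_tangent)
    show "torsion D (Y l) (Y k) x f = torsion D (Y l) (Y k) x g"
      by (rule fg[OF vfields_tangent[OF torsion_vfields[OF v]]])
  qed
  ultimately show "R_form M D d Y f x = R_form M D d Y g x"
    unfolding R_form_def using Yfg by (intro arg_cong2[where f = plus] sum.cong refl) simp_all
qed

text \<open>The frame derivatives of the centred coordinates form the matrix \<open>P\<close>;
  combining these coordinates with the inverse matrix \<open>Q\<close> gives the dual basis.\<close>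

lemma ex_dual_functions:
  assumes F: "hframe Y N" "x \<in> N"
  obtains g where "\<And>j. j \<in> frame_index \<Longrightarrow> g j \<in> C_infinity M" "\<And>j. g j x = 0"
    "\<And>j k. j \<in> frame_index \<Longrightarrow> k \<in> frame_index \<Longrightarrow> frame_field Y j x (g k) = (if j = k then 1 else 0)"
proof -
  obtain U \<phi> where c: "(U, \<phi>) \<in> charts M" and x: "x \<in> U" by (rule ex_chart)
  obtain \<xi> W where W: "open W" "x \<in> W" "W \<subseteq> U" and \<xi>: "\<And>i. \<xi> i \<in> C_infinity M"
    "\<And>z i. z \<in> W \<Longrightarrow> \<xi> i z = \<phi> z $ i"
    using ex_coordinates[OF c chart_open(1)[OF c] x subset_refl] by metis
  obtain \<beta> :: "'n \<Rightarrow> nat + 'a vfield" where \<beta>: "bij_betw \<beta> UNIV frame_index" by (rule ex_frame_enumeration)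
  have near: "\<forall>\<^sub>F z in nhds x. \<xi> i z = \<phi> z $ i" for i
    using W \<xi>(2) unfolding eventually_nhds by blast
  define P where "P = (\<chi> b i. frame_field Y (\<beta> b) x (\<xi> i))"
  define Q where "Q = (\<chi> i b. gR M x (coord_vec M U \<phi> i x) (frame_field Y (\<beta> b) x))"
  have "Q ** P = mat 1"
    unfolding Q_def P_def by (rule frame_matrix[where \<xi> = \<xi>, OF c x \<xi>(1) near F \<beta>])
  then have PQ: "P ** Q = mat 1" by (simp only: matrix_left_right_inverse)
  define \<alpha> where "\<alpha> = inv_into UNIV \<beta>"
  define g where "g = (\<lambda>j z. \<Sum>i\<in>UNIV. Q $ i $ \<alpha> j * (\<xi> i z - \<xi> i x))"
  have \<beta>\<alpha>: "\<beta> (\<alpha> j) = j" if "j \<in> frame_index" for j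
    unfolding \<alpha>_def using \<beta> that by (simp add: bij_betw_inv_into_right)
  have gC: "g j \<in> C_infinity M" for j
    unfolding g_def by (rule C_inf_sum) (intro C_inf_mult C_inf_diff C_inf_const \<xi>(1))
  have "frame_field Y j x (g k) = (if j = k then 1 else 0)" if jk: "j \<in> frame_index" "k \<in> frame_index" for j k
  proof -
    have v: "frame_field Y j x \<in> tangent_space M x" by (rule frame_tangent[OF F(1) jk(1)])
    have "frame_field Y j x (g k) = (\<Sum>i\<in>UNIV. frame_field Y j x (\<lambda>z. Q $ i $ \<alpha> k * (\<xi> i z - \<xi> i x)))"
      unfolding g_def by (rule tangent_sum[OF v]) (intro C_inf_mult C_inf_diff C_inf_const \<xi>(1))
    also have "\<dots> = (\<Sum>i\<in>UNIV. P $ \<alpha> j $ i * Q $ i $ \<alpha> k)"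
    proof (rule sum.cong[OF refl])
      fix i
      have "frame_field Y j x (\<lambda>z. Q $ i $ \<alpha> k * (\<xi> i z - \<xi> i x)) = Q $ i $ \<alpha> k * frame_field Y j x (\<lambda>z. \<xi> i z - \<xi> i x)"
        by (rule tangent_cmult[OF v C_inf_diff[OF \<xi>(1) C_inf_const]])
      also have "frame_field Y j x (\<lambda>z. \<xi> i z - \<xi> i x) = P $ \<alpha> j $ i"
        using tangent_diff[OF v \<xi>(1) C_inf_const] tangent_const[OF v] \<beta>\<alpha>[OF jk(1)] by (simp add: P_def)
      finally show "frame_field Y j x (\<lambda>z. Q $ i $ \<alpha> k * (\<xi> i z - \<xi> i x)) = P $ \<alpha> j $ i * Q $ i $ \<alpha> k" by simp
    qed
    also have "\<dots> = (P ** Q) $ \<alpha> j $ \<alpha> k" by (simp add: matrix_matrix_mult_def)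
    also have "\<dots> = (if \<alpha> j = \<alpha> k then 1 else 0)" by (simp add: PQ mat_def)
    also have "\<dots> = (if j = k then 1 else 0)" using \<beta>\<alpha>[OF jk(1)] \<beta>\<alpha>[OF jk(2)] by metis
    finally show ?thesis .
  qed
  moreover have "g j x = 0" for j by (simp add: g_def)
  ultimately show ?thesis using gC that[of g] by blast
qed

lemma tangent_product_second:
  assumes A: "A \<in> vfields M" and B: "B \<in> vfields M" and a: "a \<in> C_infinity M" and b: "b \<in> C_infinity M"
    and 0: "a x = 0" "b x = 0"
  shows "A x (\<lambda>y. B y (\<lambda>z. a z * b z)) = A x a * B x b + B x a * A x b"
proof -
  have "(\<lambda>y. B y (\<lambda>z. a z * b z)) = (\<lambda>y. a y * B y b + b y * B y a)"
    by (rule ext) (rule tangent_mult[OF vfields_tangent[OF B] a b])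
  then show ?thesis
    using tangent_add[OF vfields_tangent[OF A] C_inf_mult[OF a vfields_smooth[OF B b]] C_inf_mult[OF b vfields_smooth[OF B a]]]
      tangent_mult[OF vfields_tangent[OF A] a vfields_smooth[OF B b]]
      tangent_mult[OF vfields_tangent[OF A] b vfields_smooth[OF B a]] 0
    by simp
qed

text \<open>Quadratic polynomials in dual functions realise arbitrary symmetric second-order jets.\<close>

lemma ex_second_order:
  assumes F: "hframe Y N" "x \<in> N"
  obtains q where "q \<in> C_infinity M" "\<And>v. v \<in> tangent_space M x \<Longrightarrow> v q = 0"
    "\<And>j k. j \<in> frame_index \<Longrightarrow> k \<in> frame_index \<Longrightarrow>
      frame_field Y j x (\<lambda>y. frame_field Y k y q) = m j k + m k j"
proof -
  obtain g where g: "\<And>j. j \<in> frame_index \<Longrightarrow> g j \<in> C_infinity M" "\<And>j. g j x = 0"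
    "\<And>j k. j \<in> frame_index \<Longrightarrow> k \<in> frame_index \<Longrightarrow> frame_field Y j x (g k) = (if j = k then 1 else 0)"
    using ex_dual_functions[OF F] by blast
  define I :: "((nat + 'a vfield) \<times> (nat + 'a vfield)) set" where "I = frame_index \<times> frame_index"
  \<comment> \<open>A quadratic monomial in two dual functions. Both factors vanish at
    \<open>x\<close>, so first derivatives are 0 and second derivatives are products of first ones;
    the coefficient is absorbed in the first factor for the product rule.\<close>
  define p where "p = (\<lambda>(i :: (nat + 'a vfield) \<times> (nat + 'a vfield)) z. (m (fst i) (snd i) * g (fst i) z) * g (snd i) z)"
  define q where "q = (\<lambda>z. \<Sum>i\<in>I. p i z)"
  have fI: "finite I" by (simp add: I_def)
  have gI: "(\<lambda>z. m (fst i) (snd i) * g (fst i) z) \<in> C_infinity M" "g (snd i) \<in> C_infinity M"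
    "g (fst i) \<in> C_infinity M" if "i \<in> I" for i
    using that g(1) by (auto simp: I_def)
  have pC: "p i \<in> C_infinity M" if "i \<in> I" for i
    unfolding p_def by (rule C_inf_mult[OF gI(1,2)[OF that]])
  have qC: "q \<in> C_infinity M" unfolding q_def by (rule C_inf_sum[OF pC])
  have v0: "v q = 0" if v: "v \<in> tangent_space M x" for v
  proof -
    have "v q = (\<Sum>i\<in>I. v (p i))" unfolding q_def by (rule tangent_sum[OF v pC])
    also have "\<dots> = 0"
      by (rule sum.neutral) (use tangent_mult[OF v gI(1,2)] g(2) in \<open>simp add: p_def\<close>)
    finally show ?thesis .
  qed
  have "frame_field Y j x (\<lambda>y. frame_field Y k y q) = m j k + m k j"
    if jk: "j \<in> frame_index" "k \<in> frame_index" for j k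
  proof -
    let ?A = "frame_field Y j" and ?B = "frame_field Y k"
    have A: "?A \<in> vfields M" and B: "?B \<in> vfields M" by (rule frame_field_vfields[OF F(1)], fact jk)+
    have "(\<lambda>y. ?B y q) = (\<lambda>y. \<Sum>i\<in>I. ?B y (p i))"
      unfolding q_def by (rule ext) (rule tangent_sum[OF vfields_tangent[OF B] pC])
    then have "?A x (\<lambda>y. ?B y q) = (\<Sum>i\<in>I. ?A x (\<lambda>y. ?B y (p i)))"
      using tangent_sum[OF vfields_tangent[OF A] vfields_smooth[OF B pC]] by simp
    also have "\<dots> = (\<Sum>i\<in>I. m (fst i) (snd i) * ((if i = (j, k) then 1 else 0) + (if i = (k, j) then 1 else 0)))"
    proof (rule sum.cong[OF refl])
      fix i assume i: "i \<in> I"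
      have fs: "fst i \<in> frame_index" "snd i \<in> frame_index" using i by (auto simp: I_def)
      have delta: "(if a = fst i then 1 else 0) * (if b = snd i then 1 else 0) = (if i = (a, b) then 1 else (0::real))"
        for a b by (cases "a = fst i"; cases "b = snd i") (auto simp: prod_eq_iff)
      have "?A x (\<lambda>y. ?B y (p i)) =
          ?A x (\<lambda>z. m (fst i) (snd i) * g (fst i) z) * ?B x (g (snd i)) + ?B x (\<lambda>z. m (fst i) (snd i) * g (fst i) z) * ?A x (g (snd i))"
        unfolding p_def by (rule tangent_product_second[OF A B gI(1,2)[OF i]]) (simp_all add: g(2))
      also have "\<dots> = m (fst i) (snd i) * (?A x (g (fst i)) * ?B x (g (snd i)) + ?B x (g (fst i)) * ?A x (g (snd i)))"
        unfolding tangent_cmult[OF vfields_tangent[OF A] gI(3)[OF i]] tangent_cmult[OF vfields_tangent[OF B] gI(3)[OF i]]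
        by (simp add: algebra_simps)
      also have "\<dots> = m (fst i) (snd i) * ((if i = (j, k) then 1 else 0) + (if i = (k, j) then 1 else 0))"
        unfolding g(3)[OF jk(1) fs(1)] g(3)[OF jk(1) fs(2)] g(3)[OF jk(2) fs(1)] g(3)[OF jk(2) fs(2)] delta ..
      finally show "?A x (\<lambda>y. ?B y (p i)) = m (fst i) (snd i) * ((if i = (j, k) then 1 else 0) + (if i = (k, j) then 1 else 0))" .
    qed
    also have "\<dots> = (\<Sum>i\<in>I. if i = (j, k) then m (fst i) (snd i) else 0) + (\<Sum>i\<in>I. if i = (k, j) then m (fst i) (snd i) else 0)"
    proof -
      have "c * ((if P then 1 else 0) + (if P' then 1 else 0)) = (if P then c else 0) + (if P' then c else (0::real))"
        for c P P' by simp
      then show ?thesis by (simp only: sum.distrib)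
    qed
    also have "\<dots> = m j k + m k j"
    proof -
      have "(\<Sum>i\<in>I. if i = (a, b) then m (fst i) (snd i) else 0) = m a b" if "(a, b) \<in> I" for a b
        unfolding sum.delta[OF fI] using that by simp
      moreover have "(j, k) \<in> I" "(k, j) \<in> I" using jk by (simp_all add: I_def)
      ultimately show ?thesis by simp
    qed
    finally show ?thesis .
  qed
  with qC v0 show ?thesis by (rule that)
qed

text \<open>The second-order jet is chosen to make the left side of the inequality as small as the
  first-order data allow. With \<open>T\<close> the value of the torsion form, the mixed term of
  \<open>Gamma2\<close> is \<open>- 2 * T / \<nu>\<close> and \<open>\<nu> * Gamma2Z\<close> is
  \<open>T / \<nu>\<close>. Their sum is \<open>- T / \<nu>\<close>, so that \<open>key\<close> is
  linear in \<nu>.\<close>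

lemma CD_imp_forms:
  assumes CD: "CD M L \<rho>\<^sub>1 \<rho>\<^sub>2 \<kappa> d" and F: "hframe Y N" "x \<in> N" and f: "f \<in> C_infinity M"
  shows "R_form M D d Y f x \<ge> \<rho>\<^sub>1 * GammaH M f f x + \<rho>\<^sub>2 * GammaZ M f f x"
    "T_form M D d Y f x \<le> \<kappa> * GammaH M f f x"
proof -
  note Yh = hframeD(2)[OF F(1)] and Yv = hframeD(3)[OF F(1)]
  define \<tau> where "\<tau> = (\<lambda>l Z. gR M x (torsion D (Y l) (grad_hor M f) x) (Z x))"
  define H where "H = (\<lambda>f l k. met M x (D (Y l) (grad_hor M f) x) (Y k x))"
  define R where "R = R_form M D d Y f x"
  define T where "T = T_form M D d Y f x"
  define a where "a = R - \<rho>\<^sub>1 * GammaH M f f x - \<rho>\<^sub>2 * GammaZ M f f x"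
  define b where "b = T - \<kappa> * GammaH M f f x"
  have T: "T = (\<Sum>l=1..d. \<Sum>Z\<in>vbasis. (\<tau> l Z)\<^sup>2)" unfolding T_def \<tau>_def by (rule T_form_eq[OF F f])
  have key: "b \<le> a * \<nu>" if \<nu>: "\<nu> > 0" for \<nu>
  proof -
    \<comment> \<open>The quadratic \<open>q\<close> realises \<open>m\<close> plus its transpose.
      The horizontal block is symmetric, so one quarter of \<open>H f l k + H f k l\<close> is
      doubled and cancels the symmetrised Hessian; the mixed block carries its full value on one
      side and 0 on the other.\<close>
    define m :: "nat + 'a vfield \<Rightarrow> nat + 'a vfield \<Rightarrow> real" where "m = (\<lambda>i j. case i of
      Inl l \<Rightarrow> (case j of Inl k \<Rightarrow> - (H f l k + H f k l) / 4 | Inr Z \<Rightarrow> \<tau> l Z / \<nu> - Y l x (\<lambda>y. Z y f))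
      | Inr Z \<Rightarrow> 0)"
    obtain q where q: "q \<in> C_infinity M" "\<And>v. v \<in> tangent_space M x \<Longrightarrow> v q = 0"
      "\<And>j k. j \<in> frame_index \<Longrightarrow> k \<in> frame_index \<Longrightarrow>
        frame_field Y j x (\<lambda>y. frame_field Y k y q) = m j k + m k j"
      using ex_second_order[OF F, of m] by blast
    define h where "h = (\<lambda>y. f y + q y)"
    have h: "h \<in> C_infinity M" unfolding h_def by (rule C_inf_add[OF f q(1)])
    have hf: "v h = v f" if "v \<in> tangent_space M x" for v
      unfolding h_def using tangent_add[OF that f q(1)] q(2)[OF that] by simp
    have same: "GammaH M h h x = GammaH M f f x" "GammaZ M h h x = GammaZ M f f x"
      "R_form M D d Y h x = R_form M D d Y f x"
      by (rule first_order_cong[OF F h f], erule hf)+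
    have same_torsion: "torsion D (Y l) (grad_hor M h) x = torsion D (Y l) (grad_hor M f) x"
      if "l \<in> {1..d}" for l
      by (rule first_order_cong(5)[OF F h f hf that])
    have second: "A x (\<lambda>y. B y h) = A x (\<lambda>y. B y f) + A x (\<lambda>y. B y q)"
      if "A \<in> vfields M" "B \<in> vfields M" for A B
    proof -
      have "(\<lambda>y. B y h) = (\<lambda>y. B y f + B y q)"
        unfolding h_def by (rule ext) (rule tangent_add[OF vfields_tangent[OF that(2)] f q(1)])
      then show ?thesis
        using tangent_add[OF vfields_tangent[OF that(1)] vfields_smooth[OF that(2) f] vfields_smooth[OF that(2) q(1)]]
        by simp
    qed
    have Hh: "H h l k + H h k l = 0" if lk: "l \<in> {1..d}" "k \<in> {1..d}" for l k
    proof -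
      have "H h i j = H f i j - (H f l k + H f k l) / 2" if "i = l \<and> j = k \<or> i = k \<and> j = l" for i j
      proof -
        have ij: "i \<in> {1..d}" "j \<in> {1..d}" using that lk by auto
        have I: "Inl i \<in> frame_index" "Inl j \<in> frame_index" unfolding frame_index_def using ij by (auto intro: InlI)
        have "H h i j = H f i j + Y i x (\<lambda>y. Y j y q)"
          unfolding H_def hess_eq[OF Yv[OF ij(1)] Yh[OF ij(2)] h] hess_eq[OF Yv[OF ij(1)] Yh[OF ij(2)] f]
            second[OF Yv[OF ij(1)] Yv[OF ij(2)]]
          using hf[OF vfields_tangent[OF D_vfields[OF Yv[OF ij(1)] Yv[OF ij(2)]]]] by simp
        also have "Y i x (\<lambda>y. Y j y q) = - (H f l k + H f k l) / 2"
          using q(3)[OF I] that by (auto simp: m_def field_simps)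
        finally show ?thesis by linarith
      qed
      from this[of l k] this[of k l] show ?thesis by simp
    qed
    have Zh: "Y l x (\<lambda>y. Z y h) = \<tau> l Z / \<nu>" if lZ: "l \<in> {1..d}" "Z \<in> vbasis" for l Z
    proof -
      have I: "Inl l \<in> frame_index" "Inr Z \<in> frame_index"
        unfolding frame_index_def using lZ by (auto intro: InlI InrI)
      show ?thesis
        using q(3)[OF I] second[OF Yv[OF lZ(1)] vert_vfields[OF vbasis_in_vert[OF lZ(2)]]]
        by (simp add: m_def)
    qed
    have \<tau>h: "gR M x (torsion D (Y l) (grad_hor M h) x) (Z x) = \<tau> l Z" if "l \<in> {1..d}" for l Z
      unfolding \<tau>_def same_torsion[OF that] ..
    have "(\<Sum>l=1..d. \<Sum>k=1..d. ((H h l k + H h k l) / 2)\<^sup>2) = 0"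
      by (intro sum.neutral ballI) (simp add: Hh del: One_nat_def)
    moreover have "(\<Sum>l=1..d. \<Sum>Z\<in>vbasis. gR M x (torsion D (Y l) (grad_hor M h) x) (Z x) * Y l x (\<lambda>y. Z y h)) = T / \<nu>"
      unfolding T sum_divide_distrib
      by (intro sum.cong refl) (simp add: \<tau>h Zh power2_eq_square del: One_nat_def)
    ultimately have G2: "Gamma2 M L h x = R - 2 * (T / \<nu>)"
      using gamma2_formula[OF F h] same(3) unfolding H_def R_def by simp
    have "(\<Sum>l=1..d. \<Sum>Z\<in>vbasis. (Y l x (\<lambda>y. Z y h))\<^sup>2) = T / \<nu>\<^sup>2"
      unfolding T sum_divide_distrib
      by (intro sum.cong refl) (simp add: Zh power_divide del: One_nat_def)
    then have G2Z: "\<nu> * Gamma2Z M L h x = T / \<nu>"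
      unfolding gamma2Z_formula[OF F h] using \<nu> by (simp add: power2_eq_square)
    \<comment> \<open>The trace of the Hessian lies in its symmetric part, so the dimension term
      vanishes as well.\<close>
    have "(\<Sum>l=1..d. H h l l) = 0" by (rule sum.neutral) (use Hh in force)
    then have "L h x = 0" unfolding laplacian_hess[OF F h] H_def .
    moreover have "Gamma2 M L h x + \<nu> * Gamma2Z M L h x
        \<ge> 1 / real d * (L h x)\<^sup>2 + (\<rho>\<^sub>1 - \<kappa> / \<nu>) * GammaH M h h x + \<rho>\<^sub>2 * GammaZ M h h x"
      using CD h \<nu> unfolding CD_def by blast
    ultimately have "R - T / \<nu> \<ge> (\<rho>\<^sub>1 - \<kappa> / \<nu>) * GammaH M f f x + \<rho>\<^sub>2 * GammaZ M f f x"
      unfolding G2 G2Z same(1,2) by simp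
    then have "b / \<nu> \<le> a" unfolding a_def b_def by (simp add: diff_divide_distrib left_diff_distrib)
    then show ?thesis using \<nu> by (simp add: divide_le_eq)
  qed
  \<comment> \<open>The limit of \<nu> to 0; the witness \<open>b / (\<bar>a\<bar> + 1)\<close> is
    small enough to keep \<open>a * \<nu>\<close> below \<open>b\<close>.\<close>
  have "b \<le> 0"
  proof (rule ccontr)
    assume "\<not> b \<le> 0"
    then have b: "b > 0" by simp
    have "a * (b / (\<bar>a\<bar> + 1)) \<le> \<bar>a\<bar> * (b / (\<bar>a\<bar> + 1))" using b by (intro mult_right_mono) auto
    also have "\<dots> < b" using b by (simp add: field_simps)
    finally show False using key[of "b / (\<bar>a\<bar> + 1)"] b by simp
  qed
  \<comment> \<open>The limit of \<nu> to infinity; for negative \<open>a\<close> the witness is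
    chosen such that \<open>a * \<nu> = b - 1\<close>, and it is positive because
    \<open>b \<le> 0\<close>.\<close>
  moreover have "a \<ge> 0"
  proof (rule ccontr)
    assume "\<not> a \<ge> 0"
    then have a: "a < 0" by simp
    have "(b - 1) / a > 0" using \<open>b \<le> 0\<close> a by (simp add: divide_neg_neg)
    from key[OF this] a show False by simp
  qed
  ultimately show "R_form M D d Y f x \<ge> \<rho>\<^sub>1 * GammaH M f f x + \<rho>\<^sub>2 * GammaZ M f f x"
    "T_form M D d Y f x \<le> \<kappa> * GammaH M f f x"
    unfolding a_def b_def R_def T_def by simp_all
qed

text \<open>The Cauchy-Schwarz inequality bounds the squared trace \<open>L f\<close> by
  \<open>d\<close> times the symmetrised Hessian, and a completed square absorbs the mixed term of
  \<open>Gamma2\<close> into \<open>\<nu> * Gamma2Z\<close> and the torsion form.\<close>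

lemma forms_imp_CD_at:
  assumes F: "hframe Y N" "x \<in> N" and f: "f \<in> C_infinity M" and \<nu>: "\<nu> > 0"
    and R: "R_form M D d Y f x \<ge> \<rho>\<^sub>1 * GammaH M f f x + \<rho>\<^sub>2 * GammaZ M f f x"
    and T: "T_form M D d Y f x \<le> \<kappa> * GammaH M f f x"
  shows "Gamma2 M L f x + \<nu> * Gamma2Z M L f x
    \<ge> 1 / real d * (L f x)\<^sup>2 + (\<rho>\<^sub>1 - \<kappa> / \<nu>) * GammaH M f f x + \<rho>\<^sub>2 * GammaZ M f f x"
proof -
  define \<tau> where "\<tau> = (\<lambda>l Z. gR M x (torsion D (Y l) (grad_hor M f) x) (Z x))"
  define w where "w = (\<lambda>l Z. Y l x (\<lambda>y. Z y f))"
  define H where "H = (\<lambda>l k. met M x (D (Y l) (grad_hor M f) x) (Y k x))"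
  define S where "S = (\<Sum>l=1..d. \<Sum>k=1..d. ((H l k + H k l) / 2)\<^sup>2)"
  have "(L f x)\<^sup>2 = (\<Sum>l=1..d. H l l)\<^sup>2" unfolding laplacian_hess[OF F f] H_def ..
  also have "\<dots> \<le> (\<Sum>l=1..d. (H l l)\<^sup>2) * real d"
    using sum_squared_le_sum_of_squares[of "\<lambda>l. H l l" "{1..d}"] by simp
  also have "(\<Sum>l=1..d. (H l l)\<^sup>2) \<le> S"
    unfolding S_def
  proof (rule sum_mono)
    fix l assume l: "l \<in> {1..d}"
    have "((H l l + H l l) / 2)\<^sup>2 \<le> (\<Sum>k=1..d. ((H l k + H k l) / 2)\<^sup>2)"
      by (rule member_le_sum[OF l]) auto
    then show "(H l l)\<^sup>2 \<le> (\<Sum>k=1..d. ((H l k + H k l) / 2)\<^sup>2)" by simp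
  qed
  finally have LS: "(L f x)\<^sup>2 \<le> S * real d" by (simp add: mult_right_mono)
  have "S \<ge> 0" unfolding S_def by (intro sum_nonneg) auto
  \<comment> \<open>For \<open>d = 0\<close> the quotient \<open>1 / real d\<close> is 0 by
    convention, so non-negativity of \<open>S\<close> is enough.\<close>
  then have L: "1 / real d * (L f x)\<^sup>2 \<le> S" using LS by (cases "d = 0") (simp_all add: field_simps)
  have G2: "Gamma2 M L f x = S + R_form M D d Y f x - 2 * (\<Sum>l=1..d. \<Sum>Z\<in>vbasis. \<tau> l Z * w l Z)"
    unfolding S_def H_def \<tau>_def w_def by (rule gamma2_formula[OF F f])
  have "0 \<le> (\<Sum>l=1..d. \<Sum>Z\<in>vbasis. (\<nu> * w l Z - \<tau> l Z)\<^sup>2 / \<nu>)"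
    using \<nu> by (intro sum_nonneg) auto
  also have "\<dots> = (\<Sum>l=1..d. \<Sum>Z\<in>vbasis. \<nu> * (w l Z)\<^sup>2 - 2 * (\<tau> l Z * w l Z) + (\<tau> l Z)\<^sup>2 / \<nu>)"
    using \<nu> by (intro sum.cong refl) (simp add: power2_eq_square field_simps)
  also have "\<dots> = \<nu> * (\<Sum>l=1..d. \<Sum>Z\<in>vbasis. (w l Z)\<^sup>2) - 2 * (\<Sum>l=1..d. \<Sum>Z\<in>vbasis. \<tau> l Z * w l Z)
      + (\<Sum>l=1..d. \<Sum>Z\<in>vbasis. (\<tau> l Z)\<^sup>2) / \<nu>"
    by (simp add: sum.distrib sum_subtractf sum_distrib_left sum_divide_distrib)
  also have "(\<Sum>l=1..d. \<Sum>Z\<in>vbasis. (w l Z)\<^sup>2) = Gamma2Z M L f x"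
    unfolding w_def by (rule gamma2Z_formula[OF F f, symmetric])
  also have "(\<Sum>l=1..d. \<Sum>Z\<in>vbasis. (\<tau> l Z)\<^sup>2) = T_form M D d Y f x"
    unfolding \<tau>_def by (rule T_form_eq[OF F f, symmetric])
  finally have "2 * (\<Sum>l=1..d. \<Sum>Z\<in>vbasis. \<tau> l Z * w l Z) \<le> \<nu> * Gamma2Z M L f x + T_form M D d Y f x / \<nu>" by simp
  moreover have "T_form M D d Y f x / \<nu> \<le> \<kappa> / \<nu> * GammaH M f f x"
    using divide_right_mono[OF T, of \<nu>] \<nu> by simp
  ultimately show ?thesis using L R unfolding G2 by (simp add: left_diff_distrib)
qed

text \<open>The prescribed frame \<open>X0 x\<close> need not be horizontal far from
  \<open>x\<close>. It is replaced by globally horizontal fields with the same values near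
  \<open>x\<close>, which does not change the forms at \<open>x\<close>.\<close>

lemma CD_iff_forms:
  "CD M L \<rho>\<^sub>1 \<rho>\<^sub>2 \<kappa> d \<longleftrightarrow> (\<forall>f\<in>C_infinity M. \<forall>x.
     R_form M D d (X0 x) f x \<ge> \<rho>\<^sub>1 * GammaH M f f x + \<rho>\<^sub>2 * GammaZ M f f x \<and>
     T_form M D d (X0 x) f x \<le> \<kappa> * GammaH M f f x)" (is "_ \<longleftrightarrow> ?forms")
proof -
  have frame: "\<exists>Y N. hframe Y N \<and> x \<in> N \<and> (\<forall>f\<in>C_infinity M.
      R_form M D d (X0 x) f x = R_form M D d Y f x \<and> T_form M D d (X0 x) f x = T_form M D d Y f x)" for x
  proof (rule ex_hframe[where x = x])
    fix Y N assume F: "hframe Y N" "x \<in> N" and eq: "\<And>i y. i \<in> {1..d} \<Longrightarrow> y \<in> N \<Longrightarrow> Y i y = X0 x i y"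
    have X: "X0 x i \<in> vfields M" if "i \<in> {1..d}" for i
      using frames[of x] that unfolding local_frame_def by blast
    have "R_form M D d (X0 x) f x = R_form M D d Y f x \<and> T_form M D d (X0 x) f x = T_form M D d Y f x"
      if f: "f \<in> C_infinity M" for f
      using forms_frame_cong[where X = "X0 x" and Y = Y, OF X hframeD(3)[OF F(1)] _ f] eq F(2) by simp
    then show ?thesis using F by blast
  qed
  show ?thesis
  proof
    assume CD: "CD M L \<rho>\<^sub>1 \<rho>\<^sub>2 \<kappa> d"
    show ?forms
    proof (intro ballI allI)
      fix f x assume f: "f \<in> C_infinity M"
      obtain Y N where F: "hframe Y N" "x \<in> N" and eq: "R_form M D d (X0 x) f x = R_form M D d Y f x"
        "T_form M D d (X0 x) f x = T_form M D d Y f x" using frame[of x] f by blast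
      show "R_form M D d (X0 x) f x \<ge> \<rho>\<^sub>1 * GammaH M f f x + \<rho>\<^sub>2 * GammaZ M f f x \<and>
        T_form M D d (X0 x) f x \<le> \<kappa> * GammaH M f f x"
        unfolding eq using CD_imp_forms[OF CD F f] by blast
    qed
  next
    assume forms: ?forms
    show "CD M L \<rho>\<^sub>1 \<rho>\<^sub>2 \<kappa> d"
      unfolding CD_def
    proof (intro ballI allI impI)
      fix f \<nu> x assume f: "f \<in> C_infinity M" and \<nu>: "(\<nu>::real) > 0"
      obtain Y N where F: "hframe Y N" "x \<in> N" and eq: "R_form M D d (X0 x) f x = R_form M D d Y f x"
        "T_form M D d (X0 x) f x = T_form M D d Y f x" using frame[of x] f by blast
      have "R_form M D d (X0 x) f x \<ge> \<rho>\<^sub>1 * GammaH M f f x + \<rho>\<^sub>2 * GammaZ M f f x"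
        "T_form M D d (X0 x) f x \<le> \<kappa> * GammaH M f f x" using forms f by blast+
      from forms_imp_CD_at[OF F f \<nu> this[unfolded eq]]
      show "1 / real d * (L f x)\<^sup>2 + (\<rho>\<^sub>1 - \<kappa> / \<nu>) * GammaH M f f x + \<rho>\<^sub>2 * GammaZ M f f x
        \<le> Gamma2 M L f x + \<nu> * Gamma2Z M L f x" .
    qed
  qed
qed

end

theorem theorem2p20:
  fixes M :: "('a::{t2_space, second_countable_topology}, 'n::finite) sr_structure"
    and d :: nat
    and \<mu> :: "'a measure"
    and L :: "('a \<Rightarrow> real) \<Rightarrow> 'a \<Rightarrow> real"
    and D :: "'a vfield \<Rightarrow> 'a vfield \<Rightarrow> 'a vfield"
    and X :: "'a \<Rightarrow> nat \<Rightarrow> 'a vfield"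
    and \<rho>\<^sub>1 \<rho>\<^sub>2 \<kappa> :: real
  assumes "sub_riemannian_transverse M d"
    and "riemannian_measure M \<mu>"
    and "sub_laplacian M \<mu> L"
    and "canonical_connection M D"
    and "\<And>x. local_frame M d x (X x)"
    and "\<rho>\<^sub>2 > 0" and "\<kappa> \<ge> 0"
  shows "(CD M L \<rho>\<^sub>1 \<rho>\<^sub>2 \<kappa> d \<longrightarrow>
      (\<forall>f\<in>C_infinity M. \<forall>x.
        R_form M D d (X x) f x \<ge> \<rho>\<^sub>1 * GammaH M f f x + \<rho>\<^sub>2 * GammaZ M f f x \<and>
        T_form M D d (X x) f x \<le> \<kappa> * GammaH M f f x)) \<and>
    (CD M L \<rho>\<^sub>1 \<rho>\<^sub>2 \<kappa> d \<longleftrightarrow>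
      (\<forall>f\<in>C_infinity M. \<forall>x.
        R_form M D d (X x) f x \<ge> \<rho>\<^sub>1 * GammaH M f f x + \<rho>\<^sub>2 * GammaZ M f f x \<and>
        T_form M D d (X x) f x \<le> \<kappa> * GammaH M f f x))"
proof -
  interpret sr_connection M d X \<mu> L D
    by unfold_locales (fact assms)+
  show ?thesis using CD_iff_forms by blast
qed

end
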